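(* Let $1\le q<p\le\infty$. Let $\Phi:\mathbb{R}^{2d}\to\mathbb{R}$ satisfy: (i) $\Phi\in\mathcal{C}^\infty(\mathbb{R}^{2d})$; (ii) $\partial^\alpha\Phi$ is bounded on $\mathbb{R}^{2d}$ for every multi-index $|\alpha|\ge2$; (iii) there is $\delta>0$ with $\left|\det\left(\frac{\partial^2\Phi}{\partial x_i\partial\eta_l}(x,\eta)\right)\right|\ge\delta$ for all $(x,\eta)$. Assume moreover one of: (a) $\sigma\in M^{\infty,1}(\mathbb{R}^{2d})$ and, for some $\delta>0$, $\left|\det\left(\frac{\partial^2\Phi}{\partial x_i\partial x_l}(x,\eta)\right)\right|\ge\delta$ for all $(x,\eta)\in\mathbb{R}^{2d}$; (b) $\sigma\in M^{\infty,1}_{v_{s,0}\otimes1}(\mathbb{R}^{2d})$ with $s>d\left(\frac1q-\frac1p\right)$. Then the Fourier integral operator $T$ with phase $\Phi$ and symbol $\sigma$ extends to a bounded operator $\mathcal{M}^{p,q}(\mathbb{R}^d)\to\mathcal{M}^{q,p}(\mathbb{R}^d)$.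
   Context: $Tf(x)=\int_{\mathbb{R}^d}e^{2\pi i\Phi(x,\eta)}\sigma(x,\eta)\hat f(\eta)\,d\eta$, $f\in\mathcal{S}(\mathbb{R}^d)$, $\hat f(\eta)=\int f(x)e^{-2\pi ix\cdot\eta}dx$. $V_gf(x,\omega)=\int e^{-2\pi i\omega\cdot y}f(y)\overline{g(y-x)}dy$ (nonzero Schwartz window $g$). $M^{p,q}(\mathbb{R}^d)$: $f\in\mathcal{S}'$ with $\left(\int\left(\int|V_gf(x,\omega)|^pdx\right)^{q/p}d\omega\right)^{1/q}<\infty$; $\mathcal{M}^{p,q}$ is the closure of $\mathcal{S}$ in it. $\langle x\rangle=(1+|x|^2)^{1/2}$. For $s_1,s_2\in\mathbb{R}$, $M^{\infty,1}_{v_{s_1,s_2}\otimes1}(\mathbb{R}^{2d})$ is the space of $\sigma$ with $\int_{\mathbb{R}^{2d}}\sup_{(z_1,z_2)\in\mathbb{R}^{2d}}|V_\Psi\sigma(z_1,z_2,\zeta)|\langle z_1\rangle^{s_1}\langle z_2\rangle^{s_2}d\zeta<\infty$ ($\Psi\in\mathcal{S}(\mathbb{R}^{2d})\setminus\{0\}$); $M^{\infty,1}$ is the case $s_1=s_2=0$. *)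

theory Defs
  imports "HOL-Analysis.Analysis" "HOL-Probability.Essential_Supremum"
begin

fun partials :: "'a::real_normed_vector list \<Rightarrow> ('a \<Rightarrow> 'c::real_normed_vector) \<Rightarrow> 'a \<Rightarrow> 'c" where
  "partials [] f = f"
| "partials (v # vs) f = (\<lambda>x. frechet_derivative (partials vs f) (at x) v)"

definition smooth :: "('a::euclidean_space \<Rightarrow> 'c::real_normed_vector) \<Rightarrow> bool" where
  "smooth f \<longleftrightarrow> (\<forall>vs. set vs \<subseteq> Basis \<longrightarrow> (\<forall>x. partials vs f differentiable (at x)))"

definition schwartz :: "('a::euclidean_space \<Rightarrow> complex) set" where
  "schwartz = {f. smooth f \<and>
     (\<forall>vs. set vs \<subseteq> Basis \<longrightarrow> (\<forall>N::nat. bounded (range (\<lambda>x. norm x ^ N * norm (partials vs f x)))))}"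

definition fourier :: "('a::euclidean_space \<Rightarrow> complex) \<Rightarrow> 'a \<Rightarrow> complex" where
  "fourier f \<eta> = (LINT x|lborel. exp (- 2 * pi * \<i> * complex_of_real (x \<bullet> \<eta>)) * f x)"

definition stft :: "('a::euclidean_space \<Rightarrow> complex) \<Rightarrow> ('a \<Rightarrow> complex) \<Rightarrow> 'a \<Rightarrow> 'a \<Rightarrow> complex" where
  "stft g f x \<omega> = (LINT y|lborel. exp (- 2 * pi * \<i> * complex_of_real (\<omega> \<bullet> y)) * f y * cnj (g (y - x)))"

definition FIO :: "('a::euclidean_space \<times> 'a \<Rightarrow> real) \<Rightarrow> ('a \<times> 'a \<Rightarrow> complex) \<Rightarrow> ('a \<Rightarrow> complex) \<Rightarrow> 'a \<Rightarrow> complex" where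
  "FIO \<Phi> \<sigma> f x = (LINT \<eta>|lborel. exp (2 * pi * \<i> * complex_of_real (\<Phi> (x, \<eta>))) * \<sigma> (x, \<eta>) * fourier f \<eta>)"

definition lp_norm :: "ennreal \<Rightarrow> ('a::euclidean_space \<Rightarrow> ennreal) \<Rightarrow> ennreal" where
  "lp_norm p F =
    (if p = \<infinity> then esssup lborel F
     else (let I = (\<integral>\<^sup>+ x. (if F x = \<infinity> then \<infinity> else ennreal (enn2real (F x) powr enn2real p)) \<partial>lborel)
           in if I = \<infinity> then \<infinity> else ennreal (enn2real I powr (1 / enn2real p))))"

definition mod_norm :: "ennreal \<Rightarrow> ennreal \<Rightarrow> ('a::euclidean_space \<Rightarrow> complex) \<Rightarrow> ('a \<Rightarrow> complex) \<Rightarrow> ennreal" where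
  "mod_norm p q g f = lp_norm q (\<lambda>\<omega>. lp_norm p (\<lambda>x. ennreal (norm (stft g f x \<omega>))))"

definition inv_exp :: "ennreal \<Rightarrow> real" where
  "inv_exp p = (if p = \<infinity> then 0 else 1 / enn2real p)"

definition japanese :: "'a::real_normed_vector \<Rightarrow> real" where
  "japanese x = sqrt (1 + norm x ^ 2)"

text \<open>Symbols are functions on R^d x R^d (every element of M^{infinity,1} is a bounded
  continuous function); we require measurability and that the STFT integrals are
  defined, and finiteness of the weighted norm for some nonzero Schwartz window
  (the space does not depend on the window).\<close>
definition sym_norm :: "real \<Rightarrow> real \<Rightarrow> ('a::euclidean_space \<times> 'a \<Rightarrow> complex) \<Rightarrow> ('a \<times> 'a \<Rightarrow> complex) \<Rightarrow> ennreal" where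
  "sym_norm s1 s2 \<Psi> \<sigma> = (\<integral>\<^sup>+ \<zeta>. (SUP z. ennreal (norm (stft \<Psi> \<sigma> z \<zeta>) * japanese (fst z) powr s1 * japanese (snd z) powr s2)) \<partial>lborel)"

definition sym_class :: "real \<Rightarrow> real \<Rightarrow> ('a::euclidean_space \<times> 'a \<Rightarrow> complex) set" where
  "sym_class s1 s2 = {\<sigma>. \<sigma> \<in> borel_measurable lborel \<and>
     (\<exists>\<Psi>\<in>schwartz. \<Psi> \<noteq> (\<lambda>_. 0) \<and>
        (\<forall>z \<zeta>. integrable lborel (\<lambda>y. exp (- 2 * pi * \<i> * complex_of_real (\<zeta> \<bullet> y)) * \<sigma> y * cnj (\<Psi> (y - z)))) \<and>
        sym_norm s1 s2 \<Psi> \<sigma> < \<infinity>)}"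

definition mixed_hessian :: "((real^'n) \<times> (real^'n) \<Rightarrow> real) \<Rightarrow> real^'n \<Rightarrow> real^'n \<Rightarrow> real^'n^'n" where
  "mixed_hessian \<Phi> x \<eta> = (\<chi> i l. partials [(axis i 1, 0), (0, axis l 1)] \<Phi> (x, \<eta>))"

definition x_hessian :: "((real^'n) \<times> (real^'n) \<Rightarrow> real) \<Rightarrow> real^'n \<Rightarrow> real^'n \<Rightarrow> real^'n^'n" where
  "x_hessian \<Phi> x \<eta> = (\<chi> i l. partials [(axis i 1, 0), (axis l 1, 0)] \<Phi> (x, \<eta>))"

end

theory Submission
  imports Defs "HOL-Probability.Characteristic_Functions"
begin

text \<open>
  Expanding \<open>f\<close> into time-frequency shifts, \<open>V\<^sub>g(T f)(x', \<omega>')\<close> is an integral of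
  \<open>V\<^sub>g f(x, \<omega>)\<close> against a matrix whose entries are, up to a factor \<open>\<langle>x'\<rangle>\<^sup>-\<^sup>s\<close>, dominated by \<open>H((\<omega>', x) - \<nabla>\<Phi>(x', \<omega>))\<close>
  with \<open>H = S * \<langle>\<cdot>\<rangle>\<^sup>-\<^sup>N\<close> and \<open>S(\<zeta>) = sup\<^sub>z \<bar>V\<^sub>\<Psi> \<sigma>(z, \<zeta>)\<bar> \<langle>z\<^sub>1\<rangle>\<^sup>s\<close> integrable: freeze the gradient of the phase
  at \<open>(x', \<omega>)\<close> and integrate by parts. A map with bounded second derivatives and uniformly nondegenerate differential satisfies
  a global lower Lipschitz bound (Hadamard), so integrals of \<open>\<langle>v - G(t)\<rangle>\<^sup>-\<^sup>N\<close> are bounded uniformly in \<open>v\<close> for each partial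
  gradient \<open>G\<close> with nondegenerate Hessian. This bounds rows and columns of the matrix, and also, with \<open>\<theta> = 1/q - 1/p\<close>, the integral of
  \<open>\<langle>x'\<rangle>\<^sup>-\<^sup>s\<^sup>/\<^sup>\<theta>\<close> times the matrix over \<open>(x, x')\<close>: in case (a) by the Hessian in \<open>x\<close>, in case (b) because the weight is
  integrable. Hoelder's inequality turns these three bounds into boundedness from \<open>L\<^sup>q\<^sub>\<omega>(L\<^sup>p\<^sub>x)\<close> to \<open>L\<^sup>p\<^sub>\<omega>(L\<^sup>q\<^sub>x)\<close>.
  For Schwartz \<open>f\<close> the function \<open>V\<^sub>g(T f)\<close> is integrable on phase space, and truncating its inversion integral approximates
  \<open>T f\<close> by Schwartz functions.
\<close>

section \<open>Characters, Lebesgue integrals and polynomial weights\<close>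

text \<open>The symbol is merely a measurable function, so no distributional pairing is available:
  every exchange of integrals is absolutely convergent, which is why essential boundedness of
  \<sigma> is derived, and Fourier inversion is used only almost everywhere. Freezing at (x',
  \<omega>) is forced by the windows: the output window sits at x', and the dual window, which acts
  on the Fourier transform of f since T sees f only through it, sits at \<omega>. The remaining
  phase has a gradient of linear growth, so N derivatives cost the N-th power of the weight, and the
  windows pay for it. The argument of H vanishes on the canonical relation of \<Phi>. With N =
  2(d+1) the bound splits into an \<omega>'-part and an x-part; in each of the three matrix bounds
  one of them integrates to a constant by translation, and a single integral over a partial gradient
  is left. In the Hoelder step the kernel is distributed with exponents q/p and 1 - q/p, and one
  factor is normalised by a power of the inner integral over x, so that a mixed norm and not a plain
  Lebesgue norm comes out.\<close>

definition ee :: "real \<Rightarrow> complex" where "ee t = cis (2 * pi * t)"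

lemma norm_ee [simp]: "norm (ee t) = 1" by (simp add: ee_def)
lemma ee_add: "ee (s + t) = ee s * ee t" by (simp add: ee_def cis_mult ring_distribs)
lemma ee_diff: "ee (s - t) = ee s * ee (- t)" using ee_add[of s "-t"] by simp
lemma cnj_ee: "cnj (ee t) = ee (- t)" by (simp add: ee_def cis_cnj)
lemma exp_eq_ee: "exp (2 * pi * \<i> * complex_of_real t) = ee t"
  by (simp add: ee_def cis_conv_exp mult_ac)
lemma exp_eq_ee_minus: "exp (- 2 * pi * \<i> * complex_of_real t) = ee (- t)"
  by (simp add: ee_def cis_conv_exp mult_ac)
lemma continuous_on_ee [continuous_intros]: "continuous_on S f \<Longrightarrow> continuous_on S (\<lambda>x. ee (f x))"
  unfolding ee_def by (intro continuous_intros)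
lemma measurable_ee [measurable]: "ee \<in> borel \<rightarrow>\<^sub>M borel"
  by (intro borel_measurable_continuous_onI continuous_intros)

lemma fourier_eq: "fourier f \<eta> = (LINT x|lborel. ee (- (x \<bullet> \<eta>)) * f x)"
  unfolding fourier_def exp_eq_ee_minus ..
lemma stft_eq: "stft g f x \<omega> = (LINT y|lborel. ee (- (\<omega> \<bullet> y)) * f y * cnj (g (y - x)))"
  unfolding stft_def exp_eq_ee_minus ..
lemma FIO_eq: "FIO \<Phi> \<sigma> f x = (LINT \<eta>|lborel. ee (\<Phi> (x, \<eta>)) * \<sigma> (x, \<eta>) * fourier f \<eta>)"
  unfolding FIO_def exp_eq_ee ..

lemma lborel_translate:
  fixes t :: "'a::euclidean_space"
  shows "distr lborel borel (\<lambda>x. t + x) = lborel"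
  using lborel_affine[of 1 t] by (simp add: density_1)

lemma lborel_reflect:
  fixes t :: "'a::euclidean_space"
  shows "distr lborel borel (\<lambda>x. t - x) = lborel"
  using lborel_affine[of "-1" t] by (simp add: density_1)

lemma
  fixes f :: "'a::euclidean_space \<Rightarrow> ennreal"
  assumes [measurable]: "f \<in> borel_measurable borel"
  shows nn_integral_translate: "(\<integral>\<^sup>+x. f (t + x) \<partial>lborel) = (\<integral>\<^sup>+x. f x \<partial>lborel)"
    and nn_integral_reflect: "(\<integral>\<^sup>+x. f (t - x) \<partial>lborel) = (\<integral>\<^sup>+x. f x \<partial>lborel)"
   by (subst (2) lborel_translate[of t, symmetric], subst nn_integral_distr, simp_all)
      (subst (2) lborel_reflect[of t, symmetric], subst nn_integral_distr, simp_all)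

lemma nn_integral_translate_diff:
  fixes f :: "'a::euclidean_space \<Rightarrow> ennreal"
  assumes [measurable]: "f \<in> borel_measurable borel"
  shows "(\<integral>\<^sup>+x. f (x - t) \<partial>lborel) = (\<integral>\<^sup>+x. f x \<partial>lborel)"
  using nn_integral_translate[of f "-t"] by (simp add: add.commute)

lemma
  fixes f :: "'a::euclidean_space \<Rightarrow> 'b::{banach, second_countable_topology}"
  shows integral_translate: "(LINT x|lborel. f (t + x)) = (LINT x|lborel. f x)"
    and integral_reflect: "(LINT x|lborel. f (t - x)) = (LINT x|lborel. f x)"
    and integrable_translate_iff: "integrable lborel (\<lambda>x. f (t + x)) \<longleftrightarrow> integrable lborel f"
    and integrable_reflect_iff: "integrable lborel (\<lambda>x. f (t - x)) \<longleftrightarrow> integrable lborel f"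
proof -
  have *: "integrable lborel (\<lambda>x. f (t + x))" if "integrable lborel f" for f :: "'a \<Rightarrow> 'b" and t
    using that by (subst (asm) lborel_translate[of t, symmetric], subst (asm) integrable_distr_eq) auto
  show i1: "integrable lborel (\<lambda>x. f (t + x)) \<longleftrightarrow> integrable lborel f"
    using *[of f t] *[of "\<lambda>x. f (t + x)" "-t"] by (auto simp: algebra_simps)
  have **: "integrable lborel (\<lambda>x. f (t - x))" if "integrable lborel f" for f :: "'a \<Rightarrow> 'b" and t
    using that by (subst (asm) lborel_reflect[of t, symmetric], subst (asm) integrable_distr_eq) auto
  show i2: "integrable lborel (\<lambda>x. f (t - x)) \<longleftrightarrow> integrable lborel f"
    using **[of f t] **[of "\<lambda>x. f (t - x)" "t"] by (auto simp: algebra_simps)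
  show "(LINT x|lborel. f (t + x)) = (LINT x|lborel. f x)"
  proof (cases "integrable lborel f")
    case True
    then have [measurable]: "f \<in> borel_measurable borel" by auto
    show ?thesis by (subst (2) lborel_translate[of t, symmetric], subst integral_distr) auto
  next
    case False then show ?thesis using i1 by (simp add: not_integrable_integral_eq)
  qed
  show "(LINT x|lborel. f (t - x)) = (LINT x|lborel. f x)"
  proof (cases "integrable lborel f")
    case True
    then have [measurable]: "f \<in> borel_measurable borel" by auto
    show ?thesis by (subst (2) lborel_reflect[of t, symmetric], subst integral_distr) auto
  next
    case False then show ?thesis using i2 by (simp add: not_integrable_integral_eq)
  qed
qed

lemma
  fixes f :: "'a::euclidean_space \<Rightarrow> 'b::{banach, second_countable_topology}"
  shows integral_translate_diff: "(LINT x|lborel. f (x - t)) = (LINT x|lborel. f x)"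
    and integrable_translate_diff_iff: "integrable lborel (\<lambda>x. f (x - t)) \<longleftrightarrow> integrable lborel f"
  using integral_translate[of f "-t"] integrable_translate_iff[of f "-t"] by (simp_all add: add.commute)

lemma integrable_by_nn_integral:
  fixes f :: "'a \<Rightarrow> 'b::{banach, second_countable_topology}"
  assumes "f \<in> borel_measurable M" "(\<integral>\<^sup>+x. ennreal (g x) \<partial>M) < \<infinity>" "AE x in M. norm (f x) \<le> g x"
  shows "integrable M f"
proof (rule integrableI_bounded[OF assms(1)])
  have "(\<integral>\<^sup>+x. ennreal (norm (f x)) \<partial>M) \<le> (\<integral>\<^sup>+x. ennreal (g x) \<partial>M)"
    using assms(3) by (intro nn_integral_mono_AE) (auto simp: ennreal_leI)
  with assms(2) show "(\<integral>\<^sup>+x. ennreal (norm (f x)) \<partial>M) < \<infinity>" by (simp add: order_le_less_trans)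
qed

text \<open>Finiteness of the iterated integral of the norm in one order gives joint integrability,
  from which all five conclusions follow; each application picks the order that is easier to
  bound.\<close>

lemma
  fixes f :: "'a::euclidean_space \<Rightarrow> 'b::euclidean_space \<Rightarrow> 'c::{banach, second_countable_topology}"
  assumes m: "(\<lambda>(x, y). f x y) \<in> borel_measurable (borel \<Otimes>\<^sub>M borel)"
    and fin: "(\<integral>\<^sup>+x. (\<integral>\<^sup>+y. ennreal (norm (f x y)) \<partial>lborel) \<partial>lborel) < \<infinity>"
  shows fubini_swap: "(LINT x|lborel. (LINT y|lborel. f x y)) = (LINT y|lborel. (LINT x|lborel. f x y))"
    and fubini_integrable: "integrable lborel (\<lambda>(x, y). f x y)"
    and fubini_pair: "(LINT z|lborel. f (fst z) (snd z)) = (LINT x|lborel. (LINT y|lborel. f x y))"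
    and fubini_integrable_fst: "integrable lborel (\<lambda>x. LINT y|lborel. f x y)"
    and fubini_integrable_snd: "integrable lborel (\<lambda>y. LINT x|lborel. f x y)"
proof -
  have [measurable]: "(\<lambda>(x, y). f x y) \<in> borel_measurable (lborel \<Otimes>\<^sub>M lborel)"
    using m by (simp add: measurable_lborel1 cong: measurable_cong_sets sets_pair_measure_cong)
  have i: "integrable (lborel \<Otimes>\<^sub>M lborel) (\<lambda>(x, y). f x y)"
  proof (rule integrableI_bounded)
    have "(\<integral>\<^sup>+z. ennreal (norm (case z of (x, y) \<Rightarrow> f x y)) \<partial>(lborel \<Otimes>\<^sub>M lborel))
      = (\<integral>\<^sup>+x. (\<integral>\<^sup>+y. ennreal (norm (f x y)) \<partial>lborel) \<partial>lborel)"
      by (subst lborel.nn_integral_fst[symmetric]) (auto simp: split_beta')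
    then show "(\<integral>\<^sup>+z. ennreal (norm (case z of (x, y) \<Rightarrow> f x y)) \<partial>(lborel \<Otimes>\<^sub>M lborel)) < \<infinity>"
      using fin by simp
  qed simp
  show "integrable lborel (\<lambda>(x, y). f x y)" using i by (simp add: lborel_prod)
  show "(LINT x|lborel. (LINT y|lborel. f x y)) = (LINT y|lborel. (LINT x|lborel. f x y))"
    by (rule lborel_pair.Fubini_integral[OF i, symmetric])
  show "(LINT z|lborel. f (fst z) (snd z)) = (LINT x|lborel. (LINT y|lborel. f x y))"
    using lborel_pair.integral_fst[OF i] by (simp add: lborel_prod split_beta')
  show "integrable lborel (\<lambda>x. LINT y|lborel. f x y)" using lborel_pair.integrable_fst[OF i] .
  show "integrable lborel (\<lambda>y. LINT x|lborel. f x y)" using lborel_pair.integrable_snd[OF i] .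
qed

lemma nn_integral_lborel_pair:
  fixes f :: "'a::euclidean_space \<times> 'b::euclidean_space \<Rightarrow> ennreal"
  assumes [measurable]: "f \<in> borel_measurable borel"
  shows "(\<integral>\<^sup>+z. f z \<partial>lborel) = (\<integral>\<^sup>+x. (\<integral>\<^sup>+y. f (x, y) \<partial>lborel) \<partial>lborel)"
proof -
  have "f \<in> borel_measurable (lborel \<Otimes>\<^sub>M lborel)"
    by (simp add: lborel_prod)
  then show ?thesis by (simp add: lborel.nn_integral_fst lborel_prod)
qed

lemma nn_integral_lborel_swap:
  fixes f :: "'a::euclidean_space \<Rightarrow> 'b::euclidean_space \<Rightarrow> ennreal"
  assumes "(\<lambda>(x, y). f x y) \<in> borel_measurable (borel \<Otimes>\<^sub>M borel)"
  shows "(\<integral>\<^sup>+x. (\<integral>\<^sup>+y. f x y \<partial>lborel) \<partial>lborel) = (\<integral>\<^sup>+y. (\<integral>\<^sup>+x. f x y \<partial>lborel) \<partial>lborel)"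
proof -
  have "(\<lambda>(x, y). f x y) \<in> borel_measurable (lborel \<Otimes>\<^sub>M lborel)"
    using assms by (simp add: cong: measurable_cong_sets sets_pair_measure_cong)
  from lborel_pair.Fubini[OF this] show ?thesis by simp
qed

text \<open>The weight 1 + |x| replaces the Japanese bracket, to which it is comparable, because it
  is submultiplicative with constant 1 (\<open>wt_add\<close>), so that exchanges of weights carry
  no constants.\<close>

definition wt :: "'a::real_normed_vector \<Rightarrow> real" where "wt x = 1 + norm x"

lemma wt_ge_1: "1 \<le> wt x" and wt_pos [simp]: "0 < wt x" and wt_nonneg[simp]: "0 \<le> wt x" and wt_nz[simp]: "wt x \<noteq> 0"
proof -
  show "1 \<le> wt x" by (simp add: wt_def)
  then show "0 < wt x" "0 \<le> wt x" "wt x \<noteq> 0" by auto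
qed
lemma wt_minus [simp]: "wt (- x) = wt x" by (simp add: wt_def)
lemma wt_add: "wt (x + y) \<le> wt x * wt y"
  using norm_triangle_ineq[of x y] by (simp add: wt_def algebra_simps) (smt (verit) mult_nonneg_nonneg norm_ge_zero)
lemma wt_diff: "wt (x - y) \<le> wt x * wt y" using wt_add[of x "-y"] by simp
lemma continuous_on_wt [continuous_intros]: "continuous_on S f \<Longrightarrow> continuous_on S (\<lambda>x. wt (f x))"
  unfolding wt_def by (intro continuous_intros)
lemma measurable_wt [measurable]: "wt \<in> borel \<rightarrow>\<^sub>M borel"
  by (intro borel_measurable_continuous_onI continuous_intros)
lemma wt_Pair: "wt (x, y) \<le> wt x * wt y"
  using sqrt_sum_squares_le_sum[of "norm x" "norm y"] by (simp add: wt_def norm_Pair algebra_simps) (smt (verit) mult_nonneg_nonneg norm_ge_zero)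
lemma wt_fst: "wt (fst z) \<le> wt z" and wt_snd: "wt (snd z) \<le> wt z"
  by (cases z; simp add: wt_def norm_fst_le norm_snd_le)+
lemma wt_powr_mono: "r \<le> s \<Longrightarrow> wt x powr r \<le> wt x powr s" by (simp add: powr_mono wt_ge_1)

text \<open>Each coordinate weight is at most the full weight, so half of the exponent can be given
  to either coordinate. The separated form allows integration over one coordinate at a time.\<close>

lemma wt_powr_neg_Pair:
  assumes "0 \<le> r"
  shows "wt z powr (- 2 * r) \<le> wt (fst z) powr (- r) * wt (snd z) powr (- r)"
proof -
  have "wt z powr (- 2 * r) = wt z powr (- r) * wt z powr (- r)" by (simp add: powr_add[symmetric])
  also have "\<dots> \<le> wt (fst z) powr (- r) * wt (snd z) powr (- r)"
    using assms by (intro mult_mono powr_mono2' wt_fst wt_snd) auto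
  finally show ?thesis .
qed

text \<open>Dyadic decomposition: the weight is about 2^k on the k-th shell, whose volume is of
  order 2^(kd), so the integral is dominated by a geometric series of ratio 2^(d-r).\<close>

lemma wt_powr_neg_nn_integral:
  assumes r: "r > real DIM('a::euclidean_space)"
  shows "(\<integral>\<^sup>+x. ennreal (wt (x::'a) powr (- r)) \<partial>lborel) < \<infinity>"
proof -
  let ?d = "DIM('a)"
  let ?V = "measure lborel (ball (0::'a) 1)"
  let ?a = "2 powr (real ?d - r)"
  let ?B = "\<lambda>k::nat. ball (0::'a) (2^k)"
  define T :: "nat \<Rightarrow> 'a \<Rightarrow> ennreal" where "T k x = ennreal (2 powr r * 2 powr (- r * real k)) * indicator (?B k) x" for k x
  have bd: "ennreal (wt x powr (- r)) \<le> (\<Sum>k. T k x)" for x :: 'a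
  proof -
    \<comment> \<open>The smallest dyadic ball containing x: the previous one misses x, so the
      weight is at least 2^(k-1); the factor 2^r in \<open>T\<close> pays for this shift by
      one.\<close>
    define k where "k = (LEAST k. x \<in> ?B k)"
    obtain m where "norm x < 2^m" using real_arch_pow[of 2 "norm x"] by auto
    then have xk: "x \<in> ?B k" unfolding k_def by (intro LeastI) auto
    have "2 powr (real k - 1) \<le> wt x"
    proof (cases k)
      case 0 then show ?thesis using wt_ge_1[of x] by simp
    next
      case (Suc j)
      then have "x \<notin> ?B j" using not_less_Least[of j "\<lambda>k. x \<in> ?B k"] unfolding k_def[symmetric] by auto
      then show ?thesis using Suc by (simp add: wt_def powr_realpow)
    qed
    then have "wt x powr (- r) \<le> (2 powr (real k - 1)) powr (- r)"
      using r by (intro powr_mono2') auto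
    also have "\<dots> = 2 powr r * 2 powr (- r * real k)"
    proof -
      have "(real k - 1) * (- r) = r + (- r * real k)" by (simp add: algebra_simps)
      then show ?thesis by (simp only: powr_powr powr_add)
    qed
    finally have "ennreal (wt x powr (- r)) \<le> T k x"
      using xk by (simp add: T_def ennreal_leI)
    also have "\<dots> \<le> (\<Sum>k. T k x)"
      using sum_le_suminf[of "\<lambda>k. T k x" "{k}"] by simp
    finally show ?thesis .
  qed
  have "(\<integral>\<^sup>+x. ennreal (wt (x::'a) powr (- r)) \<partial>lborel)
    \<le> (\<integral>\<^sup>+x. (\<Sum>k. T k x) \<partial>lborel)"
    by (rule nn_integral_mono) (rule bd)
  also have "\<dots> = (\<Sum>k. ennreal (2 powr r * 2 powr (- r * real k)) * emeasure lborel (?B k))"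
    proof -
    have i: "(\<integral>\<^sup>+x. T k x \<partial>lborel) = ennreal (2 powr r * 2 powr (- r * real k)) * emeasure lborel (?B k)" for k
      unfolding T_def by (rule nn_integral_cmult_indicator) simp
    have m: "T k \<in> borel_measurable lborel" for k
      unfolding T_def by (intro borel_measurable_times_ennreal borel_measurable_const borel_measurable_indicator) simp
    show ?thesis by (subst nn_integral_suminf) (simp_all only: i m)
  qed
  also have "\<dots> = (\<Sum>k. ennreal (2 powr r * ?V * ?a ^ k))"
  proof (rule arg_cong[where f=suminf], rule ext)
    fix k
    have "emeasure lborel (?B k) = ennreal (measure lborel (?B k))"
      using emeasure_eq_ennreal_measure[of lborel "?B k"] emeasure_lborel_ball_finite[of "0::'a" "2^k"] by (auto simp: top_unique)
    also have "measure lborel (?B k) = (2^k)^?d * ?V"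
      using content_ball_conv_unit_ball[of "2^k" "0::'a"] by simp
    finally have *: "emeasure lborel (?B k) = ennreal ((2^k)^?d * ?V)" .
    have "2 powr (- r * real k) * (2^k)^?d = ?a ^ k"
    proof -
      have "(2^k)^?d = 2 powr (real ?d * real k)"
        by (simp add: powr_powr powr_realpow[symmetric] mult.commute)
      moreover have "?a ^ k = 2 powr ((real ?d - r) * real k)"
        by (simp add: powr_realpow[symmetric] powr_powr)
      moreover have "(real ?d - r) * real k = (- r * real k) + real ?d * real k" by (simp add: algebra_simps)
      ultimately show ?thesis by (simp only: powr_add)
    qed
    then show "ennreal (2 powr r * 2 powr (- r * real k)) * emeasure lborel (?B k) = ennreal (2 powr r * ?V * ?a ^ k)"
      unfolding * by (subst ennreal_mult[symmetric]) (auto simp: mult_ac)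
  qed
  also have "\<dots> = ennreal (\<Sum>k. 2 powr r * ?V * ?a ^ k)"
    using powr_less_mono[of "real ?d - r" 0 2] r by (intro suminf_ennreal2 summable_mult summable_geometric) (auto intro!: mult_nonneg_nonneg)
  also have "\<dots> < \<infinity>" by simp
  finally show ?thesis .
qed

lemma wt_powr_neg_integrable:
  assumes "r > real DIM('a::euclidean_space)"
  shows "integrable lborel (\<lambda>x::'a. wt x powr (- r))"
  by (rule integrable_by_nn_integral[OF _ wt_powr_neg_nn_integral[OF assms]]) auto

section \<open>Fourier inversion\<close>

lemma measurable_cis [measurable]: "cis \<in> borel \<rightarrow>\<^sub>M borel"
  unfolding cis_conv_exp by measurable

lemma integral_scale:
  fixes f :: "'a::euclidean_space \<Rightarrow> 'b::{banach, second_countable_topology}"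
  assumes [measurable]: "f \<in> borel_measurable borel" and c: "c \<noteq> 0"
  shows "(LINT x|lborel. f x) = \<bar>c\<bar>^DIM('a) *\<^sub>R (LINT x|lborel. f (c *\<^sub>R x))"
  using c by (subst lborel_affine[OF c, of 0]) (simp add: integral_density integral_distr)

lemma norm_power2_Basis: "(norm (u::'a::euclidean_space))\<^sup>2 = (\<Sum>b\<in>Basis. (u \<bullet> b)\<^sup>2)"
  unfolding power2_norm_eq_inner by (subst euclidean_inner) (simp add: power2_eq_square)

text \<open>The standard normal density in product form, so that integrals against it factor into
  one-dimensional normal integrals.\<close>

definition gauss_density :: "'a::euclidean_space \<Rightarrow> real" where
  "gauss_density u = (\<Prod>b\<in>Basis. std_normal_density (u \<bullet> b))"

lemma gauss_density_nonneg [simp]: "0 \<le> gauss_density u"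
  by (auto simp: gauss_density_def intro!: prod_nonneg)

lemma measurable_gauss_density [measurable]: "gauss_density \<in> borel \<rightarrow>\<^sub>M borel"
  unfolding gauss_density_def[abs_def] by measurable

lemma gauss_density_eq: "gauss_density (u::'a::euclidean_space) = exp (- (norm u)\<^sup>2 / 2) / sqrt (2 * pi) ^ DIM('a)"
proof -
  have "gauss_density u = (\<Prod>b\<in>Basis. (1 / sqrt (2 * pi)) * exp (- (u \<bullet> b)\<^sup>2 / 2))"
    unfolding gauss_density_def std_normal_density_def by simp
  also have "\<dots> = (1 / sqrt (2*pi))^DIM('a) * exp (\<Sum>b\<in>(Basis::'a set). - (u \<bullet> b)\<^sup>2 / 2)"
    by (subst prod.distrib) (simp add: exp_sum)
  also have "(\<Sum>b\<in>(Basis::'a set). - (u \<bullet> b)\<^sup>2 / 2) = - (norm u)\<^sup>2 / 2"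
    by (simp add: sum_negf sum_divide_distrib[symmetric] norm_power2_Basis)
  finally show ?thesis by (simp add: power_divide)
qed

lemma nn_integral_gauss_density: "(\<integral>\<^sup>+u. ennreal (gauss_density (u::'a::euclidean_space)) \<partial>lborel) = 1"
proof -
  have "(\<integral>\<^sup>+u. ennreal (gauss_density (u::'a)) \<partial>lborel)
      = (\<integral>\<^sup>+u. (\<Prod>b\<in>Basis. ennreal (std_normal_density ((u::'a) \<bullet> b))) \<partial>lborel)"
    by (simp add: gauss_density_def prod_ennreal)
  also have "\<dots> = (\<Prod>b\<in>(Basis::'a set). (\<integral>\<^sup>+x. ennreal (std_normal_density x) \<partial>lborel))"
    by (subst nn_integral_lborel_prod) auto
  also have "(\<integral>\<^sup>+x. ennreal (std_normal_density x) \<partial>lborel) = 1"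
    using prob_space.emeasure_space_1[OF prob_space_normal_density[of 1 0]]
    by (simp add: emeasure_density)
  finally show ?thesis by simp
qed

lemma integrable_gauss_density: "integrable lborel (gauss_density :: 'a::euclidean_space \<Rightarrow> real)"
  by (rule integrableI_bounded) (simp_all add: nn_integral_gauss_density)

lemma integral_gauss_density: "(LINT u|lborel. gauss_density (u::'a::euclidean_space)) = 1"
  using integral_eq_nn_integral[of gauss_density lborel] by (simp add: nn_integral_gauss_density)

lemma cis_sum: "finite S \<Longrightarrow> cis (sum f S) = (\<Prod>b\<in>S. cis (f b))"
  by (induction S rule: finite_induct) (auto simp: cis_mult[symmetric])

text \<open>Lebesgue measure is the image of the product measure on coordinates; character and
  density both factor, which leaves a product of one-dimensional characteristic functions.\<close>

lemma gauss_density_char: "(LINT u|lborel. cis (v \<bullet> u) * gauss_density (u::'a::euclidean_space)) = exp (- (norm v)\<^sup>2 / 2)"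
proof -
  interpret product_sigma_finite "\<lambda>_::'a. lborel :: real measure" by standard
  have i1: "integrable lborel (\<lambda>x. cis (t * x) * complex_of_real (std_normal_density x))" for t
  proof (rule Bochner_Integration.integrable_bound)
    show "integrable lborel std_normal_density" by (rule integrable_normal_density) simp
    show "(\<lambda>x. cis (t * x) * complex_of_real (std_normal_density x)) \<in> borel_measurable lborel"
      unfolding cis_conv_exp by measurable
    show "AE x in lborel. norm (cis (t * x) * complex_of_real (std_normal_density x)) \<le> norm (std_normal_density x)"
      by (simp add: norm_mult)
  qed
  have c1: "(LINT x|lborel. cis (t * x) * complex_of_real (std_normal_density x)) = exp (- (t^2) / 2)" for t :: real
  proof -
    have "char std_normal_distribution t = (LINT x|lborel. cis (t * x) * complex_of_real (std_normal_density x))"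
      unfolding char_def by (subst integral_density) (auto simp: cis_conv_exp scaleR_conv_of_real mult_ac)
    then show ?thesis using char_std_normal_distribution by simp
  qed
  have [measurable]: "(\<lambda>u::'a. cis (v \<bullet> u) * gauss_density u) \<in> borel_measurable borel"
    unfolding cis_conv_exp by measurable
  have "(LINT u|lborel. cis (v \<bullet> u) * gauss_density u)
     = (LINT f|(\<Pi>\<^sub>M b\<in>(Basis::'a set). lborel). cis (v \<bullet> (\<Sum>b\<in>Basis. f b *\<^sub>R b)) * gauss_density (\<Sum>b\<in>Basis. f b *\<^sub>R b))"
    by (subst (1) lborel_eq, subst integral_distr) (simp_all cong: measurable_cong_sets)
  also have "\<dots> = (LINT f|(\<Pi>\<^sub>M b\<in>(Basis::'a set). lborel). (\<Prod>b\<in>Basis. cis ((v \<bullet> b) * f b) * complex_of_real (std_normal_density (f b))))"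
  proof (rule Bochner_Integration.integral_cong[OF refl])
    fix f :: "'a \<Rightarrow> real"
    have "(\<Sum>b\<in>Basis. f b *\<^sub>R b) \<bullet> c = f c" if "c \<in> Basis" for c :: 'a
      using that by (simp add: inner_sum_left inner_Basis if_distrib cong: if_cong)
    then have "gauss_density (\<Sum>b\<in>Basis. f b *\<^sub>R b) = (\<Prod>b\<in>(Basis::'a set). std_normal_density (f b))"
      unfolding gauss_density_def by (intro prod.cong) auto
    moreover have "v \<bullet> (\<Sum>b\<in>Basis. f b *\<^sub>R b) = (\<Sum>b\<in>Basis. (v \<bullet> b) * f b)"
      by (simp add: inner_sum_right mult_ac)
    ultimately show "cis (v \<bullet> (\<Sum>b\<in>Basis. f b *\<^sub>R b)) * gauss_density (\<Sum>b\<in>Basis. f b *\<^sub>R b)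
        = (\<Prod>b\<in>Basis. cis ((v \<bullet> b) * f b) * complex_of_real (std_normal_density (f b)))"
      by (simp add: cis_sum prod.distrib)
  qed
  also have "\<dots> = (\<Prod>b\<in>(Basis::'a set). complex_of_real (exp (- ((v \<bullet> b)^2) / 2)))"
    by (subst product_integral_prod) (auto simp: i1 c1)
  also have "\<dots> = exp (- (norm v)\<^sup>2 / 2)"
    by (simp add: of_real_prod[symmetric] exp_sum[symmetric] sum_negf sum_divide_distrib[symmetric] norm_power2_Basis del: of_real_prod)
  finally show ?thesis .
qed

text \<open>A wide Gaussian on the frequency side becomes an approximate identity of width \<delta>,
  by the substitution u = 2 pi \<delta> \<xi> in \<open>gauss_density_char\<close>.\<close>

lemma gauss_fourier_integral:
  fixes v :: "'a::euclidean_space"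
  assumes "0 < \<delta>"
  shows "(LINT \<xi>|lborel. ee (v \<bullet> \<xi>) * exp (- (norm ((2 * pi * \<delta>) *\<^sub>R \<xi>))\<^sup>2 / 2))
     = complex_of_real (gauss_density (v /\<^sub>R \<delta>) / \<delta> ^ DIM('a))"
proof -
  let ?c = "2 * pi * \<delta>"
  let ?s = "sqrt (2*pi) ^ DIM('a)"
  have c: "?c \<noteq> 0" "?c > 0" using assms by auto
  have s: "?s > 0" by simp
  \<comment> \<open>One factor \<open>?s\<close> turns the exponential into a density, the other
    turns the characteristic function back into one; together they cancel the power of 2 pi in the
    Jacobian.\<close>
  have ss: "?s * ?s = (2*pi)^DIM('a)" by (simp only: power_mult_distrib[symmetric] real_sqrt_mult_self) simp
  have "(LINT \<xi>|lborel. ee (v \<bullet> \<xi>) * exp (- (norm (?c *\<^sub>R \<xi>))\<^sup>2 / 2))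
    = (LINT \<xi>|lborel. ?s * (cis ((v /\<^sub>R \<delta>) \<bullet> (?c *\<^sub>R \<xi>)) * gauss_density (?c *\<^sub>R \<xi>)))"
  proof (rule Bochner_Integration.integral_cong[OF refl])
    fix \<xi> :: 'a
    have "complex_of_real ?s * gauss_density (?c *\<^sub>R \<xi>) = exp (- (norm (?c *\<^sub>R \<xi>))\<^sup>2 / 2)"
      using s unfolding gauss_density_eq of_real_mult[symmetric] by simp
    moreover have "ee (v \<bullet> \<xi>) = cis ((v /\<^sub>R \<delta>) \<bullet> (?c *\<^sub>R \<xi>))"
      using assms by (simp add: ee_def field_simps)
    ultimately show "ee (v \<bullet> \<xi>) * exp (- (norm (?c *\<^sub>R \<xi>))\<^sup>2 / 2) = ?s * (cis ((v /\<^sub>R \<delta>) \<bullet> (?c *\<^sub>R \<xi>)) * gauss_density (?c *\<^sub>R \<xi>))"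
      by (simp add: mult_ac)
  qed
  also have "\<dots> = ?s * (LINT \<xi>|lborel. cis ((v /\<^sub>R \<delta>) \<bullet> (?c *\<^sub>R \<xi>)) * gauss_density (?c *\<^sub>R \<xi>))"
    by simp
  also have "(LINT \<xi>|lborel. cis ((v /\<^sub>R \<delta>) \<bullet> (?c *\<^sub>R \<xi>)) * gauss_density (?c *\<^sub>R \<xi>))
      = complex_of_real (exp (- (norm (v /\<^sub>R \<delta>))\<^sup>2 / 2)) / ?c ^ DIM('a)"
  proof -
    have "complex_of_real (exp (- (norm (v /\<^sub>R \<delta>))\<^sup>2 / 2)) = (LINT u|lborel. cis ((v /\<^sub>R \<delta>) \<bullet> u) * gauss_density u)"
      by (simp only: gauss_density_char)
    also have "\<dots> = ?c ^ DIM('a) *\<^sub>R (LINT \<xi>|lborel. cis ((v /\<^sub>R \<delta>) \<bullet> (?c *\<^sub>R \<xi>)) * gauss_density (?c *\<^sub>R \<xi>))"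
      using c by (subst integral_scale[of _ ?c]) auto
    finally show ?thesis using c by (simp add: scaleR_conv_of_real field_simps)
  qed
  also have "exp (- (norm (v /\<^sub>R \<delta>))\<^sup>2 / 2) = ?s * gauss_density (v /\<^sub>R \<delta>)" using s unfolding gauss_density_eq by simp
  also have "complex_of_real ?s * (complex_of_real (?s * gauss_density (v /\<^sub>R \<delta>)) / ?c ^ DIM('a))
     = complex_of_real (?s * ?s * gauss_density (v /\<^sub>R \<delta>) / ?c ^ DIM('a))" by simp
  also have "\<dots> = complex_of_real (gauss_density (v /\<^sub>R \<delta>) / \<delta> ^ DIM('a))"
    unfolding ss using assms by (simp add: power_mult_distrib)
  finally show ?thesis .
qed

text \<open>Boxes are closed under intersection and generate the Borel sets, so by Dynkin's argument
  the integrals vanish over all Borel sets, which forces the function to be zero almost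
  everywhere.\<close>

lemma AE_zero_if_box_integrals_zero:
  fixes h :: "'a::euclidean_space \<Rightarrow> 'b::{banach, second_countable_topology}"
  assumes i: "\<And>a b. integrable lborel (\<lambda>x. indicator (box a b) x *\<^sub>R h x)"
    and z: "\<And>a b. (LINT x|lborel. indicator (box a b) x *\<^sub>R h x) = 0"
  shows "AE x in lborel. h x = 0"
proof -
  \<comment> \<open>Only integrals over boxes exist, so the argument runs inside each box of an
    exhaustion. Complements are fine because the integral over the entire box also vanishes.\<close>
  let ?B = "\<lambda>n::nat. box (- (real n *\<^sub>R One)) (real n *\<^sub>R One) :: 'a set"
  have "AE x in lborel. indicator (?B n) x *\<^sub>R h x = 0" for n
  proof -
    let ?h = "\<lambda>x. indicator (?B n) x *\<^sub>R h x"
    have ih: "integrable lborel ?h" by (rule i)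
    show ?thesis
    proof (rule sigma_finite_measure.density_zero[OF lborel.sigma_finite_measure_axioms ih])
      fix A :: "'a set" assume "A \<in> sets lborel"
      let ?E = "range (\<lambda>(a, b). box a b :: 'a set)"
      have "A \<in> sigma_sets UNIV ?E" using \<open>A \<in> sets lborel\<close> by (simp add: borel_eq_box)
      have st: "Int_stable ?E"
        unfolding Int_stable_def by (auto simp: box_Int_box) 
      have E: "?E \<subseteq> Pow UNIV" by simp
      have sb: "A \<in> sets borel" if "A \<in> sigma_sets UNIV ?E" for A
        using that by (simp add: borel_eq_box)
      have si: "set_integrable lborel A ?h" if "A \<in> sets borel" for A
        using integrable_mult_indicator[OF _ ih, of A] that by (simp add: set_integrable_def)
      have "set_lebesgue_integral lborel A ?h = 0" if "A \<in> sigma_sets UNIV ?E" for A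
        using st E that
      proof (induction A rule: sigma_sets_induct_disjoint)
        case (basic A)
        then obtain a b where A: "A = box a b" by auto
        have "set_lebesgue_integral lborel A ?h = (LINT x|lborel. indicator (box a b \<inter> ?B n) x *\<^sub>R h x)"
          unfolding set_lebesgue_integral_def A by (rule Bochner_Integration.integral_cong) (auto simp: indicator_def)
        also have "\<dots> = 0" unfolding box_Int_box by (rule z)
        finally show ?case .
      next
        case empty then show ?case by (simp add: set_lebesgue_integral_def)
      next
        case (compl A)
        have "0 = set_lebesgue_integral lborel UNIV ?h" using z by (simp add: set_lebesgue_integral_def)
        also have "\<dots> = set_lebesgue_integral lborel (A \<union> (UNIV - A)) ?h" by simp
        also have "\<dots> = set_lebesgue_integral lborel A ?h + set_lebesgue_integral lborel (UNIV - A) ?h"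
          using sb[OF compl(1)] by (intro set_integral_Un si) auto
        finally show ?case using compl by simp
      next
        case (union A)
        have "set_lebesgue_integral lborel (\<Union>i. A i) ?h = (\<Sum>i. set_lebesgue_integral lborel (A i) ?h)"
        proof (rule lebesgue_integral_countable_add)
          have Ab: "A i \<in> sets borel" for i using union(2) by (intro sb) auto
          then show "\<And>i. A i \<in> sets lborel" by simp
          show "\<And>i j. i \<noteq> j \<Longrightarrow> A i \<inter> A j = {}" using union(1) by (auto simp: disjoint_family_on_def)
          show "set_integrable lborel (\<Union> (range A)) ?h" using Ab by (intro si) auto
        qed
        also have "\<dots> = 0" using union(2,3) by (subst suminf_cong[where g="\<lambda>_. 0"]) (auto simp: subset_eq)
        finally show ?case .
      qed
      from this[OF \<open>A \<in> sigma_sets UNIV ?E\<close>] show "set_lebesgue_integral lborel A ?h = 0" .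
    qed
  qed
  then have "AE x in lborel. \<forall>n. indicator (?B n) x *\<^sub>R h x = 0" by (intro AE_all_countable[THEN iffD2] allI)
  then show ?thesis
  proof (eventually_elim)
    fix x assume *: "\<forall>n. indicator (?B n) x *\<^sub>R h x = 0"
    have "x \<in> (\<Union>n. ?B n)" unfolding UN_box_eq_UNIV by (rule UNIV_I)
    then obtain n where "x \<in> ?B n" by (rule UN_E)
    then show "h x = 0" using *[rule_format, of n] by simp
  qed
qed


lemma integrable_scale:
  fixes f :: "'a::euclidean_space \<Rightarrow> 'b::{banach, second_countable_topology}"
  assumes f: "integrable lborel f" and c: "c \<noteq> 0"
  shows "integrable lborel (\<lambda>x. f (c *\<^sub>R x))"
proof -
  have [measurable]: "f \<in> borel_measurable borel" using f by auto
  have "integrable (density (distr lborel borel (\<lambda>x. 0 + c *\<^sub>R x)) (\<lambda>_. ennreal (\<bar>c\<bar>^DIM('a)))) f"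
    using f by (subst (asm) lborel_affine[OF c, of 0]) simp
  then have "integrable lborel (\<lambda>x. \<bar>c\<bar>^DIM('a) *\<^sub>R f (c *\<^sub>R x))"
    by (simp add: integrable_density integrable_distr_eq)
  from integrable_scaleR_right[OF this, of "1 / \<bar>c\<bar>^DIM('a)"] show ?thesis using c by simp
qed

lemma lim_1_over_Suc: "(\<lambda>n. 1 / real (Suc n)) \<longlonglongrightarrow> 0"
  using LIMSEQ_inverse_real_of_nat by (simp only: inverse_eq_divide)

text \<open>The Fourier inversion integral with a Gaussian convergence factor. It tends to the
  inversion integral as \<delta> tends to 0, while by \<open>gauss_mean_conv\<close> it is also a
  Gaussian average of f.\<close>

definition gauss_mean :: "real \<Rightarrow> ('a::euclidean_space \<Rightarrow> complex) \<Rightarrow> 'a \<Rightarrow> complex" where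
  "gauss_mean \<delta> f y = (LINT \<xi>|lborel. ee (y \<bullet> \<xi>) * exp (- (norm ((2 * pi * \<delta>) *\<^sub>R \<xi>))\<^sup>2 / 2) * fourier f \<xi>)"

lemma measurable_fourier [measurable]:
  fixes f :: "'a::euclidean_space \<Rightarrow> complex"
  assumes [measurable]: "f \<in> borel_measurable borel"
  shows "fourier f \<in> borel_measurable borel"
  unfolding fourier_eq[abs_def] by measurable

lemma gauss_mean_tendsto:
  fixes f :: "'a::euclidean_space \<Rightarrow> complex"
  assumes f: "integrable lborel f" "integrable lborel (fourier f)"
  shows "(\<lambda>n. gauss_mean (1 / Suc n) f y) \<longlonglongrightarrow> (LINT \<xi>|lborel. ee (y \<bullet> \<xi>) * fourier f \<xi>)"
  unfolding gauss_mean_def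
proof (rule integral_dominated_convergence[where w="\<lambda>\<xi>. norm (fourier f \<xi>)"])
  have [measurable]: "f \<in> borel_measurable borel" using f by auto
  show "(\<lambda>\<xi>. ee (y \<bullet> \<xi>) * fourier f \<xi>) \<in> borel_measurable lborel"
    "\<And>n. (\<lambda>\<xi>. ee (y \<bullet> \<xi>) * exp (- (norm ((2 * pi * (1 / Suc n)) *\<^sub>R \<xi>))\<^sup>2 / 2) * fourier f \<xi>) \<in> borel_measurable lborel"
    by measurable
  show "AE \<xi> in lborel. (\<lambda>n. ee (y \<bullet> \<xi>) * exp (- (norm ((2 * pi * (1 / Suc n)) *\<^sub>R \<xi>))\<^sup>2 / 2) * fourier f \<xi>)
      \<longlonglongrightarrow> ee (y \<bullet> \<xi>) * fourier f \<xi>"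
  proof (rule AE_I2)
    fix \<xi>
    have "(\<lambda>n. ee (y \<bullet> \<xi>) * complex_of_real (exp (- (norm ((2 * pi * (1 / Suc n)) *\<^sub>R \<xi>))\<^sup>2 / 2)) * fourier f \<xi>)
      \<longlonglongrightarrow> ee (y \<bullet> \<xi>) * complex_of_real (exp (- (norm ((2 * pi * 0) *\<^sub>R \<xi>))\<^sup>2 / 2)) * fourier f \<xi>"
      by (intro tendsto_intros lim_1_over_Suc) simp
    then show "(\<lambda>n. ee (y \<bullet> \<xi>) * exp (- (norm ((2 * pi * (1 / Suc n)) *\<^sub>R \<xi>))\<^sup>2 / 2) * fourier f \<xi>)
      \<longlonglongrightarrow> ee (y \<bullet> \<xi>) * fourier f \<xi>" by simp
  qed
  show "AE \<xi> in lborel. norm (ee (y \<bullet> \<xi>) * exp (- (norm ((2 * pi * (1 / Suc n)) *\<^sub>R \<xi>))\<^sup>2 / 2) * fourier f \<xi>) \<le> norm (fourier f \<xi>)" for n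
    by (intro AE_I2) (auto simp: norm_mult intro!: mult_left_le_one_le)
  show "integrable lborel (\<lambda>\<xi>. norm (fourier f \<xi>))" using f by simp
qed

lemma norm_gauss_mean_le:
  assumes f: "integrable lborel (fourier f)"
  shows "norm (gauss_mean \<delta> f y) \<le> (LINT \<xi>|lborel. norm (fourier f \<xi>))"
proof -
  have [measurable]: "fourier f \<in> borel_measurable borel" using f by auto
  have "norm (gauss_mean \<delta> f y) \<le> (LINT \<xi>|lborel. norm (ee (y \<bullet> \<xi>) * exp (- (norm ((2 * pi * \<delta>) *\<^sub>R \<xi>))\<^sup>2 / 2) * fourier f \<xi>))"
    unfolding gauss_mean_def by (rule integral_norm_bound)
  also have "\<dots> \<le> (LINT \<xi>|lborel. norm (fourier f \<xi>))"
  proof (rule integral_mono)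
    show "integrable lborel (\<lambda>\<xi>. norm (ee (y \<bullet> \<xi>) * exp (- (norm ((2 * pi * \<delta>) *\<^sub>R \<xi>))\<^sup>2 / 2) * fourier f \<xi>))"
      by (rule Bochner_Integration.integrable_bound[OF f]) (auto simp: norm_mult intro!: mult_left_le_one_le)
  qed (use f in \<open>auto simp: norm_mult intro!: mult_left_le_one_le\<close>)
  finally show ?thesis .
qed

lemma integrable_gauss:
  assumes "0 < \<delta>"
  shows "integrable lborel (\<lambda>\<xi>::'a::euclidean_space. exp (- (norm ((2 * pi * \<delta>) *\<^sub>R \<xi>))\<^sup>2 / 2))"
proof -
  have "integrable lborel (\<lambda>\<xi>::'a. sqrt (2 * pi) ^ DIM('a) * gauss_density ((2 * pi * \<delta>) *\<^sub>R \<xi>))"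
    using assms by (intro integrable_mult_right integrable_scale integrable_gauss_density) auto
  then show ?thesis unfolding gauss_density_eq by simp
qed

text \<open>The Gaussian factor makes the double integral over \<xi> and z absolutely convergent, so
  the \<xi>-integral can be carried out first.\<close>

lemma gauss_mean_conv:
  fixes f :: "'a::euclidean_space \<Rightarrow> complex"
  assumes f: "integrable lborel f" and \<delta>: "0 < \<delta>"
  shows "gauss_mean \<delta> f y = (LINT z|lborel. f z * (gauss_density ((y - z) /\<^sub>R \<delta>) / \<delta> ^ DIM('a)))"
proof -
  have [measurable]: "f \<in> borel_measurable borel" using f by auto
  let ?G = "\<lambda>\<xi>::'a. exp (- (norm ((2 * pi * \<delta>) *\<^sub>R \<xi>))\<^sup>2 / 2)"
  have "gauss_mean \<delta> f y = (LINT \<xi>|lborel. (LINT z|lborel. ee (y \<bullet> \<xi>) * ?G \<xi> * (ee (- (z \<bullet> \<xi>)) * f z)))"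
    unfolding gauss_mean_def fourier_eq by simp
  also have "\<dots> = (LINT z|lborel. (LINT \<xi>|lborel. ee (y \<bullet> \<xi>) * ?G \<xi> * (ee (- (z \<bullet> \<xi>)) * f z)))"
  proof (rule fubini_swap)
    show "(\<lambda>(\<xi>, z). ee (y \<bullet> \<xi>) * ?G \<xi> * (ee (- (z \<bullet> \<xi>)) * f z)) \<in> borel_measurable (borel \<Otimes>\<^sub>M borel)"
      by measurable
    have "(\<integral>\<^sup>+\<xi>. (\<integral>\<^sup>+z. ennreal (norm (ee (y \<bullet> \<xi>) * ?G \<xi> * (ee (- (z \<bullet> \<xi>)) * f z))) \<partial>lborel) \<partial>lborel)
      = (\<integral>\<^sup>+\<xi>. ennreal (?G \<xi>) * (\<integral>\<^sup>+z. ennreal (norm (f z)) \<partial>lborel) \<partial>lborel)"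
      by (intro nn_integral_cong, subst nn_integral_cmult[symmetric]) (auto simp: norm_mult ennreal_mult intro!: nn_integral_cong)
    also have "\<dots> = (\<integral>\<^sup>+\<xi>. ennreal (?G \<xi>) \<partial>lborel) * (\<integral>\<^sup>+z. ennreal (norm (f z)) \<partial>lborel)"
      by (rule nn_integral_multc) measurable
    also have "\<dots> < \<infinity>"
    proof -
      have "(\<integral>\<^sup>+\<xi>. ennreal (norm (?G \<xi>)) \<partial>lborel) < \<infinity>" using integrable_gauss[OF \<delta>, where 'a='a] unfolding integrable_iff_bounded by blast
      moreover have "(\<integral>\<^sup>+z. ennreal (norm (f z)) \<partial>lborel) < \<infinity>" using f unfolding integrable_iff_bounded by blast
      ultimately show ?thesis by (simp add: ennreal_mult_less_top)
    qed
    finally show "(\<integral>\<^sup>+\<xi>. (\<integral>\<^sup>+z. ennreal (norm (ee (y \<bullet> \<xi>) * ?G \<xi> * (ee (- (z \<bullet> \<xi>)) * f z))) \<partial>lborel) \<partial>lborel) < \<infinity>" .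
  qed
  also have "\<dots> = (LINT z|lborel. f z * (LINT \<xi>|lborel. ee ((y - z) \<bullet> \<xi>) * ?G \<xi>))"
    by (subst integral_mult_right_zero[symmetric]) (intro Bochner_Integration.integral_cong refl, simp add: inner_diff_left ee_diff mult_ac)
  also have "\<dots> = (LINT z|lborel. f z * (gauss_density ((y - z) /\<^sub>R \<delta>) / \<delta> ^ DIM('a)))"
    unfolding gauss_fourier_integral[OF \<delta>] by simp
  finally show ?thesis .
qed

lemma integral_gauss_density_kernel:
  fixes z :: "'a::euclidean_space" and f :: "'a \<Rightarrow> real"
  assumes [measurable]: "f \<in> borel_measurable borel" and \<delta>: "0 < \<delta>"
  shows "(LINT y|lborel. f y * (gauss_density ((y - z) /\<^sub>R \<delta>) / \<delta> ^ DIM('a))) = (LINT u|lborel. f (z + \<delta> *\<^sub>R u) * gauss_density u)"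
proof -
  have "(LINT y|lborel. f y * (gauss_density ((y - z) /\<^sub>R \<delta>) / \<delta> ^ DIM('a)))
     = (LINT v|lborel. f (z + v) * (gauss_density (v /\<^sub>R \<delta>) / \<delta> ^ DIM('a)))"
    by (subst integral_translate[symmetric, of _ z]) simp
  also have "\<dots> = \<bar>\<delta>\<bar> ^ DIM('a) *\<^sub>R (LINT u|lborel. f (z + \<delta> *\<^sub>R u) * (gauss_density ((\<delta> *\<^sub>R u) /\<^sub>R \<delta>) / \<delta> ^ DIM('a)))"
    using \<delta> by (subst integral_scale[of _ \<delta>]) auto
  also have "\<dots> = (LINT u|lborel. f (z + \<delta> *\<^sub>R u) * gauss_density u)"
    using \<delta> by simp
  finally show ?thesis .
qed

text \<open>Off the boundary of the box the indicator is continuous, so averages of shrinking width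
  converge to its value; the exceptional boundary is a null set.\<close>

lemma gauss_density_indicator_tendsto:
  fixes z :: "'a::euclidean_space"
  assumes "z \<notin> frontier (box a b)"
  shows "(\<lambda>n. LINT u|lborel. indicat_real (box a b) (z + (1 / Suc n) *\<^sub>R u) * gauss_density u) \<longlonglongrightarrow> indicat_real (box a b) z"
proof -
  have "(\<lambda>n. LINT u|lborel. indicat_real (box a b) (z + (1 / Suc n) *\<^sub>R u) * gauss_density u) \<longlonglongrightarrow> (LINT u|lborel. indicat_real (box a b) z * gauss_density (u::'a))"
  proof (rule integral_dominated_convergence[where w="gauss_density :: 'a \<Rightarrow> real"])
    show "AE u in lborel. (\<lambda>n. indicat_real (box a b) (z + (1 / Suc n) *\<^sub>R u) * gauss_density u) \<longlonglongrightarrow> indicat_real (box a b) z * gauss_density u"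
    proof (rule AE_I2)
      fix u :: 'a
      have lim: "(\<lambda>n. z + (1 / Suc n) *\<^sub>R u) \<longlonglongrightarrow> z + 0 *\<^sub>R u"
        by (intro tendsto_intros lim_1_over_Suc)
      have "isCont (indicat_real (box a b)) z"
        using assms isCont_indicator[of z "box a b"] by blast
      then have "(\<lambda>n. indicat_real (box a b) (z + (1 / Suc n) *\<^sub>R u)) \<longlonglongrightarrow> indicat_real (box a b) z"
        using lim isCont_tendsto_compose by fastforce
      then show "(\<lambda>n. indicat_real (box a b) (z + (1 / Suc n) *\<^sub>R u) * gauss_density u) \<longlonglongrightarrow> indicat_real (box a b) z * gauss_density u"
        by (intro tendsto_intros)
    qed
    show "AE u in lborel. norm (indicat_real (box a b) (z + (1 / Suc n) *\<^sub>R u) * gauss_density u) \<le> gauss_density u" for n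
      by (auto simp: indicator_def)
  qed (auto simp: integrable_gauss_density)
  then show ?thesis by (simp add: integral_gauss_density)
qed

text \<open>Both sides are compared through integrals over boxes. Integrated over a box, the
  Gaussian means converge to the integral of the inversion formula by dominated convergence; after
  Fubini the averaging acts on the indicator of the box instead of on f, and the same quantities
  converge to the integral of f.\<close>

theorem fourier_inversion_AE:
  fixes f :: "'a::euclidean_space \<Rightarrow> complex"
  assumes f: "integrable lborel f" and ff: "integrable lborel (fourier f)"
  shows "AE y in lborel. f y = (LINT \<xi>|lborel. ee (y \<bullet> \<xi>) * fourier f \<xi>)"
proof -
  have [measurable]: "f \<in> borel_measurable borel" using f by auto
  define g where "g y = (LINT \<xi>|lborel. ee (y \<bullet> \<xi>) * fourier f \<xi>)" for y
  have [measurable]: "g \<in> borel_measurable borel" unfolding g_def[abs_def] by measurable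
  have [measurable]: "gauss_mean \<delta> f \<in> borel_measurable borel" for \<delta> unfolding gauss_mean_def[abs_def] by measurable
  define C where "C = (LINT \<xi>|lborel. norm (fourier f \<xi>))"
  have gC: "norm (g y) \<le> C" for y
    unfolding g_def C_def using integral_norm_bound[of lborel "\<lambda>\<xi>. ee (y \<bullet> \<xi>) * fourier f \<xi>"] by (simp add: norm_mult)
  have ib: "integrable lborel (\<lambda>x. indicat_real (box a b) x)" for a b :: 'a
    by (rule integrable_real_indicator) (simp_all add: emeasure_lborel_box_finite[unfolded infinity_ennreal_def])
  have ig: "integrable lborel (\<lambda>x. indicat_real (box a b) x *\<^sub>R g x)" for a b :: 'a
  proof (rule Bochner_Integration.integrable_bound[OF integrable_mult_right[OF ib[of a b], of C]])
    show "AE x in lborel. norm (indicat_real (box a b) x *\<^sub>R g x) \<le> norm (C * indicat_real (box a b) x)"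
      using gC by (intro AE_I2) (auto simp: indicator_def intro: order_trans[OF _ abs_ge_self])
  qed simp
  have if': "integrable lborel (\<lambda>x. indicat_real (box a b) x *\<^sub>R f x)" for a b :: 'a
    by (rule integrable_mult_indicator[OF _ f]) simp
  have eq: "(LINT x|lborel. indicat_real (box a b) x *\<^sub>R f x) = (LINT x|lborel. indicat_real (box a b) x *\<^sub>R g x)" for a b :: 'a
  proof -
    let ?I = "indicat_real (box a b)"
    let ?L = "\<lambda>n. LINT y|lborel. ?I y *\<^sub>R gauss_mean (1 / Suc n) f y"
    have l1: "?L \<longlonglongrightarrow> (LINT y|lborel. ?I y *\<^sub>R g y)"
    proof (rule integral_dominated_convergence[where w="\<lambda>y. C * ?I y"])
      show "AE y in lborel. (\<lambda>n. ?I y *\<^sub>R gauss_mean (1 / Suc n) f y) \<longlonglongrightarrow> ?I y *\<^sub>R g y"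
        unfolding g_def by (intro AE_I2 tendsto_intros gauss_mean_tendsto f ff)
      show "AE y in lborel. norm (?I y *\<^sub>R gauss_mean (1 / Suc n) f y) \<le> C * ?I y" for n
        using norm_gauss_mean_le[OF ff, folded C_def] by (auto simp: indicator_def)
      show "integrable lborel (\<lambda>y. C * ?I y)" by (intro integrable_mult_right ib)
    qed auto
    \<comment> \<open>The Gaussian kernel depends only on the difference of its arguments, so the
      smoothing of f is traded for a smoothing of the indicator, whose limit is explicit.\<close>
    have Leq: "?L n = (LINT z|lborel. f z * complex_of_real (LINT u|lborel. ?I (z + (1 / Suc n) *\<^sub>R u) * gauss_density u))" for n
    proof -
      define d where "d = 1 / real (Suc n)"
      have d: "0 < d" by (simp add: d_def)
      define k where "k y z = gauss_density ((y - z) /\<^sub>R d) / d ^ DIM('a)" for y z :: 'a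
      have [measurable]: "(\<lambda>(y, z). k y z) \<in> borel_measurable (borel \<Otimes>\<^sub>M borel)" unfolding k_def by measurable
      have kn: "0 \<le> k y z" for y z :: 'a using d by (simp add: k_def)
      have int1: "(\<integral>\<^sup>+y. ennreal (k y z) \<partial>lborel) = 1" for z :: 'a
      proof -
        have "integrable lborel (\<lambda>y. k y z)"
          using integrable_scale[OF integrable_gauss_density[where 'a='a], of "inverse d"] d
            integrable_translate_diff_iff[of "\<lambda>v::'a. gauss_density (v /\<^sub>R d)" z] by (simp add: k_def)
        then have "(\<integral>\<^sup>+y. ennreal (k y z) \<partial>lborel) = ennreal (LINT y|lborel. k y z)"
          using kn by (intro nn_integral_eq_integral) auto
        also have "(LINT y|lborel. k y z) = 1"
          using integral_gauss_density_kernel[of "\<lambda>_. 1" d z] d unfolding k_def by (simp only: mult_1 integral_gauss_density borel_measurable_const)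
        finally show ?thesis by simp
      qed
      have gk: "gauss_mean (1 / real (Suc n)) f y = (LINT z|lborel. f z * complex_of_real (k y z))" for y
        using gauss_mean_conv[OF f d] by (simp only: d_def[symmetric] k_def)
      have "?L n = (LINT y|lborel. (LINT z|lborel. ?I y *\<^sub>R (f z * complex_of_real (k y z))))"
        unfolding gk by (simp only: integral_scaleR_right)
      also have "\<dots> = (LINT z|lborel. (LINT y|lborel. ?I y *\<^sub>R (f z * complex_of_real (k y z))))"
      proof (rule fubini_swap[symmetric])
        show "(\<lambda>(z, y). ?I y *\<^sub>R (f z * complex_of_real (k y z))) \<in> borel_measurable (borel \<Otimes>\<^sub>M borel)" by measurable
        have "(\<integral>\<^sup>+z. (\<integral>\<^sup>+y. ennreal (norm (?I y *\<^sub>R (f z * complex_of_real (k y z)))) \<partial>lborel) \<partial>lborel)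
           \<le> (\<integral>\<^sup>+z. (\<integral>\<^sup>+y. ennreal (norm (f z)) * ennreal (k y z) \<partial>lborel) \<partial>lborel)"
          by (intro nn_integral_mono) (auto simp: indicator_def norm_mult kn ennreal_mult[symmetric])
        also have "\<dots> = (\<integral>\<^sup>+z. ennreal (norm (f z)) \<partial>lborel)"
          using int1 by (subst nn_integral_cmult) auto
        also have "\<dots> < \<infinity>" using f unfolding integrable_iff_bounded by blast
        finally show "(\<integral>\<^sup>+z. (\<integral>\<^sup>+y. ennreal (norm (?I y *\<^sub>R (f z * complex_of_real (k y z)))) \<partial>lborel) \<partial>lborel) < \<infinity>" .
      qed
      also have "\<dots> = (LINT z|lborel. f z * complex_of_real (LINT y|lborel. ?I y * k y z))"
      proof (rule Bochner_Integration.integral_cong[OF refl])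
        fix z
        have "(LINT y|lborel. ?I y *\<^sub>R (f z * complex_of_real (k y z))) = (LINT y|lborel. f z * complex_of_real (?I y * k y z))"
          by (intro Bochner_Integration.integral_cong) (auto simp: scaleR_conv_of_real)
        also have "\<dots> = f z * complex_of_real (LINT y|lborel. ?I y * k y z)"
          by (simp only: integral_mult_right_zero integral_complex_of_real)
        finally show "(LINT y|lborel. ?I y *\<^sub>R (f z * complex_of_real (k y z))) = f z * complex_of_real (LINT y|lborel. ?I y * k y z)" .
      qed
      also have "\<dots> = (LINT z|lborel. f z * complex_of_real (LINT u|lborel. ?I (z + d *\<^sub>R u) * gauss_density u))"
        unfolding k_def by (subst integral_gauss_density_kernel[OF _ d]) auto
      finally show ?thesis unfolding d_def .
    qed
    have l2: "?L \<longlonglongrightarrow> (LINT z|lborel. f z * complex_of_real (?I z))"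
      unfolding Leq
    proof (rule integral_dominated_convergence[where w="\<lambda>y. norm (f y)"])
      have "cbox a b - box a b \<in> null_sets lborel"
        using negligible_frontier_interval[of a b] by (simp add: negligible_iff_null_sets null_sets_completion_iff)
      then have ae: "AE z in lborel. z \<notin> cbox a b - box a b" by (rule AE_not_in)
      have "frontier (box a b) \<subseteq> cbox a b - box a b"
        using closure_minimal[OF box_subset_cbox[of a b] closed_cbox] interior_open[OF open_box[of a b]] unfolding frontier_def by blast
      then have "(\<lambda>n. f z * complex_of_real (LINT u|lborel. ?I (z + (1 / Suc n) *\<^sub>R u) * gauss_density u)) \<longlonglongrightarrow> f z * complex_of_real (?I z)"
        if "z \<notin> cbox a b - box a b" for z
        using that by (intro tendsto_mult tendsto_const tendsto_of_real gauss_density_indicator_tendsto) blast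
      with ae show "AE z in lborel. (\<lambda>n. f z * complex_of_real (LINT u|lborel. ?I (z + (1 / Suc n) *\<^sub>R u) * gauss_density u)) \<longlonglongrightarrow> f z * complex_of_real (?I z)"
        by (auto elim: eventually_mono)
      show "AE z in lborel. norm (f z * complex_of_real (LINT u|lborel. ?I (z + (1 / Suc n) *\<^sub>R u) * gauss_density u)) \<le> norm (f z)" for n
      proof (rule AE_I2)
        fix z
        have "\<bar>LINT u|lborel. ?I (z + (1 / Suc n) *\<^sub>R u) * gauss_density u\<bar> \<le> (LINT u|lborel. \<bar>?I (z + (1 / Suc n) *\<^sub>R u) * gauss_density u\<bar>)"
          by (rule integral_abs_bound)
        also have "\<dots> \<le> (LINT u|lborel. gauss_density (u::'a))"
        proof (rule integral_mono)
          show "integrable lborel (\<lambda>u::'a. \<bar>?I (z + (1 / Suc n) *\<^sub>R u) * gauss_density u\<bar>)"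
            by (rule Bochner_Integration.integrable_bound[OF integrable_gauss_density]) (auto simp: indicator_def)
        qed (auto simp: indicator_def integrable_gauss_density)
        finally have "\<bar>LINT u|lborel. ?I (z + (1 / Suc n) *\<^sub>R u) * gauss_density u\<bar> \<le> 1" by (simp add: integral_gauss_density)
        then show "norm (f z * complex_of_real (LINT u|lborel. ?I (z + (1 / Suc n) *\<^sub>R u) * gauss_density u)) \<le> norm (f z)"
          by (simp add: norm_mult mult_left_le)
      qed
    qed (use f in auto)
    from LIMSEQ_unique[OF l2 l1] show ?thesis by (simp add: scaleR_conv_of_real mult.commute)
  qed
  have "AE x in lborel. f x - g x = 0"
    by (rule AE_zero_if_box_integrals_zero) (simp_all add: scaleR_diff_right ig if' eq)
  then show ?thesis by (simp add: g_def)
qed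

section \<open>Bounds on iterated partial derivatives\<close>

abbreviation Dv :: "'a::euclidean_space \<Rightarrow> ('a \<Rightarrow> 'c::real_normed_vector) \<Rightarrow> 'a \<Rightarrow> 'c" where
  "Dv b f \<equiv> (\<lambda>x. frechet_derivative f (at x) b)"

lemma Dv_eq: "(f has_derivative f') (at x) \<Longrightarrow> Dv b f x = f' b"
  using frechet_derivative_at by metis

lemma has_derivative_frechet: "f differentiable (at x) \<Longrightarrow> (f has_derivative frechet_derivative f (at x)) (at x)"
  by (simp add: frechet_derivative_works)

lemma partials_append: "partials (us @ vs) f = partials us (partials vs f)"
  by (induction us) auto

text \<open>One weight bounds all partial derivatives up to order k. The recursion takes the first
  derivative of f itself, whereas \<open>partials\<close> adds derivatives on the outside; with this
  order the product and chain rules can be applied to f before the induction hypothesis.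
  \<open>partials_le_iff\<close> reconciles the two.\<close>

fun partials_le :: "nat \<Rightarrow> ('a::euclidean_space \<Rightarrow> real) \<Rightarrow> ('a \<Rightarrow> 'c::real_normed_vector) \<Rightarrow> bool" where
  "partials_le 0 W f \<longleftrightarrow> (\<forall>x. f differentiable (at x) \<and> norm (f x) \<le> W x)"
| "partials_le (Suc k) W f \<longleftrightarrow> (\<forall>x. f differentiable (at x) \<and> norm (f x) \<le> W x) \<and> (\<forall>b\<in>Basis. partials_le k W (Dv b f))"

lemma partials_le_differentiable: "partials_le k W f \<Longrightarrow> f differentiable (at x)" and partials_le_norm: "partials_le k W f \<Longrightarrow> norm (f x) \<le> W x"
  by (cases k; simp)+

lemma partials_le_W_nonneg: "partials_le k W f \<Longrightarrow> 0 \<le> W x"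
  using partials_le_norm norm_ge_zero order_trans by blast

lemma partials_le_continuous: "partials_le k W f \<Longrightarrow> continuous_on A f"
  by (meson partials_le_differentiable continuous_at_imp_continuous_on differentiable_imp_continuous_within)

lemma partials_le_measurable: "partials_le k W f \<Longrightarrow> f \<in> borel_measurable borel"
  by (intro borel_measurable_continuous_onI partials_le_continuous)

lemma partials_le_iff:
  "partials_le k W f \<longleftrightarrow> (\<forall>vs. set vs \<subseteq> Basis \<and> length vs \<le> k \<longrightarrow> (\<forall>x. partials vs f differentiable (at x) \<and> norm (partials vs f x) \<le> W x))"
proof (induction k arbitrary: f)
  case 0 then show ?case by simp
next
  case (Suc k)
  have "partials_le (Suc k) W f \<longleftrightarrow> (\<forall>x. f differentiable (at x) \<and> norm (f x) \<le> W x) \<and>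
    (\<forall>b\<in>Basis. \<forall>vs. set vs \<subseteq> Basis \<and> length vs \<le> k \<longrightarrow> (\<forall>x. partials (vs @ [b]) f differentiable (at x) \<and> norm (partials (vs @ [b]) f x) \<le> W x))"
    using Suc.IH by (simp add: partials_append)
  also have "\<dots> \<longleftrightarrow> (\<forall>vs. set vs \<subseteq> Basis \<and> length vs \<le> Suc k \<longrightarrow> (\<forall>x. partials vs f differentiable (at x) \<and> norm (partials vs f x) \<le> W x))"
    (is "?L \<longleftrightarrow> ?R")
  proof
    assume L: ?L
    show ?R
    proof (intro allI impI)
      fix vs :: "'a list" and x :: 'a assume vs: "set vs \<subseteq> Basis \<and> length vs \<le> Suc k"
      show "partials vs f differentiable (at x) \<and> norm (partials vs f x) \<le> W x"
      \<comment> \<open>The last entry of the list is the derivative taken first, hence the one that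
        \<open>partials_le\<close> peels off.\<close>
      proof (cases vs rule: rev_cases)
        case Nil then show ?thesis using L by simp
      next
        case (snoc us b)
        then show ?thesis using L vs by auto
      qed
    qed
  next
    assume R: ?R
    show ?L
    proof (intro conjI ballI allI impI)
      fix x :: 'a show "f differentiable (at x)" "norm (f x) \<le> W x" using R[rule_format, of "[]"] by auto
    next
      fix b x :: 'a and vs assume "b \<in> (Basis :: 'a set)" "set vs \<subseteq> (Basis :: 'a set) \<and> length vs \<le> k"
      then show "partials (vs @ [b]) f differentiable (at x)" "norm (partials (vs @ [b]) f x) \<le> W x"
        using R[rule_format, of "vs @ [b]"] by auto
    qed
  qed
  finally show ?case .
qed

lemma partials_le_mono: "partials_le k W f \<Longrightarrow> (\<And>x. W x \<le> V x) \<Longrightarrow> partials_le k V f"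
  by (induction k arbitrary: f) (auto intro: order_trans)

lemma partials_le_order: "partials_le k W f \<Longrightarrow> j \<le> k \<Longrightarrow> partials_le j W f"
  unfolding partials_le_iff by auto

lemma partials_le_SucD: "partials_le (Suc k) W f \<Longrightarrow> partials_le k W f" by (erule partials_le_order) simp

lemma partials_le_add:
  "partials_le k W f \<Longrightarrow> partials_le k V g \<Longrightarrow> partials_le k (\<lambda>x. W x + V x) (\<lambda>x. f x + g x)"
proof (induction k arbitrary: f g)
  case 0 then show ?case by (auto intro: norm_triangle_mono)
next
  case (Suc k)
  have d: "f differentiable (at x)" "g differentiable (at x)" for x using Suc.prems by (auto intro: partials_le_differentiable)
  have "Dv b (\<lambda>x. f x + g x) = (\<lambda>x. Dv b f x + Dv b g x)" for b
    by (rule ext, rule Dv_eq) (intro has_derivative_add has_derivative_frechet d)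
  then show ?case using Suc d by (auto intro: norm_triangle_mono)
qed

text \<open>Every differentiation at most doubles the number of Leibniz terms, which accounts for
  the factor 2^k.\<close>

lemma partials_le_mult:
  fixes f g :: "'a::euclidean_space \<Rightarrow> 'c::real_normed_algebra"
  shows "partials_le k W f \<Longrightarrow> partials_le k V g \<Longrightarrow> partials_le k (\<lambda>x. 2 ^ k * (W x * V x)) (\<lambda>x. f x * g x)"
proof (induction k arbitrary: f g)
  case 0
  have "norm (f x * g x) \<le> W x * V x" for x
    using 0 partials_le_W_nonneg[OF 0(1)] by (intro order_trans[OF norm_mult_ineq] mult_mono) auto
  then show ?case using 0 by auto
next
  case (Suc k)
  have d: "f differentiable (at x)" "g differentiable (at x)" for x using Suc.prems by (auto intro: partials_le_differentiable)
  have W: "norm (f x) \<le> W x" "norm (g x) \<le> V x" "0 \<le> W x" "0 \<le> V x" for x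
    using Suc.prems partials_le_norm partials_le_W_nonneg by blast+
  have D: "Dv b (\<lambda>x. f x * g x) = (\<lambda>x. f x * Dv b g x + Dv b f x * g x)" for b
    by (rule ext, rule Dv_eq) (intro has_derivative_mult has_derivative_frechet d)
  have "norm (f x * g x) \<le> 2 ^ Suc k * (W x * V x)" for x
  proof -
    have "norm (f x * g x) \<le> 1 * (W x * V x)"
      using W by (auto intro!: order_trans[OF norm_mult_ineq] mult_mono)
    also have "\<dots> \<le> 2 ^ Suc k * (W x * V x)" using W by (intro mult_right_mono one_le_power) auto
    finally show ?thesis .
  qed
  moreover have "partials_le k (\<lambda>x. 2 ^ Suc k * (W x * V x)) (\<lambda>x. f x * Dv b g x + Dv b f x * g x)" if "b \<in> Basis" for b
    using partials_le_add[OF Suc.IH[of f "Dv b g"] Suc.IH[of "Dv b f" g]] Suc.prems that partials_le_SucD[OF Suc.prems(1)] partials_le_SucD[OF Suc.prems(2)]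
    by (simp add: algebra_simps)
  ultimately show ?case using d by (auto simp: D)
qed

lemma differentiable_bounded_linear:
  "bounded_linear T \<Longrightarrow> f differentiable (at x) \<Longrightarrow> (\<lambda>x. T (f x)) differentiable (at x)"
  unfolding differentiable_def using bounded_linear.has_derivative by blast

lemma partials_le_linear:
  assumes T: "bounded_linear T" and le: "\<And>z. norm (T z) \<le> norm z"
  shows "partials_le k W f \<Longrightarrow> partials_le k W (\<lambda>x. T (f x))"
proof (induction k arbitrary: f)
  case 0 then show ?case by (auto intro: order_trans[OF le] differentiable_bounded_linear[OF T])
next
  case (Suc k)
  have d: "f differentiable (at x)" for x using Suc.prems by (auto intro: partials_le_differentiable)
  have "Dv b (\<lambda>x. T (f x)) = (\<lambda>x. T (Dv b f x))" for b
    by (rule ext, rule Dv_eq) (intro bounded_linear.has_derivative[OF T] has_derivative_frechet d)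
  then show ?case using Suc d by (auto intro: order_trans[OF le] differentiable_bounded_linear[OF T])
qed

lemma partials_le_cnj: "partials_le k W f \<Longrightarrow> partials_le k W (\<lambda>x. cnj (f x))"
  by (rule partials_le_linear) (auto intro: bounded_linear_cnj)

lemma partials_le_of_real: "partials_le k W f \<Longrightarrow> partials_le k W (\<lambda>x. complex_of_real (f x))"
  by (rule partials_le_linear) (auto intro: bounded_linear_of_real)

lemma partials_le_cmult: "partials_le k W f \<Longrightarrow> partials_le k (\<lambda>x. norm c * W x) (\<lambda>x. (c::'c::real_normed_algebra) * f x)"
proof (induction k arbitrary: f)
  case 0 then show ?case by (auto intro!: order_trans[OF norm_mult_ineq] mult_left_mono)
next
  case (Suc k)
  have d: "f differentiable (at x)" for x using Suc.prems by (auto intro: partials_le_differentiable)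
  have "Dv b (\<lambda>x. c * f x) = (\<lambda>x. c * Dv b f x)" for b
    by (rule ext, rule Dv_eq) (intro has_derivative_mult_right has_derivative_frechet d)
  then show ?case using Suc d by (auto intro!: order_trans[OF norm_mult_ineq] mult_left_mono)
qed

lemma partials_le_zero: "(\<And>x. 0 \<le> W x) \<Longrightarrow> partials_le k W (\<lambda>x. 0)"
  by (induction k) (auto simp: fun_eq_iff)

text \<open>A map that sends basis vectors to basis vectors or to 0 turns each partial derivative
  into a single partial derivative or into 0, so the chain rule costs no constant. Translations and
  the two coordinate projections are of this kind.\<close>

lemma partials_le_comp_linear:
  assumes L: "bounded_linear L" and B: "\<And>b. b \<in> Basis \<Longrightarrow> L b \<in> Basis \<or> L b = 0"
  shows "partials_le k W f \<Longrightarrow> partials_le k (\<lambda>x. W (L x + a)) (\<lambda>x. f (L x + a))"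
proof (induction k arbitrary: f)
  case 0
  have "(\<lambda>x. f (L x + a)) differentiable (at x)" for x
    using differentiable_chain_at[of "\<lambda>x. L x + a" x f] 0 bounded_linear_imp_differentiable[OF L]
    by (auto simp: o_def)
  with 0 show ?case by auto
next
  case (Suc k)
  have df: "f differentiable (at x)" for x using Suc.prems by (auto intro: partials_le_differentiable)
  have "((\<lambda>x. f (L x + a)) has_derivative (\<lambda>h. frechet_derivative f (at (L x + a)) (L h))) (at x)" for x
  proof -
    have "((\<lambda>x. L x + a) has_derivative L) (at x)"
      using has_derivative_add[OF bounded_linear_imp_has_derivative[OF L] has_derivative_const[of a]] by simp
    from diff_chain_at[OF this has_derivative_frechet[OF df]] show ?thesis by (simp add: o_def)
  qed
  note hd = this
  have D: "Dv b (\<lambda>x. f (L x + a)) = (\<lambda>x. frechet_derivative f (at (L x + a)) (L b))" for b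
    by (rule ext) (rule Dv_eq[OF hd])
  have d: "(\<lambda>x. f (L x + a)) differentiable (at x)" for x
    using hd by (auto simp: differentiable_def)
  have "partials_le k (\<lambda>x. W (L x + a)) (Dv b (\<lambda>x. f (L x + a)))" if "b \<in> Basis" for b
  proof (cases "L b = 0")
    case True
    then have "Dv b (\<lambda>x. f (L x + a)) = (\<lambda>x. 0)"
      using linear_frechet_derivative[OF df] by (simp add: D linear_0)
    then show ?thesis using partials_le_W_nonneg[OF Suc.prems] by (simp add: partials_le_zero)
  next
    case False
    then have "L b \<in> Basis" using B that by blast
    then have "partials_le k W (Dv (L b) f)" using Suc.prems by simp
    from Suc.IH[OF this] show ?thesis by (simp add: D)
  qed
  then show ?case using d partials_le_norm[OF Suc.prems] by simp
qed

lemma partials_le_translate: "partials_le k W f \<Longrightarrow> partials_le k (\<lambda>x. W (x - a)) (\<lambda>x. f (x - a))"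
  using partials_le_comp_linear[OF bounded_linear_ident, of k W f "-a"] by auto

lemma partials_le_fst: "partials_le k W f \<Longrightarrow> partials_le k (\<lambda>x::'b::euclidean_space \<times> 'c::euclidean_space. W (fst x - a)) (\<lambda>x. f (fst x - a))"
proof -
  have "fst b \<in> Basis \<or> fst b = 0" if "b \<in> Basis" for b :: "'b \<times> 'c"
    using that by (auto simp: Basis_prod_def)
  then show "partials_le k W f \<Longrightarrow> ?thesis" using partials_le_comp_linear[OF bounded_linear_fst, of k W f "-a"] by auto
qed

lemma partials_le_snd: "partials_le k W f \<Longrightarrow> partials_le k (\<lambda>x::'b::euclidean_space \<times> 'c::euclidean_space. W (snd x - a)) (\<lambda>x. f (snd x - a))"
proof -
  have "snd b \<in> Basis \<or> snd b = 0" if "b \<in> Basis" for b :: "'b \<times> 'c"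
    using that by (auto simp: Basis_prod_def)
  then show "partials_le k W f \<Longrightarrow> ?thesis" using partials_le_comp_linear[OF bounded_linear_snd, of k W f "-a"] by auto
qed

lemma has_derivative_cexp:
  fixes \<psi> :: "'a::real_normed_vector \<Rightarrow> complex"
  assumes "(\<psi> has_derivative \<psi>') (at x)"
  shows "((\<lambda>x. exp (\<psi> x)) has_derivative (\<lambda>h. exp (\<psi> x) * \<psi>' h)) (at x)"
  using diff_chain_at[OF assms, of exp "(*) (exp (\<psi> x))"] DERIV_exp[of "\<psi> x"]
  by (simp add: has_field_derivative_def o_def)

text \<open>Each derivative of the exponential brings down one factor bounded by W. The modulus of
  the exponential stays in the bound because it is 1 for oscillating phases but carries all the
  decay for Gaussians; W is at least 1 so that lower powers of it are dominated by higher
  ones.\<close>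

lemma partials_le_exp:
  fixes \<psi> :: "'a::euclidean_space \<Rightarrow> complex"
  assumes d: "\<And>x. \<psi> differentiable (at x)" and W: "\<And>x. 1 \<le> W x"
  shows "(\<And>b. b \<in> Basis \<Longrightarrow> partials_le k W (Dv b \<psi>)) \<Longrightarrow> partials_le k (\<lambda>x. (2 ^ k * W x) ^ k * norm (exp (\<psi> x))) (\<lambda>x. exp (\<psi> x))"
proof (induction k)
  case 0
  have "((\<lambda>x. exp (\<psi> x)) has_derivative (\<lambda>h. exp (\<psi> x) * frechet_derivative \<psi> (at x) h)) (at x)" for x
    by (rule has_derivative_cexp[OF has_derivative_frechet[OF d]])
  then show ?case by (auto simp: differentiable_def)
next
  case (Suc k)
  have D: "((\<lambda>x. exp (\<psi> x)) has_derivative (\<lambda>h. exp (\<psi> x) * frechet_derivative \<psi> (at x) h)) (at x)" for x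
    by (rule has_derivative_cexp[OF has_derivative_frechet[OF d]])
  then have dd: "(\<lambda>x. exp (\<psi> x)) differentiable (at x)" for x by (auto simp: differentiable_def)
  have D: "Dv b (\<lambda>x. exp (\<psi> x)) = (\<lambda>x. exp (\<psi> x) * Dv b \<psi> x)" for b
    using Dv_eq[OF D] by blast
  have mono: "(2 ^ k * W x) ^ Suc k \<le> (2 ^ Suc k * W x) ^ Suc k" for x
    using W[of x] by (intro power_mono mult_right_mono power_increasing) auto
  have ge1: "1 \<le> (2 ^ Suc k * W x) ^ Suc k" for x
    using W[of x] by (intro one_le_power) (metis mult_mono' one_le_numeral one_le_power mult_1 zero_le_one)
  have "norm (exp (\<psi> x)) \<le> (2 ^ Suc k * W x) ^ Suc k * norm (exp (\<psi> x))" for x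
    using mult_right_mono[OF ge1, of "norm (exp (\<psi> x))" x] by simp
  moreover have "partials_le k (\<lambda>x. (2 ^ Suc k * W x) ^ Suc k * norm (exp (\<psi> x))) (Dv b (\<lambda>x. exp (\<psi> x)))" if b: "b \<in> Basis" for b
  proof -
    have aux: "c * ((c * w) ^ k * e * w) = (c * w) ^ Suc k * e" for c w e :: real by simp
    have 1: "partials_le k (\<lambda>x. (2 ^ k * W x) ^ k * norm (exp (\<psi> x))) (\<lambda>x. exp (\<psi> x))"
      by (rule Suc.IH) (rule partials_le_SucD[OF Suc.prems])
    have 2: "partials_le k W (Dv b \<psi>)" using Suc.prems[OF b] by (rule partials_le_SucD)
    show ?thesis unfolding D
    proof (rule partials_le_mono[OF partials_le_mult[OF 1 2]])
      fix x
      have "2 ^ k * ((2 ^ k * W x) ^ k * norm (exp (\<psi> x)) * W x) = (2 ^ k * W x) ^ Suc k * norm (exp (\<psi> x))"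
        by (rule aux)
      also have "\<dots> \<le> (2 ^ Suc k * W x) ^ Suc k * norm (exp (\<psi> x))"
        by (intro mult_right_mono mono) auto
      finally show "2 ^ k * ((2 ^ k * W x) ^ k * norm (exp (\<psi> x)) * W x) \<le> (2 ^ Suc k * W x) ^ Suc k * norm (exp (\<psi> x))" .
    qed
  qed
  ultimately show ?case using dd by auto
qed

text \<open>The increment f(x + b) - f(x) has integral 0 by translation invariance. It is also the
  integral of the derivative along the segment from x to x + b, and by Fubini and translation
  invariance its integral is that of the derivative itself; thus no boundary terms appear.\<close>

lemma integral_Dv_eq_0:
  fixes f :: "'a::euclidean_space \<Rightarrow> complex"
  assumes d: "\<And>x. f differentiable (at x)" and c: "continuous_on UNIV (Dv b f)"
    and i: "integrable lborel f" "integrable lborel (Dv b f)"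
  shows "(LINT x|lborel. Dv b f x) = 0"
proof -
  let ?g = "Dv b f"
  have [measurable]: "?g \<in> borel_measurable borel" using c by (rule borel_measurable_continuous_onI)
  have ftc: "(LINT t|lborel. indicat_real {0..1} t *\<^sub>R ?g (x + t *\<^sub>R b)) = f (x + b) - f x" for x
  proof -
    have "((\<lambda>t. f (x + t *\<^sub>R b)) has_vector_derivative ?g (x + t *\<^sub>R b)) (at t within {0..1})" for t
    proof -
      have "((\<lambda>t. x + t *\<^sub>R b) has_derivative (\<lambda>h. h *\<^sub>R b)) (at t)"
        by (auto intro!: derivative_eq_intros)
      from diff_chain_at[OF this has_derivative_frechet[OF d]]
      have "((\<lambda>t. f (x + t *\<^sub>R b)) has_derivative (\<lambda>h. frechet_derivative f (at (x + t *\<^sub>R b)) (h *\<^sub>R b))) (at t)"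
        by (simp add: o_def)
      then have "((\<lambda>t. f (x + t *\<^sub>R b)) has_vector_derivative ?g (x + t *\<^sub>R b)) (at t)"
        by (simp add: has_vector_derivative_def linear_cmul[OF linear_frechet_derivative[OF d]])
      then show ?thesis by (rule has_vector_derivative_at_within)
    qed
    moreover have "continuous_on {0..1} (\<lambda>t. ?g (x + t *\<^sub>R b))"
      by (rule continuous_on_compose2[OF c]) (auto intro!: continuous_intros)
    ultimately show ?thesis using integral_FTC_Icc[of 0 1 "\<lambda>t. f (x + t *\<^sub>R b)" "\<lambda>t. ?g (x + t *\<^sub>R b)"] by simp
  qed
  have "0 = (LINT x|lborel. f (x + b) - f x)"
    using i integrable_translate_iff[of f b] integral_translate[of f b]
    by (subst Bochner_Integration.integral_diff) (auto simp: add.commute)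
  also have "\<dots> = (LINT x|lborel. (LINT t|lborel. indicat_real {0..1} t *\<^sub>R ?g (x + t *\<^sub>R b)))"
    by (simp only: ftc)
  also have "\<dots> = (LINT t|lborel. (LINT x|lborel. indicat_real {0..1} t *\<^sub>R ?g (x + t *\<^sub>R b)))"
  proof (rule fubini_swap[symmetric])
    have "(\<integral>\<^sup>+t. (\<integral>\<^sup>+x. ennreal (norm (indicat_real {0..1} t *\<^sub>R ?g (x + t *\<^sub>R b))) \<partial>lborel) \<partial>lborel)
      = (\<integral>\<^sup>+t. indicator {0..1} (t::real) * (\<integral>\<^sup>+x. ennreal (norm (?g x)) \<partial>lborel) \<partial>lborel)"
    proof (rule nn_integral_cong)
      fix t :: real
      show "(\<integral>\<^sup>+x. ennreal (norm (indicat_real {0..1} t *\<^sub>R ?g (x + t *\<^sub>R b))) \<partial>lborel) = indicator {0..1} t * (\<integral>\<^sup>+x. ennreal (norm (?g x)) \<partial>lborel)"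
        using nn_integral_translate[of "\<lambda>x. ennreal (norm (?g x))" "t *\<^sub>R b"]
        by (cases "t \<in> {0..1}") (simp_all add: add.commute)
    qed
    also have "\<dots> = (\<integral>\<^sup>+x. ennreal (norm (?g x)) \<partial>lborel)"
      by (subst nn_integral_multc) simp_all
    also have "\<dots> < \<infinity>" using i(2) unfolding integrable_iff_bounded by blast
    finally show "(\<integral>\<^sup>+t. (\<integral>\<^sup>+x. ennreal (norm (indicat_real {0..1} t *\<^sub>R ?g (x + t *\<^sub>R b))) \<partial>lborel) \<partial>lborel) < \<infinity>" .
    show "(\<lambda>(t, x). indicat_real {0..1} t *\<^sub>R ?g (x + t *\<^sub>R b)) \<in> borel_measurable (borel \<Otimes>\<^sub>M borel)"
      by measurable
  qed
  also have "\<dots> = (LINT t|lborel. indicat_real {0..1} (t::real) *\<^sub>R (LINT x|lborel. ?g x))"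
  proof (rule Bochner_Integration.integral_cong[OF refl])
    fix t :: real
    show "(LINT x|lborel. indicat_real {0..1} t *\<^sub>R ?g (x + t *\<^sub>R b)) = indicat_real {0..1} t *\<^sub>R (LINT x|lborel. ?g x)"
      using integral_translate[of ?g "t *\<^sub>R b"] by (simp add: add.commute)
  qed
  also have "\<dots> = (LINT x|lborel. ?g x)" by simp
  finally show ?thesis by simp
qed

section \<open>Decay of Fourier integrals by integration by parts\<close>

lemma ee_exp: "ee t = exp (\<i> * complex_of_real (2 * pi * t))"
  by (simp add: ee_def cis_conv_exp mult_ac)

lemma has_derivative_ee_inner:
  "((\<lambda>Y. ee (\<xi> \<bullet> Y)) has_derivative (\<lambda>h. (2 * pi * (\<xi> \<bullet> h)) *\<^sub>R (\<i> * ee (\<xi> \<bullet> Y)))) (at Y)"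
proof -
  have "((\<lambda>Y. ee (\<xi> \<bullet> Y)) has_derivative (\<lambda>h. exp (\<i> * complex_of_real (2 * pi * (\<xi> \<bullet> Y))) * (\<i> * complex_of_real (2 * pi * (\<xi> \<bullet> h))))) (at Y)"
    unfolding ee_exp
    by (intro has_derivative_cexp has_derivative_mult_right has_derivative_of_real
      has_derivative_inner_right has_derivative_ident)
  then show ?thesis unfolding ee_exp[symmetric] by (simp add: scaleR_conv_of_real mult_ac)
qed

lemma partials_le_integrable:
  fixes f :: "'a::euclidean_space \<Rightarrow> complex"
  assumes "partials_le k W f" "integrable lborel W"
  shows "integrable lborel f"
  using assms by (intro Bochner_Integration.integrable_bound[OF assms(2)]) 
    (auto intro: partials_le_measurable order_trans[OF partials_le_norm abs_ge_self])

text \<open>The derivative of the product \<open>ee (\<xi> \<bullet> Y) * B Y\<close> integrates to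
  0, and its two Leibniz terms are the two sides of the identity.\<close>

lemma fourier_integral_Dv:
  fixes B :: "'a::euclidean_space \<Rightarrow> complex"
  assumes B: "partials_le (Suc k) W B" and W: "integrable lborel W" and b: "b \<in> Basis"
  shows "(LINT Y|lborel. ee (\<xi> \<bullet> Y) * Dv b B Y) = - (2 * pi * (\<xi> \<bullet> b)) *\<^sub>R (\<i> * (LINT Y|lborel. ee (\<xi> \<bullet> Y) * B Y))"
proof -
  let ?e = "\<lambda>Y. ee (\<xi> \<bullet> Y)"
  have dB: "B differentiable (at x)" for x by (rule partials_le_differentiable[OF B])
  have Db: "partials_le k W (Dv b B)" using B b by simp
  note [measurable] = partials_le_measurable[OF B] partials_le_measurable[OF Db]
  have D: "((\<lambda>Y. ?e Y * B Y) has_derivative (\<lambda>h. ?e Y * frechet_derivative B (at Y) h + ((2 * pi * (\<xi> \<bullet> h)) *\<^sub>R (\<i> * ?e Y)) * B Y)) (at Y)" for Y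
    by (intro has_derivative_mult has_derivative_ee_inner has_derivative_frechet dB)
  then have D1: "Dv b (\<lambda>Y. ?e Y * B Y) = (\<lambda>Y. ?e Y * Dv b B Y + ((2 * pi * (\<xi> \<bullet> b)) *\<^sub>R (\<i> * ?e Y)) * B Y)"
    using Dv_eq by blast
  have c: "continuous_on UNIV (Dv b (\<lambda>Y. ?e Y * B Y))"
    unfolding D1 by (intro continuous_intros partials_le_continuous[OF B] partials_le_continuous[OF Db])
  have iB: "integrable lborel (\<lambda>Y. ?e Y * B Y)"
    by (rule Bochner_Integration.integrable_bound[OF partials_le_integrable[OF B W]]) (auto simp: norm_mult)
  have iD: "integrable lborel (\<lambda>Y. ?e Y * Dv b B Y)"
    by (rule Bochner_Integration.integrable_bound[OF partials_le_integrable[OF Db W]]) (auto simp: norm_mult)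
  have iE: "integrable lborel (\<lambda>Y. ((2 * pi * (\<xi> \<bullet> b)) *\<^sub>R (\<i> * ?e Y)) * B Y)"
    using integrable_scaleR_right[OF integrable_mult_right[OF iB, of \<i>], of "2 * pi * (\<xi> \<bullet> b)"] by (simp add: mult_ac)
  have "0 = (LINT Y|lborel. Dv b (\<lambda>Y. ?e Y * B Y) Y)"
    by (rule integral_Dv_eq_0[symmetric]) (use c D iB iD iE in \<open>auto simp: differentiable_def D1\<close>)
  also have "\<dots> = (LINT Y|lborel. ?e Y * Dv b B Y) + (LINT Y|lborel. ((2 * pi * (\<xi> \<bullet> b)) *\<^sub>R (\<i> * ?e Y)) * B Y)"
    unfolding D1 by (rule Bochner_Integration.integral_add[OF iD iE])
  also have "(LINT Y|lborel. ((2 * pi * (\<xi> \<bullet> b)) *\<^sub>R (\<i> * ?e Y)) * B Y) = (2 * pi * (\<xi> \<bullet> b)) *\<^sub>R (\<i> * (LINT Y|lborel. ?e Y * B Y))"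
    by (simp add: mult.assoc)
  finally show ?thesis by (simp add: add_eq_0_iff2 minus_equation_iff eq_commute[of 0])
qed

lemma fourier_integral_decay_coordinate:
  fixes B :: "'a::euclidean_space \<Rightarrow> complex"
  assumes W: "integrable lborel W" and b: "b \<in> Basis"
  shows "partials_le N W B \<Longrightarrow> \<bar>\<xi> \<bullet> b\<bar> ^ N * norm (LINT Y|lborel. ee (\<xi> \<bullet> Y) * B Y) \<le> (LINT Y|lborel. W Y)"
proof (induction N arbitrary: B)
  case 0
  have "norm (LINT Y|lborel. ee (\<xi> \<bullet> Y) * B Y) \<le> (LINT Y|lborel. norm (ee (\<xi> \<bullet> Y) * B Y))"
    by (rule integral_norm_bound)
  also have "\<dots> \<le> (LINT Y|lborel. W Y)"
    using partials_le_integrable[OF 0 W] partials_le_norm[OF 0] by (intro integral_mono W) (auto simp: norm_mult)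
  finally show ?case by simp
next
  case (Suc N)
  have D: "partials_le N W (Dv b B)" using Suc.prems b by simp
  have "\<bar>\<xi> \<bullet> b\<bar> ^ Suc N * norm (LINT Y|lborel. ee (\<xi> \<bullet> Y) * B Y)
    \<le> \<bar>\<xi> \<bullet> b\<bar> ^ N * ((2 * pi * \<bar>\<xi> \<bullet> b\<bar>) * norm (LINT Y|lborel. ee (\<xi> \<bullet> Y) * B Y))"
  proof -
    \<comment> \<open>The factor 2 pi gained by each integration by parts is given away to keep the
      constant free of N.\<close>
    have "1 * \<bar>\<xi> \<bullet> b\<bar> \<le> 2 * pi * \<bar>\<xi> \<bullet> b\<bar>" using pi_ge_two by (intro mult_right_mono) auto
    then have "\<bar>\<xi> \<bullet> b\<bar> * norm (LINT Y|lborel. ee (\<xi> \<bullet> Y) * B Y) \<le> (2 * pi * \<bar>\<xi> \<bullet> b\<bar>) * norm (LINT Y|lborel. ee (\<xi> \<bullet> Y) * B Y)"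
      by (intro mult_right_mono) auto
    then have "\<bar>\<xi> \<bullet> b\<bar> ^ N * (\<bar>\<xi> \<bullet> b\<bar> * norm (LINT Y|lborel. ee (\<xi> \<bullet> Y) * B Y)) \<le> \<bar>\<xi> \<bullet> b\<bar> ^ N * ((2 * pi * \<bar>\<xi> \<bullet> b\<bar>) * norm (LINT Y|lborel. ee (\<xi> \<bullet> Y) * B Y))"
      by (intro mult_left_mono) auto
    then show ?thesis by (simp add: mult_ac)
  qed
  also have "(2 * pi * \<bar>\<xi> \<bullet> b\<bar>) * norm (LINT Y|lborel. ee (\<xi> \<bullet> Y) * B Y) = norm (LINT Y|lborel. ee (\<xi> \<bullet> Y) * Dv b B Y)"
    unfolding fourier_integral_Dv[OF Suc.prems W b] by (simp add: norm_mult abs_mult)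
  also have "\<bar>\<xi> \<bullet> b\<bar> ^ N * \<dots> \<le> (LINT Y|lborel. W Y)" by (rule Suc.IH[OF D])
  finally show ?case .
qed

lemma power_add_le: "0 \<le> (t::real) \<Longrightarrow> (1 + t) ^ N \<le> 2 ^ N * (1 + t ^ N)"
proof (cases "t \<le> 1")
  case True
  assume "0 \<le> t"
  have "(1 + t) ^ N \<le> 2 ^ N" using True \<open>0 \<le> t\<close> by (intro power_mono) auto
  also have "\<dots> \<le> 2 ^ N * (1 + t ^ N)" using \<open>0 \<le> t\<close> by simp
  finally show ?thesis .
next
  case False
  assume "0 \<le> t"
  have "(1 + t) ^ N \<le> (2 * t) ^ N" using False by (intro power_mono) auto
  also have "\<dots> \<le> 2 ^ N * (1 + t ^ N)" by (simp add: power_mult_distrib)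
  finally show ?thesis .
qed

text \<open>All N integrations by parts are made in the coordinate where \<xi> is largest. In C, the
  power of the dimension comes from comparing |\<xi>| with that coordinate, and 2^N from splitting
  (1 + |\<xi>|)^N by \<open>power_add_le\<close>.\<close>

lemma fourier_integral_decay:
  fixes N :: nat
  defines "C \<equiv> 2 ^ N * (1 + real DIM('a) ^ N)"
  fixes B :: "'a::euclidean_space \<Rightarrow> complex"
  assumes B: "partials_le N W B" and W: "integrable lborel W"
  shows "norm (LINT Y|lborel. ee (\<xi> \<bullet> Y) * B Y) \<le> C * wt \<xi> powr (- real N) * (LINT Y|lborel. W Y)"
proof -
  let ?F = "norm (LINT Y|lborel. ee (\<xi> \<bullet> Y) * B Y)"
  have 0: "?F \<le> (LINT Y|lborel. W Y)" 
    using fourier_integral_decay_coordinate[OF W SOME_Basis partials_le_order[OF B], of 0] by simp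
  define m where "m = (MAX b\<in>Basis. \<bar>\<xi> \<bullet> b\<bar>)"
  have mle: "\<bar>\<xi> \<bullet> b\<bar> \<le> m" if "b \<in> Basis" for b unfolding m_def using that by (intro Max_ge) auto
  have "m \<in> (\<lambda>b. \<bar>\<xi> \<bullet> b\<bar>) ` Basis" unfolding m_def by (rule Max_in) auto
  then obtain b where b: "b \<in> Basis" "m = \<bar>\<xi> \<bullet> b\<bar>" by blast
  have "norm \<xi> \<le> (\<Sum>b\<in>Basis. \<bar>\<xi> \<bullet> b\<bar>)" by (rule norm_le_l1)
  also have "\<dots> \<le> real DIM('a) * m" using sum_mono[OF mle] by simp
  finally have nm: "norm \<xi> \<le> real DIM('a) * m" .
  have "norm \<xi> ^ N * ?F \<le> (real DIM('a) * m) ^ N * ?F" by (intro mult_right_mono power_mono nm) auto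
  also have "\<dots> = real DIM('a) ^ N * (\<bar>\<xi> \<bullet> b\<bar> ^ N * ?F)" using b by (simp add: power_mult_distrib)
  also have "\<dots> \<le> real DIM('a) ^ N * (LINT Y|lborel. W Y)"
    by (intro mult_left_mono fourier_integral_decay_coordinate[OF W b(1) B]) auto
  finally have 1: "norm \<xi> ^ N * ?F \<le> real DIM('a) ^ N * (LINT Y|lborel. W Y)" .
  have "wt \<xi> ^ N * ?F \<le> 2 ^ N * (1 + norm \<xi> ^ N) * ?F"
    unfolding wt_def by (intro mult_right_mono power_add_le) auto
  also have "\<dots> = 2 ^ N * (?F + norm \<xi> ^ N * ?F)" by (simp add: algebra_simps)
  also have "\<dots> \<le> 2 ^ N * ((LINT Y|lborel. W Y) + real DIM('a) ^ N * (LINT Y|lborel. W Y))"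
    by (intro mult_left_mono add_mono 0 1) auto
  also have "\<dots> = C * (LINT Y|lborel. W Y)" by (simp add: C_def algebra_simps)
  finally have "wt \<xi> ^ N * ?F \<le> C * (LINT Y|lborel. W Y)" .
  from mult_right_mono[OF this, of "wt \<xi> powr (- real N)"]
  have "?F * (wt \<xi> ^ N * wt \<xi> powr (- real N)) \<le> C * wt \<xi> powr (- real N) * (LINT Y|lborel. W Y)"
    by (simp add: mult_ac)
  moreover have "wt \<xi> ^ N * wt \<xi> powr (- real N) = 1"
    by (simp add: powr_realpow[symmetric] powr_add[symmetric])
  ultimately show ?thesis by simp
qed

text \<open>There are finitely many partial derivatives of order at most k, so the constants of
  their seminorms can be summed into one.\<close>

lemma schwartz_partials_le:
  fixes f :: "'a::euclidean_space \<Rightarrow> complex"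
  assumes f: "f \<in> schwartz"
  obtains C where "0 \<le> C" "partials_le k (\<lambda>x. C * wt x powr (- M)) f"
proof -
  define m where "m = nat \<lceil>M\<rceil>"
  have mM: "M \<le> real m" unfolding m_def by linarith
  let ?L = "{vs. set vs \<subseteq> (Basis::'a set) \<and> length vs \<le> k}"
  have fin: "finite ?L" by (rule finite_lists_length_le) simp
  have "\<exists>K\<ge>0. \<forall>x. wt x ^ m * norm (partials vs f x) \<le> K" if "vs \<in> ?L" for vs
  proof -
    have b: "bounded (range (\<lambda>x. norm x ^ N * norm (partials vs f x)))" for N :: nat
      using f that unfolding schwartz_def by blast
    from b[of 0] obtain K0 where K0: "norm (partials vs f x) \<le> K0" for x
      by (auto simp: bounded_iff)
    from b[of m] obtain K1 where K1: "norm x ^ m * norm (partials vs f x) \<le> K1" for x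
      by (auto simp: bounded_iff)
    have K00: "0 \<le> K0" using K0[of 0] norm_ge_zero order_trans by blast
    have K10: "0 \<le> K1" using K1[of 0] by (rule order_trans[rotated]) simp
    have "wt x ^ m * norm (partials vs f x) \<le> 2 ^ m * (K0 + K1)" for x
    proof -
      have "wt x ^ m * norm (partials vs f x) \<le> 2 ^ m * (1 + norm x ^ m) * norm (partials vs f x)"
        unfolding wt_def by (intro mult_right_mono power_add_le) auto
      also have "\<dots> = 2 ^ m * (norm (partials vs f x) + norm x ^ m * norm (partials vs f x))" by (simp add: algebra_simps)
      also have "\<dots> \<le> 2 ^ m * (K0 + K1)" by (intro mult_left_mono add_mono K0 K1) auto
      finally show ?thesis .
    qed
    then show ?thesis using K00 K10 by (intro exI[of _ "2 ^ m * (K0 + K1)"]) auto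
  qed
  then have "\<forall>vs\<in>?L. \<exists>K. 0 \<le> K \<and> (\<forall>x. wt x ^ m * norm (partials vs f x) \<le> K)" by blast
  from bchoice[OF this] obtain K where
    K': "\<forall>vs\<in>?L. 0 \<le> K vs \<and> (\<forall>x. wt x ^ m * norm (partials vs f x) \<le> K vs)" ..
  have K: "0 \<le> K vs" "wt x ^ m * norm (partials vs f x) \<le> K vs" if "vs \<in> ?L" for vs x
    using bspec[OF K' that] by auto
  define C where "C = (\<Sum>vs\<in>?L. K vs)"
  have C0: "0 \<le> C" unfolding C_def by (intro sum_nonneg K)
  have KC: "K vs \<le> C" if "vs \<in> ?L" for vs unfolding C_def using that fin K by (intro member_le_sum) auto
  have "norm (partials vs f x) \<le> C * wt x powr (- M)" if "vs \<in> ?L" for vs x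
  proof -
    have "wt x ^ m * norm (partials vs f x) \<le> C" using K(2)[OF that] KC[OF that] by (rule order_trans)
    then have "norm (partials vs f x) \<le> C * wt x powr (- real m)"
      by (simp add: powr_minus powr_realpow field_simps)
    also have "\<dots> \<le> C * wt x powr (- M)" using mM C0 by (intro mult_left_mono wt_powr_mono) auto
    finally show ?thesis .
  qed
  moreover have "partials vs f differentiable (at x)" if "vs \<in> ?L" for vs x
    using f that unfolding schwartz_def smooth_def by blast
  ultimately have "partials_le k (\<lambda>x. C * wt x powr (- M)) f" unfolding partials_le_iff by blast
  with C0 show thesis by (rule that)
qed

section \<open>Short-time Fourier transforms of Schwartz functions\<close>

lemma measurable_cnj [measurable]: "cnj \<in> borel \<rightarrow>\<^sub>M borel"
  by (intro borel_measurable_continuous_onI continuous_intros)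

text \<open>A product of weights concentrated near 0 and near x decays in the distance of the two
  centres; this is how localisation is transferred from an integration variable to a
  parameter.\<close>

lemma wt_peetre:
  assumes "0 \<le> M"
  shows "wt y powr (- M) * wt (y - x) powr (- M) \<le> wt x powr (- M)"
proof -
  have "wt x \<le> wt y * wt (y - x)" using wt_diff[of y "y - x"] by simp
  then have "(wt y * wt (y - x)) powr (- M) \<le> wt x powr (- M)" using assms by (intro powr_mono2') auto
  then show ?thesis by (simp add: powr_mult)
qed

text \<open>The Schwartz class in the form used for estimates: one constant for all derivatives up
  to a given order and an arbitrary real exponent. \<open>schwartz_rapid\<close> and
  \<open>rapid_schwartz\<close> give the equivalence.\<close>

definition rapid :: "('a::euclidean_space \<Rightarrow> complex) \<Rightarrow> bool" where
  "rapid f \<longleftrightarrow> (\<forall>k M. \<exists>C\<ge>0. partials_le k (\<lambda>x. C * wt x powr (- M)) f)"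

lemma rapidE:
  assumes "rapid f"
  obtains C where "0 \<le> C" "partials_le k (\<lambda>x. C * wt x powr (- M)) f"
  using assms unfolding rapid_def by blast

lemma rapid_bound:
  assumes "rapid f"
  obtains C where "0 \<le> C" "\<And>x. norm (f x) \<le> C * wt x powr (- M)"
  using rapidE[OF assms, of 0 M] partials_le_norm by metis

lemma schwartz_rapid: "f \<in> schwartz \<Longrightarrow> rapid f"
  unfolding rapid_def using schwartz_partials_le by metis

lemma rapid_continuous: "rapid f \<Longrightarrow> continuous_on A f"
  by (meson rapidE partials_le_continuous)

lemma rapid_measurable: "rapid f \<Longrightarrow> f \<in> borel_measurable borel"
  by (intro borel_measurable_continuous_onI rapid_continuous)

lemma rapid_integrable:
  fixes f :: "'a::euclidean_space \<Rightarrow> complex"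
  assumes "rapid f" shows "integrable lborel f"
proof -
  from assms obtain C where C: "0 \<le> C" "\<And>x. norm (f x) \<le> C * wt x powr (- (real DIM('a) + 1))"
    by (rule rapid_bound[where M="real DIM('a) + 1"]) blast
  have i: "integrable lborel (\<lambda>x::'a. C * wt x powr (- (real DIM('a) + 1)))"
    by (intro integrable_mult_right wt_powr_neg_integrable) simp
  have m: "f \<in> borel_measurable lborel" using rapid_measurable[OF assms] by simp
  show ?thesis
    by (rule Bochner_Integration.integrable_bound[OF i m])
       (use C in \<open>auto intro!: AE_I2 order_trans[OF C(2) abs_ge_self]\<close>)
qed

lemma rapid_nn_integral:
  fixes f :: "'a::euclidean_space \<Rightarrow> complex"
  assumes "rapid f" shows "(\<integral>\<^sup>+x. ennreal (norm (f x)) \<partial>lborel) < \<infinity>"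
  using rapid_integrable[OF assms] unfolding integrable_iff_bounded by blast

lemma fourier_decay:
  fixes f :: "'a::euclidean_space \<Rightarrow> complex" and N :: nat
  assumes f: "rapid f"
  obtains C where "0 \<le> C" "\<And>\<eta>. norm (fourier f \<eta>) \<le> C * wt \<eta> powr (- real N)"
proof -
  obtain C where C: "0 \<le> C" "partials_le N (\<lambda>x. C * wt x powr (- (real DIM('a) + 1))) f"
    using rapidE[OF f] by blast
  have i: "integrable lborel (\<lambda>x::'a. C * wt x powr (- (real DIM('a) + 1)))"
    by (intro integrable_mult_right wt_powr_neg_integrable) simp
  define D where "D = 2 ^ N * (1 + real DIM('a) ^ N) * (LINT x|lborel. C * wt (x::'a) powr (- (real DIM('a) + 1)))"
  have "norm (fourier f \<eta>) \<le> D * wt \<eta> powr (- real N)" for \<eta>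
    using fourier_integral_decay[OF C(2) i, of "- \<eta>"] by (simp add: fourier_eq D_def inner_commute mult_ac)
  moreover have "0 \<le> D" unfolding D_def using C(1) by (intro mult_nonneg_nonneg integral_nonneg_AE) auto
  ultimately show thesis by (intro that[of D]) auto
qed

lemma fourier_rapid_integrable:
  fixes f :: "'a::euclidean_space \<Rightarrow> complex"
  assumes f: "rapid f" shows "integrable lborel (fourier f)"
proof -
  obtain C where C: "0 \<le> C" "\<And>\<eta>. norm (fourier f \<eta>) \<le> C * wt \<eta> powr (- real (DIM('a) + 1))"
    using fourier_decay[OF f] by blast
  note [measurable] = rapid_measurable[OF f]
  have i: "integrable lborel (\<lambda>x::'a. C * wt x powr (- real (DIM('a) + 1)))"
    by (intro integrable_mult_right wt_powr_neg_integrable) simp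
  show ?thesis
    by (rule Bochner_Integration.integrable_bound[OF i])
       (use C in \<open>auto intro!: AE_I2 order_trans[OF C(2) abs_ge_self]\<close>)
qed

text \<open>Decay in \<omega> comes from N integrations by parts, decay in x from the separation of
  f and the translated window. The surplus exponent d + 1 asked of f makes the majorant
  integrable.\<close>

lemma stft_decay:
  fixes f g :: "'a::euclidean_space \<Rightarrow> complex" and N :: nat
  assumes f: "rapid f" and g: "rapid g" and M: "0 \<le> M"
  obtains C where "0 \<le> C" "\<And>x \<omega>. norm (stft g f x \<omega>) \<le> C * wt x powr (- M) * wt \<omega> powr (- real N)"
proof -
  let ?r = "real DIM('a) + 1"
  obtain Cf where Cf: "0 \<le> Cf" "partials_le N (\<lambda>x. Cf * wt x powr (- (M + ?r))) f" using rapidE[OF f] by blast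
  obtain Cg where Cg: "0 \<le> Cg" "partials_le N (\<lambda>x. Cg * wt x powr (- M)) g" using rapidE[OF g] by blast
  define c where "c = 2 ^ N * (Cf * Cg)"
  have c0: "0 \<le> c" using Cf Cg by (simp add: c_def)
  have i: "integrable lborel (\<lambda>y::'a. c * wt x powr (- M) * wt y powr (- ?r))" for x :: 'a
    by (intro integrable_mult_right wt_powr_neg_integrable) simp
  have cbB: "partials_le N (\<lambda>y. c * wt x powr (- M) * wt y powr (- ?r)) (\<lambda>y. f y * cnj (g (y - x)))" for x :: 'a
  proof (rule partials_le_mono[OF partials_le_mult[OF Cf(2) partials_le_cnj[OF partials_le_translate[OF Cg(2)]]]])
    fix y :: 'a
    have "wt y powr (- (M + ?r)) = wt y powr (- M) * wt y powr (- ?r)" by (simp add: powr_add[symmetric])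
    then have "2 ^ N * (Cf * wt y powr (- (M + ?r)) * (Cg * wt (y - x) powr (- M)))
      = c * (wt y powr (- M) * wt (y - x) powr (- M)) * wt y powr (- ?r)" by (simp add: c_def mult_ac)
    also have "\<dots> \<le> c * wt x powr (- M) * wt y powr (- ?r)"
      using c0 M by (intro mult_right_mono mult_left_mono wt_peetre) auto
    finally show "2 ^ N * (Cf * wt y powr (- (M + ?r)) * (Cg * wt (y - x) powr (- M))) \<le> c * wt x powr (- M) * wt y powr (- ?r)" .
  qed
  define I where "I = (LINT y|lborel. wt (y::'a) powr (- ?r))"
  have I0: "0 \<le> I" unfolding I_def by (intro integral_nonneg_AE) auto
  define D where "D = 2 ^ N * (1 + real DIM('a) ^ N) * c * I"
  have "norm (stft g f x \<omega>) \<le> D * wt x powr (- M) * wt \<omega> powr (- real N)" for x \<omega>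
    using fourier_integral_decay[OF cbB[of x] i[of x], of "- \<omega>"]
    by (simp add: stft_eq D_def I_def mult_ac)
  moreover have "0 \<le> D" using I0 c0 by (simp add: D_def)
  ultimately show thesis by (intro that[of D]) auto
qed

lemma measurable_stft:
  fixes u g :: "'a::euclidean_space \<Rightarrow> complex"
  assumes [measurable]: "u \<in> borel_measurable borel" "g \<in> borel_measurable borel"
  shows "(\<lambda>(x, \<omega>). stft g u x \<omega>) \<in> borel_measurable (borel \<Otimes>\<^sub>M borel)"
  unfolding stft_eq split_beta' by measurable

lemma measurable_stft_compose [measurable (raw)]:
  fixes u g :: "'a::euclidean_space \<Rightarrow> complex"
  assumes "u \<in> borel_measurable borel" "g \<in> borel_measurable borel"
  assumes [measurable]: "X \<in> M \<rightarrow>\<^sub>M borel" "W \<in> M \<rightarrow>\<^sub>M borel"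
  shows "(\<lambda>z. stft g u (X z) (W z)) \<in> borel_measurable M"
  using measurable_compose[OF measurable_Pair[OF assms(3,4)] measurable_stft[OF assms(1,2)]] by simp

text \<open>As a function of x the short-time Fourier transform is a convolution of the modulated f
  with the reflected conjugate window, so its Fourier transform in x is a product.\<close>

lemma stft_x_transform:
  fixes f g :: "'a::euclidean_space \<Rightarrow> complex"
  assumes f: "integrable lborel f" and g: "integrable lborel g"
  shows "(LINT x|lborel. stft g f x \<omega> * ee (- (x \<bullet> \<zeta>))) = fourier f (\<omega> + \<zeta>) * cnj (fourier g \<zeta>)"
proof -
  have [measurable]: "f \<in> borel_measurable borel" "g \<in> borel_measurable borel" using f g by auto
  let ?F = "\<lambda>x y. ee (- (\<omega> \<bullet> y)) * f y * cnj (g (y - x)) * ee (- (x \<bullet> \<zeta>))"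
  have "(LINT x|lborel. stft g f x \<omega> * ee (- (x \<bullet> \<zeta>))) = (LINT x|lborel. (LINT y|lborel. ?F x y))"
    unfolding stft_eq by simp
  also have "\<dots> = (LINT y|lborel. (LINT x|lborel. ?F x y))"
  proof (rule fubini_swap[symmetric])
    show "(\<lambda>(y, x). ?F x y) \<in> borel_measurable (borel \<Otimes>\<^sub>M borel)" by measurable
    have "(\<integral>\<^sup>+y. (\<integral>\<^sup>+x. ennreal (norm (?F x y)) \<partial>lborel) \<partial>lborel)
       = (\<integral>\<^sup>+y. ennreal (norm (f y)) * (\<integral>\<^sup>+x. ennreal (norm (g x)) \<partial>lborel) \<partial>lborel)"
    proof (rule nn_integral_cong)
      fix y
      have "(\<integral>\<^sup>+x. ennreal (norm (?F x y)) \<partial>lborel) = (\<integral>\<^sup>+x. ennreal (norm (f y)) * ennreal (norm (g (y - x))) \<partial>lborel)"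
        by (simp add: norm_mult ennreal_mult)
      also have "\<dots> = ennreal (norm (f y)) * (\<integral>\<^sup>+x. ennreal (norm (g (y - x))) \<partial>lborel)"
        by (rule nn_integral_cmult) measurable
      also have "(\<integral>\<^sup>+x. ennreal (norm (g (y - x))) \<partial>lborel) = (\<integral>\<^sup>+x. ennreal (norm (g x)) \<partial>lborel)"
        by (rule nn_integral_reflect[of "\<lambda>x. ennreal (norm (g x))"]) measurable
      finally show "(\<integral>\<^sup>+x. ennreal (norm (?F x y)) \<partial>lborel) = ennreal (norm (f y)) * (\<integral>\<^sup>+x. ennreal (norm (g x)) \<partial>lborel)" .
    qed
    also have "\<dots> = (\<integral>\<^sup>+y. ennreal (norm (f y)) \<partial>lborel) * (\<integral>\<^sup>+x. ennreal (norm (g x)) \<partial>lborel)"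
      by (rule nn_integral_multc) measurable
    also have "\<dots> < \<infinity>" using f g unfolding integrable_iff_bounded by (simp add: ennreal_mult_less_top)
    finally show "(\<integral>\<^sup>+y. (\<integral>\<^sup>+x. ennreal (norm (?F x y)) \<partial>lborel) \<partial>lborel) < \<infinity>" .
  qed
  also have "\<dots> = (LINT y|lborel. ee (- (y \<bullet> (\<omega> + \<zeta>))) * f y * cnj (fourier g \<zeta>))"
  proof (rule Bochner_Integration.integral_cong[OF refl])
    fix y
    have "(LINT x|lborel. ?F x y) = (LINT u|lborel. ?F (y - u) y)"
      by (rule integral_reflect[of "\<lambda>x. ?F x y" y, symmetric])
    also have "\<dots> = (LINT u|lborel. ee (- (y \<bullet> (\<omega> + \<zeta>))) * f y * cnj (ee (- (u \<bullet> \<zeta>)) * g u))"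
    proof (rule Bochner_Integration.integral_cong[OF refl])
      fix u
      have "ee (- (\<omega> \<bullet> y)) * ee (- ((y - u) \<bullet> \<zeta>)) = ee (- (y \<bullet> (\<omega> + \<zeta>))) * ee (u \<bullet> \<zeta>)"
        by (simp add: ee_add[symmetric] inner_diff_left inner_diff_right inner_add_right inner_commute algebra_simps)
      then show "?F (y - u) y = ee (- (y \<bullet> (\<omega> + \<zeta>))) * f y * cnj (ee (- (u \<bullet> \<zeta>)) * g u)"
        by (simp add: cnj_ee mult_ac)
    qed
    also have "\<dots> = ee (- (y \<bullet> (\<omega> + \<zeta>))) * f y * cnj (fourier g \<zeta>)"
      unfolding fourier_eq Bochner_Integration.integral_cnj[symmetric] by (rule integral_mult_right_zero)
    finally show "(LINT x|lborel. ?F x y) = ee (- (y \<bullet> (\<omega> + \<zeta>))) * f y * cnj (fourier g \<zeta>)" .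
  qed
  also have "\<dots> = fourier f (\<omega> + \<zeta>) * cnj (fourier g \<zeta>)"
    unfolding fourier_eq[of f] by (rule integral_mult_left_zero)
  finally show ?thesis .
qed

text \<open>Inversion of the short-time Fourier transform on the frequency side: every \<gamma> that
  pairs nontrivially with the Fourier transform of g recovers that of f, the only datum about f that
  enters the operator.\<close>

lemma fourier_reproduce:
  fixes f g \<gamma> :: "'a::euclidean_space \<Rightarrow> complex"
  assumes f: "integrable lborel f" and g: "integrable lborel g"
  shows "(LINT \<omega>|lborel. \<gamma> (\<eta> - \<omega>) * (LINT x|lborel. stft g f x \<omega> * ee (- (x \<bullet> (\<eta> - \<omega>)))))
     = fourier f \<eta> * (LINT u|lborel. \<gamma> u * cnj (fourier g u))"
proof -
  have "(LINT \<omega>|lborel. \<gamma> (\<eta> - \<omega>) * (LINT x|lborel. stft g f x \<omega> * ee (- (x \<bullet> (\<eta> - \<omega>)))))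
     = (LINT \<omega>|lborel. fourier f \<eta> * (\<gamma> (\<eta> - \<omega>) * cnj (fourier g (\<eta> - \<omega>))))"
    unfolding stft_x_transform[OF f g] by (simp add: mult_ac)
  also have "\<dots> = fourier f \<eta> * (LINT \<omega>|lborel. \<gamma> (\<eta> - \<omega>) * cnj (fourier g (\<eta> - \<omega>)))"
    by (rule integral_mult_right_zero)
  also have "(LINT \<omega>|lborel. \<gamma> (\<eta> - \<omega>) * cnj (fourier g (\<eta> - \<omega>))) = (LINT u|lborel. \<gamma> u * cnj (fourier g u))"
    by (rule integral_reflect)
  finally show ?thesis .
qed

section \<open>Existence of a dual window\<close>

lemma continuous_AE_zero:
  fixes g :: "'a::euclidean_space \<Rightarrow> 'b::real_normed_vector"
  assumes c: "continuous_on UNIV g" and ae: "AE x in lborel. g x = 0"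
  shows "g x = 0"
proof (rule ccontr)
  assume "g x \<noteq> 0"
  let ?S = "{x. g x \<noteq> 0}"
  have o: "open ?S" using c by (intro open_Collect_neq) (auto intro: continuous_intros)
  have "?S \<in> null_sets lborel"
    using ae o by (subst AE_iff_null_sets) auto
  then have "negligible ?S" using o by (simp add: negligible_iff_null_sets null_sets_completion_iff)
  with open_not_negligible[OF o] \<open>g x \<noteq> 0\<close> show False by auto
qed

lemma power_le_fact_exp: "0 \<le> (x::real) \<Longrightarrow> x ^ n \<le> fact n * exp x"
proof -
  assume "0 \<le> x"
  have "(\<Sum>k\<in>{n}. x ^ k /\<^sub>R fact k) \<le> (\<Sum>k. x ^ k /\<^sub>R fact k)"
    using \<open>0 \<le> x\<close> by (intro sum_le_suminf summable_exp_generic) auto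
  then have "x ^ n /\<^sub>R fact n \<le> exp x" by (simp add: exp_def)
  then show ?thesis by (simp add: field_simps)
qed

lemma gauss_beats_power:
  assumes "0 < (a::real)" "0 \<le> t"
  shows "(1 + t) ^ n * exp (- a * t\<^sup>2) \<le> fact n * exp (1 + 1 / (4 * a))"
proof -
  have "(1 + t) ^ n * exp (- a * t\<^sup>2) \<le> (fact n * exp (1 + t)) * exp (- a * t\<^sup>2)"
    using assms by (intro mult_right_mono power_le_fact_exp) auto
  also have "\<dots> = fact n * exp (1 + t - a * t\<^sup>2)" by (simp add: exp_add[symmetric] exp_diff exp_minus field_simps)
  \<comment> \<open>Completing the square: t - a t^2 is largest at t = 1/(2a).\<close>
  also have "1 + t - a * t\<^sup>2 \<le> 1 + 1 / (4 * a)"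
  proof -
    have "0 \<le> a * (t - 1 / (2 * a))\<^sup>2" using assms by simp
    also have "\<dots> = a * t\<^sup>2 - t + 1 / (4 * a)" using assms by (simp add: power2_eq_square field_simps)
    finally show ?thesis by simp
  qed
  finally show ?thesis by simp
qed

lemma partials_le_const: "(\<And>x. norm c \<le> W x) \<Longrightarrow> partials_le k W (\<lambda>x. c)"
proof (cases k)
  case (Suc j)
  assume *: "\<And>x. norm c \<le> W x"
  then have "0 \<le> W x" for x using norm_ge_zero order_trans by blast
  then show ?thesis using * by (simp add: Suc partials_le_zero)
qed simp

lemma partials_le_affine:
  fixes a c :: complex
  assumes b: "b \<in> Basis"
  shows "partials_le k (\<lambda>u::'a::euclidean_space. norm a + norm c * wt u) (\<lambda>u. a + c * complex_of_real (u \<bullet> b))"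
proof -
  have hd: "((\<lambda>u::'a. a + c * complex_of_real (u \<bullet> b)) has_derivative (\<lambda>h. c * complex_of_real (h \<bullet> b))) (at u)" for u
    by (auto intro!: derivative_eq_intros)
  have nb: "\<bar>u \<bullet> b\<bar> \<le> wt u" for u :: 'a
    using Basis_le_norm[OF b, of u] by (simp add: wt_def)
  have n: "norm (a + c * complex_of_real (u \<bullet> b)) \<le> norm a + norm c * wt u" for u
    by (rule norm_triangle_mono) (auto simp: norm_mult intro!: mult_left_mono nb)
  have d: "(\<lambda>u. a + c * complex_of_real (u \<bullet> b)) differentiable (at u)" for u
    using hd by (auto simp: differentiable_def)
  show ?thesis
  proof (cases k)
    case 0 then show ?thesis using n d by simp
  next
    case (Suc j)
    have D: "Dv b' (\<lambda>u. a + c * complex_of_real (u \<bullet> b)) = (\<lambda>u. c * complex_of_real (b' \<bullet> b))" for b'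
      by (rule ext) (rule Dv_eq[OF hd])
    have "partials_le j (\<lambda>u::'a. norm a + norm c * wt u) (\<lambda>u. c * complex_of_real (b' \<bullet> b))" if "b' \<in> Basis" for b'
    proof (rule partials_le_const)
      fix u :: 'a
      have "norm c * \<bar>b' \<bullet> b\<bar> \<le> norm c * wt u"
        using that b wt_ge_1[of u] by (intro mult_left_mono) (auto simp: inner_Basis)
      then show "norm (c * complex_of_real (b' \<bullet> b)) \<le> norm a + norm c * wt u"
        by (simp add: norm_mult add_increasing)
    qed
    then show ?thesis using n d by (auto simp: Suc D)
  qed
qed

text \<open>The exponent has an affine gradient, so derivatives up to order k grow at most like the
  k-th power of the weight times the Gaussian, which beats every power.\<close>

lemma rapid_gauss:
  fixes y :: "'a::euclidean_space"
  assumes a: "0 < a"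
  shows "rapid (\<lambda>u. ee (- (y \<bullet> u)) * exp (- a * (norm u)\<^sup>2))"
  unfolding rapid_def
proof (intro allI)
  fix k :: nat and M :: real
  define \<psi> where "\<psi> u = - (\<i> * complex_of_real (2 * pi * (y \<bullet> u))) - complex_of_real (a * (u \<bullet> u))" for u
  have e: "(\<lambda>u. ee (- (y \<bullet> u)) * exp (- a * (norm u)\<^sup>2)) = (\<lambda>u. exp (\<psi> u))"
  proof
    fix u
    have "exp (\<psi> u) = exp (- (\<i> * complex_of_real (2 * pi * (y \<bullet> u)))) * exp (complex_of_real (- (a * (u \<bullet> u))))"
      by (simp add: \<psi>_def exp_add[symmetric])
    then show "ee (- (y \<bullet> u)) * exp (- a * (norm u)\<^sup>2) = exp (\<psi> u)"
      unfolding exp_of_real by (simp add: ee_exp power2_norm_eq_inner)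
  qed
  have hd: "(\<psi> has_derivative (\<lambda>h. - (\<i> * complex_of_real (2 * pi * (y \<bullet> h))) - complex_of_real (a * (2 * (u \<bullet> h))))) (at u)" for u
    unfolding \<psi>_def
    by (intro has_derivative_diff has_derivative_minus has_derivative_mult_right has_derivative_of_real
        has_derivative_inner_right has_derivative_ident
        has_derivative_inner[OF has_derivative_ident has_derivative_ident, THEN has_derivative_eq_rhs])
       (simp add: fun_eq_iff inner_commute)
  have d: "\<psi> differentiable (at u)" for u using hd by (auto simp: differentiable_def)
  \<comment> \<open>The coefficients of the affine gradient, together with 1 so that the weight
    handed to \<open>partials_le_exp\<close> is at least 1.\<close>
  define K where "K = 1 + 2 * pi * norm y + 2 * a"
  have K1: "1 \<le> K" unfolding K_def using a by simp
  have D: "partials_le k (\<lambda>u. K * wt u) (Dv b \<psi>)" if b: "b \<in> Basis" for b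
  proof -
    have "Dv b \<psi> = (\<lambda>u. - (\<i> * complex_of_real (2 * pi * (y \<bullet> b))) + (- complex_of_real (2 * a)) * complex_of_real (u \<bullet> b))"
      by (rule ext, subst Dv_eq[OF hd]) simp
    moreover have "partials_le k (\<lambda>u. K * wt u) (\<lambda>u. - (\<i> * complex_of_real (2 * pi * (y \<bullet> b))) + (- complex_of_real (2 * a)) * complex_of_real (u \<bullet> b))"
    proof (rule partials_le_mono[OF partials_le_affine[OF b]])
      fix u :: 'a
      have "norm (- (\<i> * complex_of_real (2 * pi * (y \<bullet> b)))) \<le> 2 * pi * norm y"
        using Basis_le_norm[OF b, of y] by (simp add: norm_mult abs_mult)
      also have "\<dots> \<le> (2 * pi * norm y) * wt u" using mult_left_mono[OF wt_ge_1[of u], of "2 * pi * norm y"] by simp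
      finally have "norm (- (\<i> * complex_of_real (2 * pi * (y \<bullet> b)))) \<le> (2 * pi * norm y) * wt u" .
      moreover have "norm (- complex_of_real (2 * a)) * wt u = 2 * a * wt u" using a by (simp del: of_real_mult)
      moreover have "0 \<le> wt u" by simp
      ultimately show "norm (- (\<i> * complex_of_real (2 * pi * (y \<bullet> b)))) + norm (- complex_of_real (2 * a)) * wt u \<le> K * wt u"
        unfolding K_def distrib_right by linarith
    qed
    ultimately show ?thesis by simp
  qed
  have W1: "1 \<le> K * wt u" for u :: 'a using mult_mono[OF K1 wt_ge_1[of u]] K1 by simp
  have cbe: "partials_le k (\<lambda>u. (2 ^ k * (K * wt u)) ^ k * norm (exp (\<psi> u))) (\<lambda>u. exp (\<psi> u))"
    by (rule partials_le_exp[OF d W1 D])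
  define m where "m = nat \<lceil>M\<rceil>"
  have mM: "M \<le> real m" unfolding m_def by linarith
  define A where "A = (2 ^ k * K) ^ k"
  define E where "E = fact (k + m) * exp (1 + 1 / (4 * a))"
  have A0: "0 \<le> A" using K1 by (simp add: A_def)
  have E0: "0 \<le> E" by (simp add: E_def)
  have le: "(2 ^ k * (K * wt u)) ^ k * norm (exp (\<psi> u)) \<le> (A * E) * wt u powr (- M)" for u
  proof -
    have n: "norm (exp (\<psi> u)) = exp (- a * (norm u)\<^sup>2)" by (simp add: \<psi>_def power2_norm_eq_inner)
    have "wt u ^ m * (wt u ^ k * exp (- a * (norm u)\<^sup>2)) = (1 + norm u) ^ (k + m) * exp (- a * (norm u)\<^sup>2)"
      by (simp add: wt_def power_add)
    also have "\<dots> \<le> E" unfolding E_def by (rule gauss_beats_power[OF a]) simp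
    finally have *: "wt u ^ m * (wt u ^ k * exp (- a * (norm u)\<^sup>2)) \<le> E" .
    have inv: "wt u powr (- real m) * wt u ^ m = 1"
      by (simp add: powr_realpow[symmetric] powr_add[symmetric])
    have "wt u ^ k * exp (- a * (norm u)\<^sup>2) = wt u powr (- real m) * (wt u ^ m * (wt u ^ k * exp (- a * (norm u)\<^sup>2)))"
      using inv by (simp add: mult.assoc[symmetric])
    also have "\<dots> \<le> wt u powr (- real m) * E" by (intro mult_left_mono *) auto
    also have "\<dots> \<le> wt u powr (- M) * E" using mM E0 by (intro mult_right_mono wt_powr_mono) auto
    finally have "A * (wt u ^ k * exp (- a * (norm u)\<^sup>2)) \<le> A * (wt u powr (- M) * E)" using A0 by (intro mult_left_mono)
    then show ?thesis unfolding n by (simp add: A_def power_mult_distrib mult_ac)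
  qed
  have "partials_le k (\<lambda>u. (A * E) * wt u powr (- M)) (\<lambda>u. exp (\<psi> u))" by (rule partials_le_mono[OF cbe le])
  then show "\<exists>C\<ge>0. partials_le k (\<lambda>u. C * wt u powr (- M)) (\<lambda>u. ee (- (y \<bullet> u)) * exp (- a * (norm u)\<^sup>2))"
    unfolding e using A0 E0 by (intro exI[of _ "A * E"]) simp
qed

text \<open>Taking \<gamma> to be the Fourier transform of g would call for derivative bounds on
  that transform; a modulated Gaussian suffices. Its pairing is the conjugate of a Gaussian mean of
  g, and if all these means vanished, Fourier inversion would give g = 0.\<close>

lemma exists_dual_window:
  fixes g :: "'a::euclidean_space \<Rightarrow> complex"
  assumes g: "rapid g" and nz: "g \<noteq> (\<lambda>_. 0)"
  obtains \<gamma> where "rapid \<gamma>" "(LINT u|lborel. \<gamma> u * cnj (fourier g u)) \<noteq> 0"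
proof -
  have "\<exists>n y. gauss_mean (1 / Suc n) g y \<noteq> 0"
  proof (rule ccontr)
    assume "\<not> ?thesis"
    then have z: "gauss_mean (1 / Suc n) g y = 0" for n y by blast
    have "(LINT \<xi>|lborel. ee (y \<bullet> \<xi>) * fourier g \<xi>) = 0" for y
      using gauss_mean_tendsto[OF rapid_integrable[OF g] fourier_rapid_integrable[OF g], of y]
      unfolding z by (simp add: LIMSEQ_const_iff)
    then have "AE y in lborel. g y = 0"
      using fourier_inversion_AE[OF rapid_integrable[OF g] fourier_rapid_integrable[OF g]] by simp
    then have "g x = 0" for x using rapid_continuous[OF g] by (rule continuous_AE_zero[rotated])
    with nz show False by auto
  qed
  then obtain n y where ny: "gauss_mean (1 / Suc n) g y \<noteq> 0" by blast
  \<comment> \<open>Chosen so that the Gaussian in \<gamma> is the convergence factor of the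
    nonvanishing mean.\<close>
  define a where "a = (2 * pi * (1 / Suc n))\<^sup>2 / 2"
  have a: "0 < a" by (simp add: a_def)
  define \<gamma> where "\<gamma> = (\<lambda>u::'a. ee (- (y \<bullet> u)) * exp (- a * (norm u)\<^sup>2))"
  have "(LINT u|lborel. \<gamma> u * cnj (fourier g u)) = cnj (gauss_mean (1 / Suc n) g y)"
  proof -
    have "cnj (gauss_mean (1 / Suc n) g y) = (LINT \<xi>|lborel. cnj (ee (y \<bullet> \<xi>) * exp (- (norm ((2 * pi * (1 / Suc n)) *\<^sub>R \<xi>))\<^sup>2 / 2) * fourier g \<xi>))"
      unfolding gauss_mean_def by (simp only: Bochner_Integration.integral_cnj)
    also have "\<dots> = (LINT u|lborel. \<gamma> u * cnj (fourier g u))"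
    proof -
      have e: "- (norm (c *\<^sub>R \<xi>))\<^sup>2 / 2 = - (c\<^sup>2 / 2) * (norm \<xi>)\<^sup>2" for c and \<xi> :: 'a
        by (simp add: power_mult_distrib)
      show ?thesis unfolding \<gamma>_def a_def e by (simp only: complex_cnj_mult cnj_ee complex_cnj_complex_of_real)
    qed
    finally show ?thesis by simp
  qed
  then show thesis using ny rapid_gauss[OF a, of y] by (intro that[of \<gamma>]) (auto simp: \<gamma>_def)
qed

section \<open>Positive kernels between mixed-norm spaces\<close>

text \<open>The power used inside \<open>lp_norm\<close>. Infinity and 0 are fixed for every
  exponent, even for zero and negative ones, so the laws for arbitrary real exponents are restricted
  to values other than 0 and infinity.\<close>

definition epow :: "ennreal \<Rightarrow> real \<Rightarrow> ennreal" where
  "epow x r = (if x = \<infinity> then \<infinity> else ennreal (enn2real x powr r))"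

lemma epow_ennreal [simp]: "0 \<le> a \<Longrightarrow> epow (ennreal a) r = ennreal (a powr r)"
  by (simp add: epow_def)
lemma epow_top [simp]: "epow top r = top" by (simp add: epow_def)
lemma epow_0 [simp]: "epow 0 r = 0" by (simp add: epow_def)
lemma epow_1 [simp]: "epow x 1 = x" by (cases x) auto

lemma measurable_epow [measurable]: "(\<lambda>x. epow x r) \<in> borel \<rightarrow>\<^sub>M borel"
  unfolding epow_def by measurable

lemma epow_mono: "0 \<le> r \<Longrightarrow> x \<le> y \<Longrightarrow> epow x r \<le> epow y r"
  by (cases x; cases y) (auto simp: top_unique intro!: ennreal_leI powr_mono2)

lemma epow_mult: "0 < r \<Longrightarrow> epow (x * y) r = epow x r * epow y r"
proof (cases x; cases y)
  fix a b :: real assume "0 < r" "x = ennreal a" "0 \<le> a" "y = ennreal b" "0 \<le> b"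
  then show ?thesis by (simp add: ennreal_mult[symmetric] powr_mult)
next
  fix a :: real assume "0 < r" "x = ennreal a" "0 \<le> a" "y = top"
  then show ?thesis by (cases "a = 0") (auto simp: ennreal_mult_top)
next
  fix b :: real assume "0 < r" "x = top" "y = ennreal b" "0 \<le> b"
  then show ?thesis by (cases "b = 0") (auto simp: ennreal_top_mult)
qed auto

lemma epow_epow: "epow (epow x r) s = epow x (r * s)"
  by (cases x) (auto simp: powr_powr)

lemma epow_add: "0 < r \<Longrightarrow> 0 < s \<Longrightarrow> epow x (r + s) = epow x r * epow x s"
  by (cases x) (auto simp: powr_add ennreal_mult[symmetric])

lemma epow_add_finite: "x \<noteq> 0 \<Longrightarrow> x \<noteq> top \<Longrightarrow> epow x (r + s) = epow x r * epow x s"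
  by (cases x) (auto simp: powr_add ennreal_mult[symmetric])

lemma epow_zero_exp: "x \<noteq> 0 \<Longrightarrow> x \<noteq> top \<Longrightarrow> epow x 0 = 1"
  by (cases x) auto

lemma epow_eq_0_iff: "epow x r = 0 \<longleftrightarrow> x = 0"
  by (cases x) (auto simp: powr_nonneg_iff)

lemma epow_eq_top_iff: "epow x r = top \<longleftrightarrow> x = top"
  by (cases x) auto

text \<open>The weighted inequality of arithmetic and geometric means for u/A and v/B. When A and B
  are the integrals of u and v, the last bracket integrates to 1 and Hoelder's inequality drops
  out.\<close>

lemma young_ennreal:
  assumes \<alpha>: "0 < \<alpha>" "\<alpha> < 1" and A: "0 < A" and B: "0 < B"
  shows "epow u \<alpha> * epow v (1 - \<alpha>) \<le> ennreal (A powr \<alpha> * B powr (1 - \<alpha>)) * (ennreal (\<alpha> / A) * u + ennreal ((1 - \<alpha>) / B) * v)"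
proof -
  have c: "0 < A powr \<alpha> * B powr (1 - \<alpha>)" using A B by simp
  have c1: "ennreal (A powr \<alpha> * B powr (1 - \<alpha>)) \<noteq> 0" "ennreal (\<alpha> / A) \<noteq> 0" "ennreal ((1 - \<alpha>) / B) \<noteq> 0"
    using c A B \<alpha> by simp_all
  show ?thesis
  proof (cases "u = top \<or> v = top")
    case True
    then have "ennreal (A powr \<alpha> * B powr (1 - \<alpha>)) * (ennreal (\<alpha> / A) * u + ennreal ((1 - \<alpha>) / B) * v) = top"
      using c1 by (auto simp: ennreal_mult_top)
    then show ?thesis by simp
  next
    case False
    then obtain a b where ab: "u = ennreal a" "0 \<le> a" "v = ennreal b" "0 \<le> b" by (cases u; cases v) auto
    have "a powr \<alpha> * b powr (1 - \<alpha>) \<le> (A powr \<alpha> * B powr (1 - \<alpha>)) * ((\<alpha> / A) * a + ((1 - \<alpha>) / B) * b)"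
    proof (cases "a = 0 \<or> b = 0")
      case True
      then show ?thesis using \<alpha> A B ab by (auto intro!: mult_nonneg_nonneg add_nonneg_nonneg)
    next
      case False
      have "(a / A) powr \<alpha> * (b / B) powr (1 - \<alpha>) \<le> \<alpha> * (a / A) + (1 - \<alpha>) * (b / B)"
        using False ab A B \<alpha> by (intro Youngs_inequality_0) auto
      then have "(A powr \<alpha> * B powr (1 - \<alpha>)) * ((a / A) powr \<alpha> * (b / B) powr (1 - \<alpha>)) \<le> (A powr \<alpha> * B powr (1 - \<alpha>)) * (\<alpha> * (a / A) + (1 - \<alpha>) * (b / B))"
        using c by (intro mult_left_mono) auto
      moreover have "(A powr \<alpha> * B powr (1 - \<alpha>)) * ((a / A) powr \<alpha> * (b / B) powr (1 - \<alpha>)) = a powr \<alpha> * b powr (1 - \<alpha>)"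
        using A B ab by (simp add: powr_divide)
      ultimately show ?thesis by simp
    qed
    then show ?thesis using ab A B \<alpha> 
      by (simp add: ennreal_mult[symmetric] ennreal_plus[symmetric] ennreal_leI del: ennreal_plus)
  qed
qed

text \<open>Stated with u and v under the integrals and the exponents outside, since it is applied
  to products of powers of kernels; the cases treat integrals equal to 0 or infinity, for which
  Young's inequality cannot be normalised.\<close>

theorem Holder_nn_integral:
  assumes [measurable]: "u \<in> borel_measurable M" "v \<in> borel_measurable M" and \<alpha>: "0 < \<alpha>" "\<alpha> < 1"
  shows "(\<integral>\<^sup>+x. epow (u x) \<alpha> * epow (v x) (1 - \<alpha>) \<partial>M) \<le> epow (\<integral>\<^sup>+x. u x \<partial>M) \<alpha> * epow (\<integral>\<^sup>+x. v x \<partial>M) (1 - \<alpha>)"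
proof -
  let ?U = "\<integral>\<^sup>+x. u x \<partial>M" and ?V = "\<integral>\<^sup>+x. v x \<partial>M"
  consider "?U = 0" | "?V = 0" | "?U \<noteq> 0" "?V \<noteq> 0" "?U = top \<or> ?V = top" | "?U \<noteq> 0" "?V \<noteq> 0" "?U \<noteq> top" "?V \<noteq> top" by blast
  then show ?thesis
  proof cases
    case 1
    then have "AE x in M. u x = 0" by (simp add: nn_integral_0_iff_AE)
    then have "(\<integral>\<^sup>+x. epow (u x) \<alpha> * epow (v x) (1 - \<alpha>) \<partial>M) = (\<integral>\<^sup>+x. 0 \<partial>M)"
      by (intro nn_integral_cong_AE) auto
    then show ?thesis by simp
  next
    case 2
    then have "AE x in M. v x = 0" by (simp add: nn_integral_0_iff_AE)
    then have "(\<integral>\<^sup>+x. epow (u x) \<alpha> * epow (v x) (1 - \<alpha>) \<partial>M) = (\<integral>\<^sup>+x. 0 \<partial>M)"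
      by (intro nn_integral_cong_AE) auto
    then show ?thesis by simp
  next
    case 3
    then have "epow ?U \<alpha> * epow ?V (1 - \<alpha>) = top"
      by (auto simp: ennreal_mult_eq_top_iff epow_eq_0_iff epow_eq_top_iff)
    then show ?thesis by simp
  next
    case 4
    then obtain A B where A: "?U = ennreal A" "0 < A" and B: "?V = ennreal B" "0 < B"
      by (cases ?U; cases ?V) (auto simp: less_le)
    let ?c = "A powr \<alpha> * B powr (1 - \<alpha>)"
    have "(\<integral>\<^sup>+x. epow (u x) \<alpha> * epow (v x) (1 - \<alpha>) \<partial>M)
      \<le> (\<integral>\<^sup>+x. ennreal ?c * (ennreal (\<alpha> / A) * u x + ennreal ((1 - \<alpha>) / B) * v x) \<partial>M)"
      by (intro nn_integral_mono young_ennreal \<alpha> A B)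
    also have "\<dots> = ennreal ?c * (ennreal (\<alpha> / A) * ?U + ennreal ((1 - \<alpha>) / B) * ?V)"
      by (simp add: nn_integral_cmult nn_integral_add)
    also have "ennreal (\<alpha> / A) * ?U + ennreal ((1 - \<alpha>) / B) * ?V = 1"
      unfolding A(1) B(1) using A(2) B(2) \<alpha>
      by (simp add: ennreal_mult[symmetric] ennreal_plus[symmetric] del: ennreal_plus)
    finally show ?thesis using A B by (simp add: ennreal_mult)
  qed
qed

text \<open>Hoelder applied to F k = (F^q k)^(1/q) k^(1 - 1/q): a kernel of mass at most c behaves
  like a probability measure up to the factor c^(q-1).\<close>

lemma Jensen_nn_integral:
  assumes [measurable]: "F \<in> borel_measurable M" "k \<in> borel_measurable M" and q: "1 \<le> q"
    and c: "(\<integral>\<^sup>+x. k x \<partial>M) \<le> c" "1 \<le> c" "c \<noteq> top"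
  shows "epow (\<integral>\<^sup>+x. F x * k x \<partial>M) q \<le> epow c (q - 1) * (\<integral>\<^sup>+x. epow (F x) q * k x \<partial>M)"
proof (cases "q = 1")
  case True
  \<comment> \<open>At q = 1 the factor is \<open>epow c 0\<close>, which equals 1 only for c
    different from 0 and infinity.\<close>
  have "c \<noteq> 0" using c by auto
  then show ?thesis using c True by (simp add: epow_zero_exp)
next
  case False
  with q have q1: "1 < q" by simp
  define \<alpha> where "\<alpha> = 1 / q"
  have \<alpha>: "0 < \<alpha>" "\<alpha> < 1" "q * \<alpha> = 1" using q1 by (auto simp: \<alpha>_def)
  have "F x * k x = epow (epow (F x) q * k x) \<alpha> * epow (k x) (1 - \<alpha>)" for x
  proof -
    have "epow (epow (F x) q * k x) \<alpha> * epow (k x) (1 - \<alpha>) = F x * (epow (k x) \<alpha> * epow (k x) (1 - \<alpha>))"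
      using \<alpha> by (simp add: epow_mult epow_epow mult.assoc)
    also have "epow (k x) \<alpha> * epow (k x) (1 - \<alpha>) = k x"
      using epow_add[of \<alpha> "1 - \<alpha>" "k x"] \<alpha> by simp
    finally show ?thesis by simp
  qed
  then have "(\<integral>\<^sup>+x. F x * k x \<partial>M) = (\<integral>\<^sup>+x. epow (epow (F x) q * k x) \<alpha> * epow (k x) (1 - \<alpha>) \<partial>M)" by simp
  also have "\<dots> \<le> epow (\<integral>\<^sup>+x. epow (F x) q * k x \<partial>M) \<alpha> * epow (\<integral>\<^sup>+x. k x \<partial>M) (1 - \<alpha>)"
    using \<alpha> by (intro Holder_nn_integral) auto
  also have "\<dots> \<le> epow (\<integral>\<^sup>+x. epow (F x) q * k x \<partial>M) \<alpha> * epow c (1 - \<alpha>)"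
    using \<alpha> c by (intro mult_left_mono epow_mono) auto
  finally have "epow (\<integral>\<^sup>+x. F x * k x \<partial>M) q \<le> epow (epow (\<integral>\<^sup>+x. epow (F x) q * k x \<partial>M) \<alpha> * epow c (1 - \<alpha>)) q"
    using q1 by (intro epow_mono) auto
  also have "\<dots> = (\<integral>\<^sup>+x. epow (F x) q * k x \<partial>M) * epow c (q - 1)"
  proof -
    have "(1 - \<alpha>) * q = q - 1" using \<alpha> by (simp add: algebra_simps)
    moreover have "\<alpha> * q = 1" using \<alpha> by (simp add: mult.commute)
    ultimately show ?thesis using q1 by (simp add: epow_mult epow_epow)
  qed
  finally show ?thesis by (simp add: mult.commute)
qed

lemma lp_norm_finite:
  assumes "p \<noteq> \<infinity>"
  shows "lp_norm p F = epow (\<integral>\<^sup>+x. epow (F x) (enn2real p) \<partial>lborel) (1 / enn2real p)"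
  using assms unfolding lp_norm_def Let_def epow_def by simp

text \<open>Collects three iterated integrals into one, so that Hoelder's inequality can be applied
  once in all three variables.\<close>

lemma nn_integral_triple:
  fixes h :: "'a::euclidean_space \<Rightarrow> 'b::euclidean_space \<Rightarrow> 'c::euclidean_space \<Rightarrow> ennreal"
  assumes [measurable]: "(\<lambda>(x, y, z). h x y z) \<in> borel_measurable borel"
  shows "(\<integral>\<^sup>+x. (\<integral>\<^sup>+y. (\<integral>\<^sup>+z. h x y z \<partial>lborel) \<partial>lborel) \<partial>lborel) = (\<integral>\<^sup>+w. h (fst w) (fst (snd w)) (snd (snd w)) \<partial>lborel)"
proof -
  have m: "(\<lambda>w. h (fst w) (fst (snd w)) (snd (snd w))) \<in> borel_measurable borel"
    using assms by (simp add: split_beta')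
  have m2: "(\<lambda>w. h x (fst w) (snd w)) \<in> borel_measurable borel" for x
  proof -
    have "(\<lambda>w::'b \<times> 'c. (x, w)) \<in> borel \<rightarrow>\<^sub>M borel" by (intro borel_measurable_continuous_onI continuous_intros)
    from measurable_compose[OF this m] show ?thesis by simp
  qed
  show ?thesis
    by (subst nn_integral_lborel_pair[OF m]) (simp add: nn_integral_lborel_pair[OF m2])
qed

lemma nn_integral_cmult2:
  "f \<in> borel_measurable M \<Longrightarrow> (\<integral>\<^sup>+x. a * (b * f x) \<partial>M) = b * (a * (\<integral>\<^sup>+x. f x \<partial>M))" for a b :: ennreal
  by (simp add: nn_integral_cmult mult.left_commute)

lemma measurable_fst_borel: "fst \<in> (borel :: ('a::topological_space \<times> 'b::topological_space) measure) \<rightarrow>\<^sub>M borel"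
  and measurable_snd_borel: "snd \<in> (borel :: ('a \<times> 'b) measure) \<rightarrow>\<^sub>M borel"
  by (intro borel_measurable_continuous_onI continuous_intros)+

text \<open>Jensen, using the row bound \<open>K1\<close>, reduces the claim to q-th powers. For
  finite p put \<alpha> = q/p, t = 1/(1/q - 1/p), and let b be the integral of F^p in x. Then l^q
  F^q K is the product of (F^p b^(\<alpha>-1) K)^\<alpha> and (l^t b^\<alpha> K)^(1-\<alpha>). The
  second factor is controlled for each \<omega>' by \<open>K3\<close>; the first becomes integrable
  in \<omega>' by the column bound \<open>K2\<close>. Both integrals are at most c times that of
  b^\<alpha>, which is the q-th power of the mixed norm of F.\<close>

theorem mixed_norm_bound:
  fixes K :: "'a::euclidean_space \<times> 'a \<Rightarrow> 'a \<times> 'a \<Rightarrow> ennreal" and F :: "'a \<times> 'a \<Rightarrow> ennreal"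
    and A :: "'a \<Rightarrow> 'a \<Rightarrow> ennreal" and l :: "'a \<Rightarrow> real" and c :: ennreal
  assumes q: "1 \<le> q" and qp: "q < p"
    and mK: "(\<lambda>(z', z). K z' z) \<in> borel_measurable (borel \<Otimes>\<^sub>M borel)"
    and mF: "F \<in> borel_measurable borel"
    and mA: "(\<lambda>(x, \<omega>). A x \<omega>) \<in> borel_measurable (borel \<Otimes>\<^sub>M borel)"
    and ml: "l \<in> borel_measurable borel" and l0: "\<And>x. 0 \<le> l x"
    and ma: "(\<lambda>\<omega>. lp_norm p (\<lambda>x. F (x, \<omega>))) \<in> borel_measurable borel"
    and c: "1 \<le> c" "c \<noteq> top"
    and AK: "\<And>x' \<omega>'. A x' \<omega>' \<le> ennreal (l x') * (\<integral>\<^sup>+z. F z * K (x', \<omega>') z \<partial>lborel)"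
    and K1: "\<And>z'. (\<integral>\<^sup>+z. K z' z \<partial>lborel) \<le> c"
    and K2: "\<And>z. (\<integral>\<^sup>+z'. K z' z \<partial>lborel) \<le> c"
    and K3: "\<And>\<omega> \<omega>'. (\<integral>\<^sup>+x'. ennreal (l x' powr (1 / (inv_exp q - inv_exp p))) * (\<integral>\<^sup>+x. K (x', \<omega>') (x, \<omega>) \<partial>lborel) \<partial>lborel) \<le> c"
  shows "lp_norm p (\<lambda>\<omega>'. lp_norm q (\<lambda>x'. A x' \<omega>')) \<le> c * lp_norm q (\<lambda>\<omega>. lp_norm p (\<lambda>x. F (x, \<omega>)))"
proof -
  note [measurable] = mK mF mA ml ma measurable_fst_borel measurable_snd_borel
  have qfin: "q \<noteq> \<infinity>" using qp by auto
  define Q where "Q = enn2real q"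
  have qQ: "q = ennreal Q" using qfin by (simp add: Q_def ennreal_enn2real_if)
  have Q1: "1 \<le> Q" using q qQ by (metis Q_def enn2real_nonneg ennreal_1 ennreal_le_iff)
  have iq: "inv_exp q = 1 / Q" using qfin by (simp add: inv_exp_def Q_def)
  define L where "L \<omega>' = (\<integral>\<^sup>+x'. epow (A x' \<omega>') Q \<partial>lborel)" for \<omega>'
  have [measurable]: "L \<in> borel_measurable borel" unfolding L_def by measurable
  have lpA: "lp_norm q (\<lambda>x'. A x' \<omega>') = epow (L \<omega>') (1 / Q)" for \<omega>'
    unfolding L_def Q_def by (rule lp_norm_finite[OF qfin])
  define a where "a \<omega> = lp_norm p (\<lambda>x. F (x, \<omega>))" for \<omega>
  have [measurable]: "a \<in> borel_measurable borel" using ma by (simp add: a_def[abs_def])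
  have rhs: "lp_norm q (\<lambda>\<omega>. lp_norm p (\<lambda>x. F (x, \<omega>))) = epow (\<integral>\<^sup>+\<omega>. epow (a \<omega>) Q \<partial>lborel) (1 / Q)"
    unfolding a_def Q_def by (rule lp_norm_finite[OF qfin])
  have c0: "c \<noteq> 0" using c by auto
  have step: "L \<omega>' \<le> epow c (Q - 1) * (\<integral>\<^sup>+x'. (\<integral>\<^sup>+\<omega>. (\<integral>\<^sup>+x. ennreal (l x' powr Q) * (epow (F (x, \<omega>)) Q * K (x', \<omega>') (x, \<omega>)) \<partial>lborel) \<partial>lborel) \<partial>lborel)" for \<omega>'
  proof -
    have "L \<omega>' \<le> (\<integral>\<^sup>+x'. epow c (Q - 1) * (\<integral>\<^sup>+\<omega>. (\<integral>\<^sup>+x. ennreal (l x' powr Q) * (epow (F (x, \<omega>)) Q * K (x', \<omega>') (x, \<omega>)) \<partial>lborel) \<partial>lborel) \<partial>lborel)"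
      unfolding L_def
    proof (rule nn_integral_mono)
      fix x'
      have "epow (A x' \<omega>') Q \<le> epow (ennreal (l x') * (\<integral>\<^sup>+z. F z * K (x', \<omega>') z \<partial>lborel)) Q"
        using Q1 by (intro epow_mono AK) auto
      also have "\<dots> = ennreal (l x' powr Q) * epow (\<integral>\<^sup>+z. F z * K (x', \<omega>') z \<partial>lborel) Q"
        using Q1 l0 by (simp add: epow_mult)
      also have "\<dots> \<le> ennreal (l x' powr Q) * (epow c (Q - 1) * (\<integral>\<^sup>+z. epow (F z) Q * K (x', \<omega>') z \<partial>lborel))"
        by (intro mult_left_mono Jensen_nn_integral Q1 K1 c) auto
      also have "(\<integral>\<^sup>+z. epow (F z) Q * K (x', \<omega>') z \<partial>lborel) = (\<integral>\<^sup>+x. (\<integral>\<^sup>+\<omega>. epow (F (x, \<omega>)) Q * K (x', \<omega>') (x, \<omega>) \<partial>lborel) \<partial>lborel)"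
        by (rule nn_integral_lborel_pair) simp
      also have "\<dots> = (\<integral>\<^sup>+\<omega>. (\<integral>\<^sup>+x. epow (F (x, \<omega>)) Q * K (x', \<omega>') (x, \<omega>) \<partial>lborel) \<partial>lborel)"
        by (rule nn_integral_lborel_swap) measurable
      also have "ennreal (l x' powr Q) * (epow c (Q - 1) * \<dots>) = epow c (Q - 1) * (\<integral>\<^sup>+\<omega>. (\<integral>\<^sup>+x. ennreal (l x' powr Q) * (epow (F (x, \<omega>)) Q * K (x', \<omega>') (x, \<omega>)) \<partial>lborel) \<partial>lborel)"
        by (simp add: nn_integral_cmult mult_ac)
      finally show "epow (A x' \<omega>') Q \<le> epow c (Q - 1) * (\<integral>\<^sup>+\<omega>. (\<integral>\<^sup>+x. ennreal (l x' powr Q) * (epow (F (x, \<omega>)) Q * K (x', \<omega>') (x, \<omega>)) \<partial>lborel) \<partial>lborel)" .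
    qed
    also have "\<dots> = epow c (Q - 1) * (\<integral>\<^sup>+x'. (\<integral>\<^sup>+\<omega>. (\<integral>\<^sup>+x. ennreal (l x' powr Q) * (epow (F (x, \<omega>)) Q * K (x', \<omega>') (x, \<omega>)) \<partial>lborel) \<partial>lborel) \<partial>lborel)"
      by (rule nn_integral_cmult) measurable
    finally show ?thesis .
  qed
  \<comment> \<open>Here b depends on \<omega> alone, so the x-integral falls on K only and
    \<open>K3\<close> applies for each \<omega> separately.\<close>
  have weight: "(\<integral>\<^sup>+x'. (\<integral>\<^sup>+\<omega>. (\<integral>\<^sup>+x. ennreal (l x' powr (1 / (inv_exp q - inv_exp p))) * (b \<omega> * K (x', \<omega>') (x, \<omega>)) \<partial>lborel) \<partial>lborel) \<partial>lborel) \<le> c * (\<integral>\<^sup>+\<omega>. b \<omega> \<partial>lborel)"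
    if [measurable]: "b \<in> borel_measurable borel" for b \<omega>'
  proof -
    let ?t = "1 / (inv_exp q - inv_exp p)"
    have "(\<integral>\<^sup>+x'. (\<integral>\<^sup>+\<omega>. (\<integral>\<^sup>+x. ennreal (l x' powr ?t) * (b \<omega> * K (x', \<omega>') (x, \<omega>)) \<partial>lborel) \<partial>lborel) \<partial>lborel)
       = (\<integral>\<^sup>+x'. (\<integral>\<^sup>+\<omega>. b \<omega> * (ennreal (l x' powr ?t) * (\<integral>\<^sup>+x. K (x', \<omega>') (x, \<omega>) \<partial>lborel)) \<partial>lborel) \<partial>lborel)"
      by (intro nn_integral_cong nn_integral_cmult2) measurable
    also have "\<dots> = (\<integral>\<^sup>+\<omega>. (\<integral>\<^sup>+x'. b \<omega> * (ennreal (l x' powr ?t) * (\<integral>\<^sup>+x. K (x', \<omega>') (x, \<omega>) \<partial>lborel)) \<partial>lborel) \<partial>lborel)"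
      by (rule nn_integral_lborel_swap) measurable
    also have "\<dots> = (\<integral>\<^sup>+\<omega>. b \<omega> * (\<integral>\<^sup>+x'. ennreal (l x' powr ?t) * (\<integral>\<^sup>+x. K (x', \<omega>') (x, \<omega>) \<partial>lborel) \<partial>lborel) \<partial>lborel)"
      by (intro nn_integral_cong nn_integral_cmult) measurable
    also have "\<dots> \<le> (\<integral>\<^sup>+\<omega>. b \<omega> * c \<partial>lborel)"
      by (intro nn_integral_mono mult_left_mono K3) auto
    also have "\<dots> = c * (\<integral>\<^sup>+\<omega>. b \<omega> \<partial>lborel)" by (subst nn_integral_multc) (simp_all add: mult.commute)
    finally show ?thesis .
  qed
  \<comment> \<open>The c^(Q-1) of Jensen and the c of the kernel bounds combine to c^Q, which
    leaves exactly one c after the final root.\<close>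
  have pows: "epow (epow c (Q - 1) * (c * s)) (1 / Q) = c * epow s (1 / Q)" for s
  proof -
    have "epow c (Q - 1 + 1) = epow c (Q - 1) * epow c 1" by (rule epow_add_finite[OF c0 c(2)])
    then have "epow c (Q - 1) * c = epow c Q" by simp
    then have "epow (epow c (Q - 1) * (c * s)) (1 / Q) = epow (epow c Q * s) (1 / Q)" by (simp add: mult.assoc[symmetric])
    also have "\<dots> = epow (epow c Q) (1 / Q) * epow s (1 / Q)" using Q1 by (intro epow_mult) auto
    also have "epow (epow c Q) (1 / Q) = c" unfolding epow_epow using Q1 by simp
    finally show ?thesis .
  qed
  show ?thesis
  proof (cases "p = \<infinity>")
    case True
    have ip: "inv_exp p = 0" using True by (simp add: inv_exp_def)
    \<comment> \<open>At p infinite the weight already has the exponent of \<open>K3\<close>, and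
      Hoelder degenerates to replacing F by its essential supremum in x.\<close>
    have t: "1 / (inv_exp q - inv_exp p) = Q" using ip iq Q1 by simp
    have bd: "epow (L \<omega>') (1 / Q) \<le> c * epow (\<integral>\<^sup>+\<omega>. epow (a \<omega>) Q \<partial>lborel) (1 / Q)" for \<omega>'
    proof -
      have "(\<integral>\<^sup>+x'. (\<integral>\<^sup>+\<omega>. (\<integral>\<^sup>+x. ennreal (l x' powr Q) * (epow (F (x, \<omega>)) Q * K (x', \<omega>') (x, \<omega>)) \<partial>lborel) \<partial>lborel) \<partial>lborel)
         \<le> (\<integral>\<^sup>+x'. (\<integral>\<^sup>+\<omega>. (\<integral>\<^sup>+x. ennreal (l x' powr Q) * (epow (a \<omega>) Q * K (x', \<omega>') (x, \<omega>)) \<partial>lborel) \<partial>lborel) \<partial>lborel)"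
      proof (rule nn_integral_mono, rule nn_integral_mono)
        fix x' \<omega>
        have "AE x in lborel. F (x, \<omega>) \<le> a \<omega>"
          unfolding a_def lp_norm_def if_P[OF True] by (rule esssup_AE)
        then show "(\<integral>\<^sup>+x. ennreal (l x' powr Q) * (epow (F (x, \<omega>)) Q * K (x', \<omega>') (x, \<omega>)) \<partial>lborel)
          \<le> (\<integral>\<^sup>+x. ennreal (l x' powr Q) * (epow (a \<omega>) Q * K (x', \<omega>') (x, \<omega>)) \<partial>lborel)"
        proof (intro nn_integral_mono_AE, eventually_elim)
          fix x assume "F (x, \<omega>) \<le> a \<omega>"
          then show "ennreal (l x' powr Q) * (epow (F (x, \<omega>)) Q * K (x', \<omega>') (x, \<omega>)) \<le> ennreal (l x' powr Q) * (epow (a \<omega>) Q * K (x', \<omega>') (x, \<omega>))"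
            using Q1 by (intro mult_left_mono mult_right_mono epow_mono) auto
        qed
      qed
      also have "\<dots> \<le> c * (\<integral>\<^sup>+\<omega>. epow (a \<omega>) Q \<partial>lborel)"
        using weight[of "\<lambda>\<omega>. epow (a \<omega>) Q" \<omega>'] unfolding t by simp
      finally have "L \<omega>' \<le> epow c (Q - 1) * (c * (\<integral>\<^sup>+\<omega>. epow (a \<omega>) Q \<partial>lborel))"
        using step[of \<omega>'] by (meson mult_left_mono order_trans zero_le)
      then have "epow (L \<omega>') (1 / Q) \<le> epow (epow c (Q - 1) * (c * (\<integral>\<^sup>+\<omega>. epow (a \<omega>) Q \<partial>lborel))) (1 / Q)"
        using Q1 by (intro epow_mono) auto
      then show ?thesis unfolding pows .
    qed
    have "lp_norm p (\<lambda>\<omega>'. lp_norm q (\<lambda>x'. A x' \<omega>')) = esssup lborel (\<lambda>\<omega>'. epow (L \<omega>') (1 / Q))"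
      unfolding lpA lp_norm_def[of p] if_P[OF True] ..
    also have "\<dots> \<le> c * epow (\<integral>\<^sup>+\<omega>. epow (a \<omega>) Q \<partial>lborel) (1 / Q)"
      by (rule esssup_I) (auto intro: bd)
    finally show ?thesis unfolding rhs .
  next
    case False
    define P where "P = enn2real p"
    have pP: "p = ennreal P" using False by (simp add: P_def ennreal_enn2real_if)
    have QP: "Q < P" using qp Q1 unfolding qQ pP by (simp add: ennreal_less_iff)
    have P0: "0 < P" using QP Q1 by simp
    have ip: "inv_exp p = 1 / P" using False by (simp add: inv_exp_def P_def)
    define \<alpha> where "\<alpha> = Q / P"
    have \<alpha>: "0 < \<alpha>" "\<alpha> < 1" "P * \<alpha> = Q" "0 < 1 - \<alpha>" using QP Q1 by (auto simp: \<alpha>_def)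
    have t: "(1 / (inv_exp q - inv_exp p)) * (1 - \<alpha>) = Q"
      unfolding iq ip \<alpha>_def using QP Q1 by (simp add: field_simps)
    define b where "b \<omega> = (\<integral>\<^sup>+x. epow (F (x, \<omega>)) P \<partial>lborel)" for \<omega>
    have [measurable]: "b \<in> borel_measurable borel" unfolding b_def by measurable
    have ab: "epow (a \<omega>) Q = epow (b \<omega>) \<alpha>" for \<omega>
      unfolding a_def lp_norm_finite[OF False] b_def P_def[symmetric] epow_epow by (simp add: \<alpha>_def)
    define S where "S = (\<integral>\<^sup>+\<omega>. epow (b \<omega>) \<alpha> \<partial>lborel)"
    have rhs': "lp_norm q (\<lambda>\<omega>. lp_norm p (\<lambda>x. F (x, \<omega>))) = epow S (1 / Q)"
      unfolding rhs ab S_def ..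
    show ?thesis
    proof (cases "S = top")
      case True
      then show ?thesis unfolding rhs' using c0 by (simp add: ennreal_mult_top)
    next
      case S: False
      \<comment> \<open>The normalising factor b^(\<alpha>-1) has a negative exponent, so it is set
        to 0 where b is 0 or infinite. In the first case F vanishes almost everywhere in x, and the
        second occurs only on a null set because S is finite.\<close>
      define d where "d \<omega> = (if b \<omega> = 0 \<or> b \<omega> = top then 0 else epow (b \<omega>) (\<alpha> - 1))" for \<omega>
      have [measurable]: "d \<in> borel_measurable borel" unfolding d_def[abs_def] by measurable
      have bd: "b \<omega> * d \<omega> \<le> epow (b \<omega>) \<alpha>" for \<omega>
        using epow_add_finite[of "b \<omega>" 1 "\<alpha> - 1"] by (auto simp: d_def)
      have "AE \<omega> in lborel. epow (b \<omega>) \<alpha> \<noteq> \<infinity>"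
        using S unfolding S_def by (intro nn_integral_PInf_AE) auto
      then have bfin: "AE \<omega> in lborel. b \<omega> \<noteq> top" by (simp add: epow_eq_top_iff)
      have split: "AE x in lborel. epow (F (x, \<omega>)) Q \<le> epow (epow (F (x, \<omega>)) P * d \<omega>) \<alpha> * epow (epow (b \<omega>) \<alpha>) (1 - \<alpha>)"
        if bf: "b \<omega> \<noteq> top" for \<omega>
      proof (cases "b \<omega> = 0")
        case True
        then have "AE x in lborel. epow (F (x, \<omega>)) P = 0" unfolding b_def by (simp add: nn_integral_0_iff_AE)
        then show ?thesis by eventually_elim (simp add: epow_eq_0_iff)
      next
        case b0: False
        have one: "epow (b \<omega>) ((\<alpha> - 1) * \<alpha>) * epow (b \<omega>) (\<alpha> * (1 - \<alpha>)) = 1"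
          using b0 bf by (simp add: epow_add_finite[symmetric] algebra_simps epow_zero_exp)
        have "epow (epow (F (x, \<omega>)) P * d \<omega>) \<alpha> * epow (epow (b \<omega>) \<alpha>) (1 - \<alpha>)
          = epow (F (x, \<omega>)) Q * (epow (b \<omega>) ((\<alpha> - 1) * \<alpha>) * epow (b \<omega>) (\<alpha> * (1 - \<alpha>)))" for x
          using \<alpha> b0 bf by (simp add: epow_mult epow_epow d_def mult.assoc)
        then show ?thesis unfolding one by simp
      \<comment> \<open>Apart from the degenerate values of b this splitting is an identity, since
        the powers of b in the two factors are reciprocal.\<close>
      qed
      define U where "U \<omega>' = (\<integral>\<^sup>+x'. (\<integral>\<^sup>+\<omega>. (\<integral>\<^sup>+x. epow (F (x, \<omega>)) P * d \<omega> * K (x', \<omega>') (x, \<omega>) \<partial>lborel) \<partial>lborel) \<partial>lborel)" for \<omega>'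
      have [measurable]: "U \<in> borel_measurable borel" unfolding U_def by measurable
      let ?t = "1 / (inv_exp q - inv_exp p)"
      have Lb: "L \<omega>' \<le> epow c (Q - 1) * (epow (U \<omega>') \<alpha> * epow (c * S) (1 - \<alpha>))" for \<omega>'
      proof -
        let ?u = "\<lambda>x' \<omega> x. epow (F (x, \<omega>)) P * d \<omega> * K (x', \<omega>') (x, \<omega>)"
        let ?v = "\<lambda>x' \<omega> x. ennreal (l x' powr ?t) * (epow (b \<omega>) \<alpha> * K (x', \<omega>') (x, \<omega>))"
        have mu: "(\<lambda>w. ?u (fst w) (fst (snd w)) (snd (snd w))) \<in> borel_measurable borel"
          and mv: "(\<lambda>w. ?v (fst w) (fst (snd w)) (snd (snd w))) \<in> borel_measurable borel"
          by measurable
        have "(\<integral>\<^sup>+x'. (\<integral>\<^sup>+\<omega>. (\<integral>\<^sup>+x. ennreal (l x' powr Q) * (epow (F (x, \<omega>)) Q * K (x', \<omega>') (x, \<omega>)) \<partial>lborel) \<partial>lborel) \<partial>lborel)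
          \<le> (\<integral>\<^sup>+x'. (\<integral>\<^sup>+\<omega>. (\<integral>\<^sup>+x. epow (?u x' \<omega> x) \<alpha> * epow (?v x' \<omega> x) (1 - \<alpha>) \<partial>lborel) \<partial>lborel) \<partial>lborel)"
        proof (rule nn_integral_mono, rule nn_integral_mono_AE)
          fix x'
          show "AE \<omega> in lborel. (\<integral>\<^sup>+x. ennreal (l x' powr Q) * (epow (F (x, \<omega>)) Q * K (x', \<omega>') (x, \<omega>)) \<partial>lborel)
             \<le> (\<integral>\<^sup>+x. epow (?u x' \<omega> x) \<alpha> * epow (?v x' \<omega> x) (1 - \<alpha>) \<partial>lborel)"
            using bfin
          proof eventually_elim
            fix \<omega> assume "b \<omega> \<noteq> top"
            from split[OF this]
            show "(\<integral>\<^sup>+x. ennreal (l x' powr Q) * (epow (F (x, \<omega>)) Q * K (x', \<omega>') (x, \<omega>)) \<partial>lborel)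
              \<le> (\<integral>\<^sup>+x. epow (?u x' \<omega> x) \<alpha> * epow (?v x' \<omega> x) (1 - \<alpha>) \<partial>lborel)"
            proof (intro nn_integral_mono_AE, eventually_elim)
              fix x
              let ?k = "K (x', \<omega>') (x, \<omega>)"
              assume *: "epow (F (x, \<omega>)) Q \<le> epow (epow (F (x, \<omega>)) P * d \<omega>) \<alpha> * epow (epow (b \<omega>) \<alpha>) (1 - \<alpha>)"
              have k: "epow ?k \<alpha> * epow ?k (1 - \<alpha>) = ?k"
                using epow_add[of \<alpha> "1 - \<alpha>" ?k] \<alpha> by simp
              have lt: "epow (ennreal (l x' powr ?t)) (1 - \<alpha>) = ennreal (l x' powr Q)"
                using t by (simp add: powr_powr)
              have "epow (?u x' \<omega> x) \<alpha> * epow (?v x' \<omega> x) (1 - \<alpha>)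
                = (epow (epow (F (x, \<omega>)) P * d \<omega>) \<alpha> * epow ?k \<alpha>) * (ennreal (l x' powr Q) * (epow (epow (b \<omega>) \<alpha>) (1 - \<alpha>) * epow ?k (1 - \<alpha>)))"
                unfolding epow_mult[OF \<alpha>(4), of "ennreal (l x' powr ?t)"] lt
                  epow_mult[OF \<alpha>(4), of "epow (b \<omega>) \<alpha>"] epow_mult[OF \<alpha>(1), of "epow (F (x, \<omega>)) P * d \<omega>"] ..
              also have "\<dots> = ennreal (l x' powr Q) * ((epow (epow (F (x, \<omega>)) P * d \<omega>) \<alpha> * epow (epow (b \<omega>) \<alpha>) (1 - \<alpha>)) * (epow ?k \<alpha> * epow ?k (1 - \<alpha>)))"
                by (simp only: mult_ac)
              finally have e: "epow (?u x' \<omega> x) \<alpha> * epow (?v x' \<omega> x) (1 - \<alpha>) = ennreal (l x' powr Q) * ((epow (epow (F (x, \<omega>)) P * d \<omega>) \<alpha> * epow (epow (b \<omega>) \<alpha>) (1 - \<alpha>)) * ?k)"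
                unfolding k .
              show "ennreal (l x' powr Q) * (epow (F (x, \<omega>)) Q * ?k) \<le> epow (?u x' \<omega> x) \<alpha> * epow (?v x' \<omega> x) (1 - \<alpha>)"
                unfolding e by (intro mult_left_mono mult_right_mono *) auto
            qed
          qed
        qed
        also have "\<dots> = (\<integral>\<^sup>+w. epow (?u (fst w) (fst (snd w)) (snd (snd w))) \<alpha> * epow (?v (fst w) (fst (snd w)) (snd (snd w))) (1 - \<alpha>) \<partial>lborel)"
          by (rule nn_integral_triple) (use mu mv in \<open>simp add: split_beta'\<close>)
        also have "\<dots> \<le> epow (\<integral>\<^sup>+w. ?u (fst w) (fst (snd w)) (snd (snd w)) \<partial>lborel) \<alpha> * epow (\<integral>\<^sup>+w. ?v (fst w) (fst (snd w)) (snd (snd w)) \<partial>lborel) (1 - \<alpha>)"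
          using mu mv \<alpha> by (intro Holder_nn_integral) auto
        also have "(\<integral>\<^sup>+w. ?u (fst w) (fst (snd w)) (snd (snd w)) \<partial>lborel) = U \<omega>'"
          unfolding U_def by (rule nn_integral_triple[symmetric]) (use mu in \<open>simp add: split_beta'\<close>)
        also have "(\<integral>\<^sup>+w. ?v (fst w) (fst (snd w)) (snd (snd w)) \<partial>lborel) = (\<integral>\<^sup>+x'. (\<integral>\<^sup>+\<omega>. (\<integral>\<^sup>+x. ?v x' \<omega> x \<partial>lborel) \<partial>lborel) \<partial>lborel)"
          by (rule nn_integral_triple[symmetric]) (use mv in \<open>simp add: split_beta'\<close>)
        also have "epow (U \<omega>') \<alpha> * epow \<dots> (1 - \<alpha>) \<le> epow (U \<omega>') \<alpha> * epow (c * S) (1 - \<alpha>)"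
          unfolding S_def using \<alpha> by (intro mult_left_mono epow_mono weight) auto
        finally show ?thesis using step[of \<omega>'] by (meson mult_left_mono order_trans zero_le)
      qed
      \<comment> \<open>Integrating over \<omega>' as well completes the integral of K over z', so
        the column bound applies; the rest is the integral of b d, which is at most that of
        b^\<alpha>.\<close>
      have UI: "(\<integral>\<^sup>+\<omega>'. U \<omega>' \<partial>lborel) \<le> c * S"
      proof -
        let ?G = "\<lambda>z. epow (F z) P * d (snd z)"
        have "U \<omega>' = (\<integral>\<^sup>+x'. (\<integral>\<^sup>+z. ?G z * K (x', \<omega>') z \<partial>lborel) \<partial>lborel)" for \<omega>'
        proof -
          have "(\<integral>\<^sup>+z. ?G z * K (x', \<omega>') z \<partial>lborel) = (\<integral>\<^sup>+x. (\<integral>\<^sup>+\<omega>. epow (F (x, \<omega>)) P * d \<omega> * K (x', \<omega>') (x, \<omega>) \<partial>lborel) \<partial>lborel)" for x'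
            by (subst nn_integral_lborel_pair) simp_all
          also have "\<dots> x' = (\<integral>\<^sup>+\<omega>. (\<integral>\<^sup>+x. epow (F (x, \<omega>)) P * d \<omega> * K (x', \<omega>') (x, \<omega>) \<partial>lborel) \<partial>lborel)" for x'
            by (rule nn_integral_lborel_swap) measurable
          finally show ?thesis unfolding U_def by simp
        qed
        then have "(\<integral>\<^sup>+\<omega>'. U \<omega>' \<partial>lborel) = (\<integral>\<^sup>+\<omega>'. (\<integral>\<^sup>+x'. (\<integral>\<^sup>+z. ?G z * K (x', \<omega>') z \<partial>lborel) \<partial>lborel) \<partial>lborel)" by simp
        also have "\<dots> = (\<integral>\<^sup>+x'. (\<integral>\<^sup>+\<omega>'. (\<integral>\<^sup>+z. ?G z * K (x', \<omega>') z \<partial>lborel) \<partial>lborel) \<partial>lborel)"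
          by (rule nn_integral_lborel_swap) measurable
        also have "\<dots> = (\<integral>\<^sup>+z'. (\<integral>\<^sup>+z. ?G z * K z' z \<partial>lborel) \<partial>lborel)"
          by (rule nn_integral_lborel_pair[symmetric]) measurable
        also have "\<dots> = (\<integral>\<^sup>+z. (\<integral>\<^sup>+z'. ?G z * K z' z \<partial>lborel) \<partial>lborel)"
          by (rule nn_integral_lborel_swap) measurable
        also have "\<dots> = (\<integral>\<^sup>+z. ?G z * (\<integral>\<^sup>+z'. K z' z \<partial>lborel) \<partial>lborel)"
          by (intro nn_integral_cong nn_integral_cmult) measurable
        also have "\<dots> \<le> (\<integral>\<^sup>+z. ?G z * c \<partial>lborel)"
          by (intro nn_integral_mono mult_left_mono K2) auto
        also have "\<dots> = c * (\<integral>\<^sup>+z. ?G z \<partial>lborel)" by (subst nn_integral_multc) (simp_all add: mult.commute)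
        also have "(\<integral>\<^sup>+z. ?G z \<partial>lborel) = (\<integral>\<^sup>+x. (\<integral>\<^sup>+\<omega>. epow (F (x, \<omega>)) P * d \<omega> \<partial>lborel) \<partial>lborel)"
          by (subst nn_integral_lborel_pair) simp_all
        also have "\<dots> = (\<integral>\<^sup>+\<omega>. (\<integral>\<^sup>+x. epow (F (x, \<omega>)) P * d \<omega> \<partial>lborel) \<partial>lborel)"
          by (rule nn_integral_lborel_swap) measurable
        also have "\<dots> = (\<integral>\<^sup>+\<omega>. b \<omega> * d \<omega> \<partial>lborel)"
          unfolding b_def by (intro nn_integral_cong nn_integral_multc) measurable
        also have "c * \<dots> \<le> c * S" unfolding S_def by (intro mult_left_mono nn_integral_mono bd) auto
        finally show ?thesis .
      qed
      have "lp_norm p (\<lambda>\<omega>'. lp_norm q (\<lambda>x'. A x' \<omega>')) = epow (\<integral>\<^sup>+\<omega>'. epow (L \<omega>') (1 / \<alpha>) \<partial>lborel) (1 / P)"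
        unfolding lpA lp_norm_finite[OF False] P_def[symmetric] epow_epow by (simp add: \<alpha>_def)
      also have "\<dots> \<le> epow (\<integral>\<^sup>+\<omega>'. epow c ((Q - 1) * (1 / \<alpha>)) * (U \<omega>' * epow (c * S) ((1 - \<alpha>) * (1 / \<alpha>))) \<partial>lborel) (1 / P)"
      proof (intro epow_mono nn_integral_mono)
        fix \<omega>'
        have "epow (L \<omega>') (1 / \<alpha>) \<le> epow (epow c (Q - 1) * (epow (U \<omega>') \<alpha> * epow (c * S) (1 - \<alpha>))) (1 / \<alpha>)"
          using \<alpha> by (intro epow_mono Lb) auto
        also have "\<dots> = epow c ((Q - 1) * (1 / \<alpha>)) * (U \<omega>' * epow (c * S) ((1 - \<alpha>) * (1 / \<alpha>)))"
        proof -
          have a: "0 < 1 / \<alpha>" "\<alpha> * (1 / \<alpha>) = 1" using \<alpha> by auto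
          show ?thesis
            unfolding epow_mult[OF a(1), of "epow c (Q - 1)"] epow_mult[OF a(1), of "epow (U \<omega>') \<alpha>"] epow_epow a(2) epow_1 ..
        qed
        finally show "epow (L \<omega>') (1 / \<alpha>) \<le> epow c ((Q - 1) * (1 / \<alpha>)) * (U \<omega>' * epow (c * S) ((1 - \<alpha>) * (1 / \<alpha>)))" .
      qed (use P0 in auto)
      also have "(\<integral>\<^sup>+\<omega>'. epow c ((Q - 1) * (1 / \<alpha>)) * (U \<omega>' * epow (c * S) ((1 - \<alpha>) * (1 / \<alpha>))) \<partial>lborel)
        = epow c ((Q - 1) * (1 / \<alpha>)) * ((\<integral>\<^sup>+\<omega>'. U \<omega>' \<partial>lborel) * epow (c * S) ((1 - \<alpha>) * (1 / \<alpha>)))"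
        by (simp add: nn_integral_cmult nn_integral_multc)
      also have "epow \<dots> (1 / P) \<le> epow (epow c ((Q - 1) * (1 / \<alpha>)) * (c * S * epow (c * S) ((1 - \<alpha>) * (1 / \<alpha>)))) (1 / P)"
        using P0 by (intro epow_mono mult_left_mono mult_right_mono UI) auto
      also have "c * S * epow (c * S) ((1 - \<alpha>) * (1 / \<alpha>)) = epow (c * S) (1 / \<alpha>)"
      proof -
        \<comment> \<open>The first Hoelder factor contributes c S once and the second contributes
          its power (1-\<alpha>)/\<alpha>; together they give 1/\<alpha> = p/q.\<close>
        have e: "1 + (1 - \<alpha>) * (1 / \<alpha>) = 1 / \<alpha>" using \<alpha> by (simp add: field_simps)
        have "c * S * epow (c * S) ((1 - \<alpha>) * (1 / \<alpha>)) = epow (c * S) (1 + (1 - \<alpha>) * (1 / \<alpha>))"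
          using \<alpha> by (subst epow_add) auto
        then show ?thesis unfolding e .
      qed
      also have "epow (epow c ((Q - 1) * (1 / \<alpha>)) * epow (c * S) (1 / \<alpha>)) (1 / P) = epow (epow c (Q - 1) * (c * S)) (1 / Q)"
      proof -
        have e: "1 / \<alpha> * (1 / P) = 1 / Q" using P0 by (simp add: \<alpha>_def)
        have "epow c ((Q - 1) * (1 / \<alpha>)) * epow (c * S) (1 / \<alpha>) = epow (epow c (Q - 1) * (c * S)) (1 / \<alpha>)"
          using \<alpha> epow_mult[of "1 / \<alpha>" "epow c (Q - 1)" "c * S"] by (simp add: epow_epow)
        then show ?thesis by (simp only: epow_epow e)
      qed
      also have "\<dots> = c * epow S (1 / Q)" by (rule pows)
      finally show ?thesis unfolding rhs' .
    qed
  qed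
qed

section \<open>Global lower Lipschitz bounds\<close>

text \<open>On a ball of radius r the derivative varies by at most c0/2, so G differs from its
  linearisation at the centre by a map of Lipschitz constant c0/2. The radius does not depend on the
  centre, which makes the global argument possible.\<close>

lemma local_lower_lipschitz:
  fixes G :: "'a::euclidean_space \<Rightarrow> 'a"
  assumes D: "\<And>y. (G has_derivative DG y) (at y)"
    and c0: "0 < c0" and low: "\<And>y h. c0 * norm h \<le> norm (DG y h)"
    and lip: "\<And>y y' h. norm (DG y h - DG y' h) \<le> M * norm (y - y') * norm h"
    and M: "0 < M" and r: "M * r \<le> c0 / 2"
    and y1: "norm (y1 - y) \<le> r" and y2: "norm (y2 - y) \<le> r"
  shows "norm (G y1 - G y2 - DG y (y1 - y2)) \<le> c0 / 2 * norm (y1 - y2)"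
proof -
  interpret L: bounded_linear "DG y" using D by (rule has_derivative_bounded_linear)
  have "norm ((G y1 - DG y y1) - (G y2 - DG y y2)) \<le> c0 / 2 * norm (y1 - y2)"
  proof (rule differentiable_bound[of "cball y r" "\<lambda>z. G z - DG y z" "\<lambda>z h. DG z h - DG y h"])
    fix z assume z: "z \<in> cball y r"
    show "((\<lambda>z. G z - DG y z) has_derivative (\<lambda>h. DG z h - DG y h)) (at z within cball y r)"
      by (intro has_derivative_diff has_derivative_at_withinI[OF D] L.has_derivative has_derivative_ident)
    show "onorm (\<lambda>h. DG z h - DG y h) \<le> c0 / 2"
    proof (rule onorm_bound)
      show "0 \<le> c0 / 2" using c0 by simp
      fix h
      have "norm (DG z h - DG y h) \<le> M * norm (z - y) * norm h" by (rule lip)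
      also have "\<dots> \<le> (M * r) * norm h" using z M
        by (intro mult_right_mono mult_left_mono) (auto simp: dist_norm norm_minus_commute)
      also have "\<dots> \<le> c0 / 2 * norm h" by (intro mult_right_mono r) auto
      finally show "norm (DG z h - DG y h) \<le> c0 / 2 * norm h" .
    qed
  qed (use y1 y2 in \<open>auto simp: dist_norm norm_minus_commute\<close>)
  then show ?thesis by (simp add: L.diff algebra_simps)
qed

text \<open>Simplified Newton iteration with the derivative frozen at y: subtracting the inverse
  derivative applied to G z - q is a contraction with factor 1/2, and its fixed point solves G z =
  q.\<close>

lemma local_surjective:
  fixes G :: "'a::euclidean_space \<Rightarrow> 'a"
  assumes D: "\<And>y. (G has_derivative DG y) (at y)"
    and c0: "0 < c0" and low: "\<And>y h. c0 * norm h \<le> norm (DG y h)"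
    and lip: "\<And>y y' h. norm (DG y h - DG y' h) \<le> M * norm (y - y') * norm h"
    and M: "0 < M" and r: "M * r \<le> c0 / 2"
    and q: "norm (q - G y) \<le> c0 / 2 * r"
  obtains z where "G z = q" "norm (z - y) \<le> norm (q - G y) / (c0 / 2)"
proof -
  \<comment> \<open>The first Newton step has length at most s/2, so a contraction with factor 1/2
    maps the ball of radius s into itself.\<close>
  define s where "s = norm (q - G y) / (c0 / 2)"
  have s0: "0 \<le> s" using c0 by (simp add: s_def)
  have sr: "s \<le> r" using q c0 by (simp add: s_def field_simps)
  interpret L: bounded_linear "DG y" using D by (rule has_derivative_bounded_linear)
  have "inj (DG y)"
  proof (rule injI)
    fix u v assume "DG y u = DG y v"
    then have "DG y (u - v) = 0" by (simp add: L.diff)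
    then show "u = v" using low[of "u - v" y] c0 by (simp add: mult_le_0_iff)
  qed
  then obtain B where B: "linear B" "\<And>v. B (DG y v) = v" "\<And>v. DG y (B v) = v"
    using linear_injective_isomorphism[OF L.linear] by blast
  have nB: "norm (B v) \<le> norm v / c0" for v
    using low[of "B v" y] c0 by (simp add: B field_simps)
  let ?T = "\<lambda>z. z - B (G z - q)"
  have T: "norm (?T z1 - ?T z2) \<le> 1/2 * norm (z1 - z2)" if "z1 \<in> cball y s" "z2 \<in> cball y s" for z1 z2
  proof -
    have "?T z1 - ?T z2 = - B (G z1 - G z2 - DG y (z1 - z2))"
    proof -
      have "B (G z1 - G z2 - DG y (z1 - z2)) = B (G z1) - B (G z2) - (z1 - z2)"
        by (simp only: linear_diff[OF B(1)] B(2))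
      then show ?thesis by (simp add: linear_diff[OF B(1)] B(2))
    qed
    then have "norm (?T z1 - ?T z2) \<le> norm (G z1 - G z2 - DG y (z1 - z2)) / c0"
      using nB by simp
    also have "\<dots> \<le> (c0 / 2 * norm (z1 - z2)) / c0"
      using that sr c0 by (intro divide_right_mono local_lower_lipschitz[OF D c0 low lip M r]) (auto simp: dist_norm norm_minus_commute)
    finally show ?thesis using c0 by simp
  qed
  have Ty: "norm (?T y - y) \<le> s / 2"
  proof -
    have "norm (?T y - y) = norm (B (q - G y))"
      by (simp add: linear_diff[OF B(1)] norm_minus_commute)
    also have "\<dots> \<le> norm (q - G y) / c0" by (rule nB)
    finally show ?thesis using c0 by (simp add: s_def)
  qed
  have "\<exists>!z. z \<in> cball y s \<and> ?T z = z"
  proof (rule Banach_fix[where c="1/2"])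
    show "complete (cball y s)" by (rule compact_imp_complete) simp
    show "cball y s \<noteq> {}" using s0 by auto
    show "?T ` cball y s \<subseteq> cball y s"
    proof safe
      fix z assume z: "z \<in> cball y s"
      have "norm (?T z - y) \<le> norm (?T z - ?T y) + norm (?T y - y)"
        using norm_triangle_ineq[of "?T z - ?T y" "?T y - y"] by simp
      also have "\<dots> \<le> 1/2 * norm (z - y) + s / 2" using z s0 by (intro add_mono T Ty) auto
      also have "\<dots> \<le> s" using z by (simp add: dist_norm norm_minus_commute)
      finally show "?T z \<in> cball y s" by (simp add: dist_norm norm_minus_commute)
    qed
    show "dist (?T x) (?T z) \<le> 1/2 * dist x z" if "x \<in> cball y s" "z \<in> cball y s" for x z
      using T[OF that] by (simp add: dist_norm)
  qed (use s0 in auto)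
  then obtain z where z: "z \<in> cball y s" "?T z = z" by blast
  then have "B (G z - q) = 0" by simp
  then have "G z - q = DG y 0" using B(3)[of "G z - q"] by simp
  then have "G z = q" by (simp add: L.zero)
  moreover have "norm (z - y) \<le> s" using z by (simp add: dist_norm norm_minus_commute)
  ultimately show thesis using that unfolding s_def by blast
qed

text \<open>Hadamard's global inverse theorem in quantitative form. Injectivity: the image of a path between two points
  with the same value is contracted to that value in small steps, each of which is lifted by the local inverses.\<close>
theorem global_lower_lipschitz:
  fixes G :: "'a::euclidean_space \<Rightarrow> 'a"
  assumes D: "\<And>y. (G has_derivative DG y) (at y)"
    and c0: "0 < c0" and low: "\<And>y h. c0 * norm h \<le> norm (DG y h)"
    and lip: "\<And>y y' h. norm (DG y h - DG y' h) \<le> M * norm (y - y') * norm h"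
    and M: "0 < M"
  shows "c0 / 2 * norm (a - b) \<le> norm (G a - G b)"
proof -
  define r where "r = c0 / (2 * M)"
  have r: "M * r \<le> c0 / 2" "0 < r" using M c0 by (auto simp: r_def)
  define c1 where "c1 = c0 / 2"
  have c1: "0 < c1" using c0 by (simp add: c1_def)
  \<comment> \<open>A displacement of \<rho> in the image lifts to one of at most r/3. Two lifted
    displacements and one increment of the path of size r/3 then stay within the radius r of local
    injectivity.\<close>
  define \<rho> where "\<rho> = c1 * (r / 3)"
  have \<rho>: "0 < \<rho>" using c1 r by (simp add: \<rho>_def)
  have LL: "c1 * norm (y1 - y2) \<le> norm (G y1 - G y2)" if "norm (y1 - y2) \<le> r" for y1 y2
  proof -
    have "norm (G y1 - G y2 - DG y2 (y1 - y2)) \<le> c0 / 2 * norm (y1 - y2)"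
      using that r by (intro local_lower_lipschitz[OF D c0 low lip M r(1)]) auto
    moreover have "norm (DG y2 (y1 - y2)) \<le> norm (G y1 - G y2 - DG y2 (y1 - y2)) + norm (G y1 - G y2)"
      using norm_triangle_ineq4[of "G y1 - G y2" "G y1 - G y2 - DG y2 (y1 - y2)"] by simp
    ultimately show ?thesis using low[of "y1 - y2" y2] by (simp add: c1_def)
  qed
  have LS: "\<exists>z. G z = q \<and> norm (z - y) \<le> norm (q - G y) / c1" if "norm (q - G y) \<le> \<rho>" for q y
  proof -
    have "norm (q - G y) \<le> c0 / 2 * r" using that c1 r norm_ge_zero[of "q - G y"] unfolding \<rho>_def c1_def by linarith
    from local_surjective[OF D c0 low lip M r(1) this] show ?thesis unfolding c1_def by blast
  qed
  have contG: "continuous_on A G" for A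
    by (meson D continuous_at_imp_continuous_on has_derivative_continuous)
  have shrink: "\<gamma> 0 = \<gamma> 1" if "continuous_on {0..1} \<gamma>" "G (\<gamma> 0) = p" "G (\<gamma> 1) = p" "\<forall>s\<in>{0..1}. norm (G (\<gamma> s) - p) \<le> real n * \<rho>"
    for \<gamma> :: "real \<Rightarrow> 'a" and p n
    using that
  proof (induction n arbitrary: \<gamma>)
    case 0
    \<comment> \<open>A path with constant image is locally constant by local injectivity, so it has
      zero derivative and is constant.\<close>
    have "\<exists>k. \<forall>s\<in>{0..1}. \<gamma> s = k"
    proof (rule has_derivative_zero_constant)
      fix s :: real assume s: "s \<in> {0..1}"
      obtain d where d: "0 < d" "\<And>t. t \<in> {0..1} \<Longrightarrow> dist t s < d \<Longrightarrow> dist (\<gamma> t) (\<gamma> s) < r"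
        using 0(1) s r(2) unfolding continuous_on_iff by meson
      have "\<gamma> t = \<gamma> s" if t: "t \<in> {0..1}" "dist t s < d" for t
      proof -
        have "c1 * norm (\<gamma> t - \<gamma> s) \<le> norm (G (\<gamma> t) - G (\<gamma> s))"
          using d(2)[OF t] by (intro LL) (simp add: dist_norm)
        moreover have "G (\<gamma> t) = p" "G (\<gamma> s) = p" using 0(4) s t by auto
        ultimately show ?thesis using c1 by (simp add: mult_le_0_iff)
      qed
      then show "(\<gamma> has_derivative (\<lambda>h. 0)) (at s within {0..1})"
        by (intro has_derivative_transform_within[OF has_derivative_const[of "\<gamma> s"] d(1) s]) auto
    qed simp
    then show ?case by auto
  next
    case (Suc n)
    \<comment> \<open>Contracting the image path towards p by n/(n+1) moves each point by at most
      \<rho>, since the path lies within (n+1)\<rho> of p; the new path lies within n\<rho>.\<close>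
    define q where "q s = p + (real n / real (Suc n)) *\<^sub>R (G (\<gamma> s) - p)" for s
    have qG: "norm (q s - G (\<gamma> s)) \<le> \<rho>" if "s \<in> {0..1}" for s
    proof -
      define k where "k = real n / real (Suc n)"
      have "q s - G (\<gamma> s) = (k - 1) *\<^sub>R (G (\<gamma> s) - p)" unfolding q_def k_def[symmetric] by (simp add: algebra_simps)
      moreover have "\<bar>k - 1\<bar> = 1 / real (Suc n)" by (simp add: k_def field_simps)
      ultimately have "norm (q s - G (\<gamma> s)) = (1 / real (Suc n)) * norm (G (\<gamma> s) - p)" by (simp only: norm_scaleR)
      also have "\<dots> \<le> (1 / real (Suc n)) * (real (Suc n) * \<rho>)"
        using Suc.prems(4) that by (intro mult_left_mono) auto
      finally show ?thesis by simp
    qed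
    have "\<forall>s\<in>{0..1}. \<exists>z. G z = q s \<and> norm (z - \<gamma> s) \<le> norm (q s - G (\<gamma> s)) / c1"
      using LS qG by blast
    from bchoice[OF this] obtain \<gamma>' where g': "\<forall>s\<in>{0..1}. G (\<gamma>' s) = q s \<and> norm (\<gamma>' s - \<gamma> s) \<le> norm (q s - G (\<gamma> s)) / c1" ..
    have near: "norm (\<gamma>' s - \<gamma> s) \<le> r / 3" if "s \<in> {0..1}" for s
    proof -
      have "norm (\<gamma>' s - \<gamma> s) \<le> norm (q s - G (\<gamma> s)) / c1" using g' that by blast
      also have "\<dots> \<le> \<rho> / c1" using qG[OF that] c1 by (intro divide_right_mono) auto
      finally show ?thesis using c1 by (simp add: \<rho>_def)
    qed
    have cq: "continuous_on {0..1} q"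
      unfolding q_def by (intro continuous_intros continuous_on_compose2[OF contG Suc.prems(1)]) auto
    \<comment> \<open>The lifts are chosen pointwise, so continuity has to be recovered: lifts at
      nearby parameters lie within r of each other, and the local lower bound converts continuity of
      q into continuity of the lift.\<close>
    have cg': "continuous_on {0..1} \<gamma>'"
      unfolding continuous_on_iff
    proof (intro ballI allI impI)
      fix s \<epsilon> :: real assume s: "s \<in> {0..1}" and \<epsilon>: "0 < \<epsilon>"
      obtain d1 where d1: "0 < d1" "\<And>t. t \<in> {0..1} \<Longrightarrow> dist t s < d1 \<Longrightarrow> dist (\<gamma> t) (\<gamma> s) < r / 3"
      proof -
        have "0 < r / 3" using r(2) by simp
        from Suc.prems(1)[unfolded continuous_on_iff, rule_format, OF s this] show thesis using that by blast
      qed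
      obtain d2 where d2: "0 < d2" "\<And>t. t \<in> {0..1} \<Longrightarrow> dist t s < d2 \<Longrightarrow> dist (q t) (q s) < c1 * \<epsilon>"
      proof -
        have "0 < c1 * \<epsilon>" using c1 \<epsilon> by simp
        from cq[unfolded continuous_on_iff, rule_format, OF s this] show thesis using that by blast
      qed
      show "\<exists>d>0. \<forall>t\<in>{0..1}. dist t s < d \<longrightarrow> dist (\<gamma>' t) (\<gamma>' s) < \<epsilon>"
      proof (intro exI[of _ "min d1 d2"] conjI ballI impI)
        show "0 < min d1 d2" using d1 d2 by simp
        fix t :: real assume t: "t \<in> {0..1}" "dist t s < min d1 d2"
        have "norm (\<gamma>' t - \<gamma>' s) \<le> norm (\<gamma>' t - \<gamma> t) + norm (\<gamma> t - \<gamma> s) + norm (\<gamma>' s - \<gamma> s)"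
          using norm_triangle_ineq[of "\<gamma>' t - \<gamma> t" "\<gamma> t - \<gamma> s"] norm_triangle_ineq4[of "\<gamma>' t - \<gamma> s" "\<gamma>' s - \<gamma> s"] by simp
        also have "\<dots> \<le> r / 3 + r / 3 + r / 3"
          using near[OF s] near[OF t(1)] d1(2)[OF t(1)] t(2) by (intro add_mono) (auto simp: dist_norm)
        finally have "c1 * norm (\<gamma>' t - \<gamma>' s) \<le> norm (G (\<gamma>' t) - G (\<gamma>' s))" by (intro LL) simp
        also have "\<dots> = norm (q t - q s)" using g' s t by simp
        also have "\<dots> < c1 * \<epsilon>" using d2(2)[OF t(1)] t(2) by (simp add: dist_norm)
        finally show "dist (\<gamma>' t) (\<gamma>' s) < \<epsilon>" using c1 by (simp add: dist_norm)
      qed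
    qed
    \<comment> \<open>Where the image is already p the lift moves by distance 0; in particular the
      endpoints are kept.\<close>
    have e: "\<gamma>' s = \<gamma> s \<and> G (\<gamma>' s) = p" if "s \<in> {0..1}" "G (\<gamma> s) = p" for s
    proof -
      have "q s = p" using that by (simp add: q_def)
      then show ?thesis using g' that by fastforce
    qed
    have "\<gamma>' 0 = \<gamma>' 1"
    proof (rule Suc.IH[OF cg'])
      show "G (\<gamma>' 0) = p" "G (\<gamma>' 1) = p" using e Suc.prems by auto
      show "\<forall>s\<in>{0..1}. norm (G (\<gamma>' s) - p) \<le> real n * \<rho>"
      proof
        fix s :: real assume s: "s \<in> {0..1}"
        have "norm (G (\<gamma>' s) - p) = (real n / real (Suc n)) * norm (G (\<gamma> s) - p)"
          using g' s by (simp add: q_def)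
        also have "\<dots> \<le> (real n / real (Suc n)) * (real (Suc n) * \<rho>)"
          using Suc.prems(4) s by (intro mult_left_mono) auto
        finally show "norm (G (\<gamma>' s) - p) \<le> real n * \<rho>" by simp
      qed
    qed
    then show ?case using e Suc.prems by auto
  qed
  have inj: "u = v" if uv: "G u = G v" for u v
  proof -
    let ?\<gamma> = "\<lambda>s::real. u + s *\<^sub>R (v - u)"
    have c: "continuous_on {0..1} ?\<gamma>" by (intro continuous_intros)
    have "continuous_on {0..1} (\<lambda>s. norm (G (?\<gamma> s) - G u))"
      by (intro continuous_intros continuous_on_compose2[OF contG c]) auto
    from compact_continuous_image[OF this] have "bounded ((\<lambda>s. norm (G (?\<gamma> s) - G u)) ` {0..1})"
      by (intro compact_imp_bounded) auto
    then obtain B where B: "\<forall>s\<in>{0..1}. norm (G (?\<gamma> s) - G u) \<le> B" by (auto simp: bounded_iff)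
    obtain n :: nat where "B / \<rho> \<le> real n" using real_arch_simple by blast
    then have n: "B \<le> real n * \<rho>" using \<rho> by (simp add: field_simps)
    have "?\<gamma> 0 = ?\<gamma> 1"
      by (rule shrink[OF c, of "G u" n]) (use uv B n in \<open>auto intro: order_trans\<close>)
    then show ?thesis by simp
  qed
  \<comment> \<open>For the Lipschitz bound the image segment from G b to G a is walked in N equal
    steps of length at most \<rho>, each lifted from the last endpoint. The lengths add up to |G a -
    G b| / c1, and global injectivity identifies the final point with a.\<close>
  obtain N :: nat where N: "norm (G a - G b) / \<rho> \<le> real N" "0 < N"
  proof -
    obtain N :: nat where "norm (G a - G b) / \<rho> \<le> real N" using real_arch_simple by blast
    then have "norm (G a - G b) / \<rho> \<le> real (Suc N)" by simp
    then show thesis using that by blast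
  qed
  define q where "q i = G b + (real i / real N) *\<^sub>R (G a - G b)" for i :: nat
  have "\<exists>z. G z = q i \<and> norm (z - b) \<le> (real i / real N) * (norm (G a - G b) / c1)" for i
  proof (induction i)
    case 0 then show ?case by (intro exI[of _ b]) (simp add: q_def)
  next
    case (Suc i)
    then obtain z where z: "G z = q i" "norm (z - b) \<le> (real i / real N) * (norm (G a - G b) / c1)" by blast
    have d: "q (Suc i) - G z = (1 / real N) *\<^sub>R (G a - G b)"
      unfolding z q_def by (simp add: algebra_simps add_divide_distrib)
    have nd: "norm (q (Suc i) - G z) = norm (G a - G b) / real N" unfolding d by simp
    have "norm (q (Suc i) - G z) \<le> \<rho>" unfolding nd using N \<rho> by (simp add: field_simps)
    from LS[OF this] obtain z' where z': "G z' = q (Suc i)" "norm (z' - z) \<le> norm (q (Suc i) - G z) / c1" by blast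
    have "norm (z' - b) \<le> norm (z' - z) + norm (z - b)" using norm_triangle_ineq[of "z' - z" "z - b"] by simp
    also have "\<dots> \<le> norm (G a - G b) / real N / c1 + (real i / real N) * (norm (G a - G b) / c1)"
      using z z' unfolding nd by (intro add_mono) auto
    also have "\<dots> = (real (Suc i) / real N) * (norm (G a - G b) / c1)" by (simp add: add_divide_distrib algebra_simps)
    finally show ?case using z' by blast
  qed
  from this[of N] obtain z where z: "G z = q N" "norm (z - b) \<le> (real N / real N) * (norm (G a - G b) / c1)" by blast
  have "q N = G a" using N by (simp add: q_def)
  then have "z = a" using inj z by simp
  then have "norm (a - b) \<le> norm (G a - G b) / c1" using z N by simp
  then show ?thesis using c1 by (simp add: c1_def field_simps)
qed

text \<open>A lower Lipschitz map moves away from v at least linearly once measured from a point t0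
  of nearly minimal distance, so the integrand is dominated by a translate of the weight. The
  constant depends only on c and r, hence is uniform in G and v.\<close>

lemma wt_lower_lipschitz_integral:
  fixes c r :: real
  assumes c: "0 < c" and r: "real DIM('a::euclidean_space) < r"
  obtains C where "C < (\<infinity>::ennreal)"
    "\<And>(G::'a \<Rightarrow> 'a) v. G \<in> borel_measurable borel \<Longrightarrow> (\<And>s t. c * norm (s - t) \<le> norm (G s - G t)) \<Longrightarrow> (\<integral>\<^sup>+t. ennreal (wt (v - G t) powr (- r)) \<partial>lborel) \<le> C"
proof -
  \<comment> \<open>The minimum with 1 serves the constant term of the weight; the factor 1/2 pays
    for comparing v with the nearly minimising value G t0.\<close>
  define k where "k = min 1 c / 2"
  have k: "0 < k" using c by (simp add: k_def)
  let ?C = "ennreal (k powr (- r)) * (\<integral>\<^sup>+t. ennreal (wt (t::'a) powr (- r)) \<partial>lborel)"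
  have "(\<integral>\<^sup>+t. ennreal (wt (v - G t) powr (- r)) \<partial>lborel) \<le> ?C"
    if [measurable]: "G \<in> borel_measurable borel" and low: "\<And>s t. c * norm (s - t) \<le> norm (G s - G t)" for G :: "'a \<Rightarrow> 'a" and v
  proof -
    define m where "m = (INF t. norm (v - G t))"
    have bdd: "bdd_below (range (\<lambda>t. norm (v - G t)))" by (rule bdd_belowI[of _ 0]) auto
    have mle: "m \<le> norm (v - G t)" for t unfolding m_def by (rule cINF_lower[OF bdd]) simp
    \<comment> \<open>An approximate minimiser is enough, whether or not v is in the range; the
      slack 1 is absorbed by the constant term of the weight.\<close>
    have "\<exists>t. norm (v - G t) < m + 1"
      using cINF_less_iff[OF _ bdd, of "m + 1"] unfolding m_def by auto
    then obtain t0 where t0: "norm (v - G t0) < m + 1" ..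
    have kw: "k * wt (t - t0) \<le> wt (v - G t)" for t
    proof -
      have "c * norm (t - t0) \<le> norm (G t - G t0)" by (rule low)
      also have "\<dots> \<le> norm (v - G t) + norm (v - G t0)"
        using norm_triangle_ineq4[of "v - G t0" "v - G t"] by simp
      also have "\<dots> \<le> 2 * norm (v - G t) + 1" using t0 mle[of t] by simp
      finally have 1: "c * norm (t - t0) \<le> 2 * norm (v - G t) + 1" .
      have "2 * (k * wt (t - t0)) = min 1 c + min 1 c * norm (t - t0)" by (simp add: k_def wt_def algebra_simps)
      also have "\<dots> \<le> 1 + c * norm (t - t0)" by (intro add_mono mult_right_mono) auto
      also have "\<dots> \<le> 2 * wt (v - G t)" using 1 by (simp add: wt_def)
      finally show ?thesis by simp
    qed
    have "(\<integral>\<^sup>+t. ennreal (wt (v - G t) powr (- r)) \<partial>lborel) \<le> (\<integral>\<^sup>+t. ennreal (k powr (- r)) * ennreal (wt (t - t0) powr (- r)) \<partial>lborel)"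
    proof (rule nn_integral_mono)
      fix t
      have "wt (v - G t) powr (- r) \<le> (k * wt (t - t0)) powr (- r)"
        using kw[of t] k r by (intro powr_mono2') (auto intro!: mult_pos_pos)
      also have "\<dots> = k powr (- r) * wt (t - t0) powr (- r)" using k by (simp add: powr_mult)
      finally show "ennreal (wt (v - G t) powr (- r)) \<le> ennreal (k powr (- r)) * ennreal (wt (t - t0) powr (- r))"
        by (simp add: ennreal_mult[symmetric] ennreal_leI)
    qed
    also have "\<dots> = ?C"
      using nn_integral_translate_diff[of "\<lambda>t. ennreal (wt t powr (- r))" t0] by (simp add: nn_integral_cmult)
    finally show ?thesis .
  qed
  moreover have "?C < \<infinity>" using wt_powr_neg_nn_integral[OF r] by (simp add: ennreal_mult_less_top)
  ultimately show thesis by (rule that[rotated])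
qed

section \<open>Derivatives of scalar functions and symmetry of second derivatives\<close>

lemma lipschitz_from_partials:
  fixes f :: "'a::euclidean_space \<Rightarrow> real"
  assumes d: "\<And>z. f differentiable (at z)" and K: "\<And>b z. b \<in> Basis \<Longrightarrow> \<bar>Dv b f z\<bar> \<le> K"
  shows "\<bar>f z - f z'\<bar> \<le> real DIM('a) * K * norm (z - z')"
proof -
  have "norm (f z - f z') \<le> real DIM('a) * K * norm (z - z')"
  proof (rule differentiable_bound[of UNIV f "\<lambda>z. frechet_derivative f (at z)"])
    show "(f has_derivative frechet_derivative f (at x)) (at x within UNIV)" for x
      using d by (simp add: has_derivative_frechet)
    have K0: "0 \<le> K" using K[OF SOME_Basis, of z] abs_ge_zero order_trans by blast
    show "onorm (frechet_derivative f (at x)) \<le> real DIM('a) * K" for x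
    proof (rule onorm_bound)
      show "0 \<le> real DIM('a) * K" using K0 by simp
      fix h :: 'a
      have lin: "linear (frechet_derivative f (at x))" by (rule linear_frechet_derivative[OF d])
      have "frechet_derivative f (at x) h = frechet_derivative f (at x) (\<Sum>b\<in>Basis. (h \<bullet> b) *\<^sub>R b)"
        by (simp add: euclidean_representation)
      also have "\<dots> = (\<Sum>b\<in>Basis. (h \<bullet> b) * Dv b f x)"
        by (simp add: linear_sum[OF lin] linear_cmul[OF lin])
      also have "\<bar>\<dots>\<bar> \<le> (\<Sum>b\<in>Basis. \<bar>(h \<bullet> b) * Dv b f x\<bar>)" by (rule sum_abs)
      also have "\<dots> \<le> (\<Sum>b\<in>(Basis::'a set). norm h * K)"
        using Basis_le_norm[of _ h] by (intro sum_mono) (auto simp: abs_mult intro!: mult_mono K)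
      finally show "norm (frechet_derivative f (at x) h) \<le> real DIM('a) * K * norm h" by (simp add: mult_ac)
    qed
  qed auto
  then show ?thesis by simp
qed

lemma Dv_line:
  fixes f :: "'a::euclidean_space \<Rightarrow> real"
  assumes d: "\<And>z. f differentiable (at z)"
  shows "((\<lambda>s. f (z + s *\<^sub>R b)) has_real_derivative Dv b f (z + s *\<^sub>R b)) (at s)"
proof -
  have "((\<lambda>s. z + s *\<^sub>R b) has_derivative (\<lambda>h. h *\<^sub>R b)) (at s)" by (auto intro!: derivative_eq_intros)
  from diff_chain_at[OF this has_derivative_frechet[OF d]]
  have "((\<lambda>s. f (z + s *\<^sub>R b)) has_derivative (\<lambda>h. h * Dv b f (z + s *\<^sub>R b))) (at s)"
    by (simp add: o_def linear_cmul[OF linear_frechet_derivative[OF d]])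
  then show ?thesis by (simp add: has_field_derivative_def mult_commute_abs)
qed

lemma second_difference:
  fixes f :: "'a::euclidean_space \<Rightarrow> real"
  assumes d: "\<And>z. f differentiable (at z)" and d2: "\<And>z. Dv b f differentiable (at z)" and h: "0 < h"
  obtains s t where "0 < s" "s < h" "0 < t" "t < h"
    "f (x + h *\<^sub>R b + h *\<^sub>R b') - f (x + h *\<^sub>R b) - f (x + h *\<^sub>R b') + f x = h\<^sup>2 * Dv b' (Dv b f) (x + s *\<^sub>R b + t *\<^sub>R b')"
proof -
  let ?u = "\<lambda>s. f ((x + h *\<^sub>R b') + s *\<^sub>R b) - f (x + s *\<^sub>R b)"
  have "\<exists>s. 0 < s \<and> s < h \<and> ?u h - ?u 0 = (h - 0) * (Dv b f ((x + h *\<^sub>R b') + s *\<^sub>R b) - Dv b f (x + s *\<^sub>R b))"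
    using h by (intro MVT2 derivative_intros Dv_line d) auto
  then obtain s where s: "0 < s" "s < h" "?u h - ?u 0 = h * (Dv b f ((x + h *\<^sub>R b') + s *\<^sub>R b) - Dv b f (x + s *\<^sub>R b))" by auto
  have "\<exists>t. 0 < t \<and> t < h \<and> Dv b f ((x + s *\<^sub>R b) + h *\<^sub>R b') - Dv b f ((x + s *\<^sub>R b) + 0 *\<^sub>R b') = (h - 0) * Dv b' (Dv b f) ((x + s *\<^sub>R b) + t *\<^sub>R b')"
    using h by (intro MVT2 Dv_line d2) auto
  then obtain t where t: "0 < t" "t < h" "Dv b f ((x + s *\<^sub>R b) + h *\<^sub>R b') - Dv b f (x + s *\<^sub>R b) = h * Dv b' (Dv b f) ((x + s *\<^sub>R b) + t *\<^sub>R b')" by auto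
  have "(x + h *\<^sub>R b') + s *\<^sub>R b = (x + s *\<^sub>R b) + h *\<^sub>R b'" by (simp add: algebra_simps)
  with s(3) t(3) have "?u h - ?u 0 = h\<^sup>2 * Dv b' (Dv b f) (x + s *\<^sub>R b + t *\<^sub>R b')" by (simp add: power2_eq_square)
  then show thesis using s t by (intro that[of s t]) (auto simp: algebra_simps)
qed

text \<open>The second difference of f over a small parallelogram is symmetric in b and b', and by
  two mean value theorems it equals h^2 times either mixed derivative at a nearby point. The
  symmetry reconciles the order of differentiation in \<open>mixed_hessian\<close> with that of the
  Jacobian of the x-gradient.\<close>

lemma Dv_commute:
  fixes f :: "'a::euclidean_space \<Rightarrow> real"
  assumes d: "\<And>z. f differentiable (at z)" and db: "\<And>z. Dv b f differentiable (at z)" and db': "\<And>z. Dv b' f differentiable (at z)"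
    and c: "continuous_on UNIV (Dv b' (Dv b f))" and c': "continuous_on UNIV (Dv b (Dv b' f))"
  shows "Dv b' (Dv b f) x = Dv b (Dv b' f) x"
proof -
  have "\<exists>z z'. norm (z - x) \<le> h * (norm b + norm b') \<and> norm (z' - x) \<le> h * (norm b + norm b') \<and> Dv b' (Dv b f) z = Dv b (Dv b' f) z'"
    if h: "0 < h" for h :: real
  proof -
    obtain s t where st: "0 < s" "s < h" "0 < t" "t < h"
      "f (x + h *\<^sub>R b + h *\<^sub>R b') - f (x + h *\<^sub>R b) - f (x + h *\<^sub>R b') + f x = h\<^sup>2 * Dv b' (Dv b f) (x + s *\<^sub>R b + t *\<^sub>R b')"
      using second_difference[OF d db h] by metis
    obtain s' t' where st': "0 < s'" "s' < h" "0 < t'" "t' < h"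
      "f (x + h *\<^sub>R b' + h *\<^sub>R b) - f (x + h *\<^sub>R b') - f (x + h *\<^sub>R b) + f x = h\<^sup>2 * Dv b (Dv b' f) (x + s' *\<^sub>R b' + t' *\<^sub>R b)"
      using second_difference[OF d db' h] by metis
    have n: "norm (u *\<^sub>R v + w *\<^sub>R y) \<le> h * (norm v + norm y)" if "0 < u" "u < h" "0 < w" "w < h" for u w and v y :: 'a
    proof -
      have "norm (u *\<^sub>R v + w *\<^sub>R y) \<le> u * norm v + w * norm y"
        using norm_triangle_ineq[of "u *\<^sub>R v" "w *\<^sub>R y"] that by simp
      also have "\<dots> \<le> h * norm v + h * norm y" using that by (intro add_mono mult_right_mono) auto
      finally show ?thesis by (simp add: algebra_simps)
    qed
    have "h\<^sup>2 * Dv b' (Dv b f) (x + s *\<^sub>R b + t *\<^sub>R b') = h\<^sup>2 * Dv b (Dv b' f) (x + s' *\<^sub>R b' + t' *\<^sub>R b)"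
      using st(5) st'(5) by (simp add: algebra_simps)
    then have "Dv b' (Dv b f) (x + s *\<^sub>R b + t *\<^sub>R b') = Dv b (Dv b' f) (x + s' *\<^sub>R b' + t' *\<^sub>R b)" using h by simp
    moreover have "norm (x + s *\<^sub>R b + t *\<^sub>R b' - x) \<le> h * (norm b + norm b')" using n[OF st(1-4), of b b'] by (simp add: add.assoc)
    moreover have "norm (x + s' *\<^sub>R b' + t' *\<^sub>R b - x) \<le> h * (norm b + norm b')" using n[OF st'(1-4), of b' b] by (simp add: add.assoc add.commute)
    ultimately show ?thesis by blast
  qed
  then have "\<forall>n::nat. \<exists>z z'. norm (z - x) \<le> (1 / real (Suc n)) * (norm b + norm b') \<and> norm (z' - x) \<le> (1 / real (Suc n)) * (norm b + norm b') \<and> Dv b' (Dv b f) z = Dv b (Dv b' f) z'"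
    by (metis zero_less_divide_1_iff of_nat_0_less_iff zero_less_Suc)
  then obtain z z' where z: "\<And>n. norm (z n - x) \<le> (1 / real (Suc n)) * (norm b + norm b')"
    "\<And>n. norm (z' n - x) \<le> (1 / real (Suc n)) * (norm b + norm b')" "\<And>n. Dv b' (Dv b f) (z n) = Dv b (Dv b' f) (z' n)"
    by metis
  have l0: "(\<lambda>n. (1 / real (Suc n)) * (norm b + norm b')) \<longlonglongrightarrow> 0"
    using tendsto_mult_right[OF lim_1_over_Suc, of "norm b + norm b'"] by simp
  have lim: "y \<longlonglongrightarrow> x" if "\<And>n. norm (y n - x) \<le> (1 / real (Suc n)) * (norm b + norm b')" for y
  proof -
    have "(\<lambda>n. y n - x) \<longlonglongrightarrow> 0"
      by (rule Lim_null_comparison[OF _ l0]) (use that in auto)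
    then show ?thesis by (simp add: LIM_zero_iff)
  qed
  have "(\<lambda>n. Dv b' (Dv b f) (z n)) \<longlonglongrightarrow> Dv b' (Dv b f) x"
    using c lim[OF z(1)] continuous_on_tendsto_compose[of UNIV "Dv b' (Dv b f)" z x] by auto
  moreover have "(\<lambda>n. Dv b (Dv b' f) (z' n)) \<longlonglongrightarrow> Dv b (Dv b' f) x"
    using c' lim[OF z(2)] continuous_on_tendsto_compose[of UNIV "Dv b (Dv b' f)" z' x] by auto
  ultimately show ?thesis unfolding z(3) using LIMSEQ_unique by blast
qed

section \<open>Quantitative invertibility of the Jacobians of partial gradients\<close>

lemma det_bound:
  fixes A :: "real^'n^'n"
  assumes K: "\<And>i j. \<bar>A $ i $ j\<bar> \<le> K"
  shows "\<bar>det A\<bar> \<le> fact CARD('n) * K ^ CARD('n)"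
proof -
  have "\<bar>det A\<bar> \<le> (\<Sum>p\<in>{p. p permutes (UNIV :: 'n set)}. \<bar>of_int (sign p) * (\<Prod>i\<in>UNIV. A $ i $ p i)\<bar>)"
    unfolding det_def by (rule sum_abs)
  also have "\<dots> \<le> (\<Sum>p\<in>{p. p permutes (UNIV :: 'n set)}. K ^ CARD('n))"
  proof (rule sum_mono)
    fix p
    have "\<bar>of_int (sign p) * (\<Prod>i\<in>UNIV. A $ i $ p i)\<bar> = (\<Prod>i\<in>(UNIV::'n set). \<bar>A $ i $ p i\<bar>)"
      by (simp add: abs_mult abs_prod sign_def)
    also have "\<dots> \<le> (\<Prod>i\<in>(UNIV::'n set). K)" by (intro prod_mono) (auto intro: K)
    finally show "\<bar>of_int (sign p) * (\<Prod>i\<in>UNIV. A $ i $ p i)\<bar> \<le> K ^ CARD('n)" by simp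
  qed
  also have "\<dots> = fact CARD('n) * K ^ CARD('n)" by (simp add: card_permutations)
  finally show ?thesis .
qed

text \<open>Cramer's rule for the equation A h = u. Normalising u to length 1 keeps the replaced
  column below K, since K is at least 1, so that \<open>det_bound\<close> applies to the
  numerator.\<close>

lemma matrix_lower_bound:
  fixes A :: "real^'n^'n"
  assumes K: "\<And>i j. \<bar>A $ i $ j\<bar> \<le> K" "1 \<le> K" and \<delta>: "0 < \<delta>" "\<delta> \<le> \<bar>det A\<bar>"
  shows "\<delta> / (real CARD('n) * (fact CARD('n) * K ^ CARD('n))) * norm h \<le> norm (A *v h)"
proof -
  let ?B = "fact CARD('n) * K ^ CARD('n)"
  have B0: "0 < ?B" using K by (intro mult_pos_pos zero_less_power) auto
  have n0: "0 < real CARD('n)" by simp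
  define u where "u = A *v h"
  show ?thesis
  proof (cases "u = 0")
    case True
    have "invertible A" using \<delta> by (auto simp: invertible_det_nz)
    then have "h = 0" using True unfolding u_def
      by (metis invertible_def matrix_vector_mul_assoc matrix_vector_mul_lid matrix_vector_mult_0_right)
    then show ?thesis by simp
  next
    case False
    then have nu: "0 < norm u" by simp
    have comp: "\<bar>h $ k\<bar> \<le> norm u * ?B / \<delta>" for k
    proof -
      have "A *v (h /\<^sub>R norm u) = u /\<^sub>R norm u" by (simp add: u_def matrix_vector_mult_scaleR)
      then have "(h /\<^sub>R norm u) $ k * det A = det (\<chi> i j. if j = k then (u /\<^sub>R norm u) $ i else A $ i $ j)"
        by (metis (no_types) cramer_lemma[where A=A and x="h /\<^sub>R norm u" and k=k])
      moreover have "\<bar>det (\<chi> i j. if j = k then (u /\<^sub>R norm u) $ i else A $ i $ j)\<bar> \<le> ?B"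
      proof (rule det_bound)
        fix i j
        have "\<bar>(u /\<^sub>R norm u) $ i\<bar> \<le> 1" using component_le_norm_cart[of "u /\<^sub>R norm u" i] nu by simp
        then show "\<bar>(\<chi> i j. if j = k then (u /\<^sub>R norm u) $ i else A $ i $ j) $ i $ j\<bar> \<le> K"
          using K by (auto intro: order_trans)
      qed
      ultimately have "\<bar>(h /\<^sub>R norm u) $ k\<bar> * \<bar>det A\<bar> \<le> ?B" by (simp add: abs_mult[symmetric])
      then have "\<bar>(h /\<^sub>R norm u) $ k\<bar> * \<delta> \<le> ?B" using \<delta> by (smt (verit) abs_ge_zero mult_left_mono)
      then have "\<bar>h $ k\<bar> / norm u * \<delta> \<le> ?B" by (simp add: abs_mult divide_inverse mult_ac)
      then show ?thesis using nu \<delta> by (simp add: field_simps)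
    qed
    have "norm h \<le> (\<Sum>k\<in>UNIV. \<bar>h $ k\<bar>)" by (rule norm_le_l1_cart)
    also have "\<dots> \<le> (\<Sum>k\<in>(UNIV::'n set). norm u * ?B / \<delta>)" by (intro sum_mono comp)
    also have "\<dots> = real CARD('n) * (norm u * ?B / \<delta>)" by simp
    finally have "norm h \<le> real CARD('n) * (norm u * ?B / \<delta>)" .
    then have "\<delta> * norm h \<le> norm u * (real CARD('n) * ?B)" using \<delta> by (simp add: field_simps)
    then have "(\<delta> * norm h) / (real CARD('n) * ?B) \<le> norm u"
      using B0 n0 by (subst pos_divide_le_eq) (auto intro!: mult_pos_pos)
    then show ?thesis unfolding u_def by simp
  qed
qed

lemma partials_uniform_bound:
  fixes \<Phi> :: "'a::euclidean_space \<Rightarrow> real"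
  assumes "\<forall>vs. set vs \<subseteq> Basis \<and> 2 \<le> length vs \<longrightarrow> bounded (range (partials vs \<Phi>))"
  obtains K where "1 \<le> K" "\<And>vs z. set vs \<subseteq> Basis \<Longrightarrow> 2 \<le> length vs \<Longrightarrow> length vs \<le> m \<Longrightarrow> \<bar>partials vs \<Phi> z\<bar> \<le> K"
proof -
  let ?L = "{vs. set vs \<subseteq> (Basis::'a set) \<and> length vs \<le> m} \<inter> {vs. 2 \<le> length vs}"
  have fin: "finite ?L" by (intro finite_Int disjI1 finite_lists_length_le) simp
  have "\<forall>vs\<in>?L. \<exists>K. \<forall>z. \<bar>partials vs \<Phi> z\<bar> \<le> K"
  proof
    fix vs assume "vs \<in> ?L"
    then have "bounded (range (partials vs \<Phi>))" using assms by blast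
    then show "\<exists>K. \<forall>z. \<bar>partials vs \<Phi> z\<bar> \<le> K" by (auto simp: bounded_iff)
  qed
  from bchoice[OF this] obtain K where K: "\<forall>vs\<in>?L. \<forall>z. \<bar>partials vs \<Phi> z\<bar> \<le> K vs" ..
  define K' where "K' = 1 + (\<Sum>vs\<in>?L. \<bar>K vs\<bar>)"
  have "\<bar>partials vs \<Phi> z\<bar> \<le> K'" if "vs \<in> ?L" for vs z
  proof -
    have "\<bar>partials vs \<Phi> z\<bar> \<le> K vs" using K that by blast
    also have "\<dots> \<le> \<bar>K vs\<bar>" by simp
    also have "\<dots> \<le> (\<Sum>vs\<in>?L. \<bar>K vs\<bar>)" by (rule member_le_sum[OF that _ fin]) simp
    finally show ?thesis by (simp add: K'_def)
  qed
  moreover have "1 \<le> K'" unfolding K'_def by (simp add: sum_nonneg)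
  ultimately show thesis by (intro that[of K']) auto
qed

lemma gradient_lower_lipschitz:
  fixes \<Phi> :: "(real^'n) \<times> (real^'n) \<Rightarrow> real" and J :: "real^'n \<Rightarrow> (real^'n) \<times> (real^'n)" and e :: "'n \<Rightarrow> (real^'n) \<times> (real^'n)"
  assumes sm: "smooth \<Phi>"
    and bd: "\<forall>vs. set vs \<subseteq> Basis \<and> 2 \<le> length vs \<longrightarrow> bounded (range (partials vs \<Phi>))"
    and J: "bounded_linear J" "\<And>h. norm (J h) = norm h" "\<And>j. J (axis j 1) \<in> Basis"
    and e: "\<And>i. e i \<in> Basis"
    and \<delta>: "0 < \<delta>" "\<And>z. \<delta> \<le> \<bar>det (\<chi> i j. Dv (J (axis j 1)) (Dv (e i) \<Phi>) z)\<bar>"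
  obtains c where "0 < c" "\<And>z s t. c * norm (s - t) \<le> norm ((\<chi> i. Dv (e i) \<Phi> (z + J s)) - (\<chi> i. Dv (e i) \<Phi> (z + J t)))"
proof -
  \<comment> \<open>Second derivatives bound the entries of the Jacobian, third derivatives their
    Lipschitz constants.\<close>
  obtain K where K: "1 \<le> K" "\<And>vs z. set vs \<subseteq> Basis \<Longrightarrow> 2 \<le> length vs \<Longrightarrow> length vs \<le> 3 \<Longrightarrow> \<bar>partials vs \<Phi> z\<bar> \<le> K"
    using partials_uniform_bound[OF bd] by metis
  have sd: "partials vs \<Phi> differentiable (at z)" if "set vs \<subseteq> Basis" for vs z
    using sm that unfolding smooth_def by blast
  define a where "a i j = Dv (J (axis j 1)) (Dv (e i) \<Phi>)" for i j
  have a: "a i j = partials [J (axis j 1), e i] \<Phi>" for i j by (simp add: a_def)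
  have aK: "\<bar>a i j z\<bar> \<le> K" for i j z unfolding a by (rule K(2)) (use J e in auto)
  define D where "D = real DIM((real^'n) \<times> (real^'n))"
  have aL: "\<bar>a i j z - a i j z'\<bar> \<le> D * K * norm (z - z')" for i j z z'
    unfolding D_def
  proof (rule lipschitz_from_partials)
    show "a i j differentiable (at z)" for z unfolding a by (rule sd) (use J e in auto)
    fix b z assume b: "b \<in> (Basis :: ((real^'n) \<times> (real^'n)) set)"
    have "\<bar>partials [b, J (axis j 1), e i] \<Phi> z\<bar> \<le> K" by (rule K(2)) (use J e b in auto)
    then show "\<bar>Dv b (a i j) z\<bar> \<le> K" by (simp add: a_def)
  qed
  define A where "A z = (\<chi> i j. a i j z)" for z
  let ?n = "real CARD('n)"
  define c0 where "c0 = \<delta> / (?n * (fact CARD('n) * K ^ CARD('n)))"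
  have c0: "0 < c0" unfolding c0_def using \<delta>(1) K(1) by (intro divide_pos_pos mult_pos_pos zero_less_power) auto
  have low: "c0 * norm h \<le> norm (A z *v h)" for z h
    unfolding c0_def by (rule matrix_lower_bound) (use aK K \<delta> in \<open>auto simp: A_def a_def\<close>)
  define M where "M = ?n * (?n * (D * K)) + 1"
  have M: "0 < M" unfolding M_def D_def using K(1) by (intro add_nonneg_pos mult_nonneg_nonneg) auto
  have lip: "norm (A z *v h - A z' *v h) \<le> M * norm (z - z') * norm h" for z z' h
  proof -
    let ?L = "D * K * norm (z - z')"
    have L0: "0 \<le> ?L" using K(1) by (simp add: D_def)
    have "norm (A z *v h - A z' *v h) \<le> (\<Sum>i\<in>UNIV. \<bar>(A z *v h - A z' *v h) $ i\<bar>)" by (rule norm_le_l1_cart)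
    also have "\<dots> \<le> (\<Sum>i\<in>(UNIV::'n set). ?n * (?L * norm h))"
    proof (rule sum_mono)
      fix i
      have "(A z *v h - A z' *v h) $ i = (\<Sum>j\<in>UNIV. (a i j z - a i j z') * h $ j)"
        by (simp add: A_def matrix_vector_mult_def sum_subtractf algebra_simps)
      also have "\<bar>\<dots>\<bar> \<le> (\<Sum>j\<in>UNIV. \<bar>(a i j z - a i j z') * h $ j\<bar>)" by (rule sum_abs)
      also have "\<dots> \<le> (\<Sum>j\<in>(UNIV::'n set). ?L * norm h)"
        using L0 by (intro sum_mono) (auto simp: abs_mult intro!: mult_mono aL component_le_norm_cart)
      finally show "\<bar>(A z *v h - A z' *v h) $ i\<bar> \<le> ?n * (?L * norm h)" by simp
    qed
    also have "\<dots> = ?n * (?n * (D * K)) * norm (z - z') * norm h" by (simp add: mult_ac)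
    also have "\<dots> \<le> M * norm (z - z') * norm h" unfolding M_def by (intro mult_right_mono) auto
    finally show ?thesis .
  qed
  have der: "((\<lambda>t. \<chi> i. Dv (e i) \<Phi> (z + J t)) has_derivative (\<lambda>h. A (z + J t) *v h)) (at t)" for z t
  proof (subst has_derivative_componentwise_within, intro ballI)
    fix b :: "real^'n" assume "b \<in> Basis"
    then obtain i where b: "b = axis i 1" by (auto simp: Basis_vec_def)
    have df: "Dv (e i) \<Phi> differentiable (at w)" for w using sd[of "[e i]" w] e by simp
    have "((\<lambda>t. z + J t) has_derivative J) (at t)"
      using has_derivative_add[OF has_derivative_const[of z] bounded_linear_imp_has_derivative[OF J(1)]] by simp
    from diff_chain_at[OF this has_derivative_frechet[OF df]]
    have "((\<lambda>t. Dv (e i) \<Phi> (z + J t)) has_derivative (\<lambda>h. frechet_derivative (Dv (e i) \<Phi>) (at (z + J t)) (J h))) (at t)"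
      by (simp add: o_def)
    moreover have "frechet_derivative (Dv (e i) \<Phi>) (at (z + J t)) (J h) = (A (z + J t) *v h) $ i" for h
    proof -
      have lin: "linear (\<lambda>h. frechet_derivative (Dv (e i) \<Phi>) (at (z + J t)) (J h))"
        using linear_compose[OF bounded_linear.linear[OF J(1)] linear_frechet_derivative[OF df]] by (simp add: o_def)
      have "h = (\<Sum>j\<in>UNIV. h $ j *\<^sub>R axis j 1)" using basis_expansion[of h] by (simp add: scalar_mult_eq_scaleR)
      then have "frechet_derivative (Dv (e i) \<Phi>) (at (z + J t)) (J h) = frechet_derivative (Dv (e i) \<Phi>) (at (z + J t)) (J (\<Sum>j\<in>UNIV. h $ j *\<^sub>R axis j 1))" by simp
      also have "\<dots> = (\<Sum>j\<in>UNIV. h $ j * a i j (z + J t))"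
        by (simp add: linear_sum[OF lin] linear_cmul[OF lin] a_def)
      finally show ?thesis by (simp add: A_def matrix_vector_mult_def mult.commute)
    qed
    ultimately show "((\<lambda>t. (\<chi> i. Dv (e i) \<Phi> (z + J t)) \<bullet> b) has_derivative (\<lambda>h. (A (z + J t) *v h) \<bullet> b)) (at t)"
      by (simp add: b inner_axis)
  qed
  have "c0 / 2 * norm (s - t) \<le> norm ((\<chi> i. Dv (e i) \<Phi> (z + J s)) - (\<chi> i. Dv (e i) \<Phi> (z + J t)))" for z s t
  proof (rule global_lower_lipschitz[where DG="\<lambda>t h. A (z + J t) *v h" and M=M])
    fix y y' h :: "real^'n"
    have "norm (A (z + J y) *v h - A (z + J y') *v h) \<le> M * norm ((z + J y) - (z + J y')) * norm h" by (rule lip)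
    also have "norm ((z + J y) - (z + J y')) = norm (y - y')"
      using bounded_linear.linear[OF J(1)] J(2)[of "y - y'"] by (simp add: linear_diff)
    finally show "norm (A (z + J y) *v h - A (z + J y') *v h) \<le> M * norm (y - y') * norm h" .
  qed (use der c0 low M in auto)
  then show thesis using c0 by (intro that[of "c0 / 2"]) auto
qed

section \<open>Inversion of the short-time Fourier transform\<close>

text \<open>Without integrability the left-hand integral is 0 by convention, so no case distinction
  is left to later estimates.\<close>

lemma ennreal_norm_integral_le:
  fixes f :: "'a \<Rightarrow> 'b::{banach, second_countable_topology}"
  shows "ennreal (norm (LINT x|M. f x)) \<le> (\<integral>\<^sup>+x. ennreal (norm (f x)) \<partial>M)"
  by (cases "integrable M f") (auto simp: integral_norm_bound_ennreal not_integrable_integral_eq)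

lemma
  fixes f :: "'a::euclidean_space \<times> 'b::euclidean_space \<Rightarrow> 'c::{banach, second_countable_topology}"
  assumes f: "integrable lborel f"
  shows integral_lborel_pair: "(LINT z|lborel. f z) = (LINT x|lborel. (LINT y|lborel. f (x, y)))"
    and integral_lborel_pair': "(LINT z|lborel. f z) = (LINT y|lborel. (LINT x|lborel. f (x, y)))"
proof -
  have i: "integrable (lborel \<Otimes>\<^sub>M lborel) f" using f by (simp add: lborel_prod)
  show "(LINT z|lborel. f z) = (LINT x|lborel. (LINT y|lborel. f (x, y)))"
    using lborel_pair.integral_fst'[OF i] by (simp add: lborel_prod)
  have i': "integrable (lborel \<Otimes>\<^sub>M lborel) (\<lambda>(x, y). f (x, y))" using i by simp
  show "(LINT z|lborel. f z) = (LINT y|lborel. (LINT x|lborel. f (x, y)))"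
    using lborel_pair.integral_snd[OF i'] by (simp add: lborel_prod split_beta')
qed

lemma stft_as_fourier: "stft g u Z \<zeta> = fourier (\<lambda>y. u y * cnj (g (y - Z))) \<zeta>"
  unfolding stft_eq fourier_eq by (simp add: inner_commute mult.assoc)

lemma stft_inversion:
  fixes u g :: "'a::euclidean_space \<Rightarrow> complex"
  assumes "integrable lborel (\<lambda>y. u y * cnj (g (y - Z)))" "integrable lborel (\<lambda>\<zeta>. stft g u Z \<zeta>)"
  shows "AE y in lborel. u y * cnj (g (y - Z)) = (LINT \<zeta>|lborel. ee (y \<bullet> \<zeta>) * stft g u Z \<zeta>)"
  using fourier_inversion_AE[OF assms(1)] assms(2) unfolding stft_as_fourier .

lemma integrable_mult_ess_bounded:
  fixes R u :: "'a::euclidean_space \<Rightarrow> complex"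
  assumes R: "integrable lborel R" and [measurable]: "u \<in> borel_measurable borel" and K: "AE y in lborel. norm (u y) \<le> K"
  shows "integrable lborel (\<lambda>y. R y * u y)"
proof (rule Bochner_Integration.integrable_bound[OF integrable_mult_right[OF integrable_norm[OF R], of K]])
  have [measurable]: "R \<in> borel_measurable borel" using R by auto
  show "(\<lambda>y. R y * u y) \<in> borel_measurable lborel" by measurable
  show "AE y in lborel. norm (R y * u y) \<le> norm (K * norm (R y))"
    using K
  proof eventually_elim
    fix y assume "norm (u y) \<le> K"
    then have "norm (R y) * norm (u y) \<le> \<bar>K\<bar> * norm (R y)"
      by (subst mult.commute) (intro mult_right_mono, auto)
    then show "norm (R y * u y) \<le> norm (K * norm (R y))" by (simp add: norm_mult)
  qed
qed

lemma rapid_integrable_norm_sq: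
  fixes g :: "'a::euclidean_space \<Rightarrow> complex"
  assumes g: "rapid g"
  shows "integrable lborel (\<lambda>y. g y * cnj (g y))"
proof -
  obtain C where C: "0 \<le> C" "\<And>x. norm (g x) \<le> C * wt x powr (- 0)" using rapid_bound[OF g] by blast
  note [measurable] = rapid_measurable[OF g]
  have "(\<lambda>y. cnj (g y)) \<in> borel_measurable borel" by measurable
  then show ?thesis
    using C by (intro integrable_mult_ess_bounded[OF rapid_integrable[OF g], of _ C])
      (auto simp: rapid_measurable[OF g])
qed

text \<open>The squared L^2 norm of the window, kept as a complex number because it multiplies
  complex integrals.\<close>

definition window_sq :: "('a::euclidean_space \<Rightarrow> complex) \<Rightarrow> complex" where
  "window_sq g = (LINT y|lborel. g y * cnj (g y))"

lemma window_sq_nonzero: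
  fixes g :: "'a::euclidean_space \<Rightarrow> complex"
  assumes g: "rapid g" and nz: "g \<noteq> (\<lambda>_. 0)"
  shows "window_sq g \<noteq> 0"
proof
  assume "window_sq g = 0"
  note [measurable] = rapid_measurable[OF g]
  have "window_sq g = complex_of_real (LINT y|lborel. (norm (g y))\<^sup>2)"
    unfolding window_sq_def by (simp only: complex_norm_square[symmetric] integral_complex_of_real[symmetric])
  with \<open>window_sq g = 0\<close> have z: "(LINT y|lborel. (norm (g y))\<^sup>2) = 0" by simp
  have "integrable lborel (\<lambda>y. (norm (g y))\<^sup>2)"
    using integrable_norm[OF rapid_integrable_norm_sq[OF g]] by (simp add: norm_mult power2_eq_square)
  with z have "AE y in lborel. (norm (g y))\<^sup>2 = 0" by (subst (asm) integral_nonneg_eq_0_iff_AE) auto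
  then have "AE y in lborel. g y = 0" by simp
  then have "g y = 0" for y by (rule continuous_AE_zero[OF rapid_continuous[OF g]])
  with nz show False by auto
qed

text \<open>Inserting the identity \<open>\<integral>\<bar>g (y - Z)\<bar>\<^sup>2 dZ = const\<close> and inverting the Fourier transform of \<open>u \<cdot> cnj g(\<cdot> - Z)\<close> for each
  \<open>Z\<close> avoids a distributional inversion formula for the short-time Fourier transform.\<close>
theorem stft_reproduce:
  fixes u g R :: "'a::euclidean_space \<Rightarrow> complex"
  assumes g: "rapid g" and um[measurable]: "u \<in> borel_measurable borel" and uK: "AE y in lborel. norm (u y) \<le> K"
    and R: "integrable lborel R"
    and V: "AE Z in lborel. integrable lborel (\<lambda>\<zeta>. stft g u Z \<zeta>)"
  shows "window_sq g * (LINT y|lborel. R y * u y)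
    = (LINT Z|lborel. (LINT \<zeta>|lborel. stft g u Z \<zeta> * (LINT y|lborel. R y * g (y - Z) * ee (\<zeta> \<bullet> y))))"
proof -
  note [measurable] = rapid_measurable[OF g]
  have [measurable]: "R \<in> borel_measurable borel" using R by auto
  have Ru: "integrable lborel (\<lambda>y. R y * u y)" by (rule integrable_mult_ess_bounded[OF R um uK])
  obtain C where C: "0 \<le> C" "\<And>x. norm (g x) \<le> C" using rapid_bound[OF g, of 0] by auto
  have gt: "integrable lborel (\<lambda>y. g (y - Z))" for Z
    using rapid_integrable[OF g] by (simp add: integrable_translate_diff_iff)
  have Rg: "integrable lborel (\<lambda>y. R y * g (y - Z))" for Z
    using C by (intro integrable_mult_ess_bounded[OF R, of _ C]) auto
  have ug: "integrable lborel (\<lambda>y. u y * cnj (g (y - Z)))" for Z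
    using integrable_mult_ess_bounded[OF integrable_cnj[OF gt[of Z]] um uK] by (simp add: mult.commute)
  have w: "(LINT Z|lborel. g (y - Z) * cnj (g (y - Z))) = window_sq g" for y
    unfolding window_sq_def by (rule integral_reflect[of "\<lambda>y. g y * cnj (g y)"])
  have "window_sq g * (LINT y|lborel. R y * u y) = (LINT y|lborel. (R y * u y) * window_sq g)"
    by (simp add: mult.commute)
  also have "\<dots> = (LINT y|lborel. (LINT Z|lborel. R y * u y * (g (y - Z) * cnj (g (y - Z)))))"
  proof -
    have "R y * u y * window_sq g = (LINT Z|lborel. R y * u y * (g (y - Z) * cnj (g (y - Z))))" for y
      by (subst w[of y, symmetric]) (simp only: integral_mult_right_zero)
    then show ?thesis by (simp only:)
  qed
  also have "\<dots> = (LINT Z|lborel. (LINT y|lborel. R y * u y * (g (y - Z) * cnj (g (y - Z)))))"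
  proof (rule fubini_swap)
    show "(\<lambda>(y, Z). R y * u y * (g (y - Z) * cnj (g (y - Z)))) \<in> borel_measurable (borel \<Otimes>\<^sub>M borel)" by measurable
    have "(\<integral>\<^sup>+y. (\<integral>\<^sup>+Z. ennreal (norm (R y * u y * (g (y - Z) * cnj (g (y - Z))))) \<partial>lborel) \<partial>lborel)
      = (\<integral>\<^sup>+y. ennreal (norm (R y * u y)) * (\<integral>\<^sup>+Z. ennreal (norm (g Z * cnj (g Z))) \<partial>lborel) \<partial>lborel)"
    proof (rule nn_integral_cong)
      fix y
      have "(\<integral>\<^sup>+Z. ennreal (norm (R y * u y * (g (y - Z) * cnj (g (y - Z))))) \<partial>lborel)
        = (\<integral>\<^sup>+Z. ennreal (norm (R y * u y)) * ennreal (norm (g (y - Z) * cnj (g (y - Z)))) \<partial>lborel)"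
        by (simp add: norm_mult ennreal_mult)
      also have "\<dots> = ennreal (norm (R y * u y)) * (\<integral>\<^sup>+Z. ennreal (norm (g (y - Z) * cnj (g (y - Z)))) \<partial>lborel)"
        by (rule nn_integral_cmult) measurable
      also have "(\<integral>\<^sup>+Z. ennreal (norm (g (y - Z) * cnj (g (y - Z)))) \<partial>lborel) = (\<integral>\<^sup>+Z. ennreal (norm (g Z * cnj (g Z))) \<partial>lborel)"
        by (rule nn_integral_reflect[of "\<lambda>Z. ennreal (norm (g Z * cnj (g Z)))"]) measurable
      finally show "(\<integral>\<^sup>+Z. ennreal (norm (R y * u y * (g (y - Z) * cnj (g (y - Z))))) \<partial>lborel)
        = ennreal (norm (R y * u y)) * (\<integral>\<^sup>+Z. ennreal (norm (g Z * cnj (g Z))) \<partial>lborel)" .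
    qed
    also have "\<dots> = (\<integral>\<^sup>+y. ennreal (norm (R y * u y)) \<partial>lborel) * (\<integral>\<^sup>+Z. ennreal (norm (g Z * cnj (g Z))) \<partial>lborel)"
      by (rule nn_integral_multc) measurable
    also have "\<dots> < \<infinity>"
      using Ru rapid_integrable_norm_sq[OF g] unfolding integrable_iff_bounded by (simp add: ennreal_mult_less_top)
    finally show "(\<integral>\<^sup>+y. (\<integral>\<^sup>+Z. ennreal (norm (R y * u y * (g (y - Z) * cnj (g (y - Z))))) \<partial>lborel) \<partial>lborel) < \<infinity>" .
  qed
  also have "\<dots> = (LINT Z|lborel. (LINT \<zeta>|lborel. stft g u Z \<zeta> * (LINT y|lborel. R y * g (y - Z) * ee (\<zeta> \<bullet> y))))"
  proof (rule integral_cong_AE)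
    show "(\<lambda>Z. LINT y|lborel. R y * u y * (g (y - Z) * cnj (g (y - Z)))) \<in> borel_measurable lborel" by measurable
    show "(\<lambda>Z. LINT \<zeta>|lborel. stft g u Z \<zeta> * (LINT y|lborel. R y * g (y - Z) * ee (\<zeta> \<bullet> y))) \<in> borel_measurable lborel" by measurable
    \<comment> \<open>For fixed Z the inversion formula fails at most on a null set of y, which the
      integral over y does not see.\<close>
    show "AE Z in lborel. (LINT y|lborel. R y * u y * (g (y - Z) * cnj (g (y - Z)))) = (LINT \<zeta>|lborel. stft g u Z \<zeta> * (LINT y|lborel. R y * g (y - Z) * ee (\<zeta> \<bullet> y)))"
      using V
    proof eventually_elim
      fix Z assume iV: "integrable lborel (\<lambda>\<zeta>. stft g u Z \<zeta>)"
      have "(LINT y|lborel. R y * u y * (g (y - Z) * cnj (g (y - Z)))) = (LINT y|lborel. R y * g (y - Z) * (LINT \<zeta>|lborel. ee (y \<bullet> \<zeta>) * stft g u Z \<zeta>))"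
      proof (rule integral_cong_AE)
        show "AE y in lborel. R y * u y * (g (y - Z) * cnj (g (y - Z))) = R y * g (y - Z) * (LINT \<zeta>|lborel. ee (y \<bullet> \<zeta>) * stft g u Z \<zeta>)"
          using stft_inversion[OF ug iV]
        proof eventually_elim
          fix y assume e: "u y * cnj (g (y - Z)) = (LINT \<zeta>|lborel. ee (y \<bullet> \<zeta>) * stft g u Z \<zeta>)"
          show "R y * u y * (g (y - Z) * cnj (g (y - Z))) = R y * g (y - Z) * (LINT \<zeta>|lborel. ee (y \<bullet> \<zeta>) * stft g u Z \<zeta>)"
            unfolding e[symmetric] by (simp add: mult_ac)
        qed
      qed measurable
      also have "\<dots> = (LINT y|lborel. (LINT \<zeta>|lborel. R y * g (y - Z) * (ee (y \<bullet> \<zeta>) * stft g u Z \<zeta>)))"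
        by (simp only: integral_mult_right_zero)
      also have "\<dots> = (LINT \<zeta>|lborel. (LINT y|lborel. R y * g (y - Z) * (ee (y \<bullet> \<zeta>) * stft g u Z \<zeta>)))"
      proof (rule fubini_swap)
        show "(\<lambda>(y, \<zeta>). R y * g (y - Z) * (ee (y \<bullet> \<zeta>) * stft g u Z \<zeta>)) \<in> borel_measurable (borel \<Otimes>\<^sub>M borel)" by measurable
        have "(\<integral>\<^sup>+y. (\<integral>\<^sup>+\<zeta>. ennreal (norm (R y * g (y - Z) * (ee (y \<bullet> \<zeta>) * stft g u Z \<zeta>))) \<partial>lborel) \<partial>lborel)
          = (\<integral>\<^sup>+y. (\<integral>\<^sup>+\<zeta>. ennreal (norm (R y * g (y - Z))) * ennreal (norm (stft g u Z \<zeta>)) \<partial>lborel) \<partial>lborel)"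
          by (simp add: norm_mult ennreal_mult)
        also have "\<dots> = (\<integral>\<^sup>+y. ennreal (norm (R y * g (y - Z))) * (\<integral>\<^sup>+\<zeta>. ennreal (norm (stft g u Z \<zeta>)) \<partial>lborel) \<partial>lborel)"
          by (intro nn_integral_cong nn_integral_cmult) measurable
        also have "\<dots> = (\<integral>\<^sup>+y. ennreal (norm (R y * g (y - Z))) \<partial>lborel) * (\<integral>\<^sup>+\<zeta>. ennreal (norm (stft g u Z \<zeta>)) \<partial>lborel)"
          by (rule nn_integral_multc) measurable
        also have "\<dots> < \<infinity>" using Rg[of Z] iV unfolding integrable_iff_bounded by (simp add: ennreal_mult_less_top)
        finally show "(\<integral>\<^sup>+y. (\<integral>\<^sup>+\<zeta>. ennreal (norm (R y * g (y - Z) * (ee (y \<bullet> \<zeta>) * stft g u Z \<zeta>))) \<partial>lborel) \<partial>lborel) < \<infinity>" .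
      qed
      also have "\<dots> = (LINT \<zeta>|lborel. stft g u Z \<zeta> * (LINT y|lborel. R y * g (y - Z) * ee (\<zeta> \<bullet> y)))"
        unfolding integral_mult_right_zero[symmetric] by (simp add: inner_commute mult_ac)
      finally show "(LINT y|lborel. R y * u y * (g (y - Z) * cnj (g (y - Z)))) = (LINT \<zeta>|lborel. stft g u Z \<zeta> * (LINT y|lborel. R y * g (y - Z) * ee (\<zeta> \<bullet> y)))" .
    qed
  qed
  finally show ?thesis .
qed

text \<open>For each z, inversion bounds the product of u with the translated window. Dividing by
  the window at a z for which it is bounded below at the given y bounds u itself. This yields the
  boundedness of symbols on which all later exchanges of integrals rest.\<close>

lemma stft_L1_imp_ess_bounded:
  fixes u g :: "'a::euclidean_space \<Rightarrow> complex"
  assumes g: "rapid g" and nz: "g \<noteq> (\<lambda>_. 0)" and [measurable]: "u \<in> borel_measurable borel"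
    and i: "\<And>z. integrable lborel (\<lambda>y. u y * cnj (g (y - z)))"
    and C: "\<And>z. (\<integral>\<^sup>+\<zeta>. ennreal (norm (stft g u z \<zeta>)) \<partial>lborel) \<le> ennreal C"
  obtains K where "0 \<le> K" "AE y in lborel. norm (u y) \<le> K"
proof -
  note [measurable] = rapid_measurable[OF g]
  define C' where "C' = max 0 C"
  have iV: "integrable lborel (\<lambda>\<zeta>. stft g u z \<zeta>)" for z
    by (rule integrableI_bounded) (use C[of z] in \<open>auto simp: less_top[symmetric] top_unique\<close>)
  have V: "norm (LINT \<zeta>|lborel. ee (y \<bullet> \<zeta>) * stft g u z \<zeta>) \<le> C'" for y z
  proof -
    have "ennreal (norm (LINT \<zeta>|lborel. ee (y \<bullet> \<zeta>) * stft g u z \<zeta>)) \<le> (\<integral>\<^sup>+\<zeta>. ennreal (norm (ee (y \<bullet> \<zeta>) * stft g u z \<zeta>)) \<partial>lborel)"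
      by (rule ennreal_norm_integral_le)
    also have "\<dots> \<le> ennreal C" using C[of z] by (simp add: norm_mult)
    also have "\<dots> \<le> ennreal C'" by (simp add: C'_def ennreal_leI)
    finally show ?thesis by (simp add: C'_def)
  qed
  have ae: "AE y in lborel. norm (u y) * norm (g (y - z)) \<le> C'" for z
    using stft_inversion[OF i iV]
  proof eventually_elim
    fix y assume "u y * cnj (g (y - z)) = (LINT \<zeta>|lborel. ee (y \<bullet> \<zeta>) * stft g u z \<zeta>)"
    then have "norm (u y * cnj (g (y - z))) \<le> C'" using V[of y z] by simp
    then show "norm (u y) * norm (g (y - z)) \<le> C'" by (simp add: norm_mult)
  qed
  from nz obtain y0 where y0: "g y0 \<noteq> 0" by auto
  define e where "e = norm (g y0) / 2"
  have e: "0 < e" using y0 by (simp add: e_def)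
  have "open {y. e < norm (g y)}"
    by (intro open_Collect_less continuous_intros rapid_continuous[OF g])
  moreover have "y0 \<in> {y. e < norm (g y)}" using y0 by (simp add: e_def)
  ultimately obtain r where r: "0 < r" "ball y0 r \<subseteq> {y. e < norm (g y)}" using open_contains_ball by blast
  \<comment> \<open>The exceptional null set depends on z, so only countably many translations may
    be used; a dense set still offers one that puts y - z where the window exceeds e.\<close>
  obtain D :: "'a set" where D: "countable D" "\<And>U. open U \<Longrightarrow> U \<noteq> {} \<Longrightarrow> \<exists>d\<in>D. d \<in> U"
    using countable_dense_exists by (metis)
  have "AE y in lborel. \<forall>z\<in>D. norm (u y) * norm (g (y - z)) \<le> C'"
    using ae by (intro AE_ball_countable[OF D(1), THEN iffD2]) auto
  then have "AE y in lborel. norm (u y) \<le> C' / e"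
  proof eventually_elim
    fix y assume *: "\<forall>z\<in>D. norm (u y) * norm (g (y - z)) \<le> C'"
    obtain z where z: "z \<in> D" "z \<in> ball (y - y0) r" using D(2)[of "ball (y - y0) r"] r by auto
    have "y - z \<in> ball y0 r" using z(2) by (simp add: dist_norm algebra_simps norm_minus_commute)
    then have "e \<le> norm (g (y - z))" using r by auto
    then have "norm (u y) * e \<le> norm (u y) * norm (g (y - z))" by (intro mult_left_mono) auto
    also have "\<dots> \<le> C'" using * z by blast
    finally show "norm (u y) \<le> C' / e" using e by (simp add: field_simps)
  qed
  then show thesis using e by (intro that[of "C' / e"]) (auto simp: C'_def)
qed

section \<open>Phases with bounded second derivatives\<close>

locale tame_phase =
  fixes \<Phi> :: "'a::euclidean_space \<times> 'a \<Rightarrow> real"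
  assumes smooth_phase: "smooth \<Phi>"
    and bounded_partials: "\<forall>vs. set vs \<subseteq> Basis \<and> 2 \<le> length vs \<longrightarrow> bounded (range (partials vs \<Phi>))"
begin

definition grad :: "'a \<times> 'a \<Rightarrow> 'a \<times> 'a" where "grad Y = (\<Sum>b\<in>Basis. Dv b \<Phi> Y *\<^sub>R b)"

lemma grad_inner_Basis: "b \<in> Basis \<Longrightarrow> grad Y \<bullet> b = Dv b \<Phi> Y"
  by (simp add: grad_def inner_sum_left inner_Basis if_distrib cong: if_cong)

lemma diff_partials: "set vs \<subseteq> Basis \<Longrightarrow> partials vs \<Phi> differentiable (at z)"
  using smooth_phase unfolding smooth_def by blast

lemma diff_phase: "\<Phi> differentiable (at z)" using diff_partials[of "[]"] by simp
lemma diff_Dv: "b \<in> Basis \<Longrightarrow> Dv b \<Phi> differentiable (at z)" using diff_partials[of "[b]"] by simp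

lemma continuous_phase: "continuous_on A \<Phi>"
  by (meson diff_phase continuous_at_imp_continuous_on differentiable_imp_continuous_within)

lemma measurable_phase [measurable]: "\<Phi> \<in> borel_measurable borel"
  by (intro borel_measurable_continuous_onI continuous_phase)

lemma continuous_grad: "continuous_on A grad"
proof -
  have "continuous_on A (Dv b \<Phi>)" if "b \<in> Basis" for b
    using differentiable_imp_continuous_within[OF diff_Dv[OF that]] by (intro continuous_at_imp_continuous_on) blast
  then show ?thesis unfolding grad_def by (intro continuous_on_sum continuous_on_scaleR continuous_on_const) blast
qed

lemma measurable_grad [measurable]: "grad \<in> borel_measurable borel"
  by (intro borel_measurable_continuous_onI continuous_grad)

lemma phase_partials_le:
  obtains K where "0 \<le> K" "\<And>Y0. partials_le N (\<lambda>Y. K * wt (Y - Y0) powr real N) (\<lambda>Y. ee (\<Phi> Y - grad Y0 \<bullet> Y))"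
proof -
  \<comment> \<open>N further derivatives of the Hessian enter, so orders up to N + 2 are
    bounded.\<close>
  obtain K where K: "1 \<le> K" "\<And>vs z. set vs \<subseteq> Basis \<Longrightarrow> 2 \<le> length vs \<Longrightarrow> length vs \<le> N + 2 \<Longrightarrow> \<bar>partials vs \<Phi> z\<bar> \<le> K"
    using partials_uniform_bound[OF bounded_partials] by metis
  define d where "d = real DIM('a \<times> 'a)"
  have d1: "1 \<le> d" unfolding d_def using DIM_positive[where 'a="'a \<times> 'a"] by linarith
  have second: "partials_le j (\<lambda>Y. K) (Dv b' (Dv b \<Phi>))" if "b \<in> Basis" "b' \<in> Basis" "j \<le> N" for b b' j
    unfolding partials_le_iff
  proof (intro allI impI conjI)
    fix vs :: "('a \<times> 'a) list" and Y assume vs: "set vs \<subseteq> Basis \<and> length vs \<le> j"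
    have e: "partials vs (Dv b' (Dv b \<Phi>)) = partials (vs @ [b', b]) \<Phi>" by (simp add: partials_append)
    show "partials vs (Dv b' (Dv b \<Phi>)) differentiable (at Y)"
      unfolding e by (rule diff_partials) (use that vs in auto)
    have "\<bar>partials (vs @ [b', b]) \<Phi> Y\<bar> \<le> K" by (rule K(2)) (use that vs in auto)
    then show "norm (partials vs (Dv b' (Dv b \<Phi>)) Y) \<le> K" unfolding e by simp
  qed
  have first: "partials_le N (\<lambda>Y. d * K * wt (Y - Y0)) (\<lambda>Y. Dv b \<Phi> Y - Dv b \<Phi> Y0)" if b: "b \<in> Basis" for b Y0
  proof -
    have hd: "((\<lambda>Y. Dv b \<Phi> Y - Dv b \<Phi> Y0) has_derivative frechet_derivative (Dv b \<Phi>) (at Y)) (at Y)" for Y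
      using has_derivative_diff[OF has_derivative_frechet[OF diff_Dv[OF b, of Y]] has_derivative_const[of "Dv b \<Phi> Y0"]] by simp
    then have df: "(\<lambda>Y. Dv b \<Phi> Y - Dv b \<Phi> Y0) differentiable (at Y)" for Y unfolding differentiable_def by blast
    have n: "norm (Dv b \<Phi> Y - Dv b \<Phi> Y0) \<le> d * K * wt (Y - Y0)" for Y
    proof -
      have "\<bar>Dv b \<Phi> Y - Dv b \<Phi> Y0\<bar> \<le> d * K * norm (Y - Y0)"
        unfolding d_def
      proof (rule lipschitz_from_partials[OF diff_Dv[OF b]])
        fix b' z assume "b' \<in> (Basis :: ('a \<times> 'a) set)"
        from partials_le_norm[OF second[OF b this, of 0], of z] show "\<bar>Dv b' (Dv b \<Phi>) z\<bar> \<le> K" by simp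
      qed
      also have "\<dots> \<le> d * K * wt (Y - Y0)" using d1 K(1) by (intro mult_left_mono) (auto simp: wt_def)
      finally show ?thesis by simp
    qed
    show ?thesis
    proof (cases N)
      case 0 then show ?thesis using df n by simp
    next
      case (Suc j)
      have D: "Dv b' (\<lambda>Y. Dv b \<Phi> Y - Dv b \<Phi> Y0) = Dv b' (Dv b \<Phi>)" for b'
        by (rule ext) (rule Dv_eq[OF hd])
      have "partials_le j (\<lambda>Y. d * K * wt (Y - Y0)) (Dv b' (Dv b \<Phi>))" if "b' \<in> Basis" for b'
      proof (rule partials_le_mono[OF second[OF b that]])
        fix Y
        have "1 * K * 1 \<le> d * K * wt (Y - Y0)" using d1 K(1) wt_ge_1[of "Y - Y0"] by (intro mult_mono) auto
        then show "K \<le> d * K * wt (Y - Y0)" by simp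
      qed (use Suc in simp)
      then show ?thesis using df n by (simp add: Suc D)
    qed
  qed
  define A where "A = 2 * pi * (d * K)"
  have A1: "1 \<le> A"
  proof -
    have "1 * (1 * 1) \<le> (2 * pi) * (d * K)" using pi_ge_two d1 K(1) by (intro mult_mono) auto
    then show ?thesis by (simp add: A_def)
  qed
  have main: "partials_le N (\<lambda>Y. (2 ^ N * A) ^ N * wt (Y - Y0) powr real N) (\<lambda>Y. ee (\<Phi> Y - grad Y0 \<bullet> Y))" for Y0
  proof -
    define \<psi> where "\<psi> Y = \<i> * complex_of_real (2 * pi * (\<Phi> Y - grad Y0 \<bullet> Y))" for Y
    have hd: "(\<psi> has_derivative (\<lambda>h. \<i> * complex_of_real (2 * pi * (frechet_derivative \<Phi> (at Y) h - grad Y0 \<bullet> h)))) (at Y)" for Y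
      unfolding \<psi>_def
      by (intro has_derivative_mult_right has_derivative_of_real has_derivative_diff has_derivative_frechet[OF diff_phase]
          has_derivative_inner_right has_derivative_ident)
    have dd: "\<psi> differentiable (at Y)" for Y unfolding differentiable_def using hd by blast
    have W1: "1 \<le> A * wt (Y - Y0)" for Y using mult_mono[OF A1 wt_ge_1[of "Y - Y0"]] A1 by simp
    have cbD: "partials_le N (\<lambda>Y. A * wt (Y - Y0)) (Dv b \<psi>)" if b: "b \<in> Basis" for b
    proof -
      have "Dv b \<psi> = (\<lambda>Y. (\<i> * complex_of_real (2 * pi)) * complex_of_real (Dv b \<Phi> Y - Dv b \<Phi> Y0))"
        by (rule ext, subst Dv_eq[OF hd]) (simp add: grad_inner_Basis[OF b])
      then show ?thesis
        using partials_le_cmult[OF partials_le_of_real[OF first[OF b, of Y0]], of "\<i> * complex_of_real (2 * pi)"]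
        by (simp add: norm_mult A_def mult.assoc)
    qed
    have "partials_le N (\<lambda>Y. (2 ^ N * (A * wt (Y - Y0))) ^ N * norm (exp (\<psi> Y))) (\<lambda>Y. exp (\<psi> Y))"
      by (rule partials_le_exp[OF dd W1 cbD])
    moreover have "exp (\<psi> Y) = ee (\<Phi> Y - grad Y0 \<bullet> Y)" for Y by (simp add: \<psi>_def ee_exp)
    moreover have "(2 ^ N * (A * wt (Y - Y0))) ^ N = (2 ^ N * A) ^ N * wt (Y - Y0) powr real N" for Y
      by (simp add: powr_realpow power_mult_distrib mult.assoc)
    ultimately show ?thesis by simp
  qed
  show thesis by (rule that[OF _ main]) (use A1 in simp)
qed

text \<open>The windows confine Y to a neighbourhood of (x', \<omega>). Freezing the gradient there
  leaves a character of frequency \<zeta> - (\<omega>', x) + grad (x', \<omega>), against which N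
  integrations by parts are made; the symbol window \<Psi> in addition ties Z to (x',
  \<omega>).\<close>

lemma window_estimate:
  fixes \<Psi> :: "'a \<times> 'a \<Rightarrow> complex" and g \<gamma> :: "'a \<Rightarrow> complex" and N :: nat
  assumes \<Psi>: "rapid \<Psi>" and g: "rapid g" and \<gamma>: "rapid \<gamma>" and M: "0 \<le> M"
  obtains C where "0 \<le> C"
    "\<And>Z \<zeta> x' \<omega>' x \<omega>. norm (LINT Y|lborel. (ee (- (\<omega>' \<bullet> fst Y)) * cnj (g (fst Y - x')) * ee (\<Phi> Y) * (\<gamma> (snd Y - \<omega>) * ee (- (x \<bullet> (snd Y - \<omega>))))) * \<Psi> (Y - Z) * ee (\<zeta> \<bullet> Y))
      \<le> C * wt (\<zeta> - (\<omega>', x) + grad (x', \<omega>)) powr (- real N) * wt (Z - (x', \<omega>)) powr (- M)"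
proof -
  define r where "r = real DIM('a \<times> 'a) + 1"
  \<comment> \<open>The decay of the windows is spent three ways: N for derivatives of the remaining
    phase, M for the transfer to Z, and r for integrability.\<close>
  define L where "L = real N + M + r"
  have L0: "0 \<le> L" using M by (simp add: L_def r_def)
  obtain C1 where C1: "0 \<le> C1" "partials_le N (\<lambda>x. C1 * wt x powr (- M)) \<Psi>" using rapidE[OF \<Psi>] by blast
  obtain C2 where C2: "0 \<le> C2" "partials_le N (\<lambda>x. C2 * wt x powr (- L)) \<gamma>" using rapidE[OF \<gamma>] by blast
  obtain C3 where C3: "0 \<le> C3" "partials_le N (\<lambda>x. C3 * wt x powr (- L)) g" using rapidE[OF g] by blast
  obtain C4 where C4: "0 \<le> C4" "\<And>Y0. partials_le N (\<lambda>Y. C4 * wt (Y - Y0) powr real N) (\<lambda>Y. ee (\<Phi> Y - grad Y0 \<bullet> Y))"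
    by (rule phase_partials_le[of N]) blast
  define c where "c = 2 ^ N * (2 ^ N * (2 ^ N * (C1 * C2) * C3) * C4)"
  have c0: "0 \<le> c" using C1 C2 C3 C4 by (simp add: c_def)
  define I where "I = (LINT Y|lborel. wt (Y :: 'a \<times> 'a) powr (- r))"
  define D where "D = 2 ^ N * (1 + real DIM('a \<times> 'a) ^ N) * (c * I)"
  have I0: "0 \<le> I" unfolding I_def by (intro integral_nonneg_AE) auto
  have D0: "0 \<le> D" using c0 I0 by (simp add: D_def)
  have "norm (LINT Y|lborel. (ee (- (\<omega>' \<bullet> fst Y)) * cnj (g (fst Y - x')) * ee (\<Phi> Y) * (\<gamma> (snd Y - \<omega>) * ee (- (x \<bullet> (snd Y - \<omega>))))) * \<Psi> (Y - Z) * ee (\<zeta> \<bullet> Y))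
      \<le> D * wt (\<zeta> - (\<omega>', x) + grad (x', \<omega>)) powr (- real N) * wt (Z - (x', \<omega>)) powr (- M)" for Z \<zeta> x' \<omega>' x \<omega>
  proof -
    let ?Y0 = "(x', \<omega>)"
    let ?\<xi> = "\<zeta> - (\<omega>', x) + grad ?Y0"
    define B where "B Y = \<Psi> (Y - Z) * \<gamma> (snd Y - \<omega>) * cnj (g (fst Y - x')) * ee (\<Phi> Y - grad ?Y0 \<bullet> Y)" for Y
    define W where "W Y = c * wt (Z - ?Y0) powr (- M) * wt (Y - ?Y0) powr (- r)" for Y
    have cbB: "partials_le N W B"
      unfolding B_def
    proof (rule partials_le_mono[OF partials_le_mult[OF partials_le_mult[OF partials_le_mult[OF partials_le_translate[OF C1(2)] partials_le_snd[OF C2(2)]] partials_le_cnj[OF partials_le_fst[OF C3(2)]]] C4(2)]])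
      fix Y :: "'a \<times> 'a"
      have "Y - ?Y0 = (fst Y - x', snd Y - \<omega>)" by (cases Y) simp
      then have "wt (Y - ?Y0) \<le> wt (fst Y - x') * wt (snd Y - \<omega>)" using wt_Pair by metis
      then have "(wt (fst Y - x') * wt (snd Y - \<omega>)) powr (- L) \<le> wt (Y - ?Y0) powr (- L)" using L0 by (intro powr_mono2') auto
      then have 1: "wt (snd Y - \<omega>) powr (- L) * wt (fst Y - x') powr (- L) \<le> wt (Y - ?Y0) powr (- L)"
        by (simp add: powr_mult mult.commute)
      have 2: "wt (Y - ?Y0) powr (- L) * wt (Y - ?Y0) powr real N = wt (Y - ?Y0) powr (- M) * wt (Y - ?Y0) powr (- r)"
        by (simp add: powr_add[symmetric] L_def)
      have 3: "wt (Y - ?Y0) powr (- M) * wt (Y - Z) powr (- M) \<le> wt (Z - ?Y0) powr (- M)"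
        using wt_peetre[OF M, of "Y - ?Y0" "Z - ?Y0"] by simp
      have "2 ^ N * (2 ^ N * (2 ^ N * (C1 * wt (Y - Z) powr (- M) * (C2 * wt (snd Y - \<omega>) powr (- L))) * (C3 * wt (fst Y - x') powr (- L))) * (C4 * wt (Y - ?Y0) powr real N))
        = c * (wt (Y - Z) powr (- M) * ((wt (snd Y - \<omega>) powr (- L) * wt (fst Y - x') powr (- L)) * wt (Y - ?Y0) powr real N))"
        by (simp add: c_def mult_ac)
      also have "\<dots> \<le> c * (wt (Y - Z) powr (- M) * (wt (Y - ?Y0) powr (- L) * wt (Y - ?Y0) powr real N))"
        using c0 by (intro mult_left_mono mult_right_mono 1) auto
      also have "\<dots> = c * ((wt (Y - ?Y0) powr (- M) * wt (Y - Z) powr (- M)) * wt (Y - ?Y0) powr (- r))"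
        unfolding 2 by (simp add: mult_ac)
      also have "\<dots> \<le> c * (wt (Z - ?Y0) powr (- M) * wt (Y - ?Y0) powr (- r))"
        using c0 by (intro mult_left_mono mult_right_mono 3) auto
      finally show "2 ^ N * (2 ^ N * (2 ^ N * (C1 * wt (Y - Z) powr (- M) * (C2 * wt (snd Y - \<omega>) powr (- L))) * (C3 * wt (fst Y - x') powr (- L))) * (C4 * wt (Y - ?Y0) powr real N)) \<le> W Y"
        by (simp add: W_def mult.assoc)
    qed
    have iW: "integrable lborel W"
      unfolding W_def r_def
      by (intro integrable_mult_right integrable_translate_diff_iff[THEN iffD2, of "\<lambda>Y. wt Y powr _"] wt_powr_neg_integrable) simp
    have IW: "(LINT Y|lborel. W Y) = c * wt (Z - ?Y0) powr (- M) * I"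
      unfolding W_def I_def using integral_translate_diff[of "\<lambda>Y. wt Y powr (- r)" ?Y0] by simp
    \<comment> \<open>All linear phases are collected into \<open>?\<xi>\<close>; only a unimodular
      constant is left over, together with the phase corrected by its frozen linear part.\<close>
    have e: "(LINT Y|lborel. (ee (- (\<omega>' \<bullet> fst Y)) * cnj (g (fst Y - x')) * ee (\<Phi> Y) * (\<gamma> (snd Y - \<omega>) * ee (- (x \<bullet> (snd Y - \<omega>))))) * \<Psi> (Y - Z) * ee (\<zeta> \<bullet> Y))
      = ee (x \<bullet> \<omega>) * (LINT Y|lborel. ee (?\<xi> \<bullet> Y) * B Y)"
    proof -
      have "(ee (- (\<omega>' \<bullet> fst Y)) * cnj (g (fst Y - x')) * ee (\<Phi> Y) * (\<gamma> (snd Y - \<omega>) * ee (- (x \<bullet> (snd Y - \<omega>))))) * \<Psi> (Y - Z) * ee (\<zeta> \<bullet> Y)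
        = ee (x \<bullet> \<omega>) * (ee (?\<xi> \<bullet> Y) * B Y)" for Y
      proof -
        have "- (\<omega>' \<bullet> fst Y) + \<Phi> Y + - (x \<bullet> (snd Y - \<omega>)) + \<zeta> \<bullet> Y = x \<bullet> \<omega> + ?\<xi> \<bullet> Y + (\<Phi> Y - grad ?Y0 \<bullet> Y)"
          by (cases Y) (simp add: inner_add_left inner_diff_left inner_diff_right)
        then have "ee (- (\<omega>' \<bullet> fst Y)) * ee (\<Phi> Y) * ee (- (x \<bullet> (snd Y - \<omega>))) * ee (\<zeta> \<bullet> Y) = ee (x \<bullet> \<omega>) * ee (?\<xi> \<bullet> Y) * ee (\<Phi> Y - grad ?Y0 \<bullet> Y)"
          unfolding ee_add[symmetric] by (rule arg_cong)
        then have "(ee (- (\<omega>' \<bullet> fst Y)) * ee (\<Phi> Y) * ee (- (x \<bullet> (snd Y - \<omega>))) * ee (\<zeta> \<bullet> Y)) * (\<Psi> (Y - Z) * \<gamma> (snd Y - \<omega>) * cnj (g (fst Y - x')))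
          = (ee (x \<bullet> \<omega>) * ee (?\<xi> \<bullet> Y) * ee (\<Phi> Y - grad ?Y0 \<bullet> Y)) * (\<Psi> (Y - Z) * \<gamma> (snd Y - \<omega>) * cnj (g (fst Y - x')))" by simp
        then show ?thesis unfolding B_def by (simp only: mult_ac)
      qed
      then show ?thesis by simp
    qed
    have "norm (LINT Y|lborel. ee (?\<xi> \<bullet> Y) * B Y) \<le> 2 ^ N * (1 + real DIM('a \<times> 'a) ^ N) * wt ?\<xi> powr (- real N) * (LINT Y|lborel. W Y)"
      by (rule fourier_integral_decay[OF cbB iW])
    also have "\<dots> = D * wt ?\<xi> powr (- real N) * wt (Z - ?Y0) powr (- M)"
      unfolding IW D_def by (simp only: mult_ac)
    finally show ?thesis unfolding e by (simp add: norm_mult)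
  qed
  with D0 show thesis by (rule that)
qed

end

section \<open>The phase-space matrix of a Fourier integral operator\<close>

lemma continuous_on_fourier:
  fixes f :: "'a::euclidean_space \<Rightarrow> complex"
  assumes f: "integrable lborel f"
  shows "continuous_on UNIV (fourier f)"
proof (rule continuous_at_imp_continuous_on, intro ballI)
  fix \<xi> :: 'a
  have [measurable]: "f \<in> borel_measurable borel" using f by auto
  show "isCont (fourier f) \<xi>"
    unfolding continuous_at_sequentially
  proof (intro allI impI)
    fix X :: "nat \<Rightarrow> 'a" assume X: "X \<longlonglongrightarrow> \<xi>"
    show "(fourier f \<circ> X) \<longlonglongrightarrow> fourier f \<xi>"
      unfolding o_def fourier_eq
    proof (rule integral_dominated_convergence[where w="\<lambda>x. norm (f x)"])
      show "AE x in lborel. (\<lambda>n. ee (- (x \<bullet> X n)) * f x) \<longlonglongrightarrow> ee (- (x \<bullet> \<xi>)) * f x"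
      proof (rule AE_I2)
        fix x :: 'a
        have c: "continuous_on UNIV (\<lambda>t. ee (- (x \<bullet> t)))" by (intro continuous_intros)
        have "(\<lambda>n. ee (- (x \<bullet> X n))) \<longlonglongrightarrow> ee (- (x \<bullet> \<xi>))"
          by (rule continuous_on_tendsto_compose[OF c X]) auto
        then show "(\<lambda>n. ee (- (x \<bullet> X n)) * f x) \<longlonglongrightarrow> ee (- (x \<bullet> \<xi>)) * f x" by (intro tendsto_intros)
      qed
    qed (use f in \<open>auto simp: norm_mult\<close>)
  qed
qed

lemma japanese_ge_1: "1 \<le> japanese x" by (simp add: japanese_def)

lemma wt_le_japanese: "wt x \<le> 2 * japanese x"
proof -
  have "norm x \<le> japanese x" unfolding japanese_def by (rule real_le_rsqrt) simp
  then show ?thesis using japanese_ge_1[of x] by (simp add: wt_def)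
qed

lemma nn_integral_fst_snd:
  fixes g \<gamma> :: "'a::euclidean_space \<Rightarrow> complex"
  assumes [measurable]: "g \<in> borel_measurable borel" "\<gamma> \<in> borel_measurable borel"
  shows "(\<integral>\<^sup>+Y. ennreal (norm (g (fst Y - a))) * ennreal (norm (\<gamma> (snd Y - b))) \<partial>lborel)
     = (\<integral>\<^sup>+y. ennreal (norm (g y)) \<partial>lborel) * (\<integral>\<^sup>+y. ennreal (norm (\<gamma> y)) \<partial>lborel)"
proof -
  note [measurable] = measurable_fst_borel measurable_snd_borel
  have "(\<integral>\<^sup>+Y. ennreal (norm (g (fst Y - a))) * ennreal (norm (\<gamma> (snd Y - b))) \<partial>lborel)
    = (\<integral>\<^sup>+x. (\<integral>\<^sup>+y. ennreal (norm (g (x - a))) * ennreal (norm (\<gamma> (y - b))) \<partial>lborel) \<partial>lborel)"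
    by (subst nn_integral_lborel_pair) simp_all
  also have "\<dots> = (\<integral>\<^sup>+x. ennreal (norm (g (x - a))) * (\<integral>\<^sup>+y. ennreal (norm (\<gamma> (y - b))) \<partial>lborel) \<partial>lborel)"
    by (intro nn_integral_cong nn_integral_cmult) measurable
  also have "\<dots> = (\<integral>\<^sup>+x. ennreal (norm (g (x - a))) \<partial>lborel) * (\<integral>\<^sup>+y. ennreal (norm (\<gamma> (y - b))) \<partial>lborel)"
    by (rule nn_integral_multc) measurable
  finally show ?thesis
    using nn_integral_translate_diff[of "\<lambda>y. ennreal (norm (g y))" a] nn_integral_translate_diff[of "\<lambda>y. ennreal (norm (\<gamma> y))" b]
    by simp
qed

text \<open>Both alternatives of the theorem are instances: the unweighted symbol class is the case
  s = 0.\<close>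

locale fio = tame_phase \<Phi> for \<Phi> :: "'a::euclidean_space \<times> 'a \<Rightarrow> real" +
  fixes \<sigma> \<Psi> :: "'a \<times> 'a \<Rightarrow> complex" and s :: real
  assumes \<sigma>_measurable [measurable]: "\<sigma> \<in> borel_measurable borel"
    and \<Psi>: "rapid \<Psi>" and \<Psi>_nz: "\<Psi> \<noteq> (\<lambda>_. 0)"
    and \<sigma>_integrable: "\<And>z. integrable lborel (\<lambda>y. \<sigma> y * cnj (\<Psi> (y - z)))"
    and s_nonneg: "0 \<le> s"
    and \<sigma>_norm: "sym_norm s 0 \<Psi> \<sigma> < \<infinity>"
begin

lemma measurable_\<Psi> [measurable]: "\<Psi> \<in> borel_measurable borel" by (rule rapid_measurable[OF \<Psi>])

text \<open>The trivial power of the second bracket is kept so that the integral of S is literally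
  \<open>sym_norm s 0\<close>.\<close>

definition S :: "'a \<times> 'a \<Rightarrow> ennreal" where
  "S \<zeta> = (SUP z. ennreal (norm (stft \<Psi> \<sigma> z \<zeta>) * japanese (fst z) powr s * japanese (snd z) powr 0))"

lemma S_finite: "(\<integral>\<^sup>+\<zeta>. S \<zeta> \<partial>lborel) < \<infinity>"
  using \<sigma>_norm by (simp add: sym_norm_def S_def)

text \<open>A supremum over uncountably many z; each member is continuous in \<zeta> as the modulus
  of a Fourier transform, times a constant, so S is lower semicontinuous.\<close>

lemma measurable_S [measurable]: "S \<in> borel_measurable borel"
proof (rule borel_measurableI_greater)
  fix a
  have "continuous_on UNIV (\<lambda>\<zeta>. stft \<Psi> \<sigma> z \<zeta>)" for z
    unfolding stft_as_fourier using continuous_on_fourier[OF \<sigma>_integrable[of z]] .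
  then have "open {\<zeta>. a < ennreal (norm (stft \<Psi> \<sigma> z \<zeta>) * japanese (fst z) powr s * japanese (snd z) powr 0)}" for z
    by (intro open_Collect_less continuous_on_const continuous_on_ennreal continuous_on_mult continuous_on_norm)
  then have "open (\<Union>z. {\<zeta>. a < ennreal (norm (stft \<Psi> \<sigma> z \<zeta>) * japanese (fst z) powr s * japanese (snd z) powr 0)})"
    by blast
  also have "(\<Union>z. {\<zeta>. a < ennreal (norm (stft \<Psi> \<sigma> z \<zeta>) * japanese (fst z) powr s * japanese (snd z) powr 0)}) = {\<zeta>. a < S \<zeta>}"
    unfolding S_def less_SUP_iff by blast
  finally show "{\<zeta> \<in> space borel. a < S \<zeta>} \<in> sets borel" by simp
qed

text \<open>Turns the weighted supremum into decay in z at the price of 2^s, from comparing the two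
  weights.\<close>

lemma S_bound: "ennreal (norm (stft \<Psi> \<sigma> z \<zeta>)) \<le> S \<zeta> * ennreal (2 powr s * wt (fst z) powr (- s))"
proof -
  let ?J = "japanese (fst z)"
  have J: "1 \<le> ?J" "0 < ?J" using japanese_ge_1[of "fst z"] by auto
  have "ennreal (norm (stft \<Psi> \<sigma> z \<zeta>)) = ennreal (norm (stft \<Psi> \<sigma> z \<zeta>) * ?J powr s * japanese (snd z) powr 0) * ennreal (?J powr (- s))"
    using J japanese_ge_1[of "snd z"] by (simp add: ennreal_mult[symmetric] powr_minus)
  also have "\<dots> \<le> S \<zeta> * ennreal (?J powr (- s))"
    unfolding S_def by (intro mult_right_mono SUP_upper) auto
  also have "\<dots> \<le> S \<zeta> * ennreal (2 powr s * wt (fst z) powr (- s))"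
  proof (intro mult_left_mono ennreal_leI)
    have "?J powr (- s) \<le> (wt (fst z) / 2) powr (- s)"
      using wt_le_japanese[of "fst z"] s_nonneg by (intro powr_mono2') auto
    also have "\<dots> = 2 powr s * wt (fst z) powr (- s)" by (simp add: powr_divide powr_minus field_simps)
    finally show "?J powr (- s) \<le> 2 powr s * wt (fst z) powr (- s)" .
  qed simp
  finally show ?thesis .
qed

lemma stft_\<sigma>_L1: "(\<integral>\<^sup>+\<zeta>. ennreal (norm (stft \<Psi> \<sigma> z \<zeta>)) \<partial>lborel) \<le> ennreal (2 powr s) * (\<integral>\<^sup>+\<zeta>. S \<zeta> \<partial>lborel)"
proof -
  have "(\<integral>\<^sup>+\<zeta>. ennreal (norm (stft \<Psi> \<sigma> z \<zeta>)) \<partial>lborel) \<le> (\<integral>\<^sup>+\<zeta>. ennreal (2 powr s) * S \<zeta> \<partial>lborel)"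
  proof (rule nn_integral_mono)
    fix \<zeta>
    have "ennreal (norm (stft \<Psi> \<sigma> z \<zeta>)) \<le> S \<zeta> * ennreal (2 powr s * wt (fst z) powr (- s))" by (rule S_bound)
    also have "\<dots> \<le> S \<zeta> * ennreal (2 powr s)"
      using s_nonneg wt_powr_mono[of "-s" 0 "fst z"] by (intro mult_left_mono ennreal_leI) auto
    finally show "ennreal (norm (stft \<Psi> \<sigma> z \<zeta>)) \<le> ennreal (2 powr s) * S \<zeta>" by (simp add: mult.commute)
  qed
  then show ?thesis by (simp add: nn_integral_cmult)
qed

lemma stft_\<sigma>_integrable: "integrable lborel (\<lambda>\<zeta>. stft \<Psi> \<sigma> z \<zeta>)"
proof (rule integrableI_bounded)
  have "(\<integral>\<^sup>+\<zeta>. ennreal (norm (stft \<Psi> \<sigma> z \<zeta>)) \<partial>lborel) \<le> ennreal (2 powr s) * (\<integral>\<^sup>+\<zeta>. S \<zeta> \<partial>lborel)" by (rule stft_\<sigma>_L1)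
  also have "\<dots> < \<infinity>" using S_finite by (simp add: ennreal_mult_less_top)
  finally show "(\<integral>\<^sup>+\<zeta>. ennreal (norm (stft \<Psi> \<sigma> z \<zeta>)) \<partial>lborel) < \<infinity>" .
qed measurable

lemma \<sigma>_ess_bounded: obtains K where "0 \<le> K" "AE Y in lborel. norm (\<sigma> Y) \<le> K"
proof -
  have "ennreal (2 powr s) * (\<integral>\<^sup>+\<zeta>. S \<zeta> \<partial>lborel) < \<infinity>" using S_finite by (simp add: ennreal_mult_less_top)
  then obtain C where C: "ennreal (2 powr s) * (\<integral>\<^sup>+\<zeta>. S \<zeta> \<partial>lborel) = ennreal C"
    by (cases "ennreal (2 powr s) * (\<integral>\<^sup>+\<zeta>. S \<zeta> \<partial>lborel)") auto
  show thesis
    by (rule stft_L1_imp_ess_bounded[OF \<Psi> \<Psi>_nz \<sigma>_measurable \<sigma>_integrable stft_\<sigma>_L1[unfolded C]]) (rule that)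
qed

lemma measurable_FIO [measurable]:
  assumes [measurable]: "f \<in> borel_measurable borel"
  shows "FIO \<Phi> \<sigma> f \<in> borel_measurable borel"
  unfolding FIO_eq[abs_def] by measurable

lemma FIO_ess_bounded:
  assumes f: "rapid f"
  obtains K where "0 \<le> K" "AE y in lborel. norm (FIO \<Phi> \<sigma> f y) \<le> K"
proof -
  obtain K where K: "0 \<le> K" "AE Y in lborel. norm (\<sigma> Y) \<le> K" by (rule \<sigma>_ess_bounded)
  have ff: "integrable lborel (fourier f)" by (rule fourier_rapid_integrable[OF f])
  have "AE Y in lborel \<Otimes>\<^sub>M lborel. norm (\<sigma> Y) \<le> K" unfolding lborel_prod by (rule K(2))
  then have "AE y in lborel. AE \<eta> in lborel. norm (\<sigma> (y, \<eta>)) \<le> K" by (rule lborel_pair.AE_pair)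
  then have "AE y in lborel. norm (FIO \<Phi> \<sigma> f y) \<le> K * (LINT \<eta>|lborel. norm (fourier f \<eta>))"
  proof eventually_elim
    fix y assume ae: "AE \<eta> in lborel. norm (\<sigma> (y, \<eta>)) \<le> K"
    have "(\<lambda>\<eta>. \<sigma> (y, \<eta>)) \<in> borel_measurable borel" by measurable
    from integrable_mult_ess_bounded[OF ff this ae]
    have i: "integrable lborel (\<lambda>\<eta>. norm (fourier f \<eta> * \<sigma> (y, \<eta>)))" by (rule integrable_norm)
    have "norm (FIO \<Phi> \<sigma> f y) \<le> (LINT \<eta>|lborel. norm (ee (\<Phi> (y, \<eta>)) * \<sigma> (y, \<eta>) * fourier f \<eta>))"
      unfolding FIO_eq by (rule integral_norm_bound)
    also have "\<dots> = (LINT \<eta>|lborel. norm (fourier f \<eta> * \<sigma> (y, \<eta>)))" by (simp add: norm_mult mult.commute)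
    also have "\<dots> \<le> (LINT \<eta>|lborel. K * norm (fourier f \<eta>))"
    proof (rule integral_mono_AE[OF i])
      show "integrable lborel (\<lambda>\<eta>. K * norm (fourier f \<eta>))" using ff by simp
      show "AE \<eta> in lborel. norm (fourier f \<eta> * \<sigma> (y, \<eta>)) \<le> K * norm (fourier f \<eta>)"
        using ae
      proof eventually_elim
        fix \<eta> assume "norm (\<sigma> (y, \<eta>)) \<le> K"
        then show "norm (fourier f \<eta> * \<sigma> (y, \<eta>)) \<le> K * norm (fourier f \<eta>)"
          unfolding norm_mult by (subst mult.commute) (intro mult_right_mono, auto)
      qed
    qed
    finally show "norm (FIO \<Phi> \<sigma> f y) \<le> K * (LINT \<eta>|lborel. norm (fourier f \<eta>))" by simp
  qed
  moreover have "0 \<le> K * (LINT \<eta>|lborel. norm (fourier f \<eta>))" using K(1) by simp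
  ultimately show thesis by (rule that[rotated])
qed

text \<open>The part of the integrand of the transformed T f that depends on neither f nor \<sigma>:
  modulation, output window and phase.\<close>

definition chirp :: "('a \<Rightarrow> complex) \<Rightarrow> 'a \<Rightarrow> 'a \<Rightarrow> 'a \<times> 'a \<Rightarrow> complex" where
  "chirp g x' \<omega>' Y = ee (- (\<omega>' \<bullet> fst Y)) * cnj (g (fst Y - x')) * ee (\<Phi> Y)"

lemma norm_chirp [simp]: "norm (chirp g x' \<omega>' Y) = norm (g (fst Y - x'))"
  by (simp add: chirp_def norm_mult)

lemma measurable_chirp [measurable]:
  assumes [measurable]: "g \<in> borel_measurable borel"
  shows "chirp g x' \<omega>' \<in> borel_measurable borel"
proof -
  note [measurable] = measurable_fst_borel
  show ?thesis unfolding chirp_def[abs_def] by measurable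
qed

lemma chirp_integrable:
  assumes g: "integrable lborel g" and h: "integrable lborel h"
  shows "integrable lborel (\<lambda>Y. chirp g x' \<omega>' Y * h (snd Y - b))"
proof (rule integrableI_bounded)
  have [measurable]: "g \<in> borel_measurable borel" "h \<in> borel_measurable borel" using g h by auto
  note [measurable] = measurable_snd_borel
  show "(\<lambda>Y. chirp g x' \<omega>' Y * h (snd Y - b)) \<in> borel_measurable lborel" by measurable
  have "(\<integral>\<^sup>+Y. ennreal (norm (chirp g x' \<omega>' Y * h (snd Y - b))) \<partial>lborel)
     = (\<integral>\<^sup>+Y. ennreal (norm (g (fst Y - x'))) * ennreal (norm (h (snd Y - b))) \<partial>lborel)"
    by (simp add: norm_mult ennreal_mult)
  also have "\<dots> < \<infinity>"
    using g h unfolding integrable_iff_bounded by (subst nn_integral_fst_snd) (auto simp: ennreal_mult_less_top)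
  finally show "(\<integral>\<^sup>+Y. ennreal (norm (chirp g x' \<omega>' Y * h (snd Y - b))) \<partial>lborel) < \<infinity>" .
qed

text \<open>Writing both integrations as one over Y = (y, \<eta>) exhibits the value as a pairing
  with \<sigma>, to which time-frequency analysis of \<sigma> in twice the dimension
  applies.\<close>

lemma stft_FIO:
  assumes g: "rapid g" and f: "rapid f"
  shows "stft g (FIO \<Phi> \<sigma> f) x' \<omega>' = (LINT Y|lborel. chirp g x' \<omega>' Y * fourier f (snd Y) * \<sigma> Y)"
proof -
  obtain K where K: "0 \<le> K" "AE Y in lborel. norm (\<sigma> Y) \<le> K" by (rule \<sigma>_ess_bounded)
  have "integrable lborel (\<lambda>Y. chirp g x' \<omega>' Y * fourier f (snd Y - 0))"
    by (rule chirp_integrable[OF rapid_integrable[OF g] fourier_rapid_integrable[OF f]])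
  then have "integrable lborel (\<lambda>Y. chirp g x' \<omega>' Y * fourier f (snd Y))" by simp
  from integrable_mult_ess_bounded[OF this \<sigma>_measurable K(2)]
  have "(LINT Y|lborel. chirp g x' \<omega>' Y * fourier f (snd Y) * \<sigma> Y)
    = (LINT y|lborel. (LINT \<eta>|lborel. chirp g x' \<omega>' (y, \<eta>) * fourier f (snd (y, \<eta>)) * \<sigma> (y, \<eta>)))"
    by (rule integral_lborel_pair)
  also have "\<dots> = (LINT y|lborel. ee (- (\<omega>' \<bullet> y)) * FIO \<Phi> \<sigma> f y * cnj (g (y - x')))"
  proof (rule Bochner_Integration.integral_cong[OF refl])
    fix y
    have "(LINT \<eta>|lborel. chirp g x' \<omega>' (y, \<eta>) * fourier f (snd (y, \<eta>)) * \<sigma> (y, \<eta>))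
      = (LINT \<eta>|lborel. (ee (- (\<omega>' \<bullet> y)) * cnj (g (y - x'))) * (ee (\<Phi> (y, \<eta>)) * \<sigma> (y, \<eta>) * fourier f \<eta>))"
      by (simp add: chirp_def mult_ac)
    also have "\<dots> = (ee (- (\<omega>' \<bullet> y)) * cnj (g (y - x'))) * FIO \<Phi> \<sigma> f y"
      unfolding FIO_eq by (rule integral_mult_right_zero)
    finally show "(LINT \<eta>|lborel. chirp g x' \<omega>' (y, \<eta>) * fourier f (snd (y, \<eta>)) * \<sigma> (y, \<eta>)) = ee (- (\<omega>' \<bullet> y)) * FIO \<Phi> \<sigma> f y * cnj (g (y - x'))"
      by (simp add: mult_ac)
  qed
  finally show ?thesis unfolding stft_eq by simp
qed

text \<open>The chirp times the frequency-side dual atom at z = (x, \<omega>). Its pairing with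
  \<sigma> is the entry of the phase-space matrix at (x', \<omega>') and z.\<close>

definition packet :: "('a \<Rightarrow> complex) \<Rightarrow> ('a \<Rightarrow> complex) \<Rightarrow> 'a \<Rightarrow> 'a \<Rightarrow> 'a \<times> 'a \<Rightarrow> 'a \<times> 'a \<Rightarrow> complex" where
  "packet g \<gamma> x' \<omega>' z Y = chirp g x' \<omega>' Y * (\<gamma> (snd Y - snd z) * ee (- (fst z \<bullet> (snd Y - snd z))))"

lemma stft_pair_integrable:
  fixes f g :: "'a \<Rightarrow> complex"
  assumes f: "rapid f" and g: "rapid g"
  shows "integrable lborel (\<lambda>z. stft g f (fst z) (snd z))"
proof -
  note [measurable] = rapid_measurable[OF f] rapid_measurable[OF g] measurable_fst_borel measurable_snd_borel
  let ?d = "DIM('a) + 1"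
  obtain C where C: "0 \<le> C" "\<And>x \<omega>. norm (stft g f x \<omega>) \<le> C * wt x powr (- real ?d) * wt \<omega> powr (- real ?d)"
    by (rule stft_decay[OF f g, of "real ?d" ?d]) auto
  show ?thesis
  proof (rule integrable_by_nn_integral)
    show "(\<lambda>z. stft g f (fst z) (snd z)) \<in> borel_measurable lborel" by measurable
    show "AE z in lborel. norm (stft g f (fst z) (snd z)) \<le> C * wt (fst z) powr (- real ?d) * wt (snd z) powr (- real ?d)"
      using C by simp
    have w: "(\<integral>\<^sup>+x. ennreal (wt (x :: 'a) powr (- real ?d)) \<partial>lborel) < \<infinity>" by (rule wt_powr_neg_nn_integral) simp
    have "(\<integral>\<^sup>+z. ennreal (C * wt (fst z :: 'a) powr (- real ?d) * wt (snd z :: 'a) powr (- real ?d)) \<partial>lborel)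
      = (\<integral>\<^sup>+x. (\<integral>\<^sup>+y. ennreal (C * wt (x :: 'a) powr (- real ?d)) * ennreal (wt (y :: 'a) powr (- real ?d)) \<partial>lborel) \<partial>lborel)"
      using C(1) by (subst nn_integral_lborel_pair) (simp_all add: ennreal_mult)
    also have "\<dots> = (\<integral>\<^sup>+x. ennreal C * ennreal (wt (x :: 'a) powr (- real ?d)) * (\<integral>\<^sup>+y. ennreal (wt (y :: 'a) powr (- real ?d)) \<partial>lborel) \<partial>lborel)"
      using C(1) by (intro nn_integral_cong, subst nn_integral_cmult) (auto simp: ennreal_mult)
    also have "\<dots> = ennreal C * (\<integral>\<^sup>+x. ennreal (wt (x :: 'a) powr (- real ?d)) \<partial>lborel) * (\<integral>\<^sup>+y. ennreal (wt (y :: 'a) powr (- real ?d)) \<partial>lborel)"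
    proof -
      have "(\<integral>\<^sup>+x. ennreal C * ennreal (wt (x :: 'a) powr (- real ?d)) * (\<integral>\<^sup>+y. ennreal (wt (y :: 'a) powr (- real ?d)) \<partial>lborel) \<partial>lborel)
        = (\<integral>\<^sup>+x. ennreal C * ennreal (wt (x :: 'a) powr (- real ?d)) \<partial>lborel) * (\<integral>\<^sup>+y. ennreal (wt (y :: 'a) powr (- real ?d)) \<partial>lborel)"
        by (rule nn_integral_multc) measurable
      also have "(\<integral>\<^sup>+x. ennreal C * ennreal (wt (x :: 'a) powr (- real ?d)) \<partial>lborel) = ennreal C * (\<integral>\<^sup>+x. ennreal (wt (x :: 'a) powr (- real ?d)) \<partial>lborel)"
        by (rule nn_integral_cmult) measurable
      finally show ?thesis .
    qed
    also have "\<dots> < \<infinity>" using w by (simp add: ennreal_mult_less_top)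
    finally show "(\<integral>\<^sup>+z. ennreal (C * wt (fst z :: 'a) powr (- real ?d) * wt (snd z :: 'a) powr (- real ?d)) \<partial>lborel) < \<infinity>" .
  qed
qed

lemma packet_integrable:
  assumes g: "rapid g" and \<gamma>: "rapid \<gamma>"
  shows "integrable lborel (packet g \<gamma> x' \<omega>' z)"
proof (rule Bochner_Integration.integrable_bound)
  note [measurable] = rapid_measurable[OF g] rapid_measurable[OF \<gamma>] measurable_snd_borel
  show "integrable lborel (\<lambda>Y. chirp g x' \<omega>' Y * \<gamma> (snd Y - snd z))"
    by (rule chirp_integrable[OF rapid_integrable[OF g] rapid_integrable[OF \<gamma>]])
  show "packet g \<gamma> x' \<omega>' z \<in> borel_measurable lborel" unfolding packet_def[abs_def] by measurable
qed (simp add: packet_def norm_mult)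

text \<open>The Fourier transform of f is replaced by its reproducing integral, and the integral
  over z is moved outside; integrability of the short-time transform and boundedness of \<sigma>
  justify this.\<close>

lemma stft_FIO_packets:
  assumes g: "rapid g" and f: "rapid f" and \<gamma>: "rapid \<gamma>"
  shows "(LINT u|lborel. \<gamma> u * cnj (fourier g u)) * stft g (FIO \<Phi> \<sigma> f) x' \<omega>'
    = (LINT z|lborel. stft g f (fst z) (snd z) * (LINT Y|lborel. packet g \<gamma> x' \<omega>' z Y * \<sigma> Y))"
proof -
  note [measurable] = rapid_measurable[OF g] rapid_measurable[OF f] rapid_measurable[OF \<gamma>] measurable_fst_borel measurable_snd_borel
  let ?c = "LINT u|lborel. \<gamma> u * cnj (fourier g u)"
  let ?V = "\<lambda>z. stft g f (fst z) (snd z)"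
  obtain K where K: "0 \<le> K" "AE Y in lborel. norm (\<sigma> Y) \<le> K" by (rule \<sigma>_ess_bounded)
  obtain C where C: "0 \<le> C" "\<And>x. norm (\<gamma> x) \<le> C" using rapid_bound[OF \<gamma>, of 0] by auto
  have iV: "integrable lborel ?V" by (rule stft_pair_integrable[OF f g])
  let ?q = "\<lambda>\<eta> z. \<gamma> (\<eta> - snd z) * (?V z * ee (- (fst z \<bullet> (\<eta> - snd z))))"
  have rep: "fourier f \<eta> * ?c = (LINT z|lborel. ?q \<eta> z)" for \<eta>
  proof -
    have "integrable lborel (?q \<eta>)"
    proof (rule Bochner_Integration.integrable_bound)
      show "integrable lborel (\<lambda>z. C * norm (?V z))" using iV by (intro integrable_mult_right integrable_norm)
      show "?q \<eta> \<in> borel_measurable lborel" by measurable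
      show "AE z in lborel. norm (?q \<eta> z) \<le> norm (C * norm (?V z))"
        using C by (auto simp: norm_mult intro!: mult_right_mono order_trans[OF C(2) abs_ge_self])
    qed
    then have "(LINT z|lborel. ?q \<eta> z) = (LINT \<omega>|lborel. (LINT x|lborel. ?q \<eta> (x, \<omega>)))" by (rule integral_lborel_pair')
    also have "\<dots> = (LINT \<omega>|lborel. \<gamma> (\<eta> - \<omega>) * (LINT x|lborel. stft g f x \<omega> * ee (- (x \<bullet> (\<eta> - \<omega>)))))" by simp
    also have "\<dots> = fourier f \<eta> * ?c" by (rule fourier_reproduce[OF rapid_integrable[OF f] rapid_integrable[OF g]])
    finally show ?thesis by simp
  qed
  have "?c * stft g (FIO \<Phi> \<sigma> f) x' \<omega>' = (LINT Y|lborel. ?c * (chirp g x' \<omega>' Y * fourier f (snd Y) * \<sigma> Y))"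
    unfolding stft_FIO[OF g f] by simp
  also have "\<dots> = (LINT Y|lborel. (LINT z|lborel. chirp g x' \<omega>' Y * \<sigma> Y * ?q (snd Y) z))"
  proof (rule Bochner_Integration.integral_cong[OF refl])
    fix Y
    have "?c * (chirp g x' \<omega>' Y * fourier f (snd Y) * \<sigma> Y) = chirp g x' \<omega>' Y * \<sigma> Y * (fourier f (snd Y) * ?c)" by (simp only: mult_ac)
    also have "\<dots> = (LINT z|lborel. chirp g x' \<omega>' Y * \<sigma> Y * ?q (snd Y) z)" unfolding rep by (simp only: integral_mult_right_zero)
    finally show "?c * (chirp g x' \<omega>' Y * fourier f (snd Y) * \<sigma> Y) = (LINT z|lborel. chirp g x' \<omega>' Y * \<sigma> Y * ?q (snd Y) z)" .
  qed
  also have "\<dots> = (LINT z|lborel. (LINT Y|lborel. chirp g x' \<omega>' Y * \<sigma> Y * ?q (snd Y) z))"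
  proof (rule fubini_swap[symmetric])
    show "(\<lambda>(z, Y). chirp g x' \<omega>' Y * \<sigma> Y * ?q (snd Y) z) \<in> borel_measurable (borel \<Otimes>\<^sub>M borel)" by measurable
    let ?B = "ennreal K * ((\<integral>\<^sup>+y. ennreal (norm (g y)) \<partial>lborel) * (\<integral>\<^sup>+y. ennreal (norm (\<gamma> y)) \<partial>lborel))"
    have B: "(\<integral>\<^sup>+Y. ennreal (norm (chirp g x' \<omega>' Y * \<sigma> Y * ?q (snd Y) z)) \<partial>lborel) \<le> ennreal (norm (?V z)) * ?B" for z
    proof -
      have "(\<integral>\<^sup>+Y. ennreal (norm (chirp g x' \<omega>' Y * \<sigma> Y * ?q (snd Y) z)) \<partial>lborel)
        \<le> (\<integral>\<^sup>+Y. (ennreal (norm (?V z)) * ennreal K) * (ennreal (norm (g (fst Y - x'))) * ennreal (norm (\<gamma> (snd Y - snd z)))) \<partial>lborel)"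
      proof (rule nn_integral_mono_AE, use K(2) in eventually_elim)
        fix Y assume Y: "norm (\<sigma> Y) \<le> K"
        have "norm (chirp g x' \<omega>' Y * \<sigma> Y * ?q (snd Y) z) = (norm (?V z) * norm (\<sigma> Y)) * (norm (g (fst Y - x')) * norm (\<gamma> (snd Y - snd z)))"
          by (simp add: norm_mult mult_ac)
        also have "\<dots> \<le> (norm (?V z) * K) * (norm (g (fst Y - x')) * norm (\<gamma> (snd Y - snd z)))"
          by (intro mult_right_mono mult_left_mono Y) auto
        finally show "ennreal (norm (chirp g x' \<omega>' Y * \<sigma> Y * ?q (snd Y) z)) \<le> (ennreal (norm (?V z)) * ennreal K) * (ennreal (norm (g (fst Y - x'))) * ennreal (norm (\<gamma> (snd Y - snd z))))"
          using K(1) by (simp add: ennreal_mult[symmetric] ennreal_leI)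
      qed
      also have "\<dots> = (ennreal (norm (?V z)) * ennreal K) * ((\<integral>\<^sup>+y. ennreal (norm (g y)) \<partial>lborel) * (\<integral>\<^sup>+y. ennreal (norm (\<gamma> y)) \<partial>lborel))"
      proof -
        have "(\<integral>\<^sup>+Y. (ennreal (norm (?V z)) * ennreal K) * (ennreal (norm (g (fst Y - x'))) * ennreal (norm (\<gamma> (snd Y - snd z)))) \<partial>lborel)
          = (ennreal (norm (?V z)) * ennreal K) * (\<integral>\<^sup>+Y. ennreal (norm (g (fst Y - x'))) * ennreal (norm (\<gamma> (snd Y - snd z))) \<partial>lborel)"
          by (rule nn_integral_cmult) measurable
        also have "(\<integral>\<^sup>+Y. ennreal (norm (g (fst Y - x'))) * ennreal (norm (\<gamma> (snd Y - snd z))) \<partial>lborel)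
          = (\<integral>\<^sup>+y. ennreal (norm (g y)) \<partial>lborel) * (\<integral>\<^sup>+y. ennreal (norm (\<gamma> y)) \<partial>lborel)"
          by (rule nn_integral_fst_snd[OF rapid_measurable[OF g] rapid_measurable[OF \<gamma>]])
        finally show ?thesis .
      qed
      finally show ?thesis by (simp add: mult.assoc)
    qed
    have "(\<integral>\<^sup>+z. (\<integral>\<^sup>+Y. ennreal (norm (chirp g x' \<omega>' Y * \<sigma> Y * ?q (snd Y) z)) \<partial>lborel) \<partial>lborel) \<le> (\<integral>\<^sup>+z. ennreal (norm (?V z)) * ?B \<partial>lborel)"
      by (rule nn_integral_mono) (rule B)
    also have "\<dots> = (\<integral>\<^sup>+z. ennreal (norm (?V z)) \<partial>lborel) * ?B" by (rule nn_integral_multc) measurable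
    also have "\<dots> < \<infinity>"
      using iV rapid_nn_integral[OF g] rapid_nn_integral[OF \<gamma>] unfolding integrable_iff_bounded by (simp add: ennreal_mult_less_top)
    finally show "(\<integral>\<^sup>+z. (\<integral>\<^sup>+Y. ennreal (norm (chirp g x' \<omega>' Y * \<sigma> Y * ?q (snd Y) z)) \<partial>lborel) \<partial>lborel) < \<infinity>" .
  qed
  also have "\<dots> = (LINT z|lborel. ?V z * (LINT Y|lborel. packet g \<gamma> x' \<omega>' z Y * \<sigma> Y))"
    unfolding integral_mult_right_zero[symmetric] packet_def by (simp only: mult_ac)
  finally show ?thesis .
qed

definition kern :: "nat \<Rightarrow> 'a \<times> 'a \<Rightarrow> 'a \<times> 'a \<Rightarrow> ennreal" where
  "kern N z' z = (\<integral>\<^sup>+\<zeta>. S \<zeta> * ennreal (wt (\<zeta> - (snd z', fst z) + grad (fst z', snd z)) powr (- real N)) \<partial>lborel)"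

text \<open>Expanding \<sigma> by \<open>stft_reproduce\<close> leaves packets tested against
  time-frequency shifts of \<Psi>, which \<open>window_estimate\<close> controls. The decay of
  \<sigma> is known at Z, but Z is confined to a neighbourhood of (x', \<omega>), so it becomes
  decay in x'.\<close>

lemma packet_bound:
  assumes g: "rapid g" and \<gamma>: "rapid \<gamma>"
  obtains C where "0 \<le> C"
    "\<And>x' \<omega>' z. ennreal (norm (LINT Y|lborel. packet g \<gamma> x' \<omega>' z Y * \<sigma> Y)) \<le> ennreal C * ennreal (wt x' powr (- s)) * kern N (x', \<omega>') z"
proof -
  define r where "r = real DIM('a \<times> 'a) + 1"
  \<comment> \<open>The share s moves the weight from Z to x', the share r makes the integral over Z
    converge.\<close>
  define M where "M = s + r"
  have M0: "0 \<le> M" using s_nonneg by (simp add: M_def r_def)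
  obtain C where C: "0 \<le> C"
    "\<And>Z \<zeta> x' \<omega>' x \<omega>. norm (LINT Y|lborel. (ee (- (\<omega>' \<bullet> fst Y)) * cnj (g (fst Y - x')) * ee (\<Phi> Y) * (\<gamma> (snd Y - \<omega>) * ee (- (x \<bullet> (snd Y - \<omega>))))) * \<Psi> (Y - Z) * ee (\<zeta> \<bullet> Y))
      \<le> C * wt (\<zeta> - (\<omega>', x) + grad (x', \<omega>)) powr (- real N) * wt (Z - (x', \<omega>)) powr (- M)"
    by (rule window_estimate[OF \<Psi> g \<gamma> M0, of N]) blast
  obtain K where K: "0 \<le> K" "AE Y in lborel. norm (\<sigma> Y) \<le> K" by (rule \<sigma>_ess_bounded)
  have w0: "window_sq \<Psi> \<noteq> 0" by (rule window_sq_nonzero[OF \<Psi> \<Psi>_nz])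
  have Ifin: "(\<integral>\<^sup>+Z. ennreal (wt (Z :: 'a \<times> 'a) powr (- r)) \<partial>lborel) < \<infinity>" by (rule wt_powr_neg_nn_integral) (simp add: r_def)
  then obtain I where I: "0 \<le> I" "(\<integral>\<^sup>+Z. ennreal (wt (Z :: 'a \<times> 'a) powr (- r)) \<partial>lborel) = ennreal I"
    by (cases "\<integral>\<^sup>+Z. ennreal (wt (Z :: 'a \<times> 'a) powr (- r)) \<partial>lborel") auto
  define D where "D = C * 2 powr s * I / norm (window_sq \<Psi>)"
  have D0: "0 \<le> D" using C(1) I(1) by (simp add: D_def)
  have "ennreal (norm (LINT Y|lborel. packet g \<gamma> x' \<omega>' z Y * \<sigma> Y)) \<le> ennreal D * ennreal (wt x' powr (- s)) * kern N (x', \<omega>') z" for x' \<omega>' z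
  proof -
    note [measurable] = measurable_fst_borel
    let ?P = "LINT Y|lborel. packet g \<gamma> x' \<omega>' z Y * \<sigma> Y"
    let ?J = "\<lambda>Z \<zeta>. LINT Y|lborel. packet g \<gamma> x' \<omega>' z Y * \<Psi> (Y - Z) * ee (\<zeta> \<bullet> Y)"
    let ?Y0 = "(x', snd z)"
    let ?k = "\<lambda>\<zeta>. wt (\<zeta> - (\<omega>', fst z) + grad ?Y0) powr (- real N)"
    have J: "norm (?J Z \<zeta>) \<le> C * ?k \<zeta> * wt (Z - ?Y0) powr (- M)" for Z \<zeta>
      unfolding packet_def chirp_def by (rule C(2))
    have "ennreal (norm (window_sq \<Psi>)) * ennreal (norm ?P) = ennreal (norm (window_sq \<Psi> * ?P))"
      by (simp add: norm_mult ennreal_mult)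
    also have "window_sq \<Psi> * ?P = (LINT Z|lborel. (LINT \<zeta>|lborel. stft \<Psi> \<sigma> Z \<zeta> * ?J Z \<zeta>))"
      by (rule stft_reproduce[OF \<Psi> \<sigma>_measurable K(2) packet_integrable[OF g \<gamma>]]) (simp add: stft_\<sigma>_integrable)
    also have "ennreal (norm \<dots>) \<le> (\<integral>\<^sup>+Z. ennreal (norm (LINT \<zeta>|lborel. stft \<Psi> \<sigma> Z \<zeta> * ?J Z \<zeta>)) \<partial>lborel)"
      by (rule ennreal_norm_integral_le)
    also have "\<dots> \<le> (\<integral>\<^sup>+Z. (\<integral>\<^sup>+\<zeta>. ennreal (norm (stft \<Psi> \<sigma> Z \<zeta> * ?J Z \<zeta>)) \<partial>lborel) \<partial>lborel)"
      by (intro nn_integral_mono ennreal_norm_integral_le)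
    also have "\<dots> \<le> (\<integral>\<^sup>+Z. (\<integral>\<^sup>+\<zeta>. ennreal (C * 2 powr s * (wt (fst Z) powr (- s) * wt (Z - ?Y0) powr (- M))) * (S \<zeta> * ennreal (?k \<zeta>)) \<partial>lborel) \<partial>lborel)"
    proof (intro nn_integral_mono)
      fix Z \<zeta>
      have "ennreal (norm (stft \<Psi> \<sigma> Z \<zeta> * ?J Z \<zeta>)) = ennreal (norm (stft \<Psi> \<sigma> Z \<zeta>)) * ennreal (norm (?J Z \<zeta>))"
        by (simp add: norm_mult ennreal_mult)
      also have "\<dots> \<le> (S \<zeta> * ennreal (2 powr s * wt (fst Z) powr (- s))) * ennreal (C * ?k \<zeta> * wt (Z - ?Y0) powr (- M))"
        by (intro mult_mono S_bound ennreal_leI J) auto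
      also have "\<dots> = ennreal (C * 2 powr s * (wt (fst Z) powr (- s) * wt (Z - ?Y0) powr (- M))) * (S \<zeta> * ennreal (?k \<zeta>))"
        using C(1) by (simp add: ennreal_mult mult_ac)
      finally show "ennreal (norm (stft \<Psi> \<sigma> Z \<zeta> * ?J Z \<zeta>)) \<le> ennreal (C * 2 powr s * (wt (fst Z) powr (- s) * wt (Z - ?Y0) powr (- M))) * (S \<zeta> * ennreal (?k \<zeta>))" .
    qed
    also have "\<dots> = (\<integral>\<^sup>+Z. ennreal (C * 2 powr s * (wt (fst Z) powr (- s) * wt (Z - ?Y0) powr (- M))) * kern N (x', \<omega>') z \<partial>lborel)"
      unfolding kern_def fst_conv snd_conv by (intro nn_integral_cong nn_integral_cmult) measurable
    also have "\<dots> \<le> (\<integral>\<^sup>+Z. ennreal (C * 2 powr s * wt x' powr (- s)) * ennreal (wt (Z - ?Y0) powr (- r)) * kern N (x', \<omega>') z \<partial>lborel)"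
    proof (intro nn_integral_mono mult_right_mono)
      fix Z :: "'a \<times> 'a"
      have "wt (fst Z) powr (- s) * wt (Z - ?Y0) powr (- s) \<le> wt x' powr (- s)"
      proof -
        have "wt (Z - ?Y0) powr (- s) \<le> wt (fst Z - x') powr (- s)"
          using s_nonneg wt_fst[of "Z - ?Y0"] by (intro powr_mono2') auto
        then have "wt (fst Z) powr (- s) * wt (Z - ?Y0) powr (- s) \<le> wt (fst Z) powr (- s) * wt (fst Z - x') powr (- s)"
          by (intro mult_left_mono) auto
        also have "\<dots> \<le> wt x' powr (- s)" by (rule wt_peetre[OF s_nonneg])
        finally show ?thesis .
      qed
      then have "(wt (fst Z) powr (- s) * wt (Z - ?Y0) powr (- s)) * wt (Z - ?Y0) powr (- r) \<le> wt x' powr (- s) * wt (Z - ?Y0) powr (- r)"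
        by (intro mult_right_mono) auto
      moreover have "wt (Z - ?Y0) powr (- M) = wt (Z - ?Y0) powr (- s) * wt (Z - ?Y0) powr (- r)"
        by (simp add: powr_add[symmetric] M_def)
      ultimately have "C * 2 powr s * (wt (fst Z) powr (- s) * wt (Z - ?Y0) powr (- M)) \<le> C * 2 powr s * (wt x' powr (- s) * wt (Z - ?Y0) powr (- r))"
        using C(1) by (intro mult_left_mono) (auto simp: mult.assoc)
      then show "ennreal (C * 2 powr s * (wt (fst Z) powr (- s) * wt (Z - ?Y0) powr (- M))) \<le> ennreal (C * 2 powr s * wt x' powr (- s)) * ennreal (wt (Z - ?Y0) powr (- r))"
        using C(1) by (simp add: ennreal_mult[symmetric] ennreal_leI mult.assoc)
    qed simp
    also have "\<dots> = ennreal (C * 2 powr s * wt x' powr (- s)) * ennreal I * kern N (x', \<omega>') z"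
    proof -
      have "(\<integral>\<^sup>+Z. ennreal (C * 2 powr s * wt x' powr (- s)) * ennreal (wt (Z - ?Y0) powr (- r)) * kern N (x', \<omega>') z \<partial>lborel)
        = (\<integral>\<^sup>+Z. ennreal (C * 2 powr s * wt x' powr (- s)) * ennreal (wt (Z - ?Y0) powr (- r)) \<partial>lborel) * kern N (x', \<omega>') z"
        by (rule nn_integral_multc) measurable
      also have "(\<integral>\<^sup>+Z. ennreal (C * 2 powr s * wt x' powr (- s)) * ennreal (wt (Z - ?Y0) powr (- r)) \<partial>lborel)
        = ennreal (C * 2 powr s * wt x' powr (- s)) * (\<integral>\<^sup>+Z. ennreal (wt (Z - ?Y0) powr (- r)) \<partial>lborel)"
        by (rule nn_integral_cmult) measurable
      also have "(\<integral>\<^sup>+Z. ennreal (wt (Z - ?Y0) powr (- r)) \<partial>lborel) = ennreal I"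
        unfolding I(2)[symmetric] by (rule nn_integral_translate_diff) measurable
      finally show ?thesis .
    qed
    finally have "ennreal (norm (window_sq \<Psi>)) * ennreal (norm ?P) \<le> ennreal (C * 2 powr s * wt x' powr (- s)) * ennreal I * kern N (x', \<omega>') z" .
    then have "ennreal (1 / norm (window_sq \<Psi>)) * (ennreal (norm (window_sq \<Psi>)) * ennreal (norm ?P)) \<le> ennreal (1 / norm (window_sq \<Psi>)) * (ennreal (C * 2 powr s * wt x' powr (- s)) * ennreal I * kern N (x', \<omega>') z)"
      by (intro mult_left_mono) auto
    moreover have "ennreal (1 / norm (window_sq \<Psi>)) * (ennreal (norm (window_sq \<Psi>)) * ennreal (norm ?P)) = ennreal (norm ?P)"
      using w0 by (simp add: ennreal_mult[symmetric])
    moreover have "ennreal (1 / norm (window_sq \<Psi>)) * (ennreal (C * 2 powr s * wt x' powr (- s)) * ennreal I * kern N (x', \<omega>') z) = ennreal D * ennreal (wt x' powr (- s)) * kern N (x', \<omega>') z"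
    proof -
      have "ennreal (1 / norm (window_sq \<Psi>)) * (ennreal (C * 2 powr s * wt x' powr (- s)) * ennreal I) = ennreal (1 / norm (window_sq \<Psi>) * (C * 2 powr s * wt x' powr (- s) * I))"
        using C(1) I(1) by (simp add: ennreal_mult[symmetric])
      also have "1 / norm (window_sq \<Psi>) * (C * 2 powr s * wt x' powr (- s) * I) = D * wt x' powr (- s)"
        by (simp add: D_def)
      also have "ennreal (D * wt x' powr (- s)) = ennreal D * ennreal (wt x' powr (- s))"
        using D0 by (intro ennreal_mult) auto
      finally have "(ennreal (1 / norm (window_sq \<Psi>)) * (ennreal (C * 2 powr s * wt x' powr (- s)) * ennreal I)) * kern N (x', \<omega>') z = ennreal D * ennreal (wt x' powr (- s)) * kern N (x', \<omega>') z"
        by (rule arg_cong)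
      then show ?thesis by (simp only: mult.assoc)
    qed
    ultimately show ?thesis by simp
  qed
  with D0 show thesis by (rule that)
qed

text \<open>The dual window and hence C depend only on g, N and the operator, so the bound is
  uniform in f.\<close>

theorem stft_FIO_bound:
  assumes g: "rapid g" and nz: "g \<noteq> (\<lambda>_. 0)"
  obtains C where "0 \<le> C"
    "\<And>f x' \<omega>'. rapid f \<Longrightarrow> ennreal (norm (stft g (FIO \<Phi> \<sigma> f) x' \<omega>'))
       \<le> ennreal C * ennreal (wt x' powr (- s)) * (\<integral>\<^sup>+z. ennreal (norm (stft g f (fst z) (snd z))) * kern N (x', \<omega>') z \<partial>lborel)"
proof -
  obtain \<gamma> where \<gamma>: "rapid \<gamma>" "(LINT u|lborel. \<gamma> u * cnj (fourier g u)) \<noteq> 0" by (rule exists_dual_window[OF g nz])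
  let ?c = "LINT u|lborel. \<gamma> u * cnj (fourier g u)"
  obtain C where C: "0 \<le> C"
    "\<And>x' \<omega>' z. ennreal (norm (LINT Y|lborel. packet g \<gamma> x' \<omega>' z Y * \<sigma> Y)) \<le> ennreal C * ennreal (wt x' powr (- s)) * kern N (x', \<omega>') z"
    by (rule packet_bound[OF g \<gamma>(1), of N]) blast
  have "ennreal (norm (stft g (FIO \<Phi> \<sigma> f) x' \<omega>'))
       \<le> ennreal (C / norm ?c) * ennreal (wt x' powr (- s)) * (\<integral>\<^sup>+z. ennreal (norm (stft g f (fst z) (snd z))) * kern N (x', \<omega>') z \<partial>lborel)"
    if f: "rapid f" for f x' \<omega>'
  proof -
    note [measurable] = rapid_measurable[OF g] rapid_measurable[OF f] measurable_fst_borel measurable_snd_borel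
    have [measurable]: "(\<lambda>z. kern N (x', \<omega>') z) \<in> borel_measurable borel" unfolding kern_def by measurable
    let ?V = "\<lambda>z. stft g f (fst z) (snd z)"
    let ?T = "stft g (FIO \<Phi> \<sigma> f) x' \<omega>'"
    let ?w = "ennreal C * ennreal (wt x' powr (- s))"
    have "ennreal (norm ?c) * ennreal (norm ?T) = ennreal (norm (?c * ?T))" by (simp add: norm_mult ennreal_mult)
    also have "?c * ?T = (LINT z|lborel. ?V z * (LINT Y|lborel. packet g \<gamma> x' \<omega>' z Y * \<sigma> Y))"
      by (rule stft_FIO_packets[OF g f \<gamma>(1)])
    also have "ennreal (norm \<dots>) \<le> (\<integral>\<^sup>+z. ennreal (norm (?V z * (LINT Y|lborel. packet g \<gamma> x' \<omega>' z Y * \<sigma> Y))) \<partial>lborel)"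
      by (rule ennreal_norm_integral_le)
    also have "\<dots> \<le> (\<integral>\<^sup>+z. ?w * (ennreal (norm (?V z)) * kern N (x', \<omega>') z) \<partial>lborel)"
    proof (rule nn_integral_mono)
      fix z
      have "ennreal (norm (?V z * (LINT Y|lborel. packet g \<gamma> x' \<omega>' z Y * \<sigma> Y))) = ennreal (norm (?V z)) * ennreal (norm (LINT Y|lborel. packet g \<gamma> x' \<omega>' z Y * \<sigma> Y))"
        by (simp add: norm_mult ennreal_mult)
      also have "\<dots> \<le> ennreal (norm (?V z)) * (?w * kern N (x', \<omega>') z)" by (intro mult_left_mono C(2)) auto
      finally show "ennreal (norm (?V z * (LINT Y|lborel. packet g \<gamma> x' \<omega>' z Y * \<sigma> Y))) \<le> ?w * (ennreal (norm (?V z)) * kern N (x', \<omega>') z)"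
        by (simp only: mult_ac)
    qed
    also have "\<dots> = ?w * (\<integral>\<^sup>+z. ennreal (norm (?V z)) * kern N (x', \<omega>') z \<partial>lborel)" by (rule nn_integral_cmult) measurable
    finally have "ennreal (1 / norm ?c) * (ennreal (norm ?c) * ennreal (norm ?T)) \<le> ennreal (1 / norm ?c) * (?w * (\<integral>\<^sup>+z. ennreal (norm (?V z)) * kern N (x', \<omega>') z \<partial>lborel))"
      by (intro mult_left_mono) auto
    moreover have "ennreal (1 / norm ?c) * (ennreal (norm ?c) * ennreal (norm ?T)) = ennreal (norm ?T)"
      using \<gamma>(2) by (simp add: ennreal_mult[symmetric])
    moreover have "ennreal (1 / norm ?c) * (?w * (\<integral>\<^sup>+z. ennreal (norm (?V z)) * kern N (x', \<omega>') z \<partial>lborel)) = ennreal (C / norm ?c) * ennreal (wt x' powr (- s)) * (\<integral>\<^sup>+z. ennreal (norm (?V z)) * kern N (x', \<omega>') z \<partial>lborel)"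
    proof -
      have "ennreal (1 / norm ?c) * ennreal C = ennreal (C / norm ?c)"
        using C(1) by (simp add: ennreal_mult[symmetric])
      then have "(ennreal (1 / norm ?c) * ennreal C) * (ennreal (wt x' powr (- s)) * (\<integral>\<^sup>+z. ennreal (norm (?V z)) * kern N (x', \<omega>') z \<partial>lborel))
        = ennreal (C / norm ?c) * (ennreal (wt x' powr (- s)) * (\<integral>\<^sup>+z. ennreal (norm (?V z)) * kern N (x', \<omega>') z \<partial>lborel))"
        by (rule arg_cong)
      then show ?thesis by (simp only: mult.assoc)
    qed
    ultimately show ?thesis by simp
  qed
  moreover have "0 \<le> C / norm ?c" using C(1) by simp
  ultimately show thesis by (rule that[rotated])
qed

end

section \<open>Row, column and weighted integrals of the kernel\<close>

context fio
begin

text \<open>The two halves of the split weight, one for each component of the defect.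
  \<open>k1\<close> does not contain x and \<open>k2\<close> does not contain \<omega>', so one of
  them can always be integrated out by translation.\<close>

definition k1 :: "'a \<times> 'a \<Rightarrow> 'a \<Rightarrow> 'a \<Rightarrow> 'a \<Rightarrow> ennreal" where
  "k1 \<zeta> x' \<omega>' \<omega> = ennreal (wt ((\<omega>' - fst \<zeta>) - fst (grad (x', \<omega>))) powr (- (real DIM('a) + 1)))"
definition k2 :: "'a \<times> 'a \<Rightarrow> 'a \<Rightarrow> 'a \<Rightarrow> 'a \<Rightarrow> ennreal" where
  "k2 \<zeta> x' x \<omega> = ennreal (wt ((x - snd \<zeta>) - snd (grad (x', \<omega>))) powr (- (real DIM('a) + 1)))"

lemma measurable_k1 [measurable (raw)]:
  assumes [measurable]: "A \<in> M \<rightarrow>\<^sub>M borel" "B \<in> M \<rightarrow>\<^sub>M borel" "C \<in> M \<rightarrow>\<^sub>M borel" "D \<in> M \<rightarrow>\<^sub>M borel"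
  shows "(\<lambda>t. k1 (A t) (B t) (C t) (D t)) \<in> borel_measurable M"
proof -
  note [measurable] = measurable_fst_borel measurable_snd_borel
  show ?thesis unfolding k1_def by measurable
qed

lemma measurable_k2 [measurable (raw)]:
  assumes [measurable]: "A \<in> M \<rightarrow>\<^sub>M borel" "B \<in> M \<rightarrow>\<^sub>M borel" "C \<in> M \<rightarrow>\<^sub>M borel" "D \<in> M \<rightarrow>\<^sub>M borel"
  shows "(\<lambda>t. k2 (A t) (B t) (C t) (D t)) \<in> borel_measurable M"
proof -
  note [measurable] = measurable_fst_borel measurable_snd_borel
  show ?thesis unfolding k2_def by measurable
qed

lemma measurable_kern: "(\<lambda>(z', z). kern m z' z) \<in> borel_measurable (borel \<Otimes>\<^sub>M borel)"
proof -
  note [measurable] = measurable_fst_borel measurable_snd_borel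
  show ?thesis unfolding kern_def by measurable
qed

lemma kern_le: "kern (2 * (DIM('a) + 1)) (x', \<omega>') (x, \<omega>) \<le> (\<integral>\<^sup>+\<zeta>. S \<zeta> * (k1 \<zeta> x' \<omega>' \<omega> * k2 \<zeta> x' x \<omega>) \<partial>lborel)"
  unfolding kern_def
proof (intro nn_integral_mono mult_left_mono)
  fix \<zeta> :: "'a \<times> 'a"
  let ?v = "\<zeta> - (snd (x', \<omega>'), fst (x, \<omega>)) + grad (fst (x', \<omega>'), snd (x, \<omega>))"
  have "wt ?v powr (- real (2 * (DIM('a) + 1))) = wt ?v powr (- 2 * (real DIM('a) + 1))" by (simp add: algebra_simps)
  also have "\<dots> \<le> wt (fst ?v) powr (- (real DIM('a) + 1)) * wt (snd ?v) powr (- (real DIM('a) + 1))" by (rule wt_powr_neg_Pair) simp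
  also have "wt (fst ?v) = wt ((\<omega>' - fst \<zeta>) - fst (grad (x', \<omega>)))"
    using wt_minus[of "fst ?v"] by (simp add: algebra_simps)
  also have "wt (snd ?v) = wt ((x - snd \<zeta>) - snd (grad (x', \<omega>)))"
    using wt_minus[of "snd ?v"] by (simp add: algebra_simps)
  finally show "ennreal (wt ?v powr (- real (2 * (DIM('a) + 1)))) \<le> k1 \<zeta> x' \<omega>' \<omega> * k2 \<zeta> x' x \<omega>"
    unfolding k1_def k2_def by (subst ennreal_mult[symmetric]) (auto intro: ennreal_leI)
qed simp

definition J where "J = (\<integral>\<^sup>+t. ennreal (wt (t :: 'a) powr (- (real DIM('a) + 1))) \<partial>lborel)"

lemma J_finite: "J < \<infinity>" unfolding J_def by (rule wt_powr_neg_nn_integral) simp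

lemma k2_x: "(\<integral>\<^sup>+x. k2 \<zeta> x' x \<omega> \<partial>lborel) = J"
  unfolding k2_def J_def diff_diff_eq by (rule nn_integral_translate_diff[of "\<lambda>t. ennreal (wt t powr (- (real DIM('a) + 1)))"]) measurable

lemma k1_\<omega>': "(\<integral>\<^sup>+\<omega>'. k1 \<zeta> x' \<omega>' \<omega> \<partial>lborel) = J"
  unfolding k1_def J_def diff_diff_eq by (rule nn_integral_translate_diff[of "\<lambda>t. ennreal (wt t powr (- (real DIM('a) + 1)))"]) measurable

text \<open>Integrating in x first uses up \<open>k2\<close>. What remains is an integral in
  \<omega> along the x-gradient at fixed x', which the nondegenerate mixed Hessian will
  bound.\<close>

lemma kern_row:
  assumes c: "\<And>v x'. (\<integral>\<^sup>+\<omega>. ennreal (wt (v - fst (grad (x', \<omega>))) powr (- (real DIM('a) + 1))) \<partial>lborel) \<le> C"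
  shows "(\<integral>\<^sup>+z. kern (2 * (DIM('a) + 1)) z' z \<partial>lborel) \<le> (\<integral>\<^sup>+\<zeta>. S \<zeta> \<partial>lborel) * (C * J)"
proof -
  note [measurable] = measurable_kern
  obtain x' \<omega>' where z': "z' = (x', \<omega>')" by (cases z')
  have "(\<integral>\<^sup>+z. kern (2 * (DIM('a) + 1)) z' z \<partial>lborel) = (\<integral>\<^sup>+x. (\<integral>\<^sup>+\<omega>. kern (2 * (DIM('a) + 1)) z' (x, \<omega>) \<partial>lborel) \<partial>lborel)"
    by (rule nn_integral_lborel_pair) measurable
  also have "\<dots> = (\<integral>\<^sup>+\<omega>. (\<integral>\<^sup>+x. kern (2 * (DIM('a) + 1)) z' (x, \<omega>) \<partial>lborel) \<partial>lborel)"
    by (rule nn_integral_lborel_swap) measurable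
  also have "\<dots> \<le> (\<integral>\<^sup>+\<omega>. (\<integral>\<^sup>+x. (\<integral>\<^sup>+\<zeta>. S \<zeta> * (k1 \<zeta> x' \<omega>' \<omega> * k2 \<zeta> x' x \<omega>) \<partial>lborel) \<partial>lborel) \<partial>lborel)"
    unfolding z' by (intro nn_integral_mono kern_le)
  also have "\<dots> = (\<integral>\<^sup>+\<omega>. (\<integral>\<^sup>+\<zeta>. (\<integral>\<^sup>+x. S \<zeta> * (k1 \<zeta> x' \<omega>' \<omega> * k2 \<zeta> x' x \<omega>) \<partial>lborel) \<partial>lborel) \<partial>lborel)"
    by (intro nn_integral_cong nn_integral_lborel_swap) measurable
  also have "\<dots> = (\<integral>\<^sup>+\<omega>. (\<integral>\<^sup>+\<zeta>. S \<zeta> * (k1 \<zeta> x' \<omega>' \<omega> * J) \<partial>lborel) \<partial>lborel)"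
    by (simp add: nn_integral_cmult k2_x)
  also have "\<dots> = (\<integral>\<^sup>+\<zeta>. (\<integral>\<^sup>+\<omega>. S \<zeta> * (k1 \<zeta> x' \<omega>' \<omega> * J) \<partial>lborel) \<partial>lborel)"
    by (rule nn_integral_lborel_swap) measurable
  also have "\<dots> = (\<integral>\<^sup>+\<zeta>. S \<zeta> * ((\<integral>\<^sup>+\<omega>. k1 \<zeta> x' \<omega>' \<omega> \<partial>lborel) * J) \<partial>lborel)"
    by (simp add: nn_integral_cmult nn_integral_multc)
  also have "\<dots> \<le> (\<integral>\<^sup>+\<zeta>. S \<zeta> * (C * J) \<partial>lborel)"
    unfolding k1_def by (intro nn_integral_mono mult_left_mono mult_right_mono c) auto
  also have "\<dots> = (\<integral>\<^sup>+\<zeta>. S \<zeta> \<partial>lborel) * (C * J)" by (rule nn_integral_multc) measurable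
  finally show ?thesis .
qed

text \<open>Here \<omega>' is integrated first and uses up \<open>k1\<close>; the rest is an
  integral in x' along the \<eta>-gradient at fixed \<omega>, again a matter of the mixed
  Hessian.\<close>

lemma kern_column:
  assumes c: "\<And>v \<omega>. (\<integral>\<^sup>+x'. ennreal (wt (v - snd (grad (x', \<omega>))) powr (- (real DIM('a) + 1))) \<partial>lborel) \<le> C"
  shows "(\<integral>\<^sup>+z'. kern (2 * (DIM('a) + 1)) z' z \<partial>lborel) \<le> (\<integral>\<^sup>+\<zeta>. S \<zeta> \<partial>lborel) * (C * J)"
proof -
  note [measurable] = measurable_kern
  obtain x \<omega> where z: "z = (x, \<omega>)" by (cases z)
  have "(\<integral>\<^sup>+z'. kern (2 * (DIM('a) + 1)) z' z \<partial>lborel) = (\<integral>\<^sup>+x'. (\<integral>\<^sup>+\<omega>'. kern (2 * (DIM('a) + 1)) (x', \<omega>') z \<partial>lborel) \<partial>lborel)"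
    by (rule nn_integral_lborel_pair) measurable
  also have "\<dots> \<le> (\<integral>\<^sup>+x'. (\<integral>\<^sup>+\<omega>'. (\<integral>\<^sup>+\<zeta>. S \<zeta> * (k1 \<zeta> x' \<omega>' \<omega> * k2 \<zeta> x' x \<omega>) \<partial>lborel) \<partial>lborel) \<partial>lborel)"
    unfolding z by (intro nn_integral_mono kern_le)
  also have "\<dots> = (\<integral>\<^sup>+x'. (\<integral>\<^sup>+\<zeta>. (\<integral>\<^sup>+\<omega>'. S \<zeta> * (k1 \<zeta> x' \<omega>' \<omega> * k2 \<zeta> x' x \<omega>) \<partial>lborel) \<partial>lborel) \<partial>lborel)"
    by (intro nn_integral_cong nn_integral_lborel_swap) measurable
  also have "\<dots> = (\<integral>\<^sup>+x'. (\<integral>\<^sup>+\<zeta>. S \<zeta> * (J * k2 \<zeta> x' x \<omega>) \<partial>lborel) \<partial>lborel)"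
    by (simp add: nn_integral_cmult nn_integral_multc k1_\<omega>')
  also have "\<dots> = (\<integral>\<^sup>+\<zeta>. (\<integral>\<^sup>+x'. S \<zeta> * (J * k2 \<zeta> x' x \<omega>) \<partial>lborel) \<partial>lborel)"
    by (rule nn_integral_lborel_swap) measurable
  also have "\<dots> = (\<integral>\<^sup>+\<zeta>. S \<zeta> * (J * (\<integral>\<^sup>+x'. k2 \<zeta> x' x \<omega> \<partial>lborel)) \<partial>lborel)"
    by (simp add: nn_integral_cmult)
  also have "\<dots> \<le> (\<integral>\<^sup>+\<zeta>. S \<zeta> * (J * C) \<partial>lborel)"
    unfolding k2_def by (intro nn_integral_mono mult_left_mono c) auto
  also have "\<dots> = (\<integral>\<^sup>+\<zeta>. S \<zeta> \<partial>lborel) * (J * C)" by (rule nn_integral_multc) measurable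
  finally show ?thesis by (simp add: mult.commute)
qed

text \<open>After x is integrated out, x' runs along the x-gradient at fixed \<omega>. The mixed
  Hessian says nothing about this map, and here the two alternatives of the theorem take effect:
  nondegeneracy in x, or an integrable l.\<close>

lemma kern_weighted:
  assumes [measurable]: "l \<in> borel_measurable borel"
    and c: "\<And>v \<omega>. (\<integral>\<^sup>+x'. l x' * ennreal (wt (v - fst (grad (x', \<omega>))) powr (- (real DIM('a) + 1))) \<partial>lborel) \<le> C"
  shows "(\<integral>\<^sup>+x'. l x' * (\<integral>\<^sup>+x. kern (2 * (DIM('a) + 1)) (x', \<omega>') (x, \<omega>) \<partial>lborel) \<partial>lborel) \<le> (\<integral>\<^sup>+\<zeta>. S \<zeta> \<partial>lborel) * (C * J)"
proof -
  note [measurable] = measurable_kern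
  have "(\<integral>\<^sup>+x'. l x' * (\<integral>\<^sup>+x. kern (2 * (DIM('a) + 1)) (x', \<omega>') (x, \<omega>) \<partial>lborel) \<partial>lborel)
    \<le> (\<integral>\<^sup>+x'. l x' * (\<integral>\<^sup>+x. (\<integral>\<^sup>+\<zeta>. S \<zeta> * (k1 \<zeta> x' \<omega>' \<omega> * k2 \<zeta> x' x \<omega>) \<partial>lborel) \<partial>lborel) \<partial>lborel)"
    by (intro nn_integral_mono mult_left_mono kern_le) auto
  also have "\<dots> = (\<integral>\<^sup>+x'. l x' * (\<integral>\<^sup>+\<zeta>. (\<integral>\<^sup>+x. S \<zeta> * (k1 \<zeta> x' \<omega>' \<omega> * k2 \<zeta> x' x \<omega>) \<partial>lborel) \<partial>lborel) \<partial>lborel)"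
    by (intro nn_integral_cong arg_cong2[where f="(*)"] refl nn_integral_lborel_swap) measurable
  also have "\<dots> = (\<integral>\<^sup>+x'. l x' * (\<integral>\<^sup>+\<zeta>. S \<zeta> * (k1 \<zeta> x' \<omega>' \<omega> * J) \<partial>lborel) \<partial>lborel)"
    by (simp add: nn_integral_cmult k2_x)
  also have "\<dots> = (\<integral>\<^sup>+x'. (\<integral>\<^sup>+\<zeta>. (S \<zeta> * J) * (l x' * k1 \<zeta> x' \<omega>' \<omega>) \<partial>lborel) \<partial>lborel)"
    by (subst nn_integral_cmult[symmetric]) (simp_all add: mult_ac)
  also have "\<dots> = (\<integral>\<^sup>+\<zeta>. (\<integral>\<^sup>+x'. (S \<zeta> * J) * (l x' * k1 \<zeta> x' \<omega>' \<omega>) \<partial>lborel) \<partial>lborel)"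
    by (rule nn_integral_lborel_swap) measurable
  also have "\<dots> = (\<integral>\<^sup>+\<zeta>. (S \<zeta> * J) * (\<integral>\<^sup>+x'. l x' * k1 \<zeta> x' \<omega>' \<omega> \<partial>lborel) \<partial>lborel)"
    by (intro nn_integral_cong nn_integral_cmult) measurable
  also have "\<dots> \<le> (\<integral>\<^sup>+\<zeta>. (S \<zeta> * J) * C \<partial>lborel)"
    unfolding k1_def by (intro nn_integral_mono mult_left_mono c) auto
  also have "\<dots> = (\<integral>\<^sup>+\<zeta>. S \<zeta> * (C * J) \<partial>lborel)" by (simp add: mult_ac)
  also have "\<dots> = (\<integral>\<^sup>+\<zeta>. S \<zeta> \<partial>lborel) * (C * J)" by (rule nn_integral_multc) measurable
  finally show ?thesis .
qed

end

section \<open>Measurability and elementary bounds for mixed norms\<close>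

lemma continuous_on_stft_fst:
  fixes f g :: "'a::euclidean_space \<Rightarrow> complex"
  assumes f: "rapid f" and g: "rapid g"
  shows "continuous_on UNIV (\<lambda>x. stft g f x \<omega>)"
proof (rule continuous_at_imp_continuous_on, intro ballI)
  fix x :: 'a
  note [measurable] = rapid_measurable[OF f] rapid_measurable[OF g]
  obtain C where C: "0 \<le> C" "\<And>x. norm (g x) \<le> C" using rapid_bound[OF g, of 0] by auto
  show "isCont (\<lambda>x. stft g f x \<omega>) x"
    unfolding continuous_at_sequentially
  proof (intro allI impI)
    fix X :: "nat \<Rightarrow> 'a" assume X: "X \<longlonglongrightarrow> x"
    show "((\<lambda>x. stft g f x \<omega>) \<circ> X) \<longlonglongrightarrow> stft g f x \<omega>"
      unfolding o_def stft_eq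
    proof (rule integral_dominated_convergence[where w="\<lambda>y. C * norm (f y)"])
      show "AE y in lborel. (\<lambda>n. ee (- (\<omega> \<bullet> y)) * f y * cnj (g (y - X n))) \<longlonglongrightarrow> ee (- (\<omega> \<bullet> y)) * f y * cnj (g (y - x))"
      proof (rule AE_I2)
        fix y :: 'a
        have "(\<lambda>n. y - X n) \<longlonglongrightarrow> y - x" by (intro tendsto_intros X)
        then have "(\<lambda>n. g (y - X n)) \<longlonglongrightarrow> g (y - x)"
          by (rule continuous_on_tendsto_compose[OF rapid_continuous[OF g, of UNIV]]) auto
        then show "(\<lambda>n. ee (- (\<omega> \<bullet> y)) * f y * cnj (g (y - X n))) \<longlonglongrightarrow> ee (- (\<omega> \<bullet> y)) * f y * cnj (g (y - x))"
          by (intro tendsto_intros)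
      qed
      show "integrable lborel (\<lambda>y. C * norm (f y))" using rapid_integrable[OF f] by simp
      show "AE y in lborel. norm (ee (- (\<omega> \<bullet> y)) * f y * cnj (g (y - X n))) \<le> C * norm (f y)" for n
      proof (rule AE_I2)
        fix y
        have "norm (f y) * norm (g (y - X n)) \<le> norm (f y) * C" by (intro mult_left_mono C(2)) auto
        then show "norm (ee (- (\<omega> \<bullet> y)) * f y * cnj (g (y - X n))) \<le> C * norm (f y)" by (simp add: norm_mult mult.commute)
      qed
    qed measurable
  qed
qed

lemma continuous_on_stft_snd:
  fixes f g :: "'a::euclidean_space \<Rightarrow> complex"
  assumes f: "rapid f" and g: "rapid g"
  shows "continuous_on UNIV (\<lambda>\<omega>. stft g f x \<omega>)"
proof -
  obtain C where C: "0 \<le> C" "\<And>x. norm (g x) \<le> C" using rapid_bound[OF g, of 0] by auto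
  note [measurable] = rapid_measurable[OF g]
  have m: "(\<lambda>y. cnj (g (y - x))) \<in> borel_measurable borel" by measurable
  have "integrable lborel (\<lambda>y. f y * cnj (g (y - x)))"
    by (rule integrable_mult_ess_bounded[OF rapid_integrable[OF f] m, of C]) (use C in auto)
  from continuous_on_fourier[OF this] show ?thesis unfolding stft_as_fourier .
qed

lemma esssup_continuous:
  fixes h :: "'a::euclidean_space \<Rightarrow> ennreal"
  assumes c: "continuous_on UNIV h"
  shows "esssup lborel h = (SUP x. h x)"
proof (rule antisym)
  have [measurable]: "h \<in> borel_measurable borel" by (rule borel_measurable_continuous_onI[OF c])
  show "esssup lborel h \<le> (SUP x. h x)" by (rule esssup_I) (auto intro: SUP_upper)
  show "(SUP x. h x) \<le> esssup lborel h"
  proof (rule SUP_least, rule ccontr)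
    fix x assume "\<not> h x \<le> esssup lborel h"
    let ?S = "{x. esssup lborel h < h x}"
    have o: "open ?S" by (intro open_Collect_less continuous_on_const c)
    have "AE x in lborel. x \<notin> ?S" using esssup_AE[of h lborel] by (auto simp: not_less)
    then have "?S \<in> null_sets lborel" using o by (subst AE_iff_null_sets) auto
    then have "negligible ?S" using o by (simp add: negligible_iff_null_sets null_sets_completion_iff)
    with open_not_negligible[OF o] \<open>\<not> h x \<le> esssup lborel h\<close> show False by (auto simp: not_le)
  qed
qed

text \<open>For infinite p the inner norm is an essential supremum; continuity in x makes it a
  genuine supremum, and continuity in \<omega> makes that lower semicontinuous.\<close>

lemma measurable_lp_norm_stft:
  fixes f g :: "'a::euclidean_space \<Rightarrow> complex"
  assumes f: "rapid f" and g: "rapid g"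
  shows "(\<lambda>\<omega>. lp_norm p (\<lambda>x. ennreal (norm (stft g f x \<omega>)))) \<in> borel_measurable borel"
proof (cases "p = \<infinity>")
  case True
  have c: "continuous_on UNIV (\<lambda>x. ennreal (norm (stft g f x \<omega>)))" for \<omega>
    by (intro continuous_on_ennreal continuous_on_norm continuous_on_stft_fst f g)
  have "lp_norm p (\<lambda>x. ennreal (norm (stft g f x \<omega>))) = (SUP x. ennreal (norm (stft g f x \<omega>)))" for \<omega>
    unfolding lp_norm_def if_P[OF True] by (rule esssup_continuous[OF c])
  moreover have "(\<lambda>\<omega>. SUP x. ennreal (norm (stft g f x \<omega>))) \<in> borel_measurable borel"
  proof (rule borel_measurableI_greater)
    fix a
    have "open {\<omega>. a < ennreal (norm (stft g f x \<omega>))}" for x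
      by (intro open_Collect_less continuous_on_const continuous_on_ennreal continuous_on_norm continuous_on_stft_snd f g)
    then have "open (\<Union>x. {\<omega>. a < ennreal (norm (stft g f x \<omega>))})" by blast
    also have "(\<Union>x. {\<omega>. a < ennreal (norm (stft g f x \<omega>))}) = {\<omega>. a < (SUP x. ennreal (norm (stft g f x \<omega>)))}"
      unfolding less_SUP_iff by blast
    finally show "{\<omega> \<in> space borel. a < (SUP x. ennreal (norm (stft g f x \<omega>)))} \<in> sets borel" by simp
  qed
  ultimately show ?thesis by simp
next
  case False
  note [measurable] = rapid_measurable[OF f] rapid_measurable[OF g]
  show ?thesis unfolding lp_norm_finite[OF False] by measurable
qed

lemma epow_le_mult:
  assumes "e \<le> b" "b \<noteq> 0" "b \<noteq> top" "1 \<le> Q"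
  shows "epow e Q \<le> epow b (Q - 1) * e"
proof -
  obtain b' where b: "b = ennreal b'" "0 \<le> b'" using assms(3) by (cases b) auto
  have "e \<noteq> top" using assms(1,3) by (auto simp: top_unique)
  then obtain e' where e: "e = ennreal e'" "0 \<le> e'" by (cases e) auto
  have le: "e' \<le> b'" using assms(1) e b by (simp add: ennreal_le_iff)
  have "e' powr Q \<le> b' powr (Q - 1) * e'"
  proof (cases "e' = 0")
    case False
    then have "e' powr Q = e' powr (Q - 1) * e'" using e by (simp add: powr_mult_base[symmetric] powr_diff)
    also have "\<dots> \<le> b' powr (Q - 1) * e'" using e le assms(4) by (intro mult_right_mono powr_mono2) auto
    finally show ?thesis .
  qed simp
  then show ?thesis using e b by (simp add: ennreal_mult[symmetric] ennreal_leI)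
qed

text \<open>Bounds on the supremum, on the x-integral for each \<omega>, and on the full integral
  dominate every mixed norm with 1 \<le> q < p by interpolating powers. Approximation errors are
  thus measured without reference to the exponents.\<close>

lemma mixed_norm_small:
  fixes E :: "'a::euclidean_space \<Rightarrow> 'a \<Rightarrow> ennreal"
  assumes q: "1 \<le> q" and qp: "q < p"
    and mE[measurable]: "(\<lambda>(x, \<omega>). E x \<omega>) \<in> borel_measurable (borel \<Otimes>\<^sub>M borel)"
    and b: "b \<noteq> 0" "b \<noteq> top"
    and E0: "\<And>x \<omega>. E x \<omega> \<le> b" and E1: "\<And>\<omega>. (\<integral>\<^sup>+x. E x \<omega> \<partial>lborel) \<le> b" and E2: "(\<integral>\<^sup>+\<omega>. (\<integral>\<^sup>+x. E x \<omega> \<partial>lborel) \<partial>lborel) \<le> b"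
  shows "lp_norm p (\<lambda>\<omega>. lp_norm q (\<lambda>x. E x \<omega>)) \<le> b"
proof -
  have qfin: "q \<noteq> \<infinity>" using qp by auto
  define Q where "Q = enn2real q"
  have qQ: "q = ennreal Q" using qfin by (simp add: Q_def ennreal_enn2real_if)
  have Q1: "1 \<le> Q" using q qQ by (metis Q_def enn2real_nonneg ennreal_1 ennreal_le_iff)
  define L where "L \<omega> = (\<integral>\<^sup>+x. epow (E x \<omega>) Q \<partial>lborel)" for \<omega>
  have [measurable]: "L \<in> borel_measurable borel" unfolding L_def by measurable
  have lpE: "lp_norm q (\<lambda>x. E x \<omega>) = epow (L \<omega>) (1 / Q)" for \<omega>
    unfolding L_def Q_def by (rule lp_norm_finite[OF qfin])
  have L1: "L \<omega> \<le> epow b (Q - 1) * (\<integral>\<^sup>+x. E x \<omega> \<partial>lborel)" for \<omega>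
  proof -
    have "L \<omega> \<le> (\<integral>\<^sup>+x. epow b (Q - 1) * E x \<omega> \<partial>lborel)"
      unfolding L_def by (intro nn_integral_mono epow_le_mult E0 b Q1)
    also have "\<dots> = epow b (Q - 1) * (\<integral>\<^sup>+x. E x \<omega> \<partial>lborel)" by (rule nn_integral_cmult) measurable
    finally show ?thesis .
  qed
  have bb: "epow b (t - 1) * b = epow b t" for t
    using epow_add_finite[OF b, of "t - 1" 1] by simp
  have L2: "L \<omega> \<le> epow b Q" for \<omega>
    using order_trans[OF L1 mult_left_mono[OF E1]] bb by simp
  show ?thesis
  proof (cases "p = \<infinity>")
    case True
    have "lp_norm p (\<lambda>\<omega>. lp_norm q (\<lambda>x. E x \<omega>)) = esssup lborel (\<lambda>\<omega>. epow (L \<omega>) (1 / Q))"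
      unfolding lpE lp_norm_def[of p] if_P[OF True] ..
    also have "\<dots> \<le> b"
    proof (rule esssup_I)
      have "epow (L \<omega>) (1 / Q) \<le> epow (epow b Q) (1 / Q)" for \<omega> using Q1 by (intro epow_mono L2) auto
      then show "AE \<omega> in lborel. epow (L \<omega>) (1 / Q) \<le> b" using Q1 by (simp add: epow_epow)
    qed measurable
    finally show ?thesis .
  next
    case False
    define P where "P = enn2real p"
    have pP: "p = ennreal P" using False by (simp add: P_def ennreal_enn2real_if)
    have QP: "Q < P" using qp Q1 unfolding qQ pP by (simp add: ennreal_less_iff)
    have P0: "0 < P" using QP Q1 by simp
    have bQ: "epow b Q \<noteq> 0" "epow b Q \<noteq> top" using b by (simp_all add: epow_eq_0_iff epow_eq_top_iff)
    have "(\<integral>\<^sup>+\<omega>. epow (L \<omega>) (P / Q) \<partial>lborel) \<le> (\<integral>\<^sup>+\<omega>. epow b (P - 1) * (\<integral>\<^sup>+x. E x \<omega> \<partial>lborel) \<partial>lborel)"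
    proof (rule nn_integral_mono)
      fix \<omega>
      have "epow (L \<omega>) (P / Q) \<le> epow (epow b Q) (P / Q - 1) * L \<omega>"
        using QP Q1 by (intro epow_le_mult L2 bQ) (simp add: field_simps)
      also have "\<dots> \<le> epow (epow b Q) (P / Q - 1) * (epow b (Q - 1) * (\<integral>\<^sup>+x. E x \<omega> \<partial>lborel))"
        by (intro mult_left_mono L1) auto
      also have "\<dots> = epow b (Q * (P / Q - 1) + (Q - 1)) * (\<integral>\<^sup>+x. E x \<omega> \<partial>lborel)"
        by (simp only: epow_epow epow_add_finite[OF b] mult.assoc)
      also have "Q * (P / Q - 1) + (Q - 1) = P - 1" using Q1 by (simp add: field_simps)
      finally show "epow (L \<omega>) (P / Q) \<le> epow b (P - 1) * (\<integral>\<^sup>+x. E x \<omega> \<partial>lborel)" .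
    qed
    also have "\<dots> = epow b (P - 1) * (\<integral>\<^sup>+\<omega>. (\<integral>\<^sup>+x. E x \<omega> \<partial>lborel) \<partial>lborel)" by (rule nn_integral_cmult) measurable
    also have "\<dots> \<le> epow b (P - 1) * b" by (intro mult_left_mono E2) auto
    finally have "(\<integral>\<^sup>+\<omega>. epow (L \<omega>) (P / Q) \<partial>lborel) \<le> epow b P" unfolding bb .
    then have "epow (\<integral>\<^sup>+\<omega>. epow (L \<omega>) (P / Q) \<partial>lborel) (1 / P) \<le> epow (epow b P) (1 / P)"
      using P0 by (intro epow_mono) auto
    also have "\<dots> = b" using P0 by (simp add: epow_epow)
    finally have "epow (\<integral>\<^sup>+\<omega>. epow (L \<omega>) (P / Q) \<partial>lborel) (1 / P) \<le> b" .
    moreover have "lp_norm p (\<lambda>\<omega>. lp_norm q (\<lambda>x. E x \<omega>)) = epow (\<integral>\<^sup>+\<omega>. epow (L \<omega>) (P / Q) \<partial>lborel) (1 / P)"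
      unfolding lpE lp_norm_finite[OF False] P_def[symmetric] epow_epow by simp
    ultimately show ?thesis by simp
  qed
qed

section \<open>Approximation by Schwartz functions\<close>

lemma rapid_schwartz: "rapid h \<Longrightarrow> h \<in> schwartz"
proof -
  assume h: "rapid h"
  have "partials vs h differentiable (at x)" if "set vs \<subseteq> Basis" for vs x
  proof -
    obtain C where "partials_le (length vs) (\<lambda>x. C * wt x powr (- 0)) h" using rapidE[OF h] by metis
    then show ?thesis unfolding partials_le_iff using that by blast
  qed
  moreover have "bounded (range (\<lambda>x. norm x ^ M * norm (partials vs h x)))" if vs: "set vs \<subseteq> Basis" for vs and M :: nat
  proof -
    obtain C where C: "0 \<le> C" "partials_le (length vs) (\<lambda>x. C * wt x powr (- real M)) h" using rapidE[OF h] by metis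
    have "norm x ^ M * norm (partials vs h x) \<le> C" for x
    proof -
      have "norm (partials vs h x) \<le> C * wt x powr (- real M)" using C(2) vs unfolding partials_le_iff by blast
      then have "norm x ^ M * norm (partials vs h x) \<le> wt x ^ M * (C * wt x powr (- real M))"
        by (intro mult_mono power_mono) (auto simp: wt_def)
      also have "\<dots> = C * (wt x powr real M * wt x powr (- real M))" by (simp add: powr_realpow)
      also have "\<dots> = C" by (simp add: powr_add[symmetric])
      finally show ?thesis .
    qed
    then show ?thesis by (auto simp: bounded_iff)
  qed
  ultimately show ?thesis unfolding schwartz_def smooth_def by blast
qed

section \<open>Differentiation under the integral sign\<close>

lemma partials_le_partials: "partials_le (length vs + n) W f \<Longrightarrow> set vs \<subseteq> Basis \<Longrightarrow> partials_le n W (partials vs f)"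
proof -
  assume f: "partials_le (length vs + n) W f" and vs: "set vs \<subseteq> Basis"
  have "partials us (partials vs f) differentiable (at x) \<and> norm (partials us (partials vs f) x) \<le> W x"
    if "set us \<subseteq> Basis" "length us \<le> n" for us x
    using f[unfolded partials_le_iff, rule_format, of "us @ vs" x] that vs by (simp add: partials_append)
  then show ?thesis unfolding partials_le_iff by blast
qed

lemma Dv_basis_expansion:
  fixes f :: "'a::euclidean_space \<Rightarrow> complex"
  assumes "f differentiable (at x)"
  shows "frechet_derivative f (at x) h = (\<Sum>b\<in>Basis. (h \<bullet> b) *\<^sub>R Dv b f x)"
proof -
  have lin: "linear (frechet_derivative f (at x))" by (rule linear_frechet_derivative[OF assms])
  have "frechet_derivative f (at x) h = frechet_derivative f (at x) (\<Sum>b\<in>Basis. (h \<bullet> b) *\<^sub>R b)"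
    by (simp add: euclidean_representation)
  then show ?thesis by (simp only: linear_sum[OF lin] linear_cmul[OF lin])
qed

lemma frechet_norm_le:
  fixes f :: "'a::euclidean_space \<Rightarrow> complex"
  assumes d: "f differentiable (at x)" and B: "\<And>b. b \<in> Basis \<Longrightarrow> norm (Dv b f x) \<le> B"
  shows "norm (frechet_derivative f (at x) h) \<le> real DIM('a) * B * norm h"
proof -
  have "norm (frechet_derivative f (at x) h) \<le> (\<Sum>b\<in>Basis. norm ((h \<bullet> b) *\<^sub>R Dv b f x))"
    unfolding Dv_basis_expansion[OF d, of h] by (rule norm_sum)
  also have "\<dots> \<le> (\<Sum>b\<in>(Basis :: 'a set). norm h * B)"
    using Basis_le_norm[of _ h] by (intro sum_mono) (auto intro!: mult_mono B)
  finally show ?thesis by (simp add: mult_ac)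
qed

text \<open>The remainder is quadratic with a constant depending only on the bound B, which is what
  survives integration over a parameter.\<close>

lemma second_order_remainder:
  fixes f :: "'a::euclidean_space \<Rightarrow> complex"
  assumes f: "partials_le 2 (\<lambda>_. B) f"
  shows "norm (f y - f x - frechet_derivative f (at x) (y - x)) \<le> (real DIM('a) * (real DIM('a) * B)) * norm (y - x) * norm (y - x)"
proof -
  let ?d = "real DIM('a)"
  have f2: "partials_le (Suc (Suc 0)) (\<lambda>_. B) f" using f by (simp add: numeral_2_eq_2)
  have df: "f differentiable (at z)" for z by (rule partials_le_differentiable[OF f])
  have f1: "partials_le (Suc 0) (\<lambda>_. B) (Dv b f)" if "b \<in> Basis" for b using f2 that by simp
  have B0: "0 \<le> B" using partials_le_W_nonneg[OF f] .
  have lip: "norm (Dv b f z - Dv b f x) \<le> ?d * B * norm (z - x)" if b: "b \<in> Basis" for b z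
  proof (rule differentiable_bound[of UNIV "Dv b f" "\<lambda>z. frechet_derivative (Dv b f) (at z)"])
    have db: "Dv b f differentiable (at w)" for w by (rule partials_le_differentiable[OF f1[OF b]])
    show "(Dv b f has_derivative frechet_derivative (Dv b f) (at w)) (at w within UNIV)" for w
      using has_derivative_frechet[OF db] by simp
    have "norm (Dv b' (Dv b f) w) \<le> B" if "b' \<in> Basis" for b' w
      using partials_le_norm[of 0 "\<lambda>_. B" "Dv b' (Dv b f)"] f1[OF b] that by simp
    then show "onorm (frechet_derivative (Dv b f) (at w)) \<le> ?d * B" for w
      using B0 by (intro onorm_bound frechet_norm_le[OF db]) auto
  qed auto
  let ?s = "norm (y - x)"
  have "norm ((f y - frechet_derivative f (at x) y) - (f x - frechet_derivative f (at x) x)) \<le> (?d * (?d * B)) * ?s * norm (y - x)"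
  proof (rule differentiable_bound[of "cball x ?s" "\<lambda>z. f z - frechet_derivative f (at x) z" "\<lambda>z h. frechet_derivative f (at z) h - frechet_derivative f (at x) h"])
    have bl: "bounded_linear (frechet_derivative f (at x))" using has_derivative_frechet[OF df] by (rule has_derivative_bounded_linear)
    fix z assume z: "z \<in> cball x ?s"
    show "((\<lambda>z. f z - frechet_derivative f (at x) z) has_derivative (\<lambda>h. frechet_derivative f (at z) h - frechet_derivative f (at x) h)) (at z within cball x ?s)"
      by (intro has_derivative_diff has_derivative_at_withinI[OF has_derivative_frechet[OF df]] bounded_linear.has_derivative[OF bl] has_derivative_ident)
    show "onorm (\<lambda>h. frechet_derivative f (at z) h - frechet_derivative f (at x) h) \<le> (?d * (?d * B)) * ?s"
    proof (rule onorm_bound)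
      show "0 \<le> (?d * (?d * B)) * ?s" using B0 by simp
      fix h
      have "frechet_derivative f (at z) h - frechet_derivative f (at x) h = (\<Sum>b\<in>Basis. (h \<bullet> b) *\<^sub>R (Dv b f z - Dv b f x))"
        unfolding Dv_basis_expansion[OF df[of z], of h] Dv_basis_expansion[OF df[of x], of h] by (simp add: scaleR_diff_right sum_subtractf)
      also have "norm \<dots> \<le> (\<Sum>b\<in>Basis. norm ((h \<bullet> b) *\<^sub>R (Dv b f z - Dv b f x)))" by (rule norm_sum)
      also have "\<dots> \<le> (\<Sum>b\<in>(Basis :: 'a set). norm h * (?d * B * ?s))"
      proof (rule sum_mono)
        fix b :: 'a assume b: "b \<in> Basis"
        have "norm (Dv b f z - Dv b f x) \<le> ?d * B * norm (z - x)" by (rule lip[OF b])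
        also have "\<dots> \<le> ?d * B * ?s" using z B0 by (intro mult_left_mono) (auto simp: dist_norm norm_minus_commute)
        finally show "norm ((h \<bullet> b) *\<^sub>R (Dv b f z - Dv b f x)) \<le> norm h * (?d * B * ?s)"
          using Basis_le_norm[OF b, of h] by (auto intro!: mult_mono)
      qed
      finally show "norm (frechet_derivative f (at z) h - frechet_derivative f (at x) h) \<le> (?d * (?d * B)) * ?s * norm h" by (simp add: mult_ac)
    qed
  qed (auto simp: dist_norm norm_minus_commute)
  moreover have "f y - f x - frechet_derivative f (at x) (y - x) = (f y - frechet_derivative f (at x) y) - (f x - frechet_derivative f (at x) x)"
    using linear_frechet_derivative[OF df] by (simp add: linear_diff)
  ultimately show ?thesis by (simp only:)
qed

text \<open>The derivative is the limit of difference quotients with increments 1/(n+1), each of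
  which is measurable in the parameter.\<close>

lemma measurable_Dv_parameter:
  fixes k :: "'b::euclidean_space \<Rightarrow> 'a::euclidean_space \<Rightarrow> complex"
  assumes d: "\<And>z x. k z differentiable (at x)" and m: "\<And>x. (\<lambda>z. k z x) \<in> borel_measurable borel"
  shows "(\<lambda>z. Dv b (k z) x) \<in> borel_measurable borel"
proof (rule borel_measurable_LIMSEQ_metric)
  let ?t = "\<lambda>n. 1 / real (Suc n)"
  note [measurable] = m
  show "(\<lambda>z. (k z (x + ?t n *\<^sub>R b) - k z x) /\<^sub>R ?t n) \<in> borel_measurable borel" for n by measurable
  fix z
  have "((\<lambda>t. x + t *\<^sub>R b) has_derivative (\<lambda>h. h *\<^sub>R b)) (at 0)" by (auto intro!: derivative_eq_intros)
  from diff_chain_at[OF this, of "k z" "frechet_derivative (k z) (at x)"] has_derivative_frechet[OF d]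
  have "((\<lambda>t. k z (x + t *\<^sub>R b)) has_derivative (\<lambda>h. h *\<^sub>R Dv b (k z) x)) (at 0)"
    by (simp add: o_def linear_cmul[OF linear_frechet_derivative[OF d]])
  then have "((\<lambda>h. norm (k z (x + (0 + h) *\<^sub>R b) - k z (x + 0 *\<^sub>R b) - h *\<^sub>R Dv b (k z) x) / norm h) \<longlongrightarrow> 0) (at 0)"
    by (simp only: has_derivative_at)
  moreover have "filterlim ?t (at 0) sequentially"
    unfolding filterlim_at using lim_1_over_Suc by simp
  ultimately have "(\<lambda>n. norm (k z (x + (0 + ?t n) *\<^sub>R b) - k z (x + 0 *\<^sub>R b) - ?t n *\<^sub>R Dv b (k z) x) / norm (?t n)) \<longlonglongrightarrow> 0"
    by (rule filterlim_compose)
  moreover have eq: "norm (k z (x + (0 + t) *\<^sub>R b) - k z (x + 0 *\<^sub>R b) - t *\<^sub>R Dv b (k z) x) / norm t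
      = norm ((k z (x + t *\<^sub>R b) - k z x) /\<^sub>R t - Dv b (k z) x)" if "0 < t" for t
  proof -
    have "(k z (x + t *\<^sub>R b) - k z x) /\<^sub>R t - Dv b (k z) x = (k z (x + t *\<^sub>R b) - k z x - t *\<^sub>R Dv b (k z) x) /\<^sub>R t"
      using that by (simp add: scaleR_diff_right)
    then show ?thesis using that by (simp add: divide_inverse mult.commute)
  qed
  moreover have "norm (k z (x + (0 + ?t n) *\<^sub>R b) - k z (x + 0 *\<^sub>R b) - ?t n *\<^sub>R Dv b (k z) x) / norm (?t n)
      = norm ((k z (x + ?t n *\<^sub>R b) - k z x) /\<^sub>R ?t n - Dv b (k z) x)" for n
    by (rule eq) simp
  ultimately have "(\<lambda>n. norm ((k z (x + ?t n *\<^sub>R b) - k z x) /\<^sub>R ?t n - Dv b (k z) x)) \<longlonglongrightarrow> 0" by (simp only:)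
  then have "(\<lambda>n. (k z (x + ?t n *\<^sub>R b) - k z x) /\<^sub>R ?t n - Dv b (k z) x) \<longlonglongrightarrow> 0" by (rule tendsto_norm_zero_cancel)
  then show "(\<lambda>n. (k z (x + ?t n *\<^sub>R b) - k z x) /\<^sub>R ?t n) \<longlonglongrightarrow> Dv b (k z) x" by (rule LIM_zero_cancel)
qed

text \<open>Uniform derivative bounds are asked for only where F does not vanish: F will be cut off
  to a ball, and time-frequency shifts obey uniform bounds only on bounded sets of
  parameters.\<close>

lemma rapid_parameter_integral:
  fixes k :: "'b::euclidean_space \<Rightarrow> 'a::euclidean_space \<Rightarrow> complex" and F :: "'b \<Rightarrow> complex"
  assumes F: "integrable lborel F" and m: "\<And>x. (\<lambda>z. k z x) \<in> borel_measurable borel"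
    and sm: "\<And>z. rapid (k z)"
    and bd: "\<And>n M. \<exists>B\<ge>0. \<forall>z. F z \<noteq> 0 \<longrightarrow> partials_le n (\<lambda>x. B * wt x powr (- M)) (k z)"
  shows "rapid (\<lambda>x. LINT z|lborel. F z * k z x)"
proof -
  have [measurable]: "F \<in> borel_measurable borel" using F by auto
  have diff: "partials vs (k z) differentiable (at x)" if "set vs \<subseteq> Basis" for vs z x
  proof -
    obtain C where "partials_le (length vs + 0) (\<lambda>x. C * wt x powr (- 0)) (k z)" using rapidE[OF sm[of z]] by metis
    from partials_le_differentiable[OF partials_le_partials[OF this that]] show ?thesis .
  qed
  have meas: "set vs \<subseteq> Basis \<Longrightarrow> (\<lambda>z. partials vs (k z) x) \<in> borel_measurable borel" for vs x
  proof (induction vs arbitrary: x)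
    case Nil then show ?case using m by simp
  next
    case (Cons b vs)
    then show ?case using measurable_Dv_parameter[where k="\<lambda>z. partials vs (k z)" and b=b and x=x] diff by simp
  qed
  have bdv: "norm (F z * partials vs (k z) x) \<le> norm (F z) * (B * wt x powr (- M))"
    if "\<forall>z. F z \<noteq> 0 \<longrightarrow> partials_le n (\<lambda>x. B * wt x powr (- M)) (k z)" "set vs \<subseteq> Basis" "length vs \<le> n" for vs z x n B M
  proof (cases "F z = 0")
    case False
    then have "norm (partials vs (k z) x) \<le> B * wt x powr (- M)" using that unfolding partials_le_iff by blast
    then show ?thesis by (simp add: norm_mult mult_left_mono)
  qed simp
  have intg: "integrable lborel (\<lambda>z. F z * partials vs (k z) x)" if vs: "set vs \<subseteq> Basis" for vs x
  proof -
    obtain B where B: "0 \<le> B" "\<forall>z. F z \<noteq> 0 \<longrightarrow> partials_le (length vs) (\<lambda>x. B * wt x powr (- 0)) (k z)" using bd by metis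
    note [measurable] = meas[OF vs]
    show ?thesis
    proof (rule Bochner_Integration.integrable_bound)
      show "integrable lborel (\<lambda>z. norm (F z) * (B * wt x powr (- 0)))" using F by simp
      show "(\<lambda>z. F z * partials vs (k z) x) \<in> borel_measurable lborel" by measurable
      show "AE z in lborel. norm (F z * partials vs (k z) x) \<le> norm (norm (F z) * (B * wt x powr (- 0)))"
      proof (rule AE_I2)
        fix z
        have "norm (F z * partials vs (k z) x) \<le> norm (F z) * (B * wt x powr (- 0))" by (rule bdv[OF B(2) vs order_refl])
        also have "\<dots> \<le> norm (norm (F z) * (B * wt x powr (- 0)))" unfolding real_norm_def by (rule abs_ge_self)
        finally show "norm (F z * partials vs (k z) x) \<le> norm (norm (F z) * (B * wt x powr (- 0)))" .
      qed
    qed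
  qed
  define P where "P vs x = (LINT z|lborel. F z * partials vs (k z) x)" for vs x
  have der: "(P vs has_derivative (\<lambda>v. \<Sum>b\<in>Basis. (v \<bullet> b) *\<^sub>R P (b # vs) x)) (at x)" if vs: "set vs \<subseteq> Basis" for vs x
  proof -
    obtain B where B: "0 \<le> B" "\<forall>z. F z \<noteq> 0 \<longrightarrow> partials_le (length vs + 2) (\<lambda>x. B * wt x powr (- 0)) (k z)" using bd by metis
    define C where "C = (LINT z|lborel. norm (F z)) * (real DIM('a) * (real DIM('a) * B))"
    \<comment> \<open>Two derivatives beyond \<open>vs\<close> give a quadratic Taylor remainder
      uniform in z on the support of F; integrated against F it shows that the integral is
      differentiable with the expected derivative.\<close>
    have rem: "norm (P vs y - P vs x - (\<Sum>b\<in>Basis. ((y - x) \<bullet> b) *\<^sub>R P (b # vs) x)) \<le> C * norm (y - x) * norm (y - x)" for y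
    proof -
      let ?f = "\<lambda>z. partials vs (k z)"
      let ?R = "\<lambda>z. F z * (?f z y - ?f z x - frechet_derivative (?f z) (at x) (y - x))"
      have e: "?R z = F z * ?f z y - F z * ?f z x - (\<Sum>b\<in>Basis. ((y - x) \<bullet> b) *\<^sub>R (F z * partials (b # vs) (k z) x))" for z
        unfolding Dv_basis_expansion[OF diff[OF vs, of z x], of "y - x"] by (simp add: right_diff_distrib sum_distrib_left)
      have ib: "integrable lborel (\<lambda>z. \<Sum>b\<in>Basis. ((y - x) \<bullet> b) *\<^sub>R (F z * partials (b # vs) (k z) x))"
        using vs by (intro Bochner_Integration.integrable_sum integrable_scaleR_right intg) auto
      have iR: "integrable lborel ?R"
        unfolding e by (intro Bochner_Integration.integrable_diff intg[OF vs] ib)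
      have "(LINT z|lborel. ?R z) = P vs y - P vs x - (\<Sum>b\<in>Basis. ((y - x) \<bullet> b) *\<^sub>R P (b # vs) x)"
      proof -
        have "(LINT z|lborel. ?R z) = P vs y - P vs x - (LINT z|lborel. (\<Sum>b\<in>Basis. ((y - x) \<bullet> b) *\<^sub>R (F z * partials (b # vs) (k z) x)))"
          unfolding e P_def
          by (subst Bochner_Integration.integral_diff, intro Bochner_Integration.integrable_diff intg[OF vs], rule ib,
              subst Bochner_Integration.integral_diff, rule intg[OF vs], rule intg[OF vs], rule refl)
        also have "(LINT z|lborel. (\<Sum>b\<in>Basis. ((y - x) \<bullet> b) *\<^sub>R (F z * partials (b # vs) (k z) x))) = (\<Sum>b\<in>Basis. ((y - x) \<bullet> b) *\<^sub>R P (b # vs) x)"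
          unfolding P_def using vs
          by (subst Bochner_Integration.integral_sum) (auto intro!: integrable_scaleR_right intg simp del: partials.simps)
        finally show ?thesis .
      qed
      then have "norm (P vs y - P vs x - (\<Sum>b\<in>Basis. ((y - x) \<bullet> b) *\<^sub>R P (b # vs) x)) \<le> (LINT z|lborel. norm (?R z))"
        using integral_norm_bound[of lborel ?R] by simp
      also have "\<dots> \<le> (LINT z|lborel. norm (F z) * ((real DIM('a) * (real DIM('a) * B)) * norm (y - x) * norm (y - x)))"
      proof (rule integral_mono)
        show "integrable lborel (\<lambda>z. norm (?R z))" using iR by (rule integrable_norm)
        show "integrable lborel (\<lambda>z. norm (F z) * ((real DIM('a) * (real DIM('a) * B)) * norm (y - x) * norm (y - x)))" using F by simp
        fix z
        show "norm (?R z) \<le> norm (F z) * ((real DIM('a) * (real DIM('a) * B)) * norm (y - x) * norm (y - x))"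
        proof (cases "F z = 0")
          case False
          then have "partials_le (length vs + 2) (\<lambda>x. B) (k z)" using B(2) by simp
          from second_order_remainder[OF partials_le_partials[OF this vs], of y x]
          show ?thesis unfolding norm_mult by (intro mult_left_mono) auto
        qed simp
      qed
      also have "\<dots> = C * norm (y - x) * norm (y - x)" by (simp add: C_def)
      finally show ?thesis .
    qed
    show ?thesis
    proof (rule has_derivativeI_sandwich[of 1])
      show "bounded_linear (\<lambda>v. \<Sum>b\<in>Basis. (v \<bullet> b) *\<^sub>R P (b # vs) x)"
        by (intro bounded_linear_sum bounded_linear_scaleR_const bounded_linear_inner_left)
      show "norm (P vs y - P vs x - (\<Sum>b\<in>Basis. ((y - x) \<bullet> b) *\<^sub>R P (b # vs) x)) / norm (y - x) \<le> C * norm (y - x)" if "y \<noteq> x" for y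
        using rem[of y] that by (simp add: pos_divide_le_eq)
      have "((\<lambda>y. C * norm (y - x)) \<longlongrightarrow> C * norm (x - x)) (at x)" by (intro tendsto_intros)
      then show "((\<lambda>y. C * norm (y - x)) \<longlongrightarrow> 0) (at x)" by simp
    qed simp
  qed
  have part: "set vs \<subseteq> Basis \<Longrightarrow> partials vs (\<lambda>x. LINT z|lborel. F z * k z x) = P vs" for vs
  proof (induction vs)
    case Nil then show ?case by (simp add: P_def[abs_def])
  next
    case (Cons b vs)
    then have IH: "partials vs (\<lambda>x. LINT z|lborel. F z * k z x) = P vs" and vs: "set vs \<subseteq> Basis" and b: "b \<in> Basis" by auto
    have "Dv b (P vs) x = P (b # vs) x" for x
    proof -
      have "Dv b (P vs) x = (\<Sum>b'\<in>Basis. (b \<bullet> b') *\<^sub>R P (b' # vs) x)" by (rule Dv_eq[OF der[OF vs]])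
      also have "\<dots> = (\<Sum>b'\<in>Basis. if b' = b then P (b # vs) x else 0)"
        using b by (intro sum.cong) (auto simp: inner_Basis)
      also have "\<dots> = P (b # vs) x" using b by simp
      finally show ?thesis .
    qed
    then show ?case by (simp add: IH fun_eq_iff)
  qed
  show ?thesis
    unfolding rapid_def
  proof (intro allI)
    fix n :: nat and M :: real
    obtain B where B: "0 \<le> B" "\<forall>z. F z \<noteq> 0 \<longrightarrow> partials_le n (\<lambda>x. B * wt x powr (- M)) (k z)" using bd by metis
    define I where "I = (LINT z|lborel. norm (F z))"
    have "partials_le n (\<lambda>x. (I * B) * wt x powr (- M)) (\<lambda>x. LINT z|lborel. F z * k z x)"
      unfolding partials_le_iff
    proof (intro allI impI)
      fix vs :: "'a list" and x assume vs: "set vs \<subseteq> Basis \<and> length vs \<le> n"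
      have "norm (P vs x) \<le> (LINT z|lborel. norm (F z * partials vs (k z) x))"
        unfolding P_def by (rule integral_norm_bound)
      also have "\<dots> \<le> (LINT z|lborel. norm (F z) * (B * wt x powr (- M)))"
        using vs F by (intro integral_mono integrable_norm intg bdv[OF B(2)]) auto
      also have "\<dots> = (I * B) * wt x powr (- M)" by (simp add: I_def)
      finally have "norm (P vs x) \<le> (I * B) * wt x powr (- M)" .
      moreover have "P vs differentiable (at x)" using der[of vs x] vs unfolding differentiable_def by blast
      ultimately show "partials vs (\<lambda>x. LINT z|lborel. F z * k z x) differentiable (at x) \<and>
         norm (partials vs (\<lambda>x. LINT z|lborel. F z * k z x) x) \<le> (I * B) * wt x powr (- M)"
        using part[of vs] vs by simp
    qed
    moreover have "0 \<le> I * B" unfolding I_def using B(1) by simp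
    ultimately show "\<exists>C\<ge>0. partials_le n (\<lambda>x. C * wt x powr (- M)) (\<lambda>x. LINT z|lborel. F z * k z x)" by blast
  qed
qed

section \<open>Time-frequency shifts of the window\<close>

lemma partials_le_modulation:
  fixes \<omega> :: "'a::euclidean_space"
  shows "partials_le n (\<lambda>y. (2 ^ n * (1 + 2 * pi * norm \<omega>)) ^ n) (\<lambda>y. ee (\<omega> \<bullet> y))"
proof -
  let ?\<psi> = "\<lambda>y. \<i> * complex_of_real (2 * pi * (\<omega> \<bullet> y))"
  have hd: "(?\<psi> has_derivative (\<lambda>h. \<i> * complex_of_real (2 * pi * (\<omega> \<bullet> h)))) (at y)" for y
    by (intro has_derivative_mult_right has_derivative_of_real has_derivative_inner_right has_derivative_ident)
  have d: "?\<psi> differentiable (at y)" for y using hd unfolding differentiable_def by blast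
  have "partials_le n (\<lambda>y. 1 + 2 * pi * norm \<omega>) (Dv b ?\<psi>)" if b: "b \<in> Basis" for b
  proof -
    have "Dv b ?\<psi> = (\<lambda>y. \<i> * complex_of_real (2 * pi * (\<omega> \<bullet> b)))" by (rule ext) (rule Dv_eq[OF hd])
    moreover have "partials_le n (\<lambda>y. 1 + 2 * pi * norm \<omega>) (\<lambda>y::'a. \<i> * complex_of_real (2 * pi * (\<omega> \<bullet> b)))"
      using Basis_le_norm[OF b, of \<omega>] by (intro partials_le_const) (simp add: norm_mult abs_mult add_increasing)
    ultimately show ?thesis by simp
  qed
  from partials_le_exp[OF d _ this] have "partials_le n (\<lambda>y. (2 ^ n * (1 + 2 * pi * norm \<omega>)) ^ n * norm (exp (?\<psi> y))) (\<lambda>y. exp (?\<psi> y))" by simp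
  then show ?thesis by (simp add: ee_exp)
qed

lemma partials_le_time_frequency_shift:
  fixes g :: "'a::euclidean_space \<Rightarrow> complex"
  assumes g: "rapid g" and \<rho>: "0 \<le> \<rho>"
  obtains B where "0 \<le> B" "\<And>x \<omega>. norm x \<le> \<rho> \<Longrightarrow> norm \<omega> \<le> \<rho> \<Longrightarrow> partials_le n (\<lambda>y. B * wt y powr (- M)) (\<lambda>y. ee (\<omega> \<bullet> y) * g (y - x))"
proof -
  \<comment> \<open>Weights can be shifted only for nonnegative exponents; for negative M the bound
    with exponent 0 is stronger than what is asked.\<close>
  define M' where "M' = max 0 M"
  obtain C where C: "0 \<le> C" "partials_le n (\<lambda>x. C * wt x powr (- M')) g" using rapidE[OF g] by blast
  define A where "A = (2 ^ n * (1 + 2 * pi * \<rho>)) ^ n"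
  have A0: "0 \<le> A" using \<rho> by (simp add: A_def)
  define B where "B = 2 ^ n * (A * (C * (1 + \<rho>) powr M'))"
  have "partials_le n (\<lambda>y. B * wt y powr (- M)) (\<lambda>y. ee (\<omega> \<bullet> y) * g (y - x))" if x: "norm x \<le> \<rho>" and \<omega>: "norm \<omega> \<le> \<rho>" for x \<omega>
  proof (rule partials_le_mono[OF partials_le_mult[OF partials_le_modulation partials_le_translate[OF C(2)]]])
    fix y :: 'a
    have 1: "(2 ^ n * (1 + 2 * pi * norm \<omega>)) ^ n \<le> A" unfolding A_def using \<omega>
      by (intro power_mono mult_left_mono add_left_mono) auto
    have "wt (y - x) powr (- M') \<le> (1 + \<rho>) powr M' * wt y powr (- M')"
    proof -
      have "wt y \<le> wt x * wt (y - x)" using wt_add[of x "y - x"] by simp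
      also have "\<dots> \<le> (1 + \<rho>) * wt (y - x)" using x by (intro mult_right_mono) (auto simp: wt_def)
      finally have "((1 + \<rho>) * wt (y - x)) powr (- M') \<le> wt y powr (- M')" by (intro powr_mono2') (auto simp: M'_def)
      then have "(1 + \<rho>) powr (- M') * wt (y - x) powr (- M') \<le> wt y powr (- M')" using \<rho> by (simp add: powr_mult)
      then have "(1 + \<rho>) powr M' * ((1 + \<rho>) powr (- M') * wt (y - x) powr (- M')) \<le> (1 + \<rho>) powr M' * wt y powr (- M')" by (intro mult_left_mono) auto
      moreover have "(1 + \<rho>) powr M' * (1 + \<rho>) powr (- M') = 1" using \<rho> by (simp add: powr_add[symmetric])
      ultimately show ?thesis by (simp add: mult.assoc[symmetric])
    qed
    also have "\<dots> \<le> (1 + \<rho>) powr M' * wt y powr (- M)" by (intro mult_left_mono wt_powr_mono) (auto simp: M'_def)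
    finally have 2: "wt (y - x) powr (- M') \<le> (1 + \<rho>) powr M' * wt y powr (- M)" .
    have "2 ^ n * ((2 ^ n * (1 + 2 * pi * norm \<omega>)) ^ n * (C * wt (y - x) powr (- M'))) \<le> 2 ^ n * (A * (C * ((1 + \<rho>) powr M' * wt y powr (- M))))"
      using C(1) A0 by (intro mult_left_mono mult_mono 1 2) auto
    then show "2 ^ n * ((2 ^ n * (1 + 2 * pi * norm \<omega>)) ^ n * (C * wt (y - x) powr (- M'))) \<le> B * wt y powr (- M)"
      by (simp add: B_def mult.assoc)
  qed
  moreover have "0 \<le> B" using A0 C(1) by (simp add: B_def)
  ultimately show thesis by (rule that[rotated])
qed

text \<open>Up to a unimodular factor the correlation of two shifted windows depends only on the
  difference of the shifts, so synthesis integrals are dominated by convolutions.\<close>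

lemma stft_time_frequency_shift:
  fixes g :: "'a::euclidean_space \<Rightarrow> complex"
  shows "(LINT y|lborel. (ee (- (\<omega>' \<bullet> y)) * cnj (g (y - x'))) * g (y - x) * ee (\<omega> \<bullet> y))
    = ee ((\<omega> - \<omega>') \<bullet> x) * stft g g (x' - x) (\<omega>' - \<omega>)"
proof -
  let ?f = "\<lambda>y. (ee (- (\<omega>' \<bullet> y)) * cnj (g (y - x'))) * g (y - x) * ee (\<omega> \<bullet> y)"
  have "(LINT y|lborel. ?f y) = (LINT t|lborel. ?f (x + t))" by (rule integral_translate[symmetric])
  also have "\<dots> = (LINT t|lborel. ee ((\<omega> - \<omega>') \<bullet> x) * (ee (- ((\<omega>' - \<omega>) \<bullet> t)) * g t * cnj (g (t - (x' - x)))))"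
  proof (rule Bochner_Integration.integral_cong[OF refl])
    fix t
    have "- (\<omega>' \<bullet> (x + t)) + \<omega> \<bullet> (x + t) = (\<omega> - \<omega>') \<bullet> x + - ((\<omega>' - \<omega>) \<bullet> t)"
      by (simp add: inner_add_right inner_diff_left)
    then have "ee (- (\<omega>' \<bullet> (x + t))) * ee (\<omega> \<bullet> (x + t)) = ee ((\<omega> - \<omega>') \<bullet> x) * ee (- ((\<omega>' - \<omega>) \<bullet> t))"
      unfolding ee_add[symmetric] by (rule arg_cong)
    then have "(ee (- (\<omega>' \<bullet> (x + t))) * ee (\<omega> \<bullet> (x + t))) * (cnj (g (x + t - x')) * g (x + t - x)) = (ee ((\<omega> - \<omega>') \<bullet> x) * ee (- ((\<omega>' - \<omega>) \<bullet> t))) * (cnj (g (x + t - x')) * g (x + t - x))"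
      by (rule arg_cong)
    moreover have "x + t - x' = t - (x' - x)" "x + t - x = t" by simp_all
    ultimately show "?f (x + t) = ee ((\<omega> - \<omega>') \<bullet> x) * (ee (- ((\<omega>' - \<omega>) \<bullet> t)) * g t * cnj (g (t - (x' - x))))"
      by (simp only: mult_ac)
  qed
  also have "\<dots> = ee ((\<omega> - \<omega>') \<bullet> x) * stft g g (x' - x) (\<omega>' - \<omega>)"
    unfolding stft_eq by (rule integral_mult_right_zero)
  finally show ?thesis .
qed

text \<open>The approximant is the inversion integral of the short-time Fourier transform, restricted to a large ball.\<close>
theorem schwartz_approximation:
  fixes u g :: "'a::euclidean_space \<Rightarrow> complex" and p q \<epsilon> :: ennreal
  assumes g: "rapid g" and nz: "g \<noteq> (\<lambda>_. 0)"
    and um: "u \<in> borel_measurable borel" and uK: "AE y in lborel. norm (u y) \<le> K"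
    and V: "integrable lborel (\<lambda>z. stft g u (fst z) (snd z))"
    and q: "1 \<le> q" and qp: "q < p" and \<epsilon>: "0 < \<epsilon>"
  shows "\<exists>h\<in>schwartz. mod_norm q p g (\<lambda>y. u y - h y) < \<epsilon>"
proof -
  note [measurable] = rapid_measurable[OF g] um measurable_fst_borel measurable_snd_borel
  let ?r = "real (DIM('a) + 1)"
  let ?V = "\<lambda>z. stft g u (fst z) (snd z)"
  let ?w = "window_sq g"
  have w0: "?w \<noteq> 0" by (rule window_sq_nonzero[OF g nz])
  obtain Cg where Cg: "0 \<le> Cg" "\<And>x. norm (g x) \<le> Cg" using rapid_bound[OF g, of 0] by auto
  obtain C where C: "0 \<le> C" "\<And>x \<omega>. norm (stft g g x \<omega>) \<le> C * wt x powr (- ?r) * wt \<omega> powr (- ?r)"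
    by (rule stft_decay[OF g g, of ?r "DIM('a) + 1"]) auto
  define R where "R x' \<omega>' y = ee (- (\<omega>' \<bullet> y)) * cnj (g (y - x'))" for x' \<omega>' y
  have [measurable]: "R x' \<omega>' \<in> borel_measurable borel" for x' \<omega>' unfolding R_def[abs_def] by measurable
  have nR: "norm (R x' \<omega>' y) = norm (g (y - x'))" for x' \<omega>' y by (simp add: R_def norm_mult)
  have gt: "integrable lborel (\<lambda>y. g (y - x))" for x using rapid_integrable[OF g] by (simp add: integrable_translate_diff_iff)
  have iR: "integrable lborel (R x' \<omega>')" for x' \<omega>'
    by (rule Bochner_Integration.integrable_bound[OF gt[of x']]) (auto simp: nR)
  define I where "I x' \<omega>' z = (LINT y|lborel. R x' \<omega>' y * g (y - fst z) * ee (snd z \<bullet> y))" for x' \<omega>' z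
  have Ieq: "I x' \<omega>' z = ee ((snd z - \<omega>') \<bullet> fst z) * stft g g (x' - fst z) (\<omega>' - snd z)" for x' \<omega>' z
    unfolding I_def R_def by (rule stft_time_frequency_shift)
  have [measurable]: "I x' \<omega>' \<in> borel_measurable borel" for x' \<omega>' unfolding Ieq[abs_def] by measurable
  have In: "norm (I x' \<omega>' z) \<le> C * wt (x' - fst z) powr (- ?r) * wt (\<omega>' - snd z) powr (- ?r)" for x' \<omega>' z
    unfolding Ieq using C(2) by (simp add: norm_mult)
  have IC: "norm (I x' \<omega>' z) \<le> C" for x' \<omega>' z
  proof -
    have w1: "wt x powr (- ?r) \<le> 1" for x :: 'a using wt_powr_mono[of "- ?r" 0 x] by simp
    have "C * wt (x' - fst z) powr (- ?r) * wt (\<omega>' - snd z) powr (- ?r) \<le> C * 1 * 1"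
      using C(1) by (intro mult_mono w1) auto
    then show ?thesis using In[of x' \<omega>' z] by simp
  qed
  have iVI: "integrable lborel (\<lambda>z. ?V z * I x' \<omega>' z)" for x' \<omega>'
    by (rule integrable_mult_ess_bounded[OF V, of _ C]) (use IC in auto)
  \<comment> \<open>The reproducing formula for the transform of u itself: replacing the full
    transform under this integral by a truncated one is what defines the approximant.\<close>
  have Vu: "?w * stft g u x' \<omega>' = (LINT z|lborel. ?V z * I x' \<omega>' z)" for x' \<omega>'
  proof -
    have "AE Z in lborel. integrable lborel (\<lambda>\<zeta>. stft g u Z \<zeta>)"
      using lborel_pair.AE_integrable_fst'[of ?V] V unfolding lborel_prod by simp
    from stft_reproduce[OF g um uK iR[of x' \<omega>'] this]
    have "?w * (LINT y|lborel. R x' \<omega>' y * u y) = (LINT Z|lborel. (LINT \<zeta>|lborel. stft g u Z \<zeta> * I x' \<omega>' (Z, \<zeta>)))"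
      unfolding I_def by simp
    also have "\<dots> = (LINT z|lborel. ?V z * I x' \<omega>' z)" using integral_lborel_pair[OF iVI[of x' \<omega>']] by simp
    also have "(LINT y|lborel. R x' \<omega>' y * u y) = stft g u x' \<omega>'" unfolding stft_eq R_def by (simp add: mult_ac)
    finally show ?thesis .
  qed
  define J where "J = (\<integral>\<^sup>+t. ennreal (wt (t :: 'a) powr (- ?r)) \<partial>lborel)"
  have Jfin: "J < \<infinity>" unfolding J_def by (rule wt_powr_neg_nn_integral) simp
  have JI: "(\<integral>\<^sup>+x. ennreal (wt (x - y) powr (- ?r)) \<partial>lborel) = J" for y :: 'a
    unfolding J_def by (rule nn_integral_translate_diff[of "\<lambda>t. ennreal (wt t powr (- ?r))"]) measurable
  \<comment> \<open>One constant for all three error bounds: each of the two coordinate weights is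
    either bounded by 1 or integrated to J.\<close>
  define c where "c = ennreal C * ((1 + J) * (1 + J))"
  have cfin: "c < \<infinity>" unfolding c_def using Jfin by (simp add: ennreal_mult_less_top)
  then obtain c' where c': "c = ennreal c'" "0 \<le> c'" by (cases c) auto
  obtain \<delta>0 where \<delta>0: "0 < \<delta>0" "\<delta>0 < \<epsilon>" using dense[OF \<epsilon>] by blast
  then obtain \<delta> where \<delta>: "\<delta>0 = ennreal \<delta>" "0 < \<delta>" by (cases \<delta>0) (auto simp: ennreal_less_zero_iff)
  let ?out = "\<lambda>n z. (indicator (- ball 0 (real n)) z :: complex) * ?V z / ?w"
  have "(\<lambda>n. LINT z|lborel. norm (?out n z)) \<longlonglongrightarrow> (LINT z|(lborel :: ('a \<times> 'a) measure). norm (0 :: complex))"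
  proof (rule integral_dominated_convergence[where w="\<lambda>z. norm (?V z) / norm ?w"])
    show "integrable lborel (\<lambda>z. norm (?V z) / norm ?w)" using V by simp
    show "AE z in lborel. (\<lambda>n. norm (?out n z)) \<longlonglongrightarrow> norm (0 :: complex)"
    proof (rule AE_I2)
      fix z :: "'a \<times> 'a"
      obtain m :: nat where m: "norm z < real m" using reals_Archimedean2 by blast
      have "eventually (\<lambda>n. norm (?out n z) = norm (0 :: complex)) sequentially"
        using eventually_ge_at_top[of m] by eventually_elim (use m in \<open>auto simp: indicator_def\<close>)
      then show "(\<lambda>n. norm (?out n z)) \<longlonglongrightarrow> norm (0 :: complex)" by (rule tendsto_eventually)
    qed
    show "AE z in lborel. norm (norm (?out n z)) \<le> norm (?V z) / norm ?w" for n
      by (intro AE_I2) (auto simp: indicator_def norm_divide)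
  qed measurable
  then have "(\<lambda>n. LINT z|lborel. norm (?out n z)) \<longlonglongrightarrow> 0" by simp
  \<comment> \<open>The added 1 avoids a division by zero when c' = 0.\<close>
  moreover have "0 < \<delta> / (c' + 1)" using \<delta> c' by simp
  ultimately have "eventually (\<lambda>n. (LINT z|lborel. norm (?out n z)) < \<delta> / (c' + 1)) sequentially"
    by (rule order_tendstoD(2))
  then obtain n where n: "(LINT z|lborel. norm (?out n z)) < \<delta> / (c' + 1)" by (auto simp: eventually_sequentially)
  define Ou where "Ou = ?out n"
  \<comment> \<open>The normalised transform inside the ball, with compact support;
    \<open>Ou\<close> is the tail, small in L^1.\<close>
  define F where "F z = (indicator (ball 0 (real n)) z :: complex) * ?V z / ?w" for z
  have mV[measurable]: "?V \<in> borel_measurable borel" using borel_measurable_integrable[OF V] by simp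
  have "F \<in> borel_measurable borel" unfolding F_def[abs_def]
    by (intro borel_measurable_divide borel_measurable_times borel_measurable_indicator mV) auto
  moreover have "Ou \<in> borel_measurable borel" unfolding Ou_def
    by (intro borel_measurable_divide borel_measurable_times borel_measurable_indicator mV) auto
  ultimately have [measurable]: "Ou \<in> borel_measurable borel" "F \<in> borel_measurable borel" by simp_all
  have iV': "integrable lborel (\<lambda>z. norm (?V z) / norm ?w)" using V by simp
  have iO: "integrable lborel Ou"
    by (rule Bochner_Integration.integrable_bound[OF iV']) (auto simp: Ou_def indicator_def norm_divide)
  have iF: "integrable lborel F"
    by (rule Bochner_Integration.integrable_bound[OF iV']) (auto simp: F_def indicator_def norm_divide)
  have FO: "?V z / ?w - F z = Ou z" for z by (auto simp: F_def Ou_def indicator_def)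
  have Osmall: "c * (\<integral>\<^sup>+z. ennreal (norm (Ou z)) \<partial>lborel) \<le> ennreal \<delta>"
  proof -
    have "(\<integral>\<^sup>+z. ennreal (norm (Ou z)) \<partial>lborel) = ennreal (LINT z|lborel. norm (Ou z))"
      using iO by (intro nn_integral_eq_integral) auto
    also have "\<dots> \<le> ennreal (\<delta> / (c' + 1))" using n by (intro ennreal_leI) (simp add: Ou_def)
    finally have "c * (\<integral>\<^sup>+z. ennreal (norm (Ou z)) \<partial>lborel) \<le> ennreal c' * ennreal (\<delta> / (c' + 1))"
      unfolding c' by (rule mult_left_mono) simp
    also have "\<dots> = ennreal (c' * (\<delta> / (c' + 1)))" using c' \<delta> by (intro ennreal_mult[symmetric]) auto
    also have "\<dots> \<le> ennreal \<delta>" using c' \<delta> by (intro ennreal_leI) (simp add: field_simps)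
    finally show ?thesis .
  qed
  define k where "k z y = ee (snd z \<bullet> y) * g (y - fst z)" for z y
  define h where "h y = (LINT z|lborel. F z * k z y)" for y
  have [measurable]: "(\<lambda>(z, y). k z y) \<in> borel_measurable (borel \<Otimes>\<^sub>M borel)" unfolding k_def by measurable
  have rh: "rapid h"
    unfolding h_def
  proof (rule rapid_parameter_integral[OF iF])
    show "(\<lambda>z. k z y) \<in> borel_measurable borel" for y by measurable
    show "rapid (k z)" for z
      unfolding rapid_def
    proof (intro allI)
      fix m M
      obtain B where "0 \<le> B" "\<And>x \<omega>. norm x \<le> norm z \<Longrightarrow> norm \<omega> \<le> norm z \<Longrightarrow> partials_le m (\<lambda>y. B * wt y powr (- M)) (\<lambda>y. ee (\<omega> \<bullet> y) * g (y - x))"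
        by (rule partials_le_time_frequency_shift[OF g norm_ge_zero[of z], of m M]) blast
      then show "\<exists>C\<ge>0. partials_le m (\<lambda>x. C * wt x powr (- M)) (k z)"
        unfolding k_def using norm_fst_le[of "fst z" "snd z"] norm_snd_le[of "snd z" "fst z"] by auto
    qed
    fix m M
    obtain B where B: "0 \<le> B" "\<And>x \<omega>. norm x \<le> real n \<Longrightarrow> norm \<omega> \<le> real n \<Longrightarrow> partials_le m (\<lambda>y. B * wt y powr (- M)) (\<lambda>y. ee (\<omega> \<bullet> y) * g (y - x))"
      by (rule partials_le_time_frequency_shift[OF g, of "real n" m M]) auto
    have "partials_le m (\<lambda>x. B * wt x powr (- M)) (k z)" if "F z \<noteq> 0" for z
    proof -
      have "norm z \<le> real n" using that by (auto simp: F_def indicator_def split: if_splits)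
      then have "norm (fst z) \<le> real n" "norm (snd z) \<le> real n"
        using norm_fst_le[of "fst z" "snd z"] norm_snd_le[of "snd z" "fst z"] by auto
      then show ?thesis unfolding k_def by (rule B(2))
    qed
    with B(1) show "\<exists>B\<ge>0. \<forall>z. F z \<noteq> 0 \<longrightarrow> partials_le m (\<lambda>x. B * wt x powr (- M)) (k z)" by blast
  qed
  note [measurable] = rapid_measurable[OF rh]
  obtain Ch where Ch: "0 \<le> Ch" "\<And>x. norm (h x) \<le> Ch" using rapid_bound[OF rh, of 0] by auto
  have Vh: "stft g h x' \<omega>' = (LINT z|lborel. F z * I x' \<omega>' z)" for x' \<omega>'
  proof -
    have "stft g h x' \<omega>' = (LINT y|lborel. R x' \<omega>' y * h y)" unfolding stft_eq R_def by (simp add: mult_ac)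
    also have "\<dots> = (LINT y|lborel. (LINT z|lborel. R x' \<omega>' y * (F z * k z y)))"
      unfolding h_def by (simp only: integral_mult_right_zero)
    also have "\<dots> = (LINT z|lborel. (LINT y|lborel. R x' \<omega>' y * (F z * k z y)))"
    proof (rule fubini_swap[symmetric])
      show "(\<lambda>(z, y). R x' \<omega>' y * (F z * k z y)) \<in> borel_measurable (borel \<Otimes>\<^sub>M borel)" by measurable
      have "(\<integral>\<^sup>+z. (\<integral>\<^sup>+y. ennreal (norm (R x' \<omega>' y * (F z * k z y))) \<partial>lborel) \<partial>lborel)
        \<le> (\<integral>\<^sup>+z. (\<integral>\<^sup>+y. (ennreal (norm (F z)) * ennreal Cg) * ennreal (norm (R x' \<omega>' y)) \<partial>lborel) \<partial>lborel)"
      proof (intro nn_integral_mono)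
        fix z y
        have "norm (R x' \<omega>' y * (F z * k z y)) = (norm (F z) * norm (g (y - fst z))) * norm (R x' \<omega>' y)"
          by (simp add: norm_mult k_def mult_ac)
        also have "\<dots> \<le> (norm (F z) * Cg) * norm (R x' \<omega>' y)" by (intro mult_right_mono mult_left_mono Cg) auto
        finally show "ennreal (norm (R x' \<omega>' y * (F z * k z y))) \<le> (ennreal (norm (F z)) * ennreal Cg) * ennreal (norm (R x' \<omega>' y))"
          using Cg(1) by (simp add: ennreal_mult[symmetric] ennreal_leI)
      qed
      also have "\<dots> = (\<integral>\<^sup>+z. (ennreal (norm (F z)) * ennreal Cg) * (\<integral>\<^sup>+y. ennreal (norm (R x' \<omega>' y)) \<partial>lborel) \<partial>lborel)"
        by (intro nn_integral_cong nn_integral_cmult) measurable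
      also have "\<dots> = (\<integral>\<^sup>+z. ennreal (norm (F z)) * (ennreal Cg * (\<integral>\<^sup>+y. ennreal (norm (R x' \<omega>' y)) \<partial>lborel)) \<partial>lborel)"
        by (simp only: mult.assoc)
      also have "\<dots> = (\<integral>\<^sup>+z. ennreal (norm (F z)) \<partial>lborel) * (ennreal Cg * (\<integral>\<^sup>+y. ennreal (norm (R x' \<omega>' y)) \<partial>lborel))"
        by (rule nn_integral_multc) measurable
      also have "\<dots> < \<infinity>" using iF iR[of x' \<omega>'] unfolding integrable_iff_bounded by (simp add: ennreal_mult_less_top)
      finally show "(\<integral>\<^sup>+z. (\<integral>\<^sup>+y. ennreal (norm (R x' \<omega>' y * (F z * k z y))) \<partial>lborel) \<partial>lborel) < \<infinity>" .
    qed
    also have "\<dots> = (LINT z|lborel. F z * I x' \<omega>' z)"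
      unfolding I_def k_def integral_mult_right_zero[symmetric] by (simp only: mult_ac)
    finally show ?thesis .
  qed
  \<comment> \<open>By linearity of the reproducing formula the transform of the error is the
    synthesis of the tail alone.\<close>
  have diff: "stft g (\<lambda>y. u y - h y) x' \<omega>' = (LINT z|lborel. Ou z * I x' \<omega>' z)" for x' \<omega>'
  proof -
    have iu: "integrable lborel (\<lambda>y. R x' \<omega>' y * u y)" by (rule integrable_mult_ess_bounded[OF iR um uK])
    have ih: "integrable lborel (\<lambda>y. R x' \<omega>' y * h y)"
      by (rule integrable_mult_ess_bounded[OF iR, of _ Ch]) (use Ch in auto)
    have "stft g (\<lambda>y. u y - h y) x' \<omega>' = (LINT y|lborel. R x' \<omega>' y * u y - R x' \<omega>' y * h y)"
      unfolding stft_eq R_def by (intro Bochner_Integration.integral_cong) (auto simp: algebra_simps)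
    also have "\<dots> = (LINT y|lborel. R x' \<omega>' y * u y) - (LINT y|lborel. R x' \<omega>' y * h y)"
      by (rule Bochner_Integration.integral_diff[OF iu ih])
    also have "(LINT y|lborel. R x' \<omega>' y * u y) = stft g u x' \<omega>'" unfolding stft_eq R_def by (simp add: mult_ac)
    also have "\<dots> = (LINT z|lborel. ?V z * I x' \<omega>' z) / ?w" using Vu[of x' \<omega>'] w0 by (simp add: field_simps)
    also have "\<dots> = (LINT z|lborel. ?V z / ?w * I x' \<omega>' z)" by simp
    also have "(LINT y|lborel. R x' \<omega>' y * h y) = stft g h x' \<omega>'" unfolding stft_eq R_def by (simp add: mult_ac)
    also have "\<dots> = (LINT z|lborel. F z * I x' \<omega>' z)" by (rule Vh)
    also have "(LINT z|lborel. ?V z / ?w * I x' \<omega>' z) - (LINT z|lborel. F z * I x' \<omega>' z) = (LINT z|lborel. ?V z / ?w * I x' \<omega>' z - F z * I x' \<omega>' z)"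
    proof (rule Bochner_Integration.integral_diff[symmetric])
      show "integrable lborel (\<lambda>z. ?V z / ?w * I x' \<omega>' z)" using integrable_divide[OF iVI[of x' \<omega>'], of ?w] by simp
      show "integrable lborel (\<lambda>z. F z * I x' \<omega>' z)" by (rule integrable_mult_ess_bounded[OF iF, of _ C]) (use IC in auto)
    qed
    also have "\<dots> = (LINT z|lborel. Ou z * I x' \<omega>' z)" by (simp only: left_diff_distrib[symmetric] FO)
    finally show ?thesis .
  qed
  define E where "E x' \<omega>' = ennreal (norm (stft g (\<lambda>y. u y - h y) x' \<omega>'))" for x' \<omega>'
  \<comment> \<open>Majorant of the error transform: the tail convolved with a product of integrable
    weights.\<close>
  define e where "e x' \<omega>' z = ennreal C * ennreal (norm (Ou z)) * (ennreal (wt (x' - fst z) powr (- ?r)) * ennreal (wt (\<omega>' - snd z) powr (- ?r)))" for x' \<omega>' z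
  have [measurable (raw)]: "(\<lambda>t. e (X t) (W t) (Z t)) \<in> borel_measurable M"
    if [measurable]: "X \<in> M \<rightarrow>\<^sub>M borel" "W \<in> M \<rightarrow>\<^sub>M borel" "Z \<in> M \<rightarrow>\<^sub>M borel" for X W Z and M :: "'c measure"
    unfolding e_def by measurable
  have mE[measurable]: "(\<lambda>(x, \<omega>). E x \<omega>) \<in> borel_measurable (borel \<Otimes>\<^sub>M borel)" unfolding E_def by measurable
  have Ee: "E x' \<omega>' \<le> (\<integral>\<^sup>+z. e x' \<omega>' z \<partial>lborel)" for x' \<omega>'
  proof -
    have "E x' \<omega>' \<le> (\<integral>\<^sup>+z. ennreal (norm (Ou z * I x' \<omega>' z)) \<partial>lborel)"
      unfolding E_def diff by (rule ennreal_norm_integral_le)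
    also have "\<dots> \<le> (\<integral>\<^sup>+z. e x' \<omega>' z \<partial>lborel)"
    proof (rule nn_integral_mono)
      fix z
      have "norm (Ou z * I x' \<omega>' z) \<le> norm (Ou z) * (C * wt (x' - fst z) powr (- ?r) * wt (\<omega>' - snd z) powr (- ?r))"
        unfolding norm_mult by (intro mult_left_mono In) auto
      then have "ennreal (norm (Ou z * I x' \<omega>' z)) \<le> ennreal (norm (Ou z) * (C * wt (x' - fst z) powr (- ?r) * wt (\<omega>' - snd z) powr (- ?r)))" by (rule ennreal_leI)
      also have "\<dots> = e x' \<omega>' z" unfolding e_def using C(1) by (simp add: ennreal_mult mult_ac)
      finally show "ennreal (norm (Ou z * I x' \<omega>' z)) \<le> e x' \<omega>' z" .
    qed
    finally show ?thesis .
  qed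
  let ?b = "\<integral>\<^sup>+z. ennreal (norm (Ou z)) \<partial>lborel"
  have J1: "1 \<le> 1 + J" "J \<le> 1 + J" by (auto simp: add_increasing)
  have w1: "ennreal (wt x powr (- ?r)) \<le> 1" for x :: 'a
    using wt_powr_mono[of "- ?r" 0 x] by (simp add: ennreal_le_1)
  \<comment> \<open>The choices a, b among 1 and J serve the pointwise bound, the bound integrated
    in x' and the fully integrated bound.\<close>
  have oc: "(\<integral>\<^sup>+z. ennreal C * ennreal (norm (Ou z)) * (a * b) \<partial>lborel) \<le> ennreal \<delta>" if "a \<le> 1 + J" "b \<le> 1 + J" for a b
  proof -
    have "(\<integral>\<^sup>+z. ennreal C * ennreal (norm (Ou z)) * (a * b) \<partial>lborel) = (\<integral>\<^sup>+z. (ennreal C * (a * b)) * ennreal (norm (Ou z)) \<partial>lborel)"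
      by (simp only: mult_ac)
    also have "\<dots> = (ennreal C * (a * b)) * ?b" by (rule nn_integral_cmult) measurable
    also have "\<dots> \<le> c * ?b" unfolding c_def by (intro mult_right_mono mult_left_mono mult_mono that) auto
    also have "\<dots> \<le> ennreal \<delta>" by (rule Osmall)
    finally show ?thesis .
  qed
  have E0: "E x' \<omega>' \<le> ennreal \<delta>" for x' \<omega>'
  proof -
    have "E x' \<omega>' \<le> (\<integral>\<^sup>+z. e x' \<omega>' z \<partial>lborel)" by (rule Ee)
    also have "\<dots> \<le> (\<integral>\<^sup>+z. ennreal C * ennreal (norm (Ou z)) * (1 * 1) \<partial>lborel)"
      unfolding e_def by (intro nn_integral_mono mult_left_mono mult_mono w1) auto
    also have "\<dots> \<le> ennreal \<delta>" by (intro oc J1)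
    finally show ?thesis .
  qed
  have E1': "(\<integral>\<^sup>+x'. E x' \<omega>' \<partial>lborel) \<le> (\<integral>\<^sup>+z. ennreal C * ennreal (norm (Ou z)) * (J * ennreal (wt (\<omega>' - snd z) powr (- ?r))) \<partial>lborel)" for \<omega>'
  proof -
    have "(\<integral>\<^sup>+x'. E x' \<omega>' \<partial>lborel) \<le> (\<integral>\<^sup>+x'. (\<integral>\<^sup>+z. e x' \<omega>' z \<partial>lborel) \<partial>lborel)" by (intro nn_integral_mono Ee)
    also have "\<dots> = (\<integral>\<^sup>+z. (\<integral>\<^sup>+x'. e x' \<omega>' z \<partial>lborel) \<partial>lborel)" by (rule nn_integral_lborel_swap) measurable
    also have "\<dots> = (\<integral>\<^sup>+z. ennreal C * ennreal (norm (Ou z)) * (J * ennreal (wt (\<omega>' - snd z) powr (- ?r))) \<partial>lborel)"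
      unfolding e_def by (simp add: nn_integral_cmult nn_integral_multc JI[simplified])
    finally show ?thesis .
  qed
  have E1: "(\<integral>\<^sup>+x'. E x' \<omega>' \<partial>lborel) \<le> ennreal \<delta>" for \<omega>'
  proof -
    have "(\<integral>\<^sup>+x'. E x' \<omega>' \<partial>lborel) \<le> (\<integral>\<^sup>+z. ennreal C * ennreal (norm (Ou z)) * (J * ennreal (wt (\<omega>' - snd z) powr (- ?r))) \<partial>lborel)" by (rule E1')
    also have "\<dots> \<le> (\<integral>\<^sup>+z. ennreal C * ennreal (norm (Ou z)) * (J * 1) \<partial>lborel)"
      by (intro nn_integral_mono mult_left_mono w1) auto
    also have "\<dots> \<le> ennreal \<delta>" by (intro oc J1)
    finally show ?thesis .
  qed
  have E2: "(\<integral>\<^sup>+\<omega>'. (\<integral>\<^sup>+x'. E x' \<omega>' \<partial>lborel) \<partial>lborel) \<le> ennreal \<delta>"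
  proof -
    have "(\<integral>\<^sup>+\<omega>'. (\<integral>\<^sup>+x'. E x' \<omega>' \<partial>lborel) \<partial>lborel) \<le> (\<integral>\<^sup>+\<omega>'. (\<integral>\<^sup>+z. ennreal C * ennreal (norm (Ou z)) * (J * ennreal (wt (\<omega>' - snd z) powr (- ?r))) \<partial>lborel) \<partial>lborel)"
      by (intro nn_integral_mono E1')
    also have "\<dots> = (\<integral>\<^sup>+z. (\<integral>\<^sup>+\<omega>'. ennreal C * ennreal (norm (Ou z)) * (J * ennreal (wt (\<omega>' - snd z) powr (- ?r))) \<partial>lborel) \<partial>lborel)"
      by (rule nn_integral_lborel_swap) measurable
    also have "\<dots> = (\<integral>\<^sup>+z. ennreal C * ennreal (norm (Ou z)) * (J * J) \<partial>lborel)"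
      by (simp add: nn_integral_cmult JI[simplified])
    also have "\<dots> \<le> ennreal \<delta>" by (intro oc J1)
    finally show ?thesis .
  qed
  have "mod_norm q p g (\<lambda>y. u y - h y) \<le> ennreal \<delta>"
    unfolding mod_norm_def E_def[symmetric]
    by (rule mixed_norm_small[OF q qp mE _ _ E0 E1 E2]) (use \<delta> in auto)
  also have "\<dots> < \<epsilon>" using \<delta>0 \<delta> by simp
  finally show ?thesis using rapid_schwartz[OF rh] by blast
qed

section \<open>Boundedness of Fourier integral operators\<close>

context fio
begin

text \<open>The three integral hypotheses feed the row, column and weighted bounds of
  \<open>mixed_norm_bound\<close>. In \<open>c3\<close> the exponent is s divided by 1/q - 1/p
  because l is the weight to the power -s and \<open>K3\<close> raises it to the reciprocal of that
  difference.\<close>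

lemma FIO_mod_norm_bound:
  assumes g: "rapid g" and nz: "g \<noteq> (\<lambda>_. 0)" and q: "1 \<le> q" and qp: "q < p" and C: "C < \<infinity>"
    and c1: "\<And>v x'. (\<integral>\<^sup>+\<omega>. ennreal (wt (v - fst (grad (x', \<omega>))) powr (- (real DIM('a) + 1))) \<partial>lborel) \<le> C"
    and c2: "\<And>v \<omega>. (\<integral>\<^sup>+x'. ennreal (wt (v - snd (grad (x', \<omega>))) powr (- (real DIM('a) + 1))) \<partial>lborel) \<le> C"
    and c3: "\<And>v \<omega>. (\<integral>\<^sup>+x'. ennreal (wt x' powr (- (s / (inv_exp q - inv_exp p))))
               * ennreal (wt (v - fst (grad (x', \<omega>))) powr (- (real DIM('a) + 1))) \<partial>lborel) \<le> C"
  obtains B where "\<And>f. rapid f \<Longrightarrow> mod_norm q p g (FIO \<Phi> \<sigma> f) \<le> ennreal B * mod_norm p q g f"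
proof -
  let ?N = "2 * (DIM('a) + 1)"
  note [measurable] = measurable_fst_borel measurable_snd_borel measurable_kern rapid_measurable[OF g]
  obtain A where A: "0 \<le> A"
    "\<And>f x' \<omega>'. rapid f \<Longrightarrow> ennreal (norm (stft g (FIO \<Phi> \<sigma> f) x' \<omega>'))
       \<le> ennreal A * ennreal (wt x' powr (- s)) * (\<integral>\<^sup>+z. ennreal (norm (stft g f (fst z) (snd z))) * kern ?N (x', \<omega>') z \<partial>lborel)"
    by (rule stft_FIO_bound[OF g nz, of ?N]) blast
  let ?b = "(\<integral>\<^sup>+\<zeta>. S \<zeta> \<partial>lborel) * (C * J)"
  \<comment> \<open>The summand 1 meets the requirement \<open>1 \<le> c\<close> of
    \<open>mixed_norm_bound\<close>.\<close>
  define c where "c = 1 + ennreal A * ?b"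
  have cfin: "c < \<infinity>" unfolding c_def using S_finite C J_finite by (simp add: ennreal_mult_less_top)
  then obtain B where B: "c = ennreal B" by (cases c) auto
  have le_c: "ennreal A * t \<le> c" if "t \<le> ?b" for t
    unfolding c_def using mult_left_mono[OF that, of "ennreal A"] by (simp add: add_increasing)
  have "mod_norm q p g (FIO \<Phi> \<sigma> f) \<le> ennreal B * mod_norm p q g f" if f: "rapid f" for f
  proof -
    note [measurable] = rapid_measurable[OF f]
    let ?F = "\<lambda>z. ennreal (norm (stft g f (fst z) (snd z)))"
    let ?A = "\<lambda>x \<omega>. ennreal (norm (stft g (FIO \<Phi> \<sigma> f) x \<omega>))"
    have "lp_norm p (\<lambda>\<omega>'. lp_norm q (\<lambda>x'. ?A x' \<omega>')) \<le> c * lp_norm q (\<lambda>\<omega>. lp_norm p (\<lambda>x. ?F (x, \<omega>)))"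
    proof (rule mixed_norm_bound[where K="\<lambda>z' z. ennreal A * kern ?N z' z" and l="\<lambda>x. wt x powr (- s)", OF q qp])
      show "(\<lambda>(z', z). ennreal A * kern ?N z' z) \<in> borel_measurable (borel \<Otimes>\<^sub>M borel)" by measurable
      show "?F \<in> borel_measurable borel" by measurable
      show "(\<lambda>(x, \<omega>). ?A x \<omega>) \<in> borel_measurable (borel \<Otimes>\<^sub>M borel)" by measurable
      show "(\<lambda>\<omega>. lp_norm p (\<lambda>x. ?F (x, \<omega>))) \<in> borel_measurable borel"
        using measurable_lp_norm_stft[OF f g, of p] by simp
      show "1 \<le> c" by (simp add: c_def)
      show "c \<noteq> top" using cfin by simp
      show "?A x' \<omega>' \<le> ennreal (wt x' powr - s) * (\<integral>\<^sup>+z. ?F z * (ennreal A * kern ?N (x', \<omega>') z) \<partial>lborel)" for x' \<omega>'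
      proof -
        have "?A x' \<omega>' \<le> ennreal A * ennreal (wt x' powr (- s)) * (\<integral>\<^sup>+z. ?F z * kern ?N (x', \<omega>') z \<partial>lborel)" by (rule A(2)[OF f])
        also have "\<dots> = ennreal (wt x' powr (- s)) * (ennreal A * (\<integral>\<^sup>+z. ?F z * kern ?N (x', \<omega>') z \<partial>lborel))" by (simp only: mult_ac)
        also have "ennreal A * (\<integral>\<^sup>+z. ?F z * kern ?N (x', \<omega>') z \<partial>lborel) = (\<integral>\<^sup>+z. ennreal A * (?F z * kern ?N (x', \<omega>') z) \<partial>lborel)"
          by (rule nn_integral_cmult[symmetric]) measurable
        also have "\<dots> = (\<integral>\<^sup>+z. ?F z * (ennreal A * kern ?N (x', \<omega>') z) \<partial>lborel)" by (simp only: mult_ac)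
        finally show ?thesis .
      qed
      show "(\<integral>\<^sup>+z. ennreal A * kern ?N z' z \<partial>lborel) \<le> c" for z'
      proof -
        have "(\<integral>\<^sup>+z. ennreal A * kern ?N z' z \<partial>lborel) = ennreal A * (\<integral>\<^sup>+z. kern ?N z' z \<partial>lborel)" by (rule nn_integral_cmult) measurable
        also have "\<dots> \<le> c" by (intro le_c kern_row c1)
        finally show ?thesis .
      qed
      show "(\<integral>\<^sup>+z'. ennreal A * kern ?N z' z \<partial>lborel) \<le> c" for z
      proof -
        have "(\<integral>\<^sup>+z'. ennreal A * kern ?N z' z \<partial>lborel) = ennreal A * (\<integral>\<^sup>+z'. kern ?N z' z \<partial>lborel)" by (rule nn_integral_cmult) measurable
        also have "\<dots> \<le> c" by (intro le_c kern_column c2)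
        finally show ?thesis .
      qed
      show "(\<integral>\<^sup>+x'. ennreal ((wt x' powr - s) powr (1 / (inv_exp q - inv_exp p))) * (\<integral>\<^sup>+x. ennreal A * kern ?N (x', \<omega>') (x, \<omega>) \<partial>lborel) \<partial>lborel) \<le> c" for \<omega> \<omega>'
      proof -
        let ?l = "\<lambda>x'. ennreal (wt x' powr (- (s / (inv_exp q - inv_exp p))))"
        have "(\<integral>\<^sup>+x'. ennreal ((wt x' powr - s) powr (1 / (inv_exp q - inv_exp p))) * (\<integral>\<^sup>+x. ennreal A * kern ?N (x', \<omega>') (x, \<omega>) \<partial>lborel) \<partial>lborel)
          = (\<integral>\<^sup>+x'. ennreal A * (?l x' * (\<integral>\<^sup>+x. kern ?N (x', \<omega>') (x, \<omega>) \<partial>lborel)) \<partial>lborel)"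
        proof (intro nn_integral_cong)
          fix x'
          have "(\<integral>\<^sup>+x. ennreal A * kern ?N (x', \<omega>') (x, \<omega>) \<partial>lborel) = ennreal A * (\<integral>\<^sup>+x. kern ?N (x', \<omega>') (x, \<omega>) \<partial>lborel)"
            by (rule nn_integral_cmult) measurable
          then show "ennreal ((wt x' powr - s) powr (1 / (inv_exp q - inv_exp p))) * (\<integral>\<^sup>+x. ennreal A * kern ?N (x', \<omega>') (x, \<omega>) \<partial>lborel)
            = ennreal A * (?l x' * (\<integral>\<^sup>+x. kern ?N (x', \<omega>') (x, \<omega>) \<partial>lborel))"
            by (simp add: powr_powr mult_ac)
        qed
        also have "\<dots> = ennreal A * (\<integral>\<^sup>+x'. ?l x' * (\<integral>\<^sup>+x. kern ?N (x', \<omega>') (x, \<omega>) \<partial>lborel) \<partial>lborel)"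
          by (rule nn_integral_cmult) measurable
        also have "\<dots> \<le> c"
          by (intro le_c kern_weighted c3) measurable
        finally show ?thesis .
      qed
    qed (auto)
    then show ?thesis unfolding mod_norm_def B by simp
  qed
  then show ?thesis by (rule that)
qed

text \<open>For rapid f the transform of f is integrable on phase space, and the column bound makes
  the kernel bounded on L^1, so the transform of T f is integrable and
  \<open>schwartz_approximation\<close> applies.\<close>

lemma FIO_schwartz_approximation:
  assumes g: "rapid g" and nz: "g \<noteq> (\<lambda>_. 0)" and f: "rapid f" and q: "1 \<le> q" and qp: "q < p" and C: "C < \<infinity>"
    and c2: "\<And>v \<omega>. (\<integral>\<^sup>+x'. ennreal (wt (v - snd (grad (x', \<omega>))) powr (- (real DIM('a) + 1))) \<partial>lborel) \<le> C"
    and \<epsilon>: "0 < \<epsilon>"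
  shows "\<exists>h\<in>schwartz. mod_norm q p g (\<lambda>y. FIO \<Phi> \<sigma> f y - h y) < \<epsilon>"
proof -
  let ?N = "2 * (DIM('a) + 1)"
  let ?F = "\<lambda>z. ennreal (norm (stft g f (fst z) (snd z)))"
  let ?G = "\<lambda>z. stft g (FIO \<Phi> \<sigma> f) (fst z) (snd z)"
  note [measurable] = measurable_fst_borel measurable_snd_borel measurable_kern rapid_measurable[OF g] rapid_measurable[OF f]
  obtain A where A: "0 \<le> A"
    "\<And>x' \<omega>'. ennreal (norm (stft g (FIO \<Phi> \<sigma> f) x' \<omega>'))
       \<le> ennreal A * ennreal (wt x' powr (- s)) * (\<integral>\<^sup>+z. ?F z * kern ?N (x', \<omega>') z \<partial>lborel)"
    by (rule stft_FIO_bound[OF g nz, of ?N]) (use f in blast)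
  obtain K where K: "AE y in lborel. norm (FIO \<Phi> \<sigma> f y) \<le> K" using FIO_ess_bounded[OF f] by blast
  let ?b = "(\<integral>\<^sup>+\<zeta>. S \<zeta> \<partial>lborel) * (C * J)"
  have "integrable lborel ?G"
  proof (rule integrableI_bounded)
    show "?G \<in> borel_measurable lborel" by measurable
    have "(\<integral>\<^sup>+z'. ennreal (norm (?G z')) \<partial>lborel) \<le> (\<integral>\<^sup>+z'. (\<integral>\<^sup>+z. ennreal A * ?F z * kern ?N z' z \<partial>lborel) \<partial>lborel)"
    proof (rule nn_integral_mono)
      fix z' :: "'a \<times> 'a"
      have w: "ennreal (wt (fst z') powr (- s)) \<le> 1"
        using wt_powr_mono[of "- s" 0 "fst z'"] s_nonneg by (simp add: ennreal_le_1)
      have "ennreal (norm (?G z')) \<le> ennreal A * ennreal (wt (fst z') powr (- s)) * (\<integral>\<^sup>+z. ?F z * kern ?N z' z \<partial>lborel)"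
        using A(2)[of "fst z'" "snd z'"] by simp
      also have "\<dots> \<le> ennreal A * 1 * (\<integral>\<^sup>+z. ?F z * kern ?N z' z \<partial>lborel)"
        by (intro mult_right_mono mult_left_mono w) auto
      also have "\<dots> = (\<integral>\<^sup>+z. ennreal A * ?F z * kern ?N z' z \<partial>lborel)"
        unfolding mult_1_right mult.assoc by (rule nn_integral_cmult[symmetric]) measurable
      finally show "ennreal (norm (?G z')) \<le> (\<integral>\<^sup>+z. ennreal A * ?F z * kern ?N z' z \<partial>lborel)" .
    qed
    also have "\<dots> = (\<integral>\<^sup>+z. (\<integral>\<^sup>+z'. ennreal A * ?F z * kern ?N z' z \<partial>lborel) \<partial>lborel)"
      by (rule nn_integral_lborel_swap) measurable
    also have "\<dots> \<le> (\<integral>\<^sup>+z. ?F z * (ennreal A * ?b) \<partial>lborel)"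
    proof (rule nn_integral_mono)
      fix z :: "'a \<times> 'a"
      have "(\<integral>\<^sup>+z'. ennreal A * ?F z * kern ?N z' z \<partial>lborel) = ennreal A * ?F z * (\<integral>\<^sup>+z'. kern ?N z' z \<partial>lborel)"
        by (rule nn_integral_cmult) measurable
      also have "\<dots> \<le> ennreal A * ?F z * ?b" by (intro mult_left_mono kern_column c2) auto
      finally show "(\<integral>\<^sup>+z'. ennreal A * ?F z * kern ?N z' z \<partial>lborel) \<le> ?F z * (ennreal A * ?b)" by (simp only: mult_ac)
    qed
    also have "\<dots> = (\<integral>\<^sup>+z. ?F z \<partial>lborel) * (ennreal A * ?b)" by (rule nn_integral_multc) measurable
    also have "\<dots> < \<infinity>"
      using stft_pair_integrable[OF f g] S_finite C J_finite unfolding integrable_iff_bounded by (simp add: ennreal_mult_less_top)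
    finally show "(\<integral>\<^sup>+z'. ennreal (norm (?G z')) \<partial>lborel) < \<infinity>" .
  qed
  then show ?thesis by (intro schwartz_approximation[OF g nz _ K _ q qp \<epsilon>]) measurable
qed

end

section \<open>From Hessian conditions to the integral bounds\<close>

lemma axis_pair_Basis:
  "(axis i 1, 0) \<in> (Basis :: ((real^'n) \<times> (real^'n)) set)" "(0, axis i 1) \<in> (Basis :: ((real^'n) \<times> (real^'n)) set)"
  by (auto simp: Basis_prod_def axis_in_Basis_iff)

context tame_phase
begin

lemma continuous_partials: "set vs \<subseteq> Basis \<Longrightarrow> continuous_on A (partials vs \<Phi>)"
  by (meson diff_partials continuous_at_imp_continuous_on differentiable_imp_continuous_within)

lemma partials_commute:
  assumes "u \<in> Basis" "v \<in> Basis"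
  shows "partials [u, v] \<Phi> z = partials [v, u] \<Phi> z"
  using Dv_commute[of \<Phi> v u z, OF diff_phase diff_Dv[OF assms(2)] diff_Dv[OF assms(1)]]
    continuous_partials[of "[u, v]" UNIV] continuous_partials[of "[v, u]" UNIV] assms by simp

end

lemma grad_coordinates:
  fixes \<Phi> :: "(real^'n) \<times> (real^'n) \<Rightarrow> real"
  assumes "tame_phase \<Phi>"
  shows "fst (tame_phase.grad \<Phi> Y) = (\<chi> i. Dv (axis i 1, 0) \<Phi> Y)"
    and "snd (tame_phase.grad \<Phi> Y) = (\<chi> i. Dv (0, axis i 1) \<Phi> Y)"
proof -
  interpret tame_phase \<Phi> by fact
  show "fst (grad Y) = (\<chi> i. Dv (axis i 1, 0) \<Phi> Y)"
    unfolding vec_eq_iff using grad_inner_Basis[OF axis_pair_Basis(1), of Y]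
    by (cases "grad Y") (simp add: inner_axis)
  show "snd (grad Y) = (\<chi> i. Dv (0, axis i 1) \<Phi> Y)"
    unfolding vec_eq_iff using grad_inner_Basis[OF axis_pair_Basis(2), of Y]
    by (cases "grad Y") (simp add: inner_axis)
qed

lemma inv_exp_less:
  assumes "1 \<le> q" "q < p"
  shows "inv_exp p < inv_exp q"
proof -
  obtain a where a: "q = ennreal a" "1 \<le> a" using assms by (cases q) (auto simp: ennreal_ge_1)
  show ?thesis
  proof (cases "p = \<infinity>")
    case True then show ?thesis using a by (simp add: inv_exp_def)
  next
    case False
    then obtain b where b: "p = ennreal b" "0 \<le> b" by (cases p) auto
    have "a < b" using assms a b by (simp add: ennreal_less_iff)
    then show ?thesis using a b False by (simp add: inv_exp_def frac_less2)
  qed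
qed

text \<open>A bounded extension between closures of the Schwartz class amounts to a norm estimate on
  Schwartz functions, together with approximability of T f by Schwartz functions in the target norm;
  the latter places the image in the closure and not merely in the modulation space.\<close>

theorem theorem1p3:
  fixes p q :: ennreal and \<Phi> :: "(real^'n) \<times> (real^'n) \<Rightarrow> real"
    and \<sigma> :: "(real^'n) \<times> (real^'n) \<Rightarrow> complex" and s :: real
  assumes "1 \<le> q" and "q < p"
    and "smooth \<Phi>"
    and "\<forall>vs. set vs \<subseteq> Basis \<and> 2 \<le> length vs \<longrightarrow> bounded (range (partials vs \<Phi>))"
    and "\<exists>\<delta>>0. \<forall>x \<eta>. \<bar>det (mixed_hessian \<Phi> x \<eta>)\<bar> \<ge> \<delta>"
    and "(\<sigma> \<in> sym_class 0 0 \<and> (\<exists>\<delta>>0. \<forall>x \<eta>. \<bar>det (x_hessian \<Phi> x \<eta>)\<bar> \<ge> \<delta>))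
       \<or> (\<sigma> \<in> sym_class s 0 \<and> s > real CARD('n) * (inv_exp q - inv_exp p))"
  shows "\<forall>g\<in>schwartz. g \<noteq> (\<lambda>_. 0) \<longrightarrow>
           (\<exists>C::real. \<forall>f\<in>schwartz.
              mod_norm q p g (FIO \<Phi> \<sigma> f) \<le> ennreal C * mod_norm p q g f
              \<and> (\<forall>\<epsilon>>0. \<exists>h\<in>schwartz. mod_norm q p g (\<lambda>y. FIO \<Phi> \<sigma> f y - h y) < \<epsilon>))"
proof -
  interpret tame_phase \<Phi> by unfold_locales (use assms in auto)
  note grad_coord = grad_coordinates[OF tame_phase_axioms]
  define \<theta> where "\<theta> = inv_exp q - inv_exp p"
  have \<theta>: "0 < \<theta>" using inv_exp_less[OF assms(1,2)] by (simp add: \<theta>_def)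
  let ?r = "real DIM(real^'n) + 1"
  have J1: "bounded_linear (\<lambda>h::real^'n. (h, 0::real^'n))" "bounded_linear (\<lambda>h::real^'n. (0::real^'n, h))"
    by (intro bounded_linear_Pair bounded_linear_ident bounded_linear_zero)+
  have mg: "(\<lambda>\<omega>. fst (grad (x', \<omega>))) \<in> borel_measurable borel" "(\<lambda>x'. fst (grad (x', \<omega>))) \<in> borel_measurable borel"
    "(\<lambda>x'. snd (grad (x', \<omega>))) \<in> borel_measurable borel" for x' \<omega>
    by (intro borel_measurable_continuous_onI continuous_on_fst continuous_on_snd continuous_on_compose2[OF continuous_grad[of UNIV]] continuous_intros; simp)+
  obtain \<delta> where \<delta>: "0 < \<delta>" "\<And>x \<eta>. \<delta> \<le> \<bar>det (mixed_hessian \<Phi> x \<eta>)\<bar>" using assms(5) by blast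
  \<comment> \<open>\<open>mixed_hessian\<close> differentiates in \<eta> first, the Jacobian of the
    x-gradient in x first; hence the appeal to symmetry. The other two matrices match after a
    transposition.\<close>
  have m1: "(\<chi> i j. Dv (0, axis j 1) (Dv (axis i 1, 0) \<Phi>) z) = mixed_hessian \<Phi> (fst z) (snd z)" for z
    unfolding mixed_hessian_def prod.collapse using partials_commute[OF axis_pair_Basis(2) axis_pair_Basis(1), of _ _ z] by simp
  have m2: "(\<chi> i j. Dv (axis j 1, 0) (Dv (0, axis i 1) \<Phi>) z) = transpose (mixed_hessian \<Phi> (fst z) (snd z))" for z
    by (simp add: mixed_hessian_def transpose_def)
  have m3: "(\<chi> i j. Dv (axis j 1, 0) (Dv (axis i 1, 0) \<Phi>) z) = transpose (x_hessian \<Phi> (fst z) (snd z))" for z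
    by (simp add: x_hessian_def transpose_def)
  obtain a1 where a1: "0 < a1" "\<And>x' s t. a1 * norm (s - t) \<le> norm (fst (grad (x', s)) - fst (grad (x', t)))"
  proof (rule gradient_lower_lipschitz[of \<Phi> "\<lambda>h. (0, h)" "\<lambda>i. (axis i 1, 0)" \<delta>, OF assms(3,4) J1(2) _ axis_pair_Basis(2) axis_pair_Basis(1) \<delta>(1)])
    fix c :: real assume c: "0 < c" "\<And>z s t. c * norm (s - t) \<le> norm ((\<chi> i. Dv (axis i 1, 0) \<Phi> (z + (0, s))) - (\<chi> i. Dv (axis i 1, 0) \<Phi> (z + (0, t))))"
    show thesis using that[of c] c(1) c(2)[of _ _ "(_, 0)"] by (simp add: grad_coord)
  qed (simp_all add: m1 \<delta>)
  \<comment> \<open>The variable x moves and the \<eta>-gradient is read off; the Jacobian is the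
    transposed mixed Hessian.\<close>
  obtain a2 where a2: "0 < a2" "\<And>\<omega> s t. a2 * norm (s - t) \<le> norm (snd (grad (s, \<omega>)) - snd (grad (t, \<omega>)))"
  proof (rule gradient_lower_lipschitz[of \<Phi> "\<lambda>h. (h, 0)" "\<lambda>i. (0, axis i 1)" \<delta>, OF assms(3,4) J1(1) _ axis_pair_Basis(1) axis_pair_Basis(2) \<delta>(1)])
    fix c :: real assume c: "0 < c" "\<And>z s t. c * norm (s - t) \<le> norm ((\<chi> i. Dv (0, axis i 1) \<Phi> (z + (s, 0))) - (\<chi> i. Dv (0, axis i 1) \<Phi> (z + (t, 0))))"
    show thesis using that[of c] c(1) c(2)[of _ _ "(0, _)"] by (simp add: grad_coord)
  qed (simp_all add: m2 \<delta> det_transpose)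
  obtain C1 where C1: "C1 < \<infinity>"
    "\<And>(G::real^'n \<Rightarrow> real^'n) v. G \<in> borel_measurable borel \<Longrightarrow> (\<And>s t. a1 * norm (s - t) \<le> norm (G s - G t)) \<Longrightarrow> (\<integral>\<^sup>+t. ennreal (wt (v - G t) powr (- ?r)) \<partial>lborel) \<le> C1"
    using wt_lower_lipschitz_integral[OF a1(1), where 'a="real^'n" and r="?r"] by auto
  obtain C2 where C2: "C2 < (\<infinity>::ennreal)"
    "\<And>(G::real^'n \<Rightarrow> real^'n) v. G \<in> borel_measurable borel \<Longrightarrow> (\<And>s t. a2 * norm (s - t) \<le> norm (G s - G t)) \<Longrightarrow> (\<integral>\<^sup>+t. ennreal (wt (v - G t) powr (- ?r)) \<partial>lborel) \<le> C2"
    using wt_lower_lipschitz_integral[OF a2(1), where 'a="real^'n" and r="?r"] by auto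
  \<comment> \<open>The alternatives merge here: s' = 0 with a bound from the Hessian in x, or s' =
    s with a bound from the weight alone.\<close>
  obtain s' C3 where s': "0 \<le> s'" "\<sigma> \<in> sym_class s' 0" and C3: "C3 < (\<infinity>::ennreal)"
    "\<And>v \<omega>. (\<integral>\<^sup>+x'. ennreal (wt x' powr (- (s' / \<theta>))) * ennreal (wt (v - fst (grad (x', \<omega>))) powr (- ?r)) \<partial>lborel) \<le> C3"
    using assms(6)
  proof (elim disjE conjE)
    assume \<sigma>: "\<sigma> \<in> sym_class 0 0" and "\<exists>\<delta>>0. \<forall>x \<eta>. \<bar>det (x_hessian \<Phi> x \<eta>)\<bar> \<ge> \<delta>"
    then obtain \<delta>' where \<delta>': "0 < \<delta>'" "\<And>x \<eta>. \<delta>' \<le> \<bar>det (x_hessian \<Phi> x \<eta>)\<bar>" by blast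
    obtain a3 where a3: "0 < a3" "\<And>\<omega> s t. a3 * norm (s - t) \<le> norm (fst (grad (s, \<omega>)) - fst (grad (t, \<omega>)))"
    proof (rule gradient_lower_lipschitz[of \<Phi> "\<lambda>h. (h, 0)" "\<lambda>i. (axis i 1, 0)" \<delta>', OF assms(3,4) J1(1) _ axis_pair_Basis(1) axis_pair_Basis(1) \<delta>'(1)])
      fix c :: real assume c: "0 < c" "\<And>z s t. c * norm (s - t) \<le> norm ((\<chi> i. Dv (axis i 1, 0) \<Phi> (z + (s, 0))) - (\<chi> i. Dv (axis i 1, 0) \<Phi> (z + (t, 0))))"
      show thesis using that[of c] c(1) c(2)[of _ _ "(0, _)"] by (simp add: grad_coord)
    qed (simp_all add: m3 \<delta>' det_transpose)
    obtain C3 where C3: "C3 < (\<infinity>::ennreal)"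
      "\<And>(G::real^'n \<Rightarrow> real^'n) v. G \<in> borel_measurable borel \<Longrightarrow> (\<And>s t. a3 * norm (s - t) \<le> norm (G s - G t)) \<Longrightarrow> (\<integral>\<^sup>+t. ennreal (wt (v - G t) powr (- ?r)) \<partial>lborel) \<le> C3"
      using wt_lower_lipschitz_integral[OF a3(1), where 'a="real^'n" and r="?r"] by auto
    show thesis
    proof (rule that[OF order_refl \<sigma> C3(1)])
      fix v \<omega>
      show "(\<integral>\<^sup>+x'. ennreal (wt x' powr (- (0 / \<theta>))) * ennreal (wt (v - fst (grad (x', \<omega>))) powr (- ?r)) \<partial>lborel) \<le> C3"
        using C3(2)[OF mg(2) a3(2)] by simp
    qed
  next
    assume \<sigma>: "\<sigma> \<in> sym_class s 0" and s: "s > real CARD('n) * (inv_exp q - inv_exp p)"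
    have s0: "0 \<le> s" using s \<theta> by (smt (verit) \<theta>_def mult_nonneg_nonneg of_nat_0_le_iff)
    \<comment> \<open>The condition on s is precisely what makes the weight with exponent
      -s/\<theta> integrable; the gradient factor is then bounded by 1.\<close>
    have "real DIM(real^'n) < s / \<theta>" using s \<theta> by (simp add: \<theta>_def[symmetric] pos_less_divide_eq)
    then have fin: "(\<integral>\<^sup>+x'. ennreal (wt (x' :: real^'n) powr (- (s / \<theta>))) \<partial>lborel) < \<infinity>" by (rule wt_powr_neg_nn_integral)
    show thesis
    proof (rule that[OF s0 \<sigma> fin])
      fix v \<omega>
      show "(\<integral>\<^sup>+x'. ennreal (wt x' powr (- (s / \<theta>))) * ennreal (wt (v - fst (grad (x', \<omega>))) powr (- ?r)) \<partial>lborel)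
        \<le> (\<integral>\<^sup>+x'. ennreal (wt (x' :: real^'n) powr (- (s / \<theta>))) \<partial>lborel)"
      proof (rule nn_integral_mono)
        fix x'
        have "ennreal (wt (v - fst (grad (x', \<omega>))) powr (- ?r)) \<le> 1"
          using wt_powr_mono[of "- ?r" 0] by (simp add: ennreal_le_1)
        from mult_left_mono[OF this, of "ennreal (wt x' powr (- (s / \<theta>)))"]
        show "ennreal (wt x' powr (- (s / \<theta>))) * ennreal (wt (v - fst (grad (x', \<omega>))) powr (- ?r)) \<le> ennreal (wt x' powr (- (s / \<theta>)))"
          by simp
      qed
    qed
  qed
  obtain \<Psi> where \<sigma>: "\<sigma> \<in> borel_measurable borel" and \<Psi>: "\<Psi> \<in> schwartz" "\<Psi> \<noteq> (\<lambda>_. 0)"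
    and iexp: "\<And>z \<zeta>. integrable lborel (\<lambda>y. exp (- 2 * pi * \<i> * complex_of_real (\<zeta> \<bullet> y)) * \<sigma> y * cnj (\<Psi> (y - z)))"
    and fin: "sym_norm s' 0 \<Psi> \<sigma> < \<infinity>"
    using s'(2) unfolding sym_class_def by (auto simp: measurable_lborel1)
  interpret fio \<Phi> \<sigma> \<Psi> s'
    \<comment> \<open>At frequency 0 the exponential is 1, which leaves the integrability of the
      windowed symbol required by the locale.\<close>
    using iexp[of 0] by unfold_locales (use s'(1) \<sigma> \<Psi> fin schwartz_rapid in auto)
  define C where "C = C1 + C2 + C3"
  have C: "C < \<infinity>" using C1(1) C2(1) C3(1) by (simp add: C_def)
  have le: "C1 \<le> C" "C2 \<le> C" "C3 \<le> C" unfolding C_def by (simp_all add: add_increasing add_increasing2)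
  note c1 = order_trans[OF C1(2)[OF mg(1) a1(2)] le(1)]
  note c2 = order_trans[OF C2(2)[OF mg(3) a2(2)] le(2)]
  note c3 = order_trans[OF C3(2)[unfolded \<theta>_def] le(3)]
  show ?thesis
  proof (intro ballI impI)
    fix g :: "real^'n \<Rightarrow> complex" assume gs: "g \<in> schwartz" and nz: "g \<noteq> (\<lambda>_. 0)"
    have g: "rapid g" by (rule schwartz_rapid[OF gs])
    obtain B where B: "\<And>f. rapid f \<Longrightarrow> mod_norm q p g (FIO \<Phi> \<sigma> f) \<le> ennreal B * mod_norm p q g f"
      by (rule FIO_mod_norm_bound[OF g nz assms(1,2) C c1 c2 c3]) blast
    show "\<exists>C::real. \<forall>f\<in>schwartz. mod_norm q p g (FIO \<Phi> \<sigma> f) \<le> ennreal C * mod_norm p q g f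
              \<and> (\<forall>\<epsilon>>0. \<exists>h\<in>schwartz. mod_norm q p g (\<lambda>y. FIO \<Phi> \<sigma> f y - h y) < \<epsilon>)"
      using B FIO_schwartz_approximation[OF g nz _ assms(1,2) C c2] schwartz_rapid by blast
  qed
qed

end
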